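(* An outerplanar graph $G$ is linear if and only if $G$ is cut-safe, block-safe, and the weak dual $\mathcal{T}_G$ of $G$ is a linear forest. Moreover, if $G$ is linear, then $G$ is isomorphic to an induced subgraph of some biconnected outerpath and also isomorphic to a spanning subgraph of some (other) biconnected outerpath.
   Context: All graphs are finite and simple. An outerplanar graph is a planar graph with a plane embedding in which all vertices lie on the outer face; outerplanar graphs are always considered with such an embedding. The weak dual $\mathcal{T}_G$ is the graph whose vertices are the bounded faces, two adjacent when the faces share an edge; it is a forest, and it is a linear forest if every component is a path. An edge incident to the outer face is a boundary edge; other edges are internal edges. An outerpath is an outerplanar graph having such an embedding whose weak dual is a path. An outerplanar graph is linear if it is isomorphic to a subgraph of a biconnected outerpath. A block is a maximal biconnected subgraph (or bridge/isolated vertex); it is trivial if it has at most two vertices. For a block $B$, a leaf face of $B$ is a bounded face of $B$ with at most one internal edge of $B$. A set of at most two boundary edges of $B$ is antipodal if either $B$ consists of a single bounded face, or the edges belong to different leaf faces of $B$. For a cutvertex $v$ and a component $C$ of $G\setminus v$, the subgraph of $G$ induced on $V(C)\cup\{v\}$ is a component incident to $v$; $\mathcal{C}_v$ is the set of these. Such a component is small for $v$ if removing $v$ from it leaves a path, and big otherwise; a small component is a tail at $v$ if it (including $v$) is a path. A component incident to $v$ is incident to a block $B$ if $v\in B$ and the component does not contain $B$. A cutvertex $v$ is safe if $\mathcal{C}_v$ has at most two big components; $G$ is cut-safe if every cutvertex is safe. A nontrivial block $B$ is safe if there exist two antipodal boundary edges $a_0b_0$, $a_1b_1$ of $B$ and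 a partition of the set of components incident to $B$ (over all cutvertices of $G$ in $B$) into $\mathcal{C}_0,\mathcal{C}_1$ such that for each $i\in\{0,1\}$: every component in $\mathcal{C}_i$ is incident to $a_i$ or to $b_i$, and at most one component in $\mathcal{C}_i$ is incident to $a_i$, and that one (if present) is a tail at $a_i$. $G$ is block-safe if every nontrivial block is safe.
   Formalization: A component incident to a cutvertex v must contain a neighbour of v (else three disjoint triangles plus a 3-vertex path are linear but not cut-safe); graphs with at most two vertices count as biconnected outerpaths, without which the spanning claim fails for them. *)

theory Defs
  imports "HOL-Analysis.Analysis"
begin

section \<open>Finite simple graphs\<close>

record 'a ugraph =
  verts :: "'a set"
  edges :: "'a set set"

definition simple_graph :: "'a ugraph \<Rightarrow> bool" where
  "simple_graph G \<longleftrightarrow> finite (verts G) \<and> (\<forall>e \<in> edges G. e \<subseteq> verts G \<and> card e = 2)"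

definition subgraph :: "'a ugraph \<Rightarrow> 'a ugraph \<Rightarrow> bool" where
  "subgraph H G \<longleftrightarrow>
     verts H \<subseteq> verts G \<and> edges H \<subseteq> edges G \<and> (\<forall>e \<in> edges H. e \<subseteq> verts H)"

definition induce :: "'a ugraph \<Rightarrow> 'a set \<Rightarrow> 'a ugraph" where
  "induce G X = \<lparr>verts = verts G \<inter> X, edges = {e \<in> edges G. e \<subseteq> X}\<rparr>"

definition induced_subgraph :: "'a ugraph \<Rightarrow> 'a ugraph \<Rightarrow> bool" where
  "induced_subgraph H G \<longleftrightarrow> verts H \<subseteq> verts G \<and> H = induce G (verts H)"

definition spanning_subgraph :: "'a ugraph \<Rightarrow> 'a ugraph \<Rightarrow> bool" where
  "spanning_subgraph H G \<longleftrightarrow> subgraph H G \<and> verts H = verts G"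

definition delete_vertex :: "'a ugraph \<Rightarrow> 'a \<Rightarrow> 'a ugraph" where
  "delete_vertex G v = induce G (verts G - {v})"

definition isomorphic :: "'a ugraph \<Rightarrow> 'b ugraph \<Rightarrow> bool" where
  "isomorphic G H \<longleftrightarrow>
     (\<exists>f. bij_betw f (verts G) (verts H) \<and> edges H = (\<lambda>e. f ` e) ` edges G)"

definition adjacency :: "'a ugraph \<Rightarrow> ('a \<times> 'a) set" where
  "adjacency G = {(u, v). {u, v} \<in> edges G}"

definition connected_graph :: "'a ugraph \<Rightarrow> bool" where
  "connected_graph G \<longleftrightarrow> (\<forall>u \<in> verts G. \<forall>v \<in> verts G. (u, v) \<in> (adjacency G)\<^sup>*)"

text \<open>The connected components, each given by its (nonempty) vertex set.\<close>
definition comp_sets :: "'a ugraph \<Rightarrow> 'a set set" where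
  "comp_sets G = {{u \<in> verts G. (v, u) \<in> (adjacency G)\<^sup>*} | v. v \<in> verts G}"

text \<open>The graph without vertices counts as a path; it is the weak dual of a forest.\<close>
definition path_graph :: "'a ugraph \<Rightarrow> bool" where
  "path_graph G \<longleftrightarrow>
     (\<exists>xs. distinct xs \<and> verts G = set xs \<and>
           edges G = {{xs ! i, xs ! Suc i} | i. Suc i < length xs})"

definition linear_forest :: "'a ugraph \<Rightarrow> bool" where
  "linear_forest G \<longleftrightarrow> (\<forall>C \<in> comp_sets G. path_graph (induce G C))"

definition cutvertex :: "'a ugraph \<Rightarrow> 'a \<Rightarrow> bool" where
  "cutvertex G v \<longleftrightarrow>
     v \<in> verts G \<and> card (comp_sets (delete_vertex G v)) > card (comp_sets G)"

text \<open>With this convention the graphs with one vertex and the single edge are biconnected, so that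
  bridges and isolated vertices are blocks.\<close>
definition biconnected :: "'a ugraph \<Rightarrow> bool" where
  "biconnected G \<longleftrightarrow> connected_graph G \<and> (\<forall>v. \<not> cutvertex G v)"

definition block :: "'a ugraph \<Rightarrow> 'a ugraph \<Rightarrow> bool" where
  "block G B \<longleftrightarrow>
     subgraph B G \<and> biconnected B \<and>
     (\<forall>B'. subgraph B' G \<and> biconnected B' \<and> subgraph B B' \<longrightarrow> B' = B)"

definition nontrivial_block :: "'a ugraph \<Rightarrow> 'a ugraph \<Rightarrow> bool" where
  "nontrivial_block G B \<longleftrightarrow> block G B \<and> card (verts B) > 2"

section \<open>Outerplane embeddings and weak duals\<close>

text \<open>A drawing assigns points of the plane to vertices and parametrised curves to edges. The same
  drawing also draws every subgraph.\<close>
record 'a drawing =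
  point :: "'a \<Rightarrow> complex"
  curve :: "'a set \<Rightarrow> real \<Rightarrow> complex"

definition drawing_image :: "'a ugraph \<Rightarrow> 'a drawing \<Rightarrow> complex set" where
  "drawing_image G D = point D ` verts G \<union> (\<Union>e \<in> edges G. path_image (curve D e))"

definition plane_embedding :: "'a ugraph \<Rightarrow> 'a drawing \<Rightarrow> bool" where
  "plane_embedding G D \<longleftrightarrow>
     inj_on (point D) (verts G) \<and>
     (\<forall>e \<in> edges G. arc (curve D e) \<and>
        {pathstart (curve D e), pathfinish (curve D e)} = point D ` e) \<and>
     (\<forall>e \<in> edges G. \<forall>v \<in> verts G. point D v \<in> path_image (curve D e) \<longrightarrow> v \<in> e) \<and>
     (\<forall>e \<in> edges G. \<forall>e' \<in> edges G. e \<noteq> e' \<longrightarrow>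
        path_image (curve D e) \<inter> path_image (curve D e') \<subseteq> point D ` (e \<inter> e'))"

definition bounded_faces :: "'a ugraph \<Rightarrow> 'a drawing \<Rightarrow> complex set set" where
  "bounded_faces G D = {F \<in> components (- drawing_image G D). bounded F}"

definition outer_face :: "'a ugraph \<Rightarrow> 'a drawing \<Rightarrow> complex set" where
  "outer_face G D = outside (drawing_image G D)"

definition outerplane_embedding :: "'a ugraph \<Rightarrow> 'a drawing \<Rightarrow> bool" where
  "outerplane_embedding G D \<longleftrightarrow>
     plane_embedding G D \<and> (\<forall>v \<in> verts G. point D v \<in> frontier (outer_face G D))"

definition edge_on_face :: "'a drawing \<Rightarrow> 'a set \<Rightarrow> complex set \<Rightarrow> bool" where
  "edge_on_face D e F \<longleftrightarrow> path_image (curve D e) \<subseteq> frontier F"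

definition boundary_edges :: "'a ugraph \<Rightarrow> 'a drawing \<Rightarrow> 'a set set" where
  "boundary_edges G D = {e \<in> edges G. edge_on_face D e (outer_face G D)}"

definition internal_edges :: "'a ugraph \<Rightarrow> 'a drawing \<Rightarrow> 'a set set" where
  "internal_edges G D = edges G - boundary_edges G D"

definition weak_dual :: "'a ugraph \<Rightarrow> 'a drawing \<Rightarrow> complex set ugraph" where
  "weak_dual G D =
     \<lparr>verts = bounded_faces G D,
      edges = {{F, F'} | F F'. F \<in> bounded_faces G D \<and> F' \<in> bounded_faces G D \<and> F \<noteq> F' \<and>
                 (\<exists>e \<in> edges G. edge_on_face D e F \<and> edge_on_face D e F')}\<rparr>"

definition outerpath :: "'a ugraph \<Rightarrow> bool" where
  "outerpath G \<longleftrightarrow>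
     simple_graph G \<and> (\<exists>D. outerplane_embedding G D \<and> path_graph (weak_dual G D))"

text \<open>The host graph lives on the natural numbers, since the vertex type of \<open>G\<close> may be too small to
  contain it; every finite graph has an isomorphic copy there.\<close>
definition linear_graph :: "'a ugraph \<Rightarrow> bool" where
  "linear_graph G \<longleftrightarrow>
     (\<exists>(H :: nat ugraph) K. outerpath H \<and> biconnected H \<and> subgraph K H \<and> isomorphic G K)"

section \<open>Cut-safety\<close>

text \<open>If \<open>G\<close> is disconnected, the components of \<open>G\<close> that do not contain \<open>v\<close> are also components of
  \<open>G\<close> minus \<open>v\<close>, but they are not incident to \<open>v\<close>; hence the condition that \<open>C\<close> contains a neighbour
  of \<open>v\<close>.\<close>
definition incident_components :: "'a ugraph \<Rightarrow> 'a \<Rightarrow> 'a ugraph set" where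
  "incident_components G v =
     {induce G (insert v C) | C.
        C \<in> comp_sets (delete_vertex G v) \<and> (\<exists>u \<in> C. {v, u} \<in> edges G)}"

definition small_component :: "'a ugraph \<Rightarrow> 'a \<Rightarrow> bool" where
  "small_component K v \<longleftrightarrow> path_graph (delete_vertex K v)"

definition big_component :: "'a ugraph \<Rightarrow> 'a \<Rightarrow> bool" where
  "big_component K v \<longleftrightarrow> \<not> small_component K v"

definition tail :: "'a ugraph \<Rightarrow> 'a \<Rightarrow> bool" where
  "tail K v \<longleftrightarrow> small_component K v \<and> path_graph K"

definition safe_cutvertex :: "'a ugraph \<Rightarrow> 'a \<Rightarrow> bool" where
  "safe_cutvertex G v \<longleftrightarrow> card {K \<in> incident_components G v. big_component K v} \<le> 2"

definition cut_safe :: "'a ugraph \<Rightarrow> bool" where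
  "cut_safe G \<longleftrightarrow> (\<forall>v. cutvertex G v \<longrightarrow> safe_cutvertex G v)"

section \<open>Block-safety\<close>

definition leaf_faces :: "'a ugraph \<Rightarrow> 'a drawing \<Rightarrow> complex set set" where
  "leaf_faces B D =
     {F \<in> bounded_faces B D. card {e \<in> internal_edges B D. edge_on_face D e F} \<le> 1}"

text \<open>The injective choice \<open>f\<close> says that distinct edges lie on different leaf faces. The definition
  allows \<open>S\<close> to be a single edge; a safe block asks for two distinct edges.\<close>
definition antipodal :: "'a ugraph \<Rightarrow> 'a drawing \<Rightarrow> 'a set set \<Rightarrow> bool" where
  "antipodal B D S \<longleftrightarrow>
     S \<subseteq> boundary_edges B D \<and> card S \<le> 2 \<and>
     (card (bounded_faces B D) = 1 \<or>
      (\<exists>f. inj_on f S \<and> (\<forall>e \<in> S. f e \<in> leaf_faces B D \<and> edge_on_face D e (f e))))"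

definition block_components :: "'a ugraph \<Rightarrow> 'a ugraph \<Rightarrow> 'a ugraph set" where
  "block_components G B =
     {K. \<exists>v. cutvertex G v \<and> v \<in> verts B \<and> K \<in> incident_components G v \<and> \<not> subgraph B K}"

definition incident_at :: "'a ugraph \<Rightarrow> 'a ugraph set \<Rightarrow> 'a \<Rightarrow> 'a ugraph set" where
  "incident_at G \<C> v = {K \<in> \<C>. cutvertex G v \<and> K \<in> incident_components G v}"

definition safe_side :: "'a ugraph \<Rightarrow> 'a ugraph set \<Rightarrow> 'a \<Rightarrow> 'a \<Rightarrow> bool" where
  "safe_side G \<C> a b \<longleftrightarrow>
     \<C> \<subseteq> incident_at G \<C> a \<union> incident_at G \<C> b \<and>
     card (incident_at G \<C> a) \<le> 1 \<and> (\<forall>K \<in> incident_at G \<C> a. tail K a)"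

definition safe_block :: "'a ugraph \<Rightarrow> 'a drawing \<Rightarrow> 'a ugraph \<Rightarrow> bool" where
  "safe_block G D B \<longleftrightarrow>
     (\<exists>a0 b0 a1 b1 \<C>0 \<C>1.
        {a0, b0} \<noteq> {a1, b1} \<and> antipodal B D {{a0, b0}, {a1, b1}} \<and>
        \<C>0 \<union> \<C>1 = block_components G B \<and> \<C>0 \<inter> \<C>1 = {} \<and>
        safe_side G \<C>0 a0 b0 \<and> safe_side G \<C>1 a1 b1)"

definition block_safe :: "'a ugraph \<Rightarrow> 'a drawing \<Rightarrow> bool" where
  "block_safe G D \<longleftrightarrow> (\<forall>B. nontrivial_block G B \<longrightarrow> safe_block G D B)"

end

theory Submission
  imports Defs
begin

text \<open>Call a graph a ladder if its vertices can be listed in two rows such that every edge joins two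
  consecutive vertices of a row or two vertices of different rows, and no two edges between the rows
  cross. Each of linearity and safety is equivalent to being a ladder.

  In an outerplane graph the boundary of a nontrivial block is a Hamiltonian cycle of the block, and its
  bounded faces correspond to the pieces into which the chords cut this cycle. Hence the weak dual of the
  block is a path exactly if removing one cycle edge on each of two leaf faces leaves the two rows of a
  ladder, with the removed edges as first and last rung. In particular a biconnected outerpath is a
  ladder, and being a ladder passes to subgraphs.

  In a ladder, the vertices attached to a block lie beyond its first or its last rung, which gives
  block-safety, and a branch at a vertex that is not a path uses an edge between the rows on one side of
  the vertex, which gives cut-safety. Conversely, the ladders of the blocks of a safe graph are glued
  along cutvertices, starting from a vertex with two big branches or, if there is none, from a smallest
  big branch.

  Finally, a ladder is drawn on two parallel lines with straight edges. Adding both rows and both extreme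
  rungs gives a spanning host; subdividing the missing row edges first makes the host induced.\<close>

section \<open>Lists as paths\<close>

text \<open>The faces are given only topologically, while ladders and safety speak of an order. The
  passage between them is an induction that cuts a cycle along a chord. It rests on two facts: in a
  theta graph one of the three paths lies inside the cycle of the other two, and no cycle of an
  outerplane graph encloses a vertex. Together they force every chord inside, so each cut divides
  inside, chords and faces at once. All bounded faces are reached in this way, since a point off the
  drawing that no cycle encloses lies in the outer face.

  The obstacle in the converse is that a ladder grows only at its two ends: any number of path
  branches fit at an end vertex, but only one big branch. From a vertex with two big branches, the
  way back is big at every later vertex, so cut-safety leaves at most one further big branch, and
  block-safety fixes the end of a block where the way back leaves, since a big branch is no tail. If
  every vertex has exactly one big branch, then in a smallest one everything that hangs on its first
  block or bridge is a path.\<close>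

fun nxt :: "'a list \<Rightarrow> 'a \<Rightarrow> 'a \<Rightarrow> bool" where
  "nxt [] a b \<longleftrightarrow> False"
| "nxt (x # xs) a b \<longleftrightarrow> xs \<noteq> [] \<and> a = x \<and> b = hd xs \<or> nxt xs a b"

fun before :: "'a list \<Rightarrow> 'a \<Rightarrow> 'a \<Rightarrow> bool" where
  "before [] a b \<longleftrightarrow> False"
| "before (x # xs) a b \<longleftrightarrow> a = x \<and> b \<in> set xs \<or> before xs a b"

definition pedges :: "'a list \<Rightarrow> 'a set set" where
  "pedges xs = {{a, b} | a b. nxt xs a b}"

lemma nxt_append:
  "nxt (xs @ ys) a b \<longleftrightarrow>
     nxt xs a b \<or> nxt ys a b \<or> xs \<noteq> [] \<and> ys \<noteq> [] \<and> a = last xs \<and> b = hd ys"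
  by (induction xs) (auto simp: hd_append)

lemma nxt_rev [simp]: "nxt (rev xs) a b \<longleftrightarrow> nxt xs b a"
  by (induction xs) (auto simp: nxt_append last_rev)

lemma nxt_set: "nxt xs a b \<Longrightarrow> a \<in> set xs \<and> b \<in> set xs"
  by (induction xs) auto

lemma nxt_split: "nxt xs a b \<longleftrightarrow> (\<exists>p r. xs = p @ a # b # r)"
proof
  show "nxt xs a b \<Longrightarrow> \<exists>p r. xs = p @ a # b # r"
  proof (induction xs)
    case (Cons x xs)
    then show ?case
      by (metis append_Cons append_Nil list.collapse nxt.simps(2))
  qed simp
qed (auto simp: nxt_append)

lemma nxt_nth: "nxt xs a b \<longleftrightarrow> (\<exists>i. Suc i < length xs \<and> a = xs ! i \<and> b = xs ! Suc i)"
proof (induction xs)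
  case (Cons x xs)
  have "(\<exists>i. Suc i < length (x # xs) \<and> a = (x # xs) ! i \<and> b = (x # xs) ! Suc i) \<longleftrightarrow>
    (xs \<noteq> [] \<and> a = x \<and> b = hd xs) \<or> (\<exists>i. Suc i < length xs \<and> a = xs ! i \<and> b = xs ! Suc i)"
    (is "?L \<longleftrightarrow> ?R")
  proof
    assume ?L then obtain i where i: "Suc i < length (x # xs)" "a = (x # xs) ! i" "b = (x # xs) ! Suc i"
      by auto
    then show ?R by (cases i) (auto simp: hd_conv_nth)
  next
    assume ?R
    then show ?L
    proof
      assume "xs \<noteq> [] \<and> a = x \<and> b = hd xs"
      then show ?L by (intro exI[of _ 0]) (auto simp: hd_conv_nth)
    next
      assume "\<exists>i. Suc i < length xs \<and> a = xs ! i \<and> b = xs ! Suc i"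
      then obtain i where "Suc i < length xs \<and> a = xs ! i \<and> b = xs ! Suc i" by auto
      then show ?L by (intro exI[of _ "Suc i"]) auto
    qed
  qed
  then show ?case using Cons by auto
qed simp

lemma nxt_map: "nxt (map f xs) a b \<longleftrightarrow> (\<exists>x y. nxt xs x y \<and> a = f x \<and> b = f y)"
proof (induction xs)
  case (Cons x xs)
  show ?case by (cases "xs = []") (simp_all add: hd_map Cons, blast)
qed simp

lemma nxt_neq: "distinct xs \<Longrightarrow> nxt xs a b \<Longrightarrow> a \<noteq> b"
  by (auto simp: nxt_split)

lemma nxtI: "nxt (p @ a # b # r) a b"
  by (auto simp: nxt_append)

lemma nxt_filter:
  assumes "nxt xs a b" "P a" "P b"
  shows "nxt (filter P xs) a b"
  using assms by (auto simp: nxt_split[of xs] nxtI)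

lemma before_append:
  "before (xs @ ys) a b \<longleftrightarrow> before xs a b \<or> before ys a b \<or> a \<in> set xs \<and> b \<in> set ys"
  by (induction xs) auto

lemma before_rev [simp]: "before (rev xs) a b \<longleftrightarrow> before xs b a"
  by (induction xs) (auto simp: before_append)

lemma before_set: "before xs a b \<Longrightarrow> a \<in> set xs \<and> b \<in> set xs"
  by (induction xs) auto

lemma before_split: "before xs a b \<longleftrightarrow> (\<exists>p q r. xs = p @ a # q @ b # r)"
proof
  show "before xs a b \<Longrightarrow> \<exists>p q r. xs = p @ a # q @ b # r"
  proof (induction xs)
    case (Cons x xs)
    then show ?case by (metis append_Cons append_Nil before.simps(2) split_list)
  qed simp
qed (auto simp: before_append)

lemma before_asym: "distinct xs \<Longrightarrow> before xs a b \<Longrightarrow> \<not> before xs b a"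
  by (induction xs) (auto dest: before_set)

lemma before_irrefl: "distinct xs \<Longrightarrow> \<not> before xs a a"
  using before_asym by metis

lemma before_total: "a \<in> set xs \<Longrightarrow> b \<in> set xs \<Longrightarrow> a = b \<or> before xs a b \<or> before xs b a"
  by (induction xs) auto

lemma before_map: "before (map f xs) a b \<longleftrightarrow> (\<exists>x y. before xs x y \<and> a = f x \<and> b = f y)"
proof (induction xs)
  case (Cons x xs)
  show ?case unfolding before.simps list.map Cons.IH by auto
qed simp

lemma before_filter: "before (filter P xs) a b \<longleftrightarrow> before xs a b \<and> P a \<and> P b"
  by (induction xs) (auto dest: before_set)

lemma pedges_Nil [simp]: "pedges [] = {}" and pedges_single [simp]: "pedges [x] = {}"
  by (auto simp: pedges_def)

lemma pedges_Cons: "xs \<noteq> [] \<Longrightarrow> pedges (x # xs) = insert {x, hd xs} (pedges xs)"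
  by (auto simp: pedges_def)

lemma pedges_append:
  "xs \<noteq> [] \<Longrightarrow> ys \<noteq> [] \<Longrightarrow> pedges (xs @ ys) = insert {last xs, hd ys} (pedges xs \<union> pedges ys)"
  by (auto simp: pedges_def nxt_append)

lemma pedges_append_subset: "pedges xs \<subseteq> pedges (xs @ ys)" "pedges ys \<subseteq> pedges (xs @ ys)"
  by (auto simp: pedges_def nxt_append)

lemma pedges_rev [simp]: "pedges (rev xs) = pedges xs"
  unfolding pedges_def by (simp, metis insert_commute)

lemma pedges_subset: "e \<in> pedges xs \<Longrightarrow> e \<subseteq> set xs"
  by (auto simp: pedges_def dest: nxt_set)

lemma pedges_map: "pedges (map f xs) = (`) f ` pedges xs"
  by (auto simp: pedges_def nxt_map image_def)

section \<open>Connected vertex sets\<close>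

text \<open>Connectedness as a cut condition: it yields a crossing edge for every proper nonempty
  part, which is how connectedness is used below. \<open>conn_rtrancl\<close> shows that it agrees
  with reachability inside \<open>U\<close>. The empty set counts as connected.\<close>

definition conn :: "'a set set \<Rightarrow> 'a set \<Rightarrow> bool" where
  "conn E U \<longleftrightarrow> (\<forall>A. A \<subseteq> U \<and> A \<noteq> {} \<and> A \<noteq> U \<longrightarrow> (\<exists>a\<in>A. \<exists>b\<in>U - A. {a, b} \<in> E))"

lemma conn_crossing:
  assumes "conn E U" "x \<in> U" "x \<in> A" "y \<in> U" "y \<notin> A"
  obtains a b where "a \<in> U" "a \<in> A" "b \<in> U" "b \<notin> A" "{a, b} \<in> E"
proof -
  have "U \<inter> A \<subseteq> U \<and> U \<inter> A \<noteq> {} \<and> U \<inter> A \<noteq> U" using assms by auto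
  then have "\<exists>a\<in>U \<inter> A. \<exists>b\<in>U - U \<inter> A. {a, b} \<in> E"
    using assms(1) unfolding conn_def by blast
  then show thesis using that by blast
qed

lemma conn_single [simp]: "conn E {x}" "conn E {}"
  by (auto simp: conn_def)

lemma conn_mono: "conn E U \<Longrightarrow> E \<subseteq> E' \<Longrightarrow> conn E' U"
  unfolding conn_def by (meson subsetD)

lemma conn_cong: "U \<subseteq> W \<Longrightarrow> conn {e \<in> E. e \<subseteq> W} U \<longleftrightarrow> conn E U"
  unfolding conn_def by (intro iff_allI imp_cong refl bex_cong) auto

lemma conn_Union:
  assumes "\<And>C. C \<in> \<C> \<Longrightarrow> conn E C" "\<And>C. C \<in> \<C> \<Longrightarrow> x \<in> C"
  shows "conn E (\<Union>\<C>)"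
  unfolding conn_def
proof (intro allI impI)
  fix A assume A: "A \<subseteq> \<Union>\<C> \<and> A \<noteq> {} \<and> A \<noteq> \<Union>\<C>"
  then obtain a b where ab: "a \<in> A" "b \<in> \<Union>\<C>" "b \<notin> A" by blast
  \<comment> \<open>\<open>x\<close> lies in \<open>A\<close> or outside it; a member of the family
    that reaches the other side meets both \<open>A\<close> and its complement.\<close>
  obtain C where C: "C \<in> \<C>" "if x \<in> A then b \<in> C else a \<in> C" using ab A by (metis UnionE subsetD)
  have "\<exists>p q. p \<in> C \<and> p \<in> A \<and> q \<in> C \<and> q \<notin> A" using C ab assms(2)[OF C(1)]
    by (auto split: if_splits)
  then obtain p q where "p \<in> C" "p \<in> A" "q \<in> C" "q \<notin> A" by blast
  from conn_crossing[OF assms(1)[OF C(1)] this]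
  show "\<exists>a\<in>A. \<exists>b\<in>\<Union>\<C> - A. {a, b} \<in> E" using C(1) by (metis Diff_iff UnionI)
qed

lemma conn_Un: "conn E U \<Longrightarrow> conn E W \<Longrightarrow> U \<inter> W \<noteq> {} \<Longrightarrow> conn E (U \<union> W)"
proof -
  assume a: "conn E U" "conn E W" "U \<inter> W \<noteq> {}"
  then obtain x where "x \<in> U" "x \<in> W" by auto
  then have "conn E (\<Union>{U, W})" using a by (intro conn_Union[of _ _ x]) auto
  then show ?thesis by simp
qed

lemma conn_edge: "{x, y} \<in> E \<Longrightarrow> conn E {x, y}"
proof -
  assume e: "{x, y} \<in> E"
  then have "{y, x} \<in> E" by (simp add: insert_commute)
  have "x \<in> A \<and> y \<notin> A \<or> y \<in> A \<and> x \<notin> A" if "A \<subseteq> {x, y}" "A \<noteq> {}" "A \<noteq> {x, y}" for A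
    using that by blast
  with e \<open>{y, x} \<in> E\<close> show ?thesis unfolding conn_def by blast
qed

lemma conn_insert: "conn E U \<Longrightarrow> u \<in> U \<Longrightarrow> {u, x} \<in> E \<Longrightarrow> conn E (insert x U)"
  using conn_Un[OF conn_edge[of u x E], of U] by (auto simp: insert_absorb insert_commute)

lemma conn_Un_edge:
  "conn E U \<Longrightarrow> conn E W \<Longrightarrow> u \<in> U \<Longrightarrow> w \<in> W \<Longrightarrow> {u, w} \<in> E \<Longrightarrow> conn E (U \<union> W)"
  using conn_Un[OF conn_insert[of E U u w], of W] by (auto simp: insert_absorb)

lemma conn_list: "pedges p \<subseteq> E \<Longrightarrow> conn E (set p)"
proof (induction p)
  case (Cons x p)
  show ?case
  proof (cases "p = []")
    case False
    then have "{hd p, x} \<in> E" "pedges p \<subseteq> E" using Cons.prems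
      by (auto simp: pedges_Cons insert_commute)
    then show ?thesis using Cons.IH conn_insert[of E "set p" "hd p" x] False by simp
  qed simp
qed simp

text \<open>The end vertices of simple paths from \<open>u\<close> form a set that no edge inside
  \<open>U\<close> leaves.\<close>

lemma conn_path:
  assumes "conn E U" "u \<in> U" "v \<in> U"
  obtains p where "distinct p" "p \<noteq> []" "hd p = u" "last p = v" "set p \<subseteq> U" "pedges p \<subseteq> E"
proof -
  define A where "A = {w. \<exists>p. distinct p \<and> p \<noteq> [] \<and> hd p = u \<and> last p = w \<and> set p \<subseteq> U \<and> pedges p \<subseteq> E}"
  have "distinct [u] \<and> [u] \<noteq> [] \<and> hd [u] = u \<and> last [u] = u \<and> set [u] \<subseteq> U \<and> pedges [u] \<subseteq> E"
    using assms by auto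
  then have uA: "u \<in> A" unfolding A_def by blast
  have "v \<in> A"
  proof (rule ccontr)
    assume "v \<notin> A"
    from conn_crossing[OF assms(1,2) uA assms(3) this] obtain a b
      where ab: "a \<in> U" "a \<in> A" "b \<in> U" "b \<notin> A" "{a, b} \<in> E" .
    then obtain p where p: "distinct p" "p \<noteq> []" "hd p = u" "last p = a" "set p \<subseteq> U" "pedges p \<subseteq> E"
      unfolding A_def by blast
    have "b \<in> A"
    proof (cases "b \<in> set p")
      case True
      \<comment> \<open>A path that already passes through \<open>b\<close> is cut off there, which
        keeps it simple.\<close>
      then obtain q r where q: "p = (q @ [b]) @ r" by (auto dest: split_list)
      then have "hd (q @ [b]) = u" using p by (cases q) auto
      moreover have "pedges (q @ [b]) \<subseteq> E" using p(6) pedges_append_subset(1) q by blast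
      moreover have "distinct (q @ [b]) \<and> set (q @ [b]) \<subseteq> U" using p q by auto
      ultimately show ?thesis unfolding A_def by (intro CollectI exI[of _ "q @ [b]"]) auto
    next
      case False
      then have "distinct (p @ [b]) \<and> set (p @ [b]) \<subseteq> U \<and> hd (p @ [b]) = u \<and> pedges (p @ [b]) \<subseteq> E"
        using p ab by (auto simp: pedges_append)
      then show ?thesis unfolding A_def by (intro CollectI exI[of _ "p @ [b]"]) auto
    qed
    then show False using ab by simp
  qed
  then show thesis using that unfolding A_def by blast
qed

lemma conn_rtrancl:
  "conn E U \<longleftrightarrow> (\<forall>u\<in>U. \<forall>v\<in>U. (u, v) \<in> {(a, b). {a, b} \<in> E \<and> a \<in> U \<and> b \<in> U}\<^sup>*)"
  (is "_ \<longleftrightarrow> (\<forall>u\<in>U. \<forall>v\<in>U. (u, v) \<in> ?R\<^sup>*)")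
proof
  assume c: "conn E U"
  show "\<forall>u\<in>U. \<forall>v\<in>U. (u, v) \<in> ?R\<^sup>*"
  proof (intro ballI, rule ccontr)
    fix u v assume uv: "u \<in> U" "v \<in> U" "(u, v) \<notin> ?R\<^sup>*"
    from conn_crossing[OF c uv(1) _ uv(2), of "{w. (u, w) \<in> ?R\<^sup>*}"] uv(3)
    obtain a b where "a \<in> U" "(u, a) \<in> ?R\<^sup>*" "b \<in> U" "(u, b) \<notin> ?R\<^sup>*" "{a, b} \<in> E" by auto
    then show False by (auto dest: rtrancl_into_rtrancl)
  qed
next
  assume r: "\<forall>u\<in>U. \<forall>v\<in>U. (u, v) \<in> ?R\<^sup>*"
  show "conn E U" unfolding conn_def
  proof (intro allI impI, rule ccontr)
    fix A assume A: "A \<subseteq> U \<and> A \<noteq> {} \<and> A \<noteq> U" and n: "\<not> (\<exists>a\<in>A. \<exists>b\<in>U - A. {a, b} \<in> E)"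
    then obtain u v where uv: "u \<in> A" "v \<in> U" "v \<notin> A" by blast
    have "(u, v) \<in> ?R\<^sup>*" using r uv A by blast
    then have "v \<in> A" by induction (use uv n in auto)
    then show False using uv by simp
  qed
qed

lemma connected_graph_conn:
  assumes "\<forall>e\<in>edges G. e \<subseteq> verts G"
  shows "connected_graph G \<longleftrightarrow> conn (edges G) (verts G)"
proof -
  have "adjacency G = {(a, b). {a, b} \<in> edges G \<and> a \<in> verts G \<and> b \<in> verts G}"
    using assms by (auto simp: adjacency_def)
  then show ?thesis by (simp add: connected_graph_def conn_rtrancl)
qed

text \<open>In this form a component is recognised from \<open>conn\<close> and closure under
  adjacency, without computing reachability.\<close>

lemma comp_sets_iff:
  assumes "\<forall>e\<in>edges G. e \<subseteq> verts G"
  shows "C \<in> comp_sets G \<longleftrightarrow>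
    C \<noteq> {} \<and> C \<subseteq> verts G \<and> conn (edges G) C \<and> (\<forall>a\<in>C. \<forall>b. {a, b} \<in> edges G \<longrightarrow> b \<in> C)"
proof
  assume "C \<in> comp_sets G"
  then obtain v where v: "v \<in> verts G" "C = {u \<in> verts G. (v, u) \<in> (adjacency G)\<^sup>*}"
    by (auto simp: comp_sets_def)
  have cl: "\<forall>a\<in>C. \<forall>b. {a, b} \<in> edges G \<longrightarrow> b \<in> C"
    using assms v by (auto simp: adjacency_def intro: rtrancl_into_rtrancl)
  have "conn (edges G) C" unfolding conn_def
  proof (intro allI impI, rule ccontr)
    fix A assume A: "A \<subseteq> C \<and> A \<noteq> {} \<and> A \<noteq> C" and n: "\<not> (\<exists>a\<in>A. \<exists>b\<in>C - A. {a, b} \<in> edges G)"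
    \<comment> \<open>Of \<open>A\<close> and its complement in \<open>C\<close>, the part that
      contains \<open>v\<close>. It is closed under adjacency, hence all of
      \<open>C\<close>.\<close>
    define A' where "A' = (if v \<in> A then A else C - A)"
    have cl': "b \<in> A'" if "a \<in> A'" "{a, b} \<in> edges G" for a b
      using that cl n A by (auto simp: A'_def insert_commute split: if_splits)
    have "u \<in> A'" if "(v, u) \<in> (adjacency G)\<^sup>*" for u
      using that
    proof induction
      case base then show ?case using v by (auto simp: A'_def)
    next
      case (step y z) then show ?case using cl' by (auto simp: adjacency_def)
    qed
    then have "C \<subseteq> A'" using v by auto
    then show False using A by (auto simp: A'_def split: if_splits)
  qed
  then show "C \<noteq> {} \<and> C \<subseteq> verts G \<and> conn (edges G) C \<and> (\<forall>a\<in>C. \<forall>b. {a, b} \<in> edges G \<longrightarrow> b \<in> C)"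
  proof (intro conjI)
    have "v \<in> C" using v by simp
    then show "C \<noteq> {}" by blast
    show "C \<subseteq> verts G" using v(2) by simp
    show "conn (edges G) C" by fact
    show "\<forall>a\<in>C. \<forall>b. {a, b} \<in> edges G \<longrightarrow> b \<in> C" by (rule cl)
  qed
next
  assume C: "C \<noteq> {} \<and> C \<subseteq> verts G \<and> conn (edges G) C \<and> (\<forall>a\<in>C. \<forall>b. {a, b} \<in> edges G \<longrightarrow> b \<in> C)"
  then obtain v where v: "v \<in> C" by auto
  have "C = {u \<in> verts G. (v, u) \<in> (adjacency G)\<^sup>*}"
  proof (intro equalityI subsetI)
    fix u assume "u \<in> C"
    then have "(v, u) \<in> {(a, b). {a, b} \<in> edges G \<and> a \<in> C \<and> b \<in> C}\<^sup>*" using iffD1[OF conn_rtrancl[of "edges G" C]] C v by simp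
    moreover have "{(a, b). {a, b} \<in> edges G \<and> a \<in> C \<and> b \<in> C}\<^sup>* \<subseteq> (adjacency G)\<^sup>*"
      by (rule rtrancl_mono) (auto simp: adjacency_def)
    ultimately show "u \<in> {u \<in> verts G. (v, u) \<in> (adjacency G)\<^sup>*}" using C \<open>u \<in> C\<close> by auto
  next
    fix u assume "u \<in> {u \<in> verts G. (v, u) \<in> (adjacency G)\<^sup>*}"
    then have "(v, u) \<in> (adjacency G)\<^sup>*" by simp
    then show "u \<in> C"
    proof induction
      case (step y z)
      then show ?case using C unfolding adjacency_def by blast
    qed (rule v)
  qed
  moreover have "v \<in> verts G" using C v by blast
  ultimately show "C \<in> comp_sets G" unfolding comp_sets_def by blast
qed

lemma comp_exists:
  assumes "\<forall>e\<in>edges G. e \<subseteq> verts G" "x \<in> verts G"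
  obtains C where "C \<in> comp_sets G" "x \<in> C"
  using assms by (auto simp: comp_sets_def)

lemma conn_subset_comp:
  assumes "\<forall>e\<in>edges G. e \<subseteq> verts G" "C \<in> comp_sets G" "conn (edges G) U" "U \<inter> C \<noteq> {}"
  shows "U \<subseteq> C"
proof (rule ccontr)
  assume "\<not> U \<subseteq> C"
  then obtain x y where xy: "x \<in> U" "x \<in> C" "y \<in> U" "y \<notin> C" using assms by blast
  from conn_crossing[OF assms(3) xy] show False
    using assms(2) unfolding comp_sets_iff[OF assms(1)] by metis
qed

lemma comp_sets_disjoint:
  assumes "\<forall>e\<in>edges G. e \<subseteq> verts G" "C \<in> comp_sets G" "C' \<in> comp_sets G" "C \<inter> C' \<noteq> {}"
  shows "C = C'"
  using assms conn_subset_comp[OF assms(1)] comp_sets_iff[OF assms(1)]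
  by (metis Int_commute subset_antisym)

lemma path_graph_iff:
  "path_graph G \<longleftrightarrow> (\<exists>xs. distinct xs \<and> verts G = set xs \<and> edges G = pedges xs)"
proof -
  have "{{xs ! i, xs ! Suc i} | i. Suc i < length xs} = pedges xs" for xs :: "'a list"
    unfolding pedges_def nxt_nth by auto
  then show ?thesis by (simp add: path_graph_def)
qed

section \<open>Arcs in the plane\<close>

text \<open>A connected component of the union cannot meet both open parts, so it is a component of
  one of them.\<close>

lemma components_Un_open:
  fixes A B :: "'a::real_normed_vector set"
  assumes "open A" "open B" "A \<inter> B = {}"
  shows "components (A \<union> B) = components A \<union> components B"
proof -
  have *: "connected_component_set (A \<union> B) x = connected_component_set A x"
    if "open A" "open B" "A \<inter> B = {}" "x \<in> A" for A B :: "'a set" and x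
  proof (rule equalityI)
    let ?C = "connected_component_set (A \<union> B) x"
    have "?C \<subseteq> A \<union> B" "x \<in> ?C" using that by (auto simp: connected_component_subset)
    moreover have "A \<inter> ?C = {} \<or> B \<inter> ?C = {}"
      using that(3) \<open>?C \<subseteq> A \<union> B\<close> by (intro connectedD) (auto simp: that)
    ultimately have "?C \<subseteq> A" using that by blast
    then show "?C \<subseteq> connected_component_set A x"
      using \<open>x \<in> ?C\<close> by (intro connected_component_maximal) auto
    show "connected_component_set A x \<subseteq> ?C"
      by (intro connected_component_mono) auto
  qed
  have "connected_component_set (A \<union> B) x = connected_component_set B x" if "x \<in> B" for x
    using *[of B A x] assms that by (simp add: Un_commute Int_commute)
  then show ?thesis using *[OF assms] unfolding components_def by (auto simp: image_Un)
qed

lemma cc_outside: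
  fixes S :: "complex set"
  assumes "bounded S" "p \<in> outside S" "q \<in> outside S"
  shows "connected_component (- S) p q"
proof -
  have "connected (outside S)" using assms by (intro connected_outside) auto
  moreover have "outside S \<subseteq> - S" using outside_no_overlap by blast
  ultimately show ?thesis using assms unfolding connected_component_def by blast
qed

text \<open>The same \<open>q\<close> works for all subsets: it is a common stand-in for infinity
  while parts of a drawing are added or removed.\<close>

lemma far_point:
  fixes X :: "complex set"
  assumes "bounded X"
  obtains q where "\<And>S. S \<subseteq> X \<Longrightarrow> q \<in> outside S"
proof -
  obtain r where r: "0 < r" "X \<subseteq> ball 0 r" using bounded_subset_ballD[OF assms] by blast
  then have "complex_of_real r \<in> outside S" if "S \<subseteq> X" for S
  proof -
    have "- ball 0 r \<subseteq> outside S"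
      using r that by (intro outside_subset_convex) auto
    then show ?thesis using r by auto
  qed
  then show thesis using that by blast
qed

text \<open>Janiszewski's theorem read backwards: if \<open>p\<close> were outside both
  \<open>A \<union> C\<close> and \<open>B \<union> C\<close>, whose intersection is the connected
  set \<open>C\<close>, then \<open>p\<close> could be joined to a far point off the union of all
  three, hence off \<open>A \<union> B\<close>.\<close>

lemma inside_Un_cases:
  fixes A B C :: "complex set"
  assumes "compact A" "compact B" "compact C" "connected C" "p \<notin> A \<union> B \<union> C"
    and AB: "(A \<union> C) \<inter> (B \<union> C) = C"
    and p: "p \<in> inside (A \<union> B)"
  shows "p \<in> inside (A \<union> C) \<or> p \<in> inside (B \<union> C)"
proof (rule ccontr)
  assume "\<not> ?thesis"
  then have o: "p \<in> outside (A \<union> C)" "p \<in> outside (B \<union> C)"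
    using assms(5) inside_Un_outside by blast+
  obtain q where q: "\<And>S. S \<subseteq> A \<union> B \<union> C \<Longrightarrow> q \<in> outside S"
    using far_point[of "A \<union> B \<union> C"] assms by (auto simp: compact_imp_bounded)
  have cc: "connected_component (- S) p q" if "p \<in> outside S" "S \<subseteq> A \<union> B \<union> C" for S
  proof -
    have "bounded (A \<union> B \<union> C)" using assms(1-3) by (simp add: compact_imp_bounded)
    from bounded_subset[OF this that(2)] show ?thesis using that q by (intro cc_outside) auto
  qed
  have "connected_component (- ((A \<union> C) \<union> (B \<union> C))) p q"
  proof (rule Janiszewski)
    show "connected ((A \<union> C) \<inter> (B \<union> C))" using AB assms by simp
    show "connected_component (- (A \<union> C)) p q" "connected_component (- (B \<union> C)) p q"
      using cc[OF o(1)] cc[OF o(2)] by blast+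
  qed (use assms in \<open>auto simp: compact_Un compact_imp_closed\<close>)
  then have "connected_component (- (A \<union> B)) q p"
    using connected_component_sym connected_component_of_subset[of "- (A \<union> C \<union> (B \<union> C))" p q "- (A \<union> B)"]
    by blast
  then have "p \<in> outside (A \<union> B)"
    using outside_same_component q by blast
  then show False using p inside_Int_outside by blast
qed

text \<open>If \<open>c\<close> avoids the inside of the first cycle, that inside is covered by the
  insides of the other two cycles. Being connected and disjoint from the boundary curves, it lies in
  one of them, and its own boundary then carries the remaining arc there.\<close>

lemma theta_inside:
  fixes c1 c2 c :: "real \<Rightarrow> complex"
  assumes "arc c1" "pathstart c1 = a" "pathfinish c1 = b"
      and "arc c2" "pathstart c2 = a" "pathfinish c2 = b"
      and "arc c" "pathstart c = a" "pathfinish c = b"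
      and 12: "path_image c1 \<inter> path_image c2 = {a, b}"
      and 1: "path_image c1 \<inter> path_image c = {a, b}"
      and 2: "path_image c2 \<inter> path_image c = {a, b}"
  shows "path_image c - {a, b} \<subseteq> inside (path_image c1 \<union> path_image c2) \<or>
         path_image c2 - {a, b} \<subseteq> inside (path_image c1 \<union> path_image c) \<or>
         path_image c1 - {a, b} \<subseteq> inside (path_image c2 \<union> path_image c)"
proof -
  let ?P1 = "path_image c1" and ?P2 = "path_image c2" and ?P0 = "path_image c"
  have sp: "simple_path (p +++ reversepath q)" "path_image (p +++ reversepath q) = path_image p \<union> path_image q"
      "pathfinish (p +++ reversepath q) = pathstart (p +++ reversepath q)"
    if "arc p" "arc q" "pathstart p = a" "pathfinish p = b" "pathstart q = a" "pathfinish q = b"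
      "path_image p \<inter> path_image q = {a, b}" for p q
    using that by (auto simp: simple_path_join_loop_eq arc_reversepath path_image_join)
  have J: "open (inside (path_image p \<union> path_image q)) \<and> connected (inside (path_image p \<union> path_image q))
     \<and> frontier (inside (path_image p \<union> path_image q)) = path_image p \<union> path_image q
     \<and> inside (path_image p \<union> path_image q) \<noteq> {}"
    if "arc p" "arc q" "pathstart p = a" "pathfinish p = b" "pathstart q = a" "pathfinish q = b"
      "path_image p \<inter> path_image q = {a, b}" for p q
    using Jordan_inside_outside[OF sp(1,3)[OF that]] sp(2)[OF that] by simp
  note J12 = J[OF assms(1,4,2,3,5,6) 12] and J1 = J[OF assms(1,7,2,3,8,9) 1] and J2 = J[OF assms(4,7,5,6,8,9) 2]
  have conn_open: "connected (path_image p - {a, b})" if "arc p" "pathstart p = a" "pathfinish p = b" for p :: "real \<Rightarrow> complex"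
    using connected_simple_path_endless[OF arc_imp_simple_path[OF that(1)]] that by simp
  show ?thesis
  proof (cases "?P0 \<inter> inside (?P1 \<union> ?P2) = {}")
    case False
    from split_inside_simple_closed_curve[OF arc_imp_simple_path[OF assms(1)] assms(2,3)
        arc_imp_simple_path[OF assms(4)] assms(5,6) arc_imp_simple_path[OF assms(7)] assms(8,9) _ 12 1 2 False]
    have "?P0 - {a, b} \<subseteq> inside (?P1 \<union> ?P2)"
      using arc_distinct_ends[OF assms(1)] assms(2,3) by (metis UnCI subsetI)
    then show ?thesis by simp
  next
    case True
    let ?I = "inside (?P1 \<union> ?P2)"
    have "?I \<subseteq> inside (?P1 \<union> ?P0) \<union> inside (?P2 \<union> ?P0)"
    proof
      fix p assume p: "p \<in> ?I"
      then have "p \<notin> ?P1 \<union> ?P2 \<union> ?P0" using True inside_no_overlap by blast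
      moreover have "(?P1 \<union> ?P0) \<inter> (?P2 \<union> ?P0) = ?P0" using 12 1 by blast
      ultimately show "p \<in> inside (?P1 \<union> ?P0) \<union> inside (?P2 \<union> ?P0)"
        using inside_Un_cases[of ?P1 ?P2 ?P0 p] p assms
        by (auto simp: compact_arc_image connected_arc_image)
    qed
    then have disj: "?I \<subseteq> inside (?P1 \<union> ?P0) \<or> ?I \<subseteq> inside (?P2 \<union> ?P0)"
    proof -
      have "?I \<inter> frontier (inside (?P1 \<union> ?P0)) = {}"
        using J1 True inside_no_overlap[of "?P1 \<union> ?P2"] by blast
      moreover have "connected ?I" using J12 by simp
      ultimately have "?I \<inter> inside (?P1 \<union> ?P0) = {} \<or> ?I - inside (?P1 \<union> ?P0) = {}"
        using connected_Int_frontier by blast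
      then show ?thesis using \<open>?I \<subseteq> _\<close> by blast
    qed
    have fin: "path_image p - {a, b} \<subseteq> inside (path_image q \<union> ?P0)"
      if "?I \<subseteq> inside (path_image q \<union> ?P0)" "frontier (inside (path_image q \<union> ?P0)) = path_image q \<union> ?P0"
        "path_image p \<subseteq> ?P1 \<union> ?P2" "path_image p \<inter> path_image q = {a, b}" "path_image p \<inter> ?P0 = {a, b}" for p q
    proof -
      have "path_image p \<subseteq> frontier ?I" using J12 that by simp
      also have "\<dots> \<subseteq> closure (inside (path_image q \<union> ?P0))"
        using closure_mono[OF that(1)] by (auto simp: frontier_def)
      also have "\<dots> = inside (path_image q \<union> ?P0) \<union> path_image q \<union> ?P0"
        using closure_Un_frontier[of "inside (path_image q \<union> ?P0)"] that(2) by (simp add: Un_assoc)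
      finally have *: "path_image p \<subseteq> inside (path_image q \<union> ?P0) \<union> path_image q \<union> ?P0" .
      show ?thesis
      proof
        fix x assume x: "x \<in> path_image p - {a, b}"
        then have "x \<notin> path_image q" "x \<notin> ?P0" using that(4,5) by blast+
        then show "x \<in> inside (path_image q \<union> ?P0)" using * x by blast
      qed
    qed
    from disj show ?thesis
      using fin[of c1 c2] fin[of c2 c1] J1 J2 12 1 2 by (metis Int_commute Un_upper1 Un_upper2)
  qed
qed

section \<open>Paths and cycles in plane graphs\<close>

definition cedges :: "'a list \<Rightarrow> 'a set set" where
  "cedges zs = insert {last zs, hd zs} (pedges zs)"

definition cyc :: "'a set set \<Rightarrow> 'a list \<Rightarrow> bool" where
  "cyc E zs \<longleftrightarrow> distinct zs \<and> length zs \<ge> 3 \<and> cedges zs \<subseteq> E"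

definition dimg :: "'a drawing \<Rightarrow> 'a set set \<Rightarrow> complex set" where
  "dimg D F = (\<Union>e\<in>F. path_image (curve D e))"

lemma dimg_Un: "dimg D (F \<union> F') = dimg D F \<union> dimg D F'"
  and dimg_insert: "dimg D (insert e F) = path_image (curve D e) \<union> dimg D F"
  and dimg_empty [simp]: "dimg D {} = {}"
  by (auto simp: dimg_def)

lemma dimg_mono: "F \<subseteq> F' \<Longrightarrow> dimg D F \<subseteq> dimg D F'"
  by (auto simp: dimg_def)

lemma pedges_append_if:
  "pedges (xs @ ys) = pedges xs \<union> pedges ys \<union> (if xs = [] \<or> ys = [] then {} else {{last xs, hd ys}})"
  by (auto simp: pedges_append)

lemma pedges_Cons_if: "pedges (x # xs) = pedges xs \<union> (if xs = [] then {} else {{x, hd xs}})"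
  by (auto simp: pedges_Cons)

lemma cedges_rotate: "cedges (xs @ ys) = cedges (ys @ xs)"
  unfolding cedges_def pedges_append_if by (cases "xs = []"; cases "ys = []") auto

lemma cyc_rotate: "cyc E (xs @ ys) \<longleftrightarrow> cyc E (ys @ xs)"
  unfolding cyc_def cedges_rotate[of xs ys] by auto

lemma cedges_subset: "zs \<noteq> [] \<Longrightarrow> e \<in> cedges zs \<Longrightarrow> e \<subseteq> set zs"
  by (auto simp: cedges_def dest: pedges_subset)

text \<open>The two arcs of a cycle between \<open>u\<close> and \<open>v\<close>, both listed from
  \<open>u\<close> to \<open>v\<close>. The second runs backwards through the ends of the list, past
  the closing edge.\<close>

lemma cedges_split:
  "cedges (as @ u # bs @ v # cs) = pedges (u # bs @ [v]) \<union> pedges (u # rev as @ rev cs @ [v])"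
proof -
  have "cedges (as @ u # bs @ v # cs) = cedges ((u # bs @ [v]) @ (cs @ as))"
    using cedges_rotate[of as "u # bs @ v # cs"] by simp
  also have "\<dots> = pedges (u # bs @ [v]) \<union> pedges (rev (u # rev as @ rev cs @ [v]))"
    unfolding cedges_def pedges_append_if pedges_Cons_if
    by (cases "as = []"; cases "cs = []") (auto simp: hd_append last_append insert_commute pedges_append_if pedges_Cons_if)
  also have "pedges (rev (u # rev as @ rev cs @ [v])) = pedges (u # rev as @ rev cs @ [v])"
    by (rule pedges_rev)
  finally show ?thesis .
qed

lemma cedges_split1: "cedges (u # bs @ [v]) = insert {u, v} (pedges (u # bs @ [v]))"
  by (simp add: cedges_def insert_commute)

lemma cedges_split2:
  "cedges (as @ u # v # cs) = insert {u, v} (pedges (u # rev as @ rev cs @ [v]))"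
  using cedges_split[of as u "[]" v cs] by (simp add: pedges_Cons insert_commute)

lemma closing_edge_notin:
  assumes "distinct zs" "length zs \<ge> 3"
  shows "{last zs, hd zs} \<notin> pedges zs"
proof
  assume "{last zs, hd zs} \<in> pedges zs"
  then obtain i where i: "Suc i < length zs" "{last zs, hd zs} = {zs ! i, zs ! Suc i}"
    by (auto simp: pedges_def nxt_nth)
  have n: "last zs = zs ! (length zs - 1)" "hd zs = zs ! 0"
    using assms last_conv_nth[of zs] hd_conv_nth[of zs] by fastforce+
  have "zs ! 0 = zs ! i \<or> zs ! 0 = zs ! Suc i" "zs ! (length zs - 1) = zs ! i \<or> zs ! (length zs - 1) = zs ! Suc i"
    using i n by (metis insertCI insertE singletonD)+
  moreover have "0 < length zs" "length zs - 1 < length zs" "i < length zs" using assms i by auto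
  ultimately have "0 = i" "length zs - 1 = i \<or> length zs - 1 = Suc i"
    using nth_eq_iff_index_eq[OF assms(1)] i(1) by (metis nat.distinct(1))+
  then show False using assms by auto
qed

lemma two_in_list:
  assumes "e \<subseteq> set zs" "card e = 2"
  obtains as u bs v cs where "zs = as @ u # bs @ v # cs" "e = {u, v}" "u \<noteq> v"
proof -
  obtain x y where xy: "e = {x, y}" "x \<noteq> y" using assms by (auto simp: card_2_iff)
  then have "before zs x y \<or> before zs y x" using assms before_total by fastforce
  then show thesis
    using that xy unfolding before_split by (metis insert_commute)
qed

locale plane_graph =
  fixes G :: "'a ugraph" and D :: "'a drawing"
  assumes simple: "simple_graph G" and plane: "plane_embedding G D"
begin

abbreviation "E \<equiv> edges G"
abbreviation "V \<equiv> verts G"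
abbreviation "img e \<equiv> path_image (curve D e)"
abbreviation "opn e \<equiv> path_image (curve D e) - point D ` e"

lemma edge_subset: "e \<in> E \<Longrightarrow> e \<subseteq> V" and edge_card: "e \<in> E \<Longrightarrow> card e = 2"
  and finite_V: "finite V"
  using simple by (auto simp: simple_graph_def)

lemma finite_E: "finite E"
  using finite_V edge_subset by (meson Pow_iff finite_Pow_iff finite_subset subsetI)

lemma point_inj: "u \<in> V \<Longrightarrow> v \<in> V \<Longrightarrow> point D u = point D v \<Longrightarrow> u = v"
  using plane by (auto simp: plane_embedding_def inj_on_def)

lemma edge_arc0: "e \<in> E \<Longrightarrow> arc (curve D e)"
  and edge_ends0: "e \<in> E \<Longrightarrow> {pathstart (curve D e), pathfinish (curve D e)} = point D ` e"
  and point_on_edge: "e \<in> E \<Longrightarrow> w \<in> V \<Longrightarrow> point D w \<in> img e \<Longrightarrow> w \<in> e"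
  and edges_Int: "e \<in> E \<Longrightarrow> e' \<in> E \<Longrightarrow> e \<noteq> e' \<Longrightarrow> img e \<inter> img e' \<subseteq> point D ` (e \<inter> e')"
  using plane by (auto simp: plane_embedding_def)

lemma point_in_edge: "e \<in> E \<Longrightarrow> w \<in> e \<Longrightarrow> point D w \<in> img e"
proof -
  assume "e \<in> E" "w \<in> e"
  then have "point D w \<in> {pathstart (curve D e), pathfinish (curve D e)}"
    using edge_ends0[of e] by simp
  then show ?thesis by auto
qed

lemma edge_arc:
  assumes "{u, v} \<in> E"
  obtains g where "arc g" "path_image g = img {u, v}" "pathstart g = point D u" "pathfinish g = point D v"
proof -
  let ?c = "curve D {u, v}"
  have "arc ?c" "{pathstart ?c, pathfinish ?c} = {point D u, point D v}"
    using edge_arc0 edge_ends0 assms by auto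
  then have "pathstart ?c = point D u \<and> pathfinish ?c = point D v \<or>
      pathstart ?c = point D v \<and> pathfinish ?c = point D u"
    by (auto simp: doubleton_eq_iff)
  then show thesis
    using that[of ?c] that[of "reversepath ?c"] \<open>arc ?c\<close> by (auto simp: arc_reversepath)
qed

text \<open>The first edge meets the rest only in its end \<open>b\<close>, because \<open>a\<close>
  does not occur again, so the arcs of the edges can be joined one by one.\<close>

lemma list_arc:
  assumes "distinct p" "length p \<ge> 2" "pedges p \<subseteq> E"
  obtains g where "arc g" "path_image g = dimg D (pedges p)"
    "pathstart g = point D (hd p)" "pathfinish g = point D (last p)"
  using assms
proof (induction p arbitrary: thesis)
  case (Cons a p)
  from Cons.prems(3) have "p \<noteq> []" by auto
  then obtain b q where p: "p = b # q" by (meson neq_Nil_conv)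
  have e: "{a, b} \<in> E" using Cons.prems p by (auto simp: pedges_Cons)
  obtain h where h: "arc h" "path_image h = img {a, b}" "pathstart h = point D a" "pathfinish h = point D b"
    using edge_arc[OF e] .
  show thesis
  proof (cases "q = []")
    case True
    then show thesis using h p Cons.prems(1)[of h] by (auto simp: pedges_Cons dimg_def)
  next
    case False
    then have "distinct p" "length p \<ge> 2" "pedges p \<subseteq> E"
      using Cons.prems p by (auto simp: pedges_Cons Suc_le_eq)
    then obtain g where g: "arc g" "path_image g = dimg D (pedges p)"
      "pathstart g = point D b" "pathfinish g = point D (last p)"
      using Cons.IH p by auto
    have "img {a, b} \<inter> img e \<subseteq> {point D b}" if "e \<in> pedges p" for e
    proof -
      have "a \<notin> e" using pedges_subset[OF that] Cons.prems by auto
      then show ?thesis using edges_Int[OF e, of e] that \<open>pedges p \<subseteq> E\<close> by auto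
    qed
    then have "path_image h \<inter> path_image g \<subseteq> {pathstart g}"
      using g h by (auto simp: dimg_def)
    then have "arc (h +++ g)" using g h by (intro arc_join) auto
    moreover have "path_image (h +++ g) = dimg D (pedges (a # p))"
      using g h p by (simp add: path_image_join pedges_Cons dimg_insert)
    ultimately show thesis using Cons.prems(1)[of "h +++ g"] g h p by auto
  qed
qed simp

lemma dimg_Int:
  assumes "F \<subseteq> E" "F' \<subseteq> E" "F \<inter> F' = {}"
  shows "dimg D F \<inter> dimg D F' \<subseteq> point D ` (\<Union>F \<inter> \<Union>F')"
  using edges_Int assms unfolding dimg_def by blast

lemma point_in_dimg: "F \<subseteq> E \<Longrightarrow> w \<in> V \<Longrightarrow> point D w \<in> dimg D F \<longleftrightarrow> w \<in> \<Union>F"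
  using point_on_edge point_in_edge unfolding dimg_def by blast

lemma pedges_Union: "length p \<ge> 2 \<Longrightarrow> \<Union>(pedges p) = set p"
proof (induction p)
  case (Cons a p)
  then show ?case by (cases p; cases "tl p") (auto simp: pedges_Cons)
qed simp

lemma set_subset_V: "length p \<ge> 2 \<Longrightarrow> pedges p \<subseteq> E \<Longrightarrow> set p \<subseteq> V"
  using pedges_Union[of p] edge_subset by blast

lemma lists_Int:
  assumes "length p \<ge> 2" "length q \<ge> 2" "pedges p \<subseteq> E" "pedges q \<subseteq> E" "set p \<inter> set q = {u, v}"
    "pedges p \<inter> pedges q = {}"
  shows "dimg D (pedges p) \<inter> dimg D (pedges q) = {point D u, point D v}"
proof
  show "dimg D (pedges p) \<inter> dimg D (pedges q) \<subseteq> {point D u, point D v}"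
    using dimg_Int[OF assms(3,4,6)]
    unfolding pedges_Union[OF assms(1)] pedges_Union[OF assms(2)] assms(5) by simp
  have "u \<in> V" "v \<in> V" using set_subset_V[OF assms(1,3)] assms(5) by auto
  moreover have "u \<in> \<Union>(pedges p)" "v \<in> \<Union>(pedges p)" "u \<in> \<Union>(pedges q)" "v \<in> \<Union>(pedges q)"
    unfolding pedges_Union[OF assms(1)] pedges_Union[OF assms(2)] using assms(5) by auto
  ultimately show "{point D u, point D v} \<subseteq> dimg D (pedges p) \<inter> dimg D (pedges q)"
    using point_in_dimg[OF assms(3)] point_in_dimg[OF assms(4)] by simp
qed

lemma theta_lists:
  assumes "distinct p" "length p \<ge> 2" "pedges p \<subseteq> E" "hd p = u" "last p = v"
    and "distinct q" "length q \<ge> 2" "pedges q \<subseteq> E" "hd q = u" "last q = v"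
    and "distinct r" "length r \<ge> 2" "pedges r \<subseteq> E" "hd r = u" "last r = v"
    and "set p \<inter> set q = {u, v}" "set p \<inter> set r = {u, v}" "set q \<inter> set r = {u, v}"
    and "pedges p \<inter> pedges q = {}" "pedges p \<inter> pedges r = {}" "pedges q \<inter> pedges r = {}"
  shows "dimg D (pedges r) - {point D u, point D v} \<subseteq> inside (dimg D (pedges p) \<union> dimg D (pedges q)) \<or>
    dimg D (pedges q) - {point D u, point D v} \<subseteq> inside (dimg D (pedges p) \<union> dimg D (pedges r)) \<or>
    dimg D (pedges p) - {point D u, point D v} \<subseteq> inside (dimg D (pedges q) \<union> dimg D (pedges r))"
proof -
  obtain g where g: "arc g" "path_image g = dimg D (pedges p)" "pathstart g = point D u" "pathfinish g = point D v"
    using list_arc[of p] assms by metis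
  obtain h where h: "arc h" "path_image h = dimg D (pedges q)" "pathstart h = point D u" "pathfinish h = point D v"
    using list_arc[of q] assms by metis
  obtain k where k: "arc k" "path_image k = dimg D (pedges r)" "pathstart k = point D u" "pathfinish k = point D v"
    using list_arc[of r] assms by metis
  show ?thesis
    using theta_inside[OF g(1,3,4) h(1,3,4) k(1,3,4)] g h k
      lists_Int[of p q u v] lists_Int[of p r u v] lists_Int[of q r u v] assms by simp
qed

lemma cyc_path:
  assumes "cyc E zs"
  obtains c where "simple_path c" "pathfinish c = pathstart c" "path_image c = dimg D (cedges zs)"
proof -
  have z: "distinct zs" "length zs \<ge> 3" "pedges zs \<subseteq> E" "{last zs, hd zs} \<in> E"
    using assms by (auto simp: cyc_def cedges_def)
  have ne: "zs \<noteq> []" using z by auto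
  obtain g where g: "arc g" "path_image g = dimg D (pedges zs)" "pathstart g = point D (hd zs)" "pathfinish g = point D (last zs)"
    using list_arc[of zs] z by auto
  obtain h where h: "arc h" "path_image h = img {last zs, hd zs}" "pathstart h = point D (last zs)" "pathfinish h = point D (hd zs)"
    using edge_arc[OF z(4)] .
  have l: "[last zs, hd zs] = [last zs] @ [hd zs]" by simp
  have "set zs \<inter> set [last zs, hd zs] = {last zs, hd zs}" using ne by auto
  then have "dimg D (pedges zs) \<inter> dimg D (pedges [last zs, hd zs]) = {point D (last zs), point D (hd zs)}"
    using closing_edge_notin[OF z(1,2)] z by (intro lists_Int) (auto simp: pedges_Cons)
  then have "dimg D (pedges zs) \<inter> img {last zs, hd zs} \<subseteq> {point D (last zs), point D (hd zs)}"
    by (simp add: pedges_Cons dimg_def)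
  then have "simple_path (g +++ h)"
    using g h by (intro simple_path_join_loop) auto
  moreover have "path_image (g +++ h) = dimg D (cedges zs)"
    using g h by (auto simp: path_image_join cedges_def dimg_insert)
  ultimately show thesis using that[of "g +++ h"] g h by auto
qed

text \<open>The Jordan curve theorem for the closed curve that draws a cycle, collected in the forms
  needed below.\<close>

lemma cyc_Jordan:
  assumes "cyc E zs"
  defines "Z \<equiv> dimg D (cedges zs)"
  shows "inside Z \<noteq> {}" "open (inside Z)" "connected (inside Z)" "open (outside Z)" "connected (outside Z)"
    "bounded (inside Z)" "\<not> bounded (outside Z)" "inside Z \<inter> outside Z = {}" "inside Z \<union> outside Z = - Z"
    "frontier (inside Z) = Z" "frontier (outside Z) = Z" "compact Z"
    "closure (inside Z) = inside Z \<union> Z"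
proof -
  obtain c where c: "simple_path c" "pathfinish c = pathstart c" "path_image c = Z"
    using cyc_path[OF assms(1)] unfolding Z_def .
  have fr: "frontier (inside Z) = Z"
    using Jordan_inside_outside[OF c(1,2)] c(3) by simp
  from Jordan_inside_outside[OF c(1,2)]
  show "inside Z \<noteq> {}" "open (inside Z)" "connected (inside Z)" "open (outside Z)" "connected (outside Z)"
    "bounded (inside Z)" "\<not> bounded (outside Z)" "inside Z \<inter> outside Z = {}" "inside Z \<union> outside Z = - Z"
    "frontier (outside Z) = Z" unfolding c(3) by auto
  show "frontier (inside Z) = Z" by fact
  show "compact Z" using compact_simple_path_image[OF c(1)] c(3) by simp
  show "closure (inside Z) = inside Z \<union> Z" using closure_Un_frontier[of "inside Z"] fr by simp
qed

lemma opn_ne: "e \<in> E \<Longrightarrow> opn e \<noteq> {}"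
  and connected_opn: "e \<in> E \<Longrightarrow> connected (opn e)"
proof -
  assume e: "e \<in> E"
  have s: "opn e = img e - {pathstart (curve D e), pathfinish (curve D e)}" using edge_ends0[OF e] by simp
  show "connected (opn e)" unfolding s
    using connected_simple_path_endless arc_imp_simple_path edge_arc0[OF e] by blast
  show "opn e \<noteq> {}" unfolding s
    using nonempty_simple_path_endless arc_imp_simple_path edge_arc0[OF e] by blast
qed

text \<open>A connected set with more than one point has no isolated points, and removing the two
  end points keeps all limit points.\<close>

lemma img_closure_opn: "e \<in> E \<Longrightarrow> img e \<subseteq> closure (opn e)"
proof
  fix x assume e: "e \<in> E" and x: "x \<in> img e"
  have "connected (img e)" using edge_arc0[OF e] by (simp add: connected_arc_image)
  moreover have "\<nexists>a. img e = {a}"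
  proof
    assume "\<exists>a. img e = {a}"
    then have "pathstart (curve D e) = pathfinish (curve D e)"
      by (metis pathstart_in_path_image pathfinish_in_path_image singletonD)
    then show False using arc_distinct_ends[OF edge_arc0[OF e]] by simp
  qed
  ultimately have "x islimpt img e" using x by (intro connected_imp_perfect) auto
  moreover have "finite (point D ` e)" "img e = point D ` e \<union> opn e"
    using e edge_card[OF e] point_in_edge[OF e] card_ge_0_finite[of e] by auto
  ultimately have "x islimpt opn e" using islimpt_Un_finite by metis
  then show "x \<in> closure (opn e)" by (simp add: closure_def)
qed

lemma opn_disjoint: "e \<in> E \<Longrightarrow> F \<subseteq> E \<Longrightarrow> e \<notin> F \<Longrightarrow> opn e \<inter> dimg D F = {}"
  using edges_Int unfolding dimg_def by blast

lemma opn_no_point: "e \<in> E \<Longrightarrow> opn e \<inter> point D ` V = {}"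
  using point_on_edge by blast

lemma edge_side:
  assumes "cyc E zs" "e \<in> E" "e \<notin> cedges zs"
  shows "opn e \<subseteq> inside (dimg D (cedges zs)) \<or> opn e \<subseteq> outside (dimg D (cedges zs))"
proof -
  note J = cyc_Jordan[OF assms(1)]
  have "opn e \<inter> dimg D (cedges zs) = {}"
    using assms opn_disjoint by (auto simp: cyc_def)
  then have sub: "opn e \<subseteq> inside (dimg D (cedges zs)) \<union> outside (dimg D (cedges zs))"
    using J(9) by auto
  then have "inside (dimg D (cedges zs)) \<inter> opn e = {} \<or> outside (dimg D (cedges zs)) \<inter> opn e = {}"
    using J by (intro connectedD[OF connected_opn[OF assms(2)]]) auto
  then show ?thesis using sub by blast
qed

lemma drawing_image_eq: "drawing_image G D = point D ` V \<union> dimg D E"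
  by (simp add: drawing_image_def dimg_def)

lemma compact_dimg: "F \<subseteq> E \<Longrightarrow> compact (dimg D F)"
  unfolding dimg_def using finite_E edge_arc0
  by (intro compact_UN) (auto intro: finite_subset compact_arc_image)

text \<open>Edges are added one by one. A new edge between connected vertices closes a cycle that meets
  the rest of the drawing in an arc; otherwise it joins two disjoint parts of the drawing. In both
  cases Janiszewski's theorem applies.\<close>
lemma outside_by_cycles:
  assumes p: "p \<notin> drawing_image G D"
    and nc: "\<And>zs. cyc E zs \<Longrightarrow> p \<notin> inside (dimg D (cedges zs))"
  shows "p \<in> outside (drawing_image G D)"
proof -
  let ?X = "\<lambda>F. point D ` V \<union> dimg D F"
  have cX: "compact (?X F)" if "F \<subseteq> E" for F
    using compact_dimg[OF that] finite_V by (simp add: compact_Un finite_imp_compact)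
  have pX: "p \<notin> ?X E" using p by (simp add: drawing_image_eq)
  obtain q where q: "\<And>S. S \<subseteq> ?X E \<Longrightarrow> q \<in> outside S"
    using far_point[of "?X E"] compact_imp_bounded[OF cX[of E]] by blast
  have qX: "q \<notin> ?X E" using q[of "?X E"] outside_no_overlap by blast
  have "connected_component (- ?X F) p q" if "F \<subseteq> E" for F
    using finite_subset[OF that finite_E] that
  proof (induction F)
    case empty
    have "connected (UNIV - point D ` V)"
      using finite_V by (intro connected_open_delete_finite) (auto simp: connected_UNIV)
    moreover have "p \<in> UNIV - point D ` V" "q \<in> UNIV - point D ` V" using pX qX by auto
    moreover have "UNIV - point D ` V = - ?X {}" by auto
    ultimately show ?case unfolding connected_component_def by (metis order_refl)
  next
    case (insert e F)
    then have eE: "e \<in> E" and FE: "F \<subseteq> E" and eF: "e \<notin> F" by auto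
    obtain u v where e: "e = {u, v}" "u \<noteq> v" using edge_card[OF eE] by (auto simp: card_2_iff)
    have uv: "u \<in> V" "v \<in> V" using edge_subset[OF eE] e by auto
    have IH: "connected_component (- ?X F) p q" using insert by auto
    \<comment> \<open>The component of \<open>u\<close> in the graph with vertex set
      \<open>V\<close> and edge set \<open>F\<close>.\<close>
    define A where "A = \<Union>{U. conn F U \<and> u \<in> U \<and> U \<subseteq> V}"
    have cA: "conn F A" unfolding A_def by (rule conn_Union[of _ _ u]) auto
    have uA: "u \<in> A" unfolding A_def using uv by (intro UnionI[of "{u}"]) auto
    have AV: "A \<subseteq> V" unfolding A_def by auto
    have clA: "b \<in> A" if "{a, b} \<in> F" "a \<in> A" for a b
    proof -
      have "conn F (insert b A)" using conn_insert[OF cA that(2,1)] .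
      moreover have "b \<in> V" using that(1) FE edge_subset by auto
      ultimately have "insert b A \<in> {U. conn F U \<and> u \<in> U \<and> U \<subseteq> V}" using uA AV by auto
      then show ?thesis unfolding A_def by blast
    qed
    have XeF: "?X (insert e F) = ?X F \<union> img e" by (auto simp: dimg_insert)
    show ?case
    proof (cases "v \<in> A")
      case True
      obtain r where r: "distinct r" "r \<noteq> []" "hd r = u" "last r = v" "set r \<subseteq> A" "pedges r \<subseteq> F"
        using conn_path[OF cA uA True] .
      have "length r \<ge> 3"
      proof (rule ccontr)
        assume "\<not> 3 \<le> length r"
        moreover have "length r > 0" using r(2) by simp
        ultimately have "length r = 1 \<or> length r = 2" by linarith
        then have "r = [u] \<or> r = [u, v]"
          using r(3,4) by (auto simp: length_Suc_conv numeral_2_eq_2)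
        moreover have "r \<noteq> [u]" using r(4) e by auto
        moreover have "r \<noteq> [u, v]"
        proof
          assume "r = [u, v]"
          then have "pedges r = {e}" using e by (simp add: pedges_Cons)
          then show False using r(6) eF by simp
        qed
        ultimately show False by blast
      qed
      have ce: "cedges r = insert e (pedges r)"
        using r(3,4) e by (simp add: cedges_def insert_commute)
      have cyc: "cyc E r" unfolding cyc_def ce using \<open>length r \<ge> 3\<close> r FE eE by auto
      obtain g where g: "arc g" "path_image g = dimg D (pedges r)"
        using list_arc[of r] r FE \<open>length r \<ge> 3\<close> by (metis One_nat_def Suc_leD eval_nat_numeral(3) numeral_2_eq_2 order_trans)
      let ?T = "dimg D (cedges r)"
      have T: "?T = img e \<union> dimg D (pedges r)" by (simp add: ce dimg_insert)
      have TE: "?T \<subseteq> ?X E" using cyc dimg_mono[of "cedges r" E D] by (auto simp: cyc_def)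
      have pr: "\<Union>(pedges r) = set r" using pedges_Union[of r] \<open>length r \<ge> 3\<close> by simp
      have "?X F \<inter> img e \<subseteq> point D ` e"
        using opn_disjoint[OF eE FE eF] opn_no_point[OF eE] by blast
      also have "point D ` e \<subseteq> dimg D (pedges r)"
        using point_in_dimg[of "pedges r"] pr r FE e uv hd_in_set[OF r(2)] last_in_set[OF r(2)] by auto
      finally have "?X F \<inter> ?T = dimg D (pedges r)"
        using T dimg_mono[OF r(6)] by blast
      then have "connected (?X F \<inter> ?T)" using connected_arc_image[OF g(1)] g(2) by simp
      moreover have "connected_component (- ?T) p q"
      proof (rule cc_outside)
        show "bounded ?T" using cyc_Jordan(12)[OF cyc] by (rule compact_imp_bounded)
        show "p \<in> outside ?T" using nc[OF cyc] pX TE inside_Un_outside[of ?T] by blast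
        show "q \<in> outside ?T" using q[OF TE] .
      qed
      moreover have "closed ?T" using cyc_Jordan(12)[OF cyc] by (rule compact_imp_closed)
      ultimately have "connected_component (- (?X F \<union> ?T)) p q"
        using Janiszewski[OF cX[OF FE] _ _ IH] by blast
      then show ?thesis
        by (rule connected_component_of_subset) (use XeF T in auto)
    next
      case False
      \<comment> \<open>\<open>?S1\<close> draws the component of \<open>u\<close>,
        \<open>?S2\<close> everything else. The edge \<open>e\<close> touches the first only in
        \<open>u\<close>, and both together touch the second only in \<open>v\<close>, so
        Janiszewski's theorem is applied twice.\<close>
      let ?F1 = "{f \<in> F. f \<subseteq> A}" and ?F2 = "{f \<in> F. f \<subseteq> V - A}"
      let ?S1 = "point D ` A \<union> dimg D ?F1" and ?S2 = "point D ` (V - A) \<union> dimg D ?F2"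
      have Fs: "F = ?F1 \<union> ?F2"
      proof
        show "F \<subseteq> ?F1 \<union> ?F2"
        proof
          fix f assume f: "f \<in> F"
          then obtain a b where ab: "f = {a, b}" using edge_card FE by (metis card_2_iff subsetD)
          then have "{a, b} \<in> F" "{b, a} \<in> F" using f by (auto simp: insert_commute)
          then have "a \<in> A \<longleftrightarrow> b \<in> A" using clA by blast
          moreover have "f \<subseteq> V" using f FE edge_subset by blast
          ultimately show "f \<in> ?F1 \<union> ?F2" using f ab by auto
        qed
      qed auto
      have XF: "?X F = ?S1 \<union> ?S2"
      proof -
        have "dimg D F = dimg D ?F1 \<union> dimg D ?F2" using Fs dimg_Un by metis
        moreover have "V = A \<union> (V - A)" using AV by auto
        ultimately show ?thesis by (metis (no_types, lifting) Un_assoc Un_left_commute image_Un)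
      qed
      have F1E: "?F1 \<subseteq> E" and F2E: "?F2 \<subseteq> E" using FE by auto
      have i1: "?S1 \<inter> img e = {point D u}"
      proof
        have "x = point D u" if "x \<in> ?S1" "x \<in> img e" for x
        proof -
          have "x \<in> point D ` e"
            using that opn_disjoint[OF eE F1E] eF opn_no_point[OF eE] AV by blast
          moreover have "x \<noteq> point D v"
          proof
            assume "x = point D v"
            moreover have "point D v \<notin> point D ` A" using point_inj uv AV False by blast
            moreover have "point D v \<notin> dimg D ?F1" using point_in_dimg[OF F1E uv(2)] False by blast
            ultimately show False using that(1) by blast
          qed
          ultimately show ?thesis using e by auto
        qed
        then show "?S1 \<inter> img e \<subseteq> {point D u}" by blast
        show "{point D u} \<subseteq> ?S1 \<inter> img e" using uA point_in_edge[OF eE] e by auto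
      qed
      have i2: "(?S1 \<union> img e) \<inter> ?S2 = {point D v}"
      proof
        have "x = point D v" if x: "x \<in> ?S1 \<union> img e" "x \<in> ?S2" for x
        proof (cases "x \<in> ?S1")
          case True
          have "point D ` A \<inter> point D ` (V - A) = {}" using point_inj AV by blast
          moreover have "point D ` A \<inter> dimg D ?F2 = {}"
          proof -
            have "point D a \<notin> dimg D ?F2" if "a \<in> A" for a
              using point_in_dimg[OF F2E, of a] that AV by blast
            then show ?thesis by blast
          qed
          moreover have "point D ` (V - A) \<inter> dimg D ?F1 = {}"
          proof -
            have "point D a \<notin> dimg D ?F1" if "a \<in> V - A" for a
              using point_in_dimg[OF F1E, of a] that by blast
            then show ?thesis by blast
          qed
          moreover have "dimg D ?F1 \<inter> dimg D ?F2 = {}"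
          proof -
            have "?F1 \<inter> ?F2 = {}"
            proof (rule ccontr)
              assume "?F1 \<inter> ?F2 \<noteq> {}"
              then obtain f where "f \<in> F" "f \<subseteq> A" "f \<subseteq> V - A" by blast
              then have "f = {}" by blast
              then show False using edge_card FE \<open>f \<in> F\<close> by fastforce
            qed
            from dimg_Int[OF F1E F2E this] show ?thesis by blast
          qed
          ultimately show ?thesis using True x(2) by blast
        next
          case False
          then have xe: "x \<in> img e" using x by simp
          then have "x \<in> point D ` e"
            using x opn_disjoint[OF eE F2E] eF opn_no_point[OF eE] by blast
          moreover have "point D u \<notin> ?S2"
          proof -
            have "point D u \<notin> point D ` (V - A)" using point_inj uv uA by blast
            moreover have "point D u \<notin> dimg D ?F2" using point_in_dimg[OF F2E uv(1)] uA by blast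
            ultimately show ?thesis by blast
          qed
          ultimately show ?thesis using e x(2) by blast
        qed
        then show "(?S1 \<union> img e) \<inter> ?S2 \<subseteq> {point D v}" by blast
        show "{point D v} \<subseteq> (?S1 \<union> img e) \<inter> ?S2"
          using False point_in_edge[OF eE] e uv by auto
      qed
      have pe: "p \<notin> img e" "q \<notin> img e" using pX qX eE by (auto simp: dimg_def)
      have "connected (- img e)" using connected_arc_complement[OF edge_arc0[OF eE]] by simp
      then have "connected_component (- img e) p q"
        using pe unfolding connected_component_def by (metis ComplI order_refl)
      moreover have "connected_component (- ?S1) p q"
        using IH by (rule connected_component_of_subset) (use XF in blast)
      moreover have "compact ?S1"
        using compact_dimg[OF F1E] finite_subset[OF AV finite_V]
        by (simp add: compact_Un finite_imp_compact)
      moreover have ce: "compact (img e)" using edge_arc0[OF eE] by (simp add: compact_arc_image)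
      moreover have "closed (img e)" using ce by (rule compact_imp_closed)
      moreover have "connected (?S1 \<inter> img e)" unfolding i1 by simp
      ultimately have "connected_component (- (?S1 \<union> img e)) p q"
        using Janiszewski[of ?S1 "img e" p q] by blast
      moreover have "connected_component (- ?S2) p q"
        using IH by (rule connected_component_of_subset) (use XF in blast)
      moreover have "closed ?S2"
        using compact_dimg[OF F2E] finite_V
        by (intro compact_imp_closed) (simp add: compact_Un finite_imp_compact)
      moreover have "compact (?S1 \<union> img e)" using \<open>compact ?S1\<close> ce by (rule compact_Un)
      moreover have "connected ((?S1 \<union> img e) \<inter> ?S2)" unfolding i2 by simp
      ultimately have "connected_component (- (?S1 \<union> img e \<union> ?S2)) p q"
        using Janiszewski[of "?S1 \<union> img e" ?S2 p q] by blast
      then show ?thesis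
        by (rule connected_component_of_subset) (use XeF XF in blast)
    qed
  qed
  from this[OF order_refl] have "connected_component (- drawing_image G D) q p"
    unfolding drawing_image_eq by (rule connected_component_sym)
  moreover have "q \<in> outside (drawing_image G D)" using q drawing_image_eq by blast
  ultimately show ?thesis using outside_same_component by blast
qed

end

section \<open>Chords and inner faces of a cycle in an outerplane graph\<close>

locale outerplane_graph = plane_graph +
  assumes outer: "\<And>v. v \<in> V \<Longrightarrow> point D v \<in> frontier (outer_face G D)"
begin

text \<open>The inside of a cycle is open and disjoint from the outer face, hence from its closure,
  which contains all vertices. In this form outerplanarity enters the arguments about faces.\<close>

lemma no_vertex_inside:
  assumes "cyc E zs" "w \<in> V"
  shows "point D w \<notin> inside (dimg D (cedges zs))"
proof -
  let ?Z = "dimg D (cedges zs)"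
  note J = cyc_Jordan[OF assms(1)]
  have "?Z \<subseteq> drawing_image G D"
    using assms(1) dimg_mono[of "cedges zs" E D] by (auto simp: drawing_image_eq cyc_def)
  then have "outer_face G D \<subseteq> outside ?Z" unfolding outer_face_def by (rule outside_mono)
  then have "closure (outer_face G D) \<inter> inside ?Z = {}"
    using J(2,8) open_Int_closure_eq_empty[of "inside ?Z" "outer_face G D"] by blast
  then show ?thesis using outer[OF assms(2)] by (auto simp: frontier_def)
qed

lemma edge_inside_ends:
  assumes "cyc E zs" "e \<in> E" "opn e \<inter> inside (dimg D (cedges zs)) \<noteq> {}"
  shows "e \<subseteq> set zs" "e \<notin> cedges zs" "opn e \<subseteq> inside (dimg D (cedges zs))"
proof -
  let ?Z = "dimg D (cedges zs)"
  note J = cyc_Jordan[OF assms(1)]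
  show ne: "e \<notin> cedges zs"
    using assms(3) inside_no_overlap[of ?Z] unfolding dimg_def by blast
  show sub: "opn e \<subseteq> inside ?Z"
    using edge_side[OF assms(1,2) ne] assms(3) J(8) by blast
  show "e \<subseteq> set zs"
  proof
    fix w assume w: "w \<in> e"
    then have wV: "w \<in> V" using edge_subset assms(2) by blast
    have "point D w \<in> closure (opn e)" using img_closure_opn[OF assms(2)] point_in_edge[OF assms(2) w] by blast
    then have "point D w \<in> inside ?Z \<union> ?Z" using closure_mono[OF sub] J(13) by blast
    then have "point D w \<in> ?Z" using no_vertex_inside[OF assms(1) wV] by blast
    then have "w \<in> \<Union>(cedges zs)"
      using point_in_dimg[of "cedges zs" w] assms(1) wV by (auto simp: cyc_def)
    moreover have "zs \<noteq> []" using assms(1) by (auto simp: cyc_def)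
    ultimately show "w \<in> set zs" using cedges_subset by fastforce
  qed
qed

definition chords :: "'a list \<Rightarrow> 'a set set" where
  "chords zs = {e \<in> E. e \<subseteq> set zs} - cedges zs"

text \<open>Defined for every cycle, so that cutting along a chord can be iterated. For a cycle
  through all vertices these are the bounded faces of the drawing, as \<open>ham_faces\<close>
  shows.\<close>

definition faces :: "'a list \<Rightarrow> complex set set" where
  "faces zs = components (inside (dimg D (cedges zs)) - dimg D (chords zs))"

lemma chord_ends:
  assumes "cyc E (as @ u # bs @ v # cs)" "{u, v} \<in> chords (as @ u # bs @ v # cs)"
  shows "bs \<noteq> []" "as @ cs \<noteq> []"
proof -
  have ne: "{u, v} \<notin> cedges (as @ u # bs @ v # cs)" using assms(2) by (simp add: chords_def)
  show "bs \<noteq> []"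
    using ne unfolding cedges_split by (auto simp: pedges_Cons)
  show "as @ cs \<noteq> []"
    using ne unfolding cedges_split by (auto simp: pedges_Cons)
qed

lemma cyc_split:
  assumes "cyc E (as @ u # bs @ v # cs)" "{u, v} \<in> chords (as @ u # bs @ v # cs)"
  shows "cyc E (u # bs @ [v])" "cyc E (as @ u # v # cs)"
proof -
  note ne = chord_ends[OF assms]
  have E: "{u, v} \<in> E" using assms(2) by (simp add: chords_def)
  show "cyc E (u # bs @ [v])"
    using assms(1) E ne(1) unfolding cyc_def cedges_split cedges_split1
    by (cases bs) auto
  show "cyc E (as @ u # v # cs)"
    using assms(1) E ne(2) unfolding cyc_def cedges_split cedges_split2
    by (cases as; cases cs) auto
qed

lemma split_edges:
  assumes "cyc E (as @ u # bs @ v # cs)" "{u, v} \<in> chords (as @ u # bs @ v # cs)"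
  shows "pedges (u # bs @ [v]) \<inter> pedges (u # rev as @ rev cs @ [v]) = {}"
    "{u, v} \<notin> pedges (u # bs @ [v])" "{u, v} \<notin> pedges (u # rev as @ rev cs @ [v])"
proof -
  have ne: "{u, v} \<notin> pedges (u # bs @ [v])" "{u, v} \<notin> pedges (u # rev as @ rev cs @ [v])"
    and E: "pedges (u # bs @ [v]) \<subseteq> E"
    using assms unfolding chords_def cyc_def cedges_split by auto
  have d: "distinct (as @ u # bs @ v # cs)" using assms(1) by (simp add: cyc_def)
  have "e = {u, v}" if e: "e \<in> pedges (u # bs @ [v])" "e \<in> pedges (u # rev as @ rev cs @ [v])" for e
  proof -
    have "e \<subseteq> {u, v}" using pedges_subset[OF e(1)] pedges_subset[OF e(2)] d by auto
    moreover have "card e = 2" using edge_card e(1) E by blast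
    moreover have "card {u, v} = 2" using d by auto
    ultimately show ?thesis using card_seteq[of "{u, v}" e] by auto
  qed
  then show "pedges (u # bs @ [v]) \<inter> pedges (u # rev as @ rev cs @ [v]) = {}" using ne by blast
qed (use assms in \<open>auto simp: chords_def cedges_split\<close>)

text \<open>The chord and the two arcs of the cycle form a theta graph. Each arc has an inner vertex
  and thus cannot lie inside the cycle formed by the rest, so the chord is the enclosed
  path.\<close>

lemma chord_inside:
  assumes "cyc E zs" "e \<in> chords zs"
  shows "opn e \<subseteq> inside (dimg D (cedges zs))"
proof -
  have eE: "e \<in> E" "e \<subseteq> set zs" "e \<notin> cedges zs" using assms(2) by (auto simp: chords_def)
  obtain as u bs v cs where zs: "zs = as @ u # bs @ v # cs" and e: "e = {u, v}" "u \<noteq> v"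
    using two_in_list[OF eE(2) edge_card[OF eE(1)]] .
  note a = assms[unfolded zs e]
  note ne = chord_ends[OF a] and c12 = cyc_split[OF a] and se = split_edges[OF a]
  let ?p = "u # bs @ [v]" and ?q = "u # rev as @ rev cs @ [v]" and ?r = "[u, v]"
  have d: "distinct (as @ u # bs @ v # cs)" using a by (simp add: cyc_def)
  have sub: "pedges ?p \<subseteq> E" "pedges ?q \<subseteq> E" using a(1) by (auto simp: cyc_def cedges_split)
  have r: "pedges ?r = {e}" by (simp add: pedges_Cons e)
  have V: "set zs \<subseteq> V" unfolding zs using set_subset_V[OF _ sub(1)] set_subset_V[OF _ sub(2)] by auto
  have di: "dimg D (pedges ?r) = img e" unfolding r by (simp add: dimg_def)
  have "dimg D (pedges ?r) - {point D u, point D v} \<subseteq> inside (dimg D (pedges ?p) \<union> dimg D (pedges ?q)) \<or>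
    dimg D (pedges ?q) - {point D u, point D v} \<subseteq> inside (dimg D (pedges ?p) \<union> dimg D (pedges ?r)) \<or>
    dimg D (pedges ?p) - {point D u, point D v} \<subseteq> inside (dimg D (pedges ?q) \<union> dimg D (pedges ?r))"
    using d sub r eE se e by (intro theta_lists) auto
  moreover have "\<not> dimg D (pedges ?p) - {point D u, point D v} \<subseteq> inside (dimg D (pedges ?q) \<union> dimg D (pedges ?r))"
  proof
    assume s: "dimg D (pedges ?p) - {point D u, point D v} \<subseteq> inside (dimg D (pedges ?q) \<union> dimg D (pedges ?r))"
    obtain w where w: "w \<in> set bs" using ne by (cases bs) auto
    have "point D w \<in> dimg D (pedges ?p)"
      using point_in_dimg[OF sub(1), of w] w V zs pedges_Union[of ?p] by auto
    moreover have "point D w \<notin> {point D u, point D v}"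
      using point_inj V w zs d by auto
    moreover have "dimg D (pedges ?q) \<union> dimg D (pedges ?r) = dimg D (cedges (as @ u # v # cs))"
      unfolding cedges_split2 dimg_insert di e by auto
    ultimately show False using s no_vertex_inside[OF c12(2), of w] w V zs by auto
  qed
  moreover have "\<not> dimg D (pedges ?q) - {point D u, point D v} \<subseteq> inside (dimg D (pedges ?p) \<union> dimg D (pedges ?r))"
  proof
    assume s: "dimg D (pedges ?q) - {point D u, point D v} \<subseteq> inside (dimg D (pedges ?p) \<union> dimg D (pedges ?r))"
    obtain w where w: "w \<in> set (as @ cs)" using ne by (cases "as @ cs") auto
    have "point D w \<in> dimg D (pedges ?q)"
      using point_in_dimg[OF sub(2), of w] w V zs pedges_Union[of ?q] by auto
    moreover have "point D w \<notin> {point D u, point D v}"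
      using point_inj[of w u] point_inj[of w v] V w zs d by auto
    moreover have "dimg D (pedges ?p) \<union> dimg D (pedges ?r) = dimg D (cedges (u # bs @ [v]))"
      unfolding cedges_split1 dimg_insert di e by auto
    ultimately have "point D w \<in> inside (dimg D (cedges (u # bs @ [v])))" using s by auto
    moreover have "w \<in> V" using w V zs by auto
    ultimately show False using no_vertex_inside[OF c12(1)] by blast
  qed
  ultimately show ?thesis unfolding di zs cedges_split dimg_Un using e by auto
qed

end

lemma card_le1_mono: "A \<subseteq> B \<Longrightarrow> finite B \<Longrightarrow> card B \<le> 1 \<Longrightarrow> card A \<le> 1"
  using card_mono[of B A] by simp

context outerplane_graph begin

lemma finite_chords [simp]: "finite (chords zs)"
  using finite_E by (auto simp: chords_def)

lemma closed_chords: "closed (dimg D (chords z))"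
  by (intro compact_imp_closed compact_dimg) (auto simp: chords_def)

lemma inside_split:
  assumes "cyc E (as @ u # bs @ v # cs)" "{u, v} \<in> chords (as @ u # bs @ v # cs)"
  shows "inside (dimg D (cedges (as @ u # bs @ v # cs))) =
      inside (dimg D (cedges (u # bs @ [v]))) \<union> inside (dimg D (cedges (as @ u # v # cs))) \<union> opn {u, v}"
    "inside (dimg D (cedges (u # bs @ [v]))) \<inter> inside (dimg D (cedges (as @ u # v # cs))) = {}"
proof -
  let ?p = "u # bs @ [v]" and ?q = "u # rev as @ rev cs @ [v]"
  note se = split_edges[OF assms] and ci = chord_inside[OF assms] and ne = chord_ends[OF assms]
  have d: "distinct (as @ u # bs @ v # cs)" using assms by (simp add: cyc_def)
  have sub: "pedges ?p \<subseteq> E" "pedges ?q \<subseteq> E" using assms(1) by (auto simp: cyc_def cedges_split)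
  have eE: "{u, v} \<in> E" using assms(2) by (simp add: chords_def)
  have r: "pedges [u, v] = {{u, v}}" by (simp add: pedges_Cons)
  have dr: "dimg D (pedges [u, v]) = img {u, v}" unfolding r by (simp add: dimg_def)
  have dq: "distinct ?p" "distinct ?q" using d by (auto simp: Int_Un_distrib)
  obtain g where g: "arc g" "path_image g = dimg D (pedges ?p)" "pathstart g = point D u" "pathfinish g = point D v"
    using list_arc[of ?p] dq sub by auto
  obtain h where h: "arc h" "path_image h = dimg D (pedges ?q)" "pathstart h = point D u" "pathfinish h = point D v"
    using list_arc[of ?q] dq sub by auto
  obtain k where k: "arc k" "path_image k = img {u, v}" "pathstart k = point D u" "pathfinish k = point D v"
    using edge_arc[OF eE] .
  have i: "path_image g \<inter> path_image h = {point D u, point D v}"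
    unfolding g h using d sub se by (intro lists_Int) auto
  have j: "path_image g \<inter> path_image k = {point D u, point D v}"
    unfolding g k dr[symmetric] using d sub se eE r by (intro lists_Int) auto
  have l: "path_image h \<inter> path_image k = {point D u, point D v}"
    unfolding h k dr[symmetric] using d sub se eE r by (intro lists_Int) auto
  have nuv: "point D u \<noteq> point D v" using arc_distinct_ends[OF g(1)] g by simp
  have gh: "path_image g \<union> path_image h = dimg D (cedges (as @ u # bs @ v # cs))"
    by (simp add: g h cedges_split dimg_Un)
  have gk: "path_image g \<union> path_image k = dimg D (cedges (u # bs @ [v]))"
    by (auto simp: g k cedges_split1 dimg_insert)
  have hk: "path_image h \<union> path_image k = dimg D (cedges (as @ u # v # cs))"
    by (auto simp: h k cedges_split2 dimg_insert)
  have "opn {u, v} \<noteq> {}" using opn_ne[OF eE] .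
  then have "path_image k \<inter> inside (path_image g \<union> path_image h) \<noteq> {}"
  proof -
    have "opn {u, v} \<subseteq> path_image k \<inter> inside (path_image g \<union> path_image h)"
      unfolding k(2) gh using ci by blast
    then show ?thesis using \<open>opn {u, v} \<noteq> {}\<close> by blast
  qed
  from split_inside_simple_closed_curve[OF arc_imp_simple_path[OF g(1)] g(3,4)
      arc_imp_simple_path[OF h(1)] h(3,4) arc_imp_simple_path[OF k(1)] k(3,4) nuv i j l this]
  have *: "inside (path_image g \<union> path_image k) \<inter> inside (path_image h \<union> path_image k) = {}"
    "inside (path_image g \<union> path_image k) \<union> inside (path_image h \<union> path_image k) \<union>
           (path_image k - {point D u, point D v}) = inside (path_image g \<union> path_image h)" by blast+
  show "inside (dimg D (cedges (as @ u # bs @ v # cs))) =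
      inside (dimg D (cedges (u # bs @ [v]))) \<union> inside (dimg D (cedges (as @ u # v # cs))) \<union> opn {u, v}"
    unfolding gh[symmetric] gk[symmetric] hk[symmetric] using *(2) k(2) by simp
  show "inside (dimg D (cedges (u # bs @ [v]))) \<inter> inside (dimg D (cedges (as @ u # v # cs))) = {}"
    using *(1) unfolding gk hk .
qed

lemma cedges_split_chord:
  assumes "cyc E (as @ u # bs @ v # cs)" "{u, v} \<in> chords (as @ u # bs @ v # cs)"
  shows "cedges (as @ u # bs @ v # cs) = (cedges (u # bs @ [v]) - {{u, v}}) \<union> (cedges (as @ u # v # cs) - {{u, v}})"
    "{u, v} \<in> cedges (u # bs @ [v])" "{u, v} \<in> cedges (as @ u # v # cs)" "{u, v} \<notin> cedges (as @ u # bs @ v # cs)"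
  using split_edges[OF assms] unfolding cedges_split cedges_split1 cedges_split2 by auto

lemma subset_two: "e \<in> E \<Longrightarrow> e \<subseteq> {u, v} \<Longrightarrow> e = {u, v}"
  using edge_card[of e] card_seteq[of "{u, v}" e] card_insert_le_m1[of 2 "{v}" u] by auto

text \<open>Another chord runs inside the cycle and meets the cutting chord at most in an end, so it
  enters one of the two halves and has both ends there. Combinatorially: chords do not
  cross.\<close>

lemma chords_split:
  assumes "cyc E (as @ u # bs @ v # cs)" "{u, v} \<in> chords (as @ u # bs @ v # cs)"
  shows "chords (as @ u # bs @ v # cs) = insert {u, v} (chords (u # bs @ [v]) \<union> chords (as @ u # v # cs))"
    "(cedges (u # bs @ [v]) \<union> chords (u # bs @ [v])) \<inter> (cedges (as @ u # v # cs) \<union> chords (as @ u # v # cs)) = {{u, v}}"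
    "{u, v} \<notin> chords (u # bs @ [v])" "{u, v} \<notin> chords (as @ u # v # cs)"
proof -
  let ?zs = "as @ u # bs @ v # cs" and ?z1 = "u # bs @ [v]" and ?z2 = "as @ u # v # cs"
  note c12 = cyc_split[OF assms] and ce = cedges_split_chord[OF assms] and ins = inside_split[OF assms]
  have d: "distinct ?zs" using assms by (simp add: cyc_def)
  have s12: "set ?z1 \<inter> set ?z2 = {u, v}" using d by auto
  have sE: "cedges ?z1 \<subseteq> E" "cedges ?z2 \<subseteq> E" using c12 by (auto simp: cyc_def)
  have eE: "{u, v} \<in> E" using assms(2) by (simp add: chords_def)
  show "(cedges ?z1 \<union> chords ?z1) \<inter> (cedges ?z2 \<union> chords ?z2) = {{u, v}}" (is "?A \<inter> ?B = _")
  proof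
    show "?A \<inter> ?B \<subseteq> {{u, v}}"
    proof
      fix e assume e: "e \<in> ?A \<inter> ?B"
      then have "e \<subseteq> set ?z1" "e \<subseteq> set ?z2"
        using cedges_subset[of ?z1 e] cedges_subset[of ?z2 e] unfolding chords_def by blast+
      moreover have "e \<in> E" using e sE unfolding chords_def by blast
      ultimately show "e \<in> {{u, v}}" using subset_two[of e u v] s12 by blast
    qed
    show "{{u, v}} \<subseteq> ?A \<inter> ?B" using ce by blast
  qed
  then show n: "{u, v} \<notin> chords ?z1" "{u, v} \<notin> chords ?z2"
    using ce unfolding chords_def by blast+
  show "chords ?zs = insert {u, v} (chords ?z1 \<union> chords ?z2)"
  proof (intro equalityI subsetI)
    fix e assume e: "e \<in> chords ?zs"
    show "e \<in> insert {u, v} (chords ?z1 \<union> chords ?z2)"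
    proof (cases "e = {u, v}")
      case False
      have eE': "e \<in> E" "e \<notin> cedges ?zs" using e by (auto simp: chords_def)
      then have nc: "e \<notin> cedges ?z1" "e \<notin> cedges ?z2" using ce False by blast+
      have "opn e \<inter> opn {u, v} = {}"
        using edges_Int[OF eE'(1) eE False] by blast
      then have "opn e \<inter> inside (dimg D (cedges ?z1)) \<noteq> {} \<or> opn e \<inter> inside (dimg D (cedges ?z2)) \<noteq> {}"
        using chord_inside[OF assms(1) e] opn_ne[OF eE'(1)] ins(1) by blast
      then have "e \<subseteq> set ?z1 \<or> e \<subseteq> set ?z2"
        using edge_inside_ends(1)[OF c12(1) eE'(1)] edge_inside_ends(1)[OF c12(2) eE'(1)] by blast
      then show ?thesis using nc eE' by (auto simp: chords_def)
    qed simp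
  next
    fix e assume e: "e \<in> insert {u, v} (chords ?z1 \<union> chords ?z2)"
    show "e \<in> chords ?zs"
    proof (cases "e = {u, v}")
      case False
      then have "e \<in> chords ?z1 \<or> e \<in> chords ?z2" using e by blast
      then have e': "e \<in> E" "e \<subseteq> set ?zs" "e \<in> ?A \<and> e \<notin> cedges ?z1 \<or> e \<in> ?B \<and> e \<notin> cedges ?z2"
        by (auto simp: chords_def)
      have "e \<notin> cedges ?zs"
      proof
        assume "e \<in> cedges ?zs"
        then have "e \<in> ?A \<inter> ?B" using ce(1) e'(3) by blast
        then show False using \<open>?A \<inter> ?B = _\<close> False by blast
      qed
      then show ?thesis using e' by (simp add: chords_def)
    qed (use assms in simp)
  qed
qed

lemma faces_split:
  assumes "cyc E (as @ u # bs @ v # cs)" "{u, v} \<in> chords (as @ u # bs @ v # cs)"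
  shows "faces (as @ u # bs @ v # cs) = faces (u # bs @ [v]) \<union> faces (as @ u # v # cs)"
    "faces (u # bs @ [v]) \<inter> faces (as @ u # v # cs) = {}"
proof -
  let ?zs = "as @ u # bs @ v # cs" and ?z1 = "u # bs @ [v]" and ?z2 = "as @ u # v # cs"
  let ?I = "\<lambda>z. inside (dimg D (cedges z))" and ?X = "\<lambda>z. dimg D (chords z)"
  note c12 = cyc_split[OF assms] and ins = inside_split[OF assms] and cs = chords_split[OF assms]
  have eE: "{u, v} \<in> E" using assms(2) by (simp add: chords_def)
  have opn: "open (?I z - ?X z)" if "cyc E z" for z
    using cyc_Jordan(2)[OF that] closed_chords by (rule open_Diff)
  have in1: "img {u, v} \<inter> ?I z = {}" if "{u, v} \<in> cedges z" for z
    using inside_no_overlap[of "dimg D (cedges z)"] that unfolding dimg_def by blast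
  note in1' = in1[OF cedges_split_chord(2)[OF assms]] in1[OF cedges_split_chord(3)[OF assms]]
  \<comment> \<open>Chords of one half stay inside that half, so they do not cut the other.\<close>
  have in2: "?X z \<inter> ?I z' = {}" if "cyc E z" "cyc E z'" and zz: "?I z \<inter> ?I z' = {}" for z z'
  proof -
    have "img g \<inter> ?I z' = {}" if g: "g \<in> chords z" for g
    proof -
      have "g \<subseteq> V" "g \<in> E" using g edge_subset by (auto simp: chords_def)
      then have "point D ` g \<inter> ?I z' = {}" using no_vertex_inside[OF \<open>cyc E z'\<close>] by blast
      moreover have "opn g \<inter> ?I z' = {}" using chord_inside[OF \<open>cyc E z\<close> g] zz by blast
      ultimately show ?thesis by blast
    qed
    then show ?thesis unfolding dimg_def by blast
  qed
  have X: "?X ?zs = img {u, v} \<union> ?X ?z1 \<union> ?X ?z2" unfolding cs(1) by (simp add: dimg_insert dimg_Un Un_assoc)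
  have *: "I - X = (A - X1) \<union> (B - X2)"
    if "I = A \<union> B \<union> o'" "X = f \<union> X1 \<union> X2" "o' \<subseteq> f" "f \<inter> A = {}" "f \<inter> B = {}"
      "X1 \<inter> B = {}" "X2 \<inter> A = {}" for I A B o' X f X1 X2 :: "complex set"
    using that by blast
  have "?I ?zs - ?X ?zs = (?I ?z1 - ?X ?z1) \<union> (?I ?z2 - ?X ?z2)"
  proof (rule *)
    show "?I ?zs = ?I ?z1 \<union> ?I ?z2 \<union> opn {u, v}" by (rule ins(1))
    show "?X ?zs = img {u, v} \<union> ?X ?z1 \<union> ?X ?z2" by (rule X)
    show "opn {u, v} \<subseteq> img {u, v}" by blast
    show "?X ?z1 \<inter> ?I ?z2 = {}" using in2[OF c12 ins(2)] .
    show "?X ?z2 \<inter> ?I ?z1 = {}" using in2[OF c12(2,1)] ins(2) by (simp add: Int_commute)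
  qed (use in1' in auto)
  moreover have "(?I ?z1 - ?X ?z1) \<inter> (?I ?z2 - ?X ?z2) = {}" using ins(2) by blast
  ultimately show "faces ?zs = faces ?z1 \<union> faces ?z2"
    unfolding faces_def using components_Un_open[OF opn[OF c12(1)] opn[OF c12(2)]] by simp
  have "F \<subseteq> ?I z \<and> F \<noteq> {}" if "F \<in> faces z" for F z
    using that in_components_subset in_components_nonempty unfolding faces_def by blast
  then show "faces ?z1 \<inter> faces ?z2 = {}" using ins(2) by blast
qed

text \<open>Each half has fewer chords, the cutting chord being an edge of both smaller
  cycles.\<close>

lemma polygon_induct [consumes 1, case_names no_chord chord]:
  assumes "cyc E zs"
    and "\<And>zs. cyc E zs \<Longrightarrow> chords zs = {} \<Longrightarrow> P zs"
    and "\<And>as u bs v cs. cyc E (as @ u # bs @ v # cs) \<Longrightarrow> {u, v} \<in> chords (as @ u # bs @ v # cs) \<Longrightarrow>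
      P (u # bs @ [v]) \<Longrightarrow> P (as @ u # v # cs) \<Longrightarrow> P (as @ u # bs @ v # cs)"
  shows "P zs"
  using assms(1)
proof (induction "card (chords zs)" arbitrary: zs rule: less_induct)
  case less
  show ?case
  proof (cases "chords zs = {}")
    case False
    then obtain e where e: "e \<in> chords zs" by blast
    then have "e \<subseteq> set zs" "e \<in> E" by (auto simp: chords_def)
    then obtain as u bs v cs where zs: "zs = as @ u # bs @ v # cs" "e = {u, v}"
      using two_in_list[of e zs] edge_card by metis
    note a = less.prems[unfolded zs] e[unfolded zs]
    note cs = chords_split[OF a] and c = cyc_split[OF a]
    have "chords (u # bs @ [v]) \<subset> chords zs" "chords (as @ u # v # cs) \<subset> chords zs"
      using cs a unfolding zs by blast+
    then have "card (chords (u # bs @ [v])) < card (chords zs)" "card (chords (as @ u # v # cs)) < card (chords zs)"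
      by (auto intro: psubset_card_mono)
    then show ?thesis using less.hyps c assms(3)[OF a] zs by blast
  qed (use assms(2) less.prems in blast)
qed

lemma face_subset: "F \<in> faces zs \<Longrightarrow> F \<subseteq> inside (dimg D (cedges zs))"
  using in_components_subset unfolding faces_def by blast

text \<open>The boundary of a face lies on the cycle and its chords, and any other edge shares only
  end points with these.\<close>

lemma face_edges:
  assumes "cyc E zs" "F \<in> faces zs" "e \<in> E" "edge_on_face D e F"
  shows "e \<in> cedges zs \<union> chords zs"
proof (rule ccontr)
  let ?Z = "dimg D (cedges zs)" and ?X = "dimg D (chords zs)"
  assume n: "e \<notin> cedges zs \<union> chords zs"
  have "cedges zs \<union> chords zs \<subseteq> E" using assms(1) by (auto simp: cyc_def chords_def)
  from opn_disjoint[OF assms(3) this n] have d: "opn e \<inter> (?Z \<union> ?X) = {}" by (simp add: dimg_Un)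
  have "closed ?X" by (intro compact_imp_closed compact_dimg) (auto simp: chords_def)
  then have op: "open (inside ?Z - ?X)" using cyc_Jordan(2)[OF assms(1)] by (intro open_Diff)
  have "frontier F \<subseteq> frontier (inside ?Z - ?X)"
    using frontier_of_components_subset assms(2) unfolding faces_def by blast
  also have "\<dots> \<subseteq> closure (inside ?Z) - (inside ?Z - ?X)"
    using op closure_mono[of "inside ?Z - ?X" "inside ?Z"] unfolding frontier_def by (auto simp: interior_open)
  also have "\<dots> \<subseteq> ?Z \<union> ?X" using cyc_Jordan(13)[OF assms(1)] by blast
  finally have "frontier F \<subseteq> ?Z \<union> ?X" .
  then have "opn e = {}" using assms(4) d unfolding edge_on_face_def by blast
  then show False using opn_ne[OF assms(3)] by simp
qed

lemma faces_no_chord: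
  assumes "cyc E zs" "chords zs = {}"
  shows "faces zs = {inside (dimg D (cedges zs))}"
  using cyc_Jordan(1,3)[OF assms(1)] assms(2) by (simp add: faces_def components_eq_sing_iff)

text \<open>Induction along a chord: an edge other than the cutting chord belongs to one half only,
  while the cutting chord is a cycle edge of both halves and gets one face from each.\<close>

lemma faces_on_edge:
  assumes "cyc E zs"
  shows "(\<forall>e\<in>cedges zs. \<exists>F. {F \<in> faces zs. edge_on_face D e F} = {F}) \<and>
    (\<forall>e\<in>chords zs. \<exists>F F'. F \<noteq> F' \<and> {F \<in> faces zs. edge_on_face D e F} = {F, F'})"
  using assms
proof (induction rule: polygon_induct)
  case (no_chord zs)
  have "edge_on_face D e (inside (dimg D (cedges zs)))" if "e \<in> cedges zs" for e
    unfolding edge_on_face_def cyc_Jordan(10)[OF no_chord(1)] using that by (auto simp: dimg_def)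
  then show ?case unfolding faces_no_chord[OF no_chord] using no_chord by auto
next
  case (chord as u bs v cs)
  let ?zs = "as @ u # bs @ v # cs" and ?z1 = "u # bs @ [v]" and ?z2 = "as @ u # v # cs"
  note a = chord(1,2)
  note c12 = cyc_split[OF a] and cs = chords_split[OF a] and fs = faces_split[OF a] and ce = cedges_split_chord[OF a]
  let ?on = "\<lambda>z e. {F \<in> faces z. edge_on_face D e F}"
  have U: "?on ?zs e = ?on ?z1 e \<union> ?on ?z2 e" for e using fs by blast
  have E: "cedges ?z1 \<union> chords ?z1 \<subseteq> E" "cedges ?z2 \<union> chords ?z2 \<subseteq> E"
    using c12 by (auto simp: cyc_def chords_def)
  have n1: "?on ?z2 e = {}" if "e \<in> cedges ?z1 \<union> chords ?z1" "e \<noteq> {u, v}" for e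
    using face_edges[OF c12(2)] that cs(2) E by blast
  have n2: "?on ?z1 e = {}" if "e \<in> cedges ?z2 \<union> chords ?z2" "e \<noteq> {u, v}" for e
    using face_edges[OF c12(1)] that cs(2) E by blast
  show ?case
  proof (intro conjI ballI)
    fix e assume "e \<in> cedges ?zs"
    then consider "e \<in> cedges ?z1" "e \<noteq> {u, v}" | "e \<in> cedges ?z2" "e \<noteq> {u, v}" using ce by blast
    then show "\<exists>F. ?on ?zs e = {F}"
    proof cases
      case 1 then have "?on ?zs e = ?on ?z1 e" unfolding U using n1 by blast
      then show ?thesis using chord(3) 1 by metis
    next
      case 2 then have "?on ?zs e = ?on ?z2 e" unfolding U using n2 by blast
      then show ?thesis using chord(4) 2 by metis
    qed
  next
    fix e assume "e \<in> chords ?zs"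
    then consider "e = {u, v}" | "e \<in> chords ?z1" "e \<noteq> {u, v}" | "e \<in> chords ?z2" "e \<noteq> {u, v}"
      using cs(1) by blast
    then show "\<exists>F F'. F \<noteq> F' \<and> ?on ?zs e = {F, F'}"
    proof cases
      case 1
      obtain F1 where F1: "?on ?z1 {u, v} = {F1}" using chord(3) ce by blast
      obtain F2 where F2: "?on ?z2 {u, v} = {F2}" using chord(4) ce by blast
      have "F1 \<noteq> F2" using F1 F2 fs(2) by blast
      moreover have "?on ?zs e = {F1, F2}" unfolding U 1 F1 F2 by blast
      ultimately show ?thesis by blast
    next
      case 2 then have "?on ?zs e = ?on ?z1 e" unfolding U using n1 by blast
      then show ?thesis using chord(3) 2 by simp
    next
      case 3 then have "?on ?zs e = ?on ?z2 e" unfolding U using n2 by blast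
      then show ?thesis using chord(4) 3 by simp
    qed
  qed
qed

lemma face_of_cycle_edge:
  assumes "cyc E zs" "e \<in> cedges zs"
  obtains F where "F \<in> faces zs" "edge_on_face D e F"
    "\<And>F'. F' \<in> faces zs \<Longrightarrow> edge_on_face D e F' \<Longrightarrow> F' = F"
proof -
  obtain F where "{F \<in> faces zs. edge_on_face D e F} = {F}" using faces_on_edge[OF assms(1)] assms(2) by blast
  then show thesis using that[of F] by blast
qed

definition dual_edges :: "complex set set set" where
  "dual_edges = {{F, F'} | F F'. F \<noteq> F' \<and> (\<exists>e\<in>E. edge_on_face D e F \<and> edge_on_face D e F')}"

text \<open>The faces of each half are connected by induction, and the two faces along the cutting
  chord join them.\<close>

lemma faces_connected:
  assumes "cyc E zs"
  shows "conn dual_edges (faces zs)"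
  using assms
proof (induction rule: polygon_induct)
  case (no_chord zs)
  then show ?case by (simp add: faces_no_chord)
next
  case (chord as u bs v cs)
  note a = chord(1,2)
  note c12 = cyc_split[OF a] and fs = faces_split[OF a] and ce = cedges_split_chord[OF a]
  obtain F1 where F1: "F1 \<in> faces (u # bs @ [v])" "edge_on_face D {u, v} F1" using face_of_cycle_edge[OF c12(1) ce(2)] .
  obtain F2 where F2: "F2 \<in> faces (as @ u # v # cs)" "edge_on_face D {u, v} F2" using face_of_cycle_edge[OF c12(2) ce(3)] .
  have "{F1, F2} \<in> dual_edges"
  proof -
    have "F1 \<noteq> F2" using F1(1) F2(1) fs(2) by blast
    moreover have "{u, v} \<in> E" using a(2) by (simp add: chords_def)
    ultimately show ?thesis using F1(2) F2(2) unfolding dual_edges_def by blast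
  qed
  then show ?case using conn_Un_edge[OF chord(3,4) F1(1) F2(1)] fs(1) by simp
qed

lemma cedges_other:
  assumes "cyc E zs" obtains e' where "e' \<in> cedges zs" "e' \<noteq> e"
proof -
  have z: "distinct zs" "length zs \<ge> 3" using assms by (auto simp: cyc_def)
  then have "pedges zs \<noteq> {}" by (cases zs; cases "tl zs") (auto simp: pedges_Cons)
  then obtain x where "x \<in> pedges zs" by blast
  moreover have "{last zs, hd zs} \<notin> pedges zs" using closing_edge_notin z by blast
  ultimately have "x \<in> cedges zs" "{last zs, hd zs} \<in> cedges zs" "x \<noteq> {last zs, hd zs}"
    by (auto simp: cedges_def)
  then show thesis using that by metis
qed

text \<open>Counting \<open>e0\<close> like a chord makes the induction work: in the half that
  avoids \<open>e0\<close>, the cutting chord takes over its role. Applied to a half of a larger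
  cycle, it yields a face that is a leaf of the larger cycle too.\<close>

lemma leaf_face:
  assumes "cyc E zs" "e0 \<in> cedges zs"
  shows "\<exists>F\<in>faces zs. card {e \<in> insert e0 (chords zs). edge_on_face D e F} \<le> 1 \<and>
    (\<exists>e\<in>cedges zs. e \<noteq> e0 \<and> edge_on_face D e F)"
  using assms
proof (induction arbitrary: e0 rule: polygon_induct)
  case (no_chord zs)
  obtain e where e: "e \<in> cedges zs" "e \<noteq> e0" using cedges_other[OF no_chord(1)] by metis
  have "edge_on_face D e (inside (dimg D (cedges zs)))"
    unfolding edge_on_face_def cyc_Jordan(10)[OF no_chord(1)] using e by (auto simp: dimg_def)
  moreover have "card {e \<in> insert e0 (chords zs). edge_on_face D e (inside (dimg D (cedges zs)))} \<le> card {e0}"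
    using no_chord(2) by (intro card_mono) auto
  ultimately show ?case unfolding faces_no_chord[OF no_chord(1,2)] using e by auto
next
  case (chord as u bs v cs)
  let ?zs = "as @ u # bs @ v # cs" and ?z1 = "u # bs @ [v]" and ?z2 = "as @ u # v # cs"
  note a = chord(1,2)
  note c12 = cyc_split[OF a] and cs = chords_split[OF a] and fs = faces_split[OF a] and ce = cedges_split_chord[OF a]
  \<comment> \<open>\<open>z'\<close> is the half that contains \<open>e0\<close>, and
    \<open>z\<close> is the other one, where the face is found.\<close>
  have *: "\<exists>F\<in>faces ?zs. card {e \<in> insert e0 (chords ?zs). edge_on_face D e F} \<le> 1 \<and>
    (\<exists>e\<in>cedges ?zs. e \<noteq> e0 \<and> edge_on_face D e F)"
    if z: "z = ?z1 \<and> z' = ?z2 \<or> z = ?z2 \<and> z' = ?z1" and e0: "e0 \<in> cedges z'" "e0 \<noteq> {u, v}" for z z'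
  proof -
    have "cyc E z" using z c12 by blast
    moreover have "cedges z \<union> chords z \<subseteq> E" using \<open>cyc E z\<close> by (auto simp: cyc_def chords_def)
    moreover have "{u, v} \<in> cedges z" using z ce(2,3) by blast
    moreover have "(cedges z' \<union> chords z') \<inter> (cedges z \<union> chords z) = {{u, v}}"
      using z cs(2) by (metis Int_commute)
    moreover have "chords ?zs = insert {u, v} (chords z' \<union> chords z)" using z cs(1) by (metis Un_commute)
    moreover have "cedges z - {{u, v}} \<subseteq> cedges ?zs" "faces z \<subseteq> faces ?zs" using z ce(1) fs(1) by blast+
    ultimately have c: "cyc E z" "{u, v} \<in> cedges z" "cedges z \<union> chords z \<subseteq> E"
      "(cedges z' \<union> chords z') \<inter> (cedges z \<union> chords z) = {{u, v}}" "chords ?zs = insert {u, v} (chords z' \<union> chords z)"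
      "cedges z - {{u, v}} \<subseteq> cedges ?zs" "faces z \<subseteq> faces ?zs" by blast+
    obtain F e where F: "F \<in> faces z" "card {e \<in> insert {u, v} (chords z). edge_on_face D e F} \<le> 1"
      "e \<in> cedges z" "e \<noteq> {u, v}" "edge_on_face D e F"
      using z chord(3)[of "{u, v}"] chord(4)[of "{u, v}"] ce by blast
    have "{e \<in> insert e0 (chords ?zs). edge_on_face D e F} \<subseteq> {e \<in> insert {u, v} (chords z). edge_on_face D e F}"
    proof
      fix g assume g: "g \<in> {e \<in> insert e0 (chords ?zs). edge_on_face D e F}"
      have "e0 \<in> E" using e0 z c12 by (auto simp: cyc_def)
      then have "g \<in> E" using g by (auto simp: chords_def)
      then have "g \<in> cedges z \<union> chords z" using face_edges[OF c(1) F(1)] g by blast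
      then show "g \<in> {e \<in> insert {u, v} (chords z). edge_on_face D e F}"
        using g c(4,5) e0 by blast
    qed
    from card_le1_mono[OF this _ F(2)] have "card {e \<in> insert e0 (chords ?zs). edge_on_face D e F} \<le> 1"
      by simp
    moreover have "e \<noteq> e0" using c(4) e0 F by blast
    ultimately show ?thesis using F c by blast
  qed
  have "e0 \<in> cedges ?z1 \<and> e0 \<noteq> {u, v} \<or> e0 \<in> cedges ?z2 \<and> e0 \<noteq> {u, v}" using chord(5) ce by blast
  then show ?case using *[of ?z1 ?z2] *[of ?z2 ?z1] by blast
qed

end

section \<open>Ladders\<close>

text \<open>Two rungs may share an end, as \<open>before\<close> is strict. Consecutive vertices of
  a row need not be adjacent; such gaps are what lets subgraphs be ladders on the same rows.\<close>

definition lad :: "'a set set \<Rightarrow> 'a list \<Rightarrow> 'a list \<Rightarrow> bool" where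
  "lad E xs ys \<longleftrightarrow> distinct (xs @ ys) \<and>
     (\<forall>e\<in>E. e \<in> pedges xs \<or> e \<in> pedges ys \<or> (\<exists>a\<in>set xs. \<exists>b\<in>set ys. e = {a, b})) \<and>
     (\<forall>t t' b b'. {t, b} \<in> E \<longrightarrow> {t', b'} \<in> E \<longrightarrow> before xs t t' \<longrightarrow> \<not> before ys b' b)"

lemma split_unique:
  "distinct (as @ u # r) \<Longrightarrow> as @ u # r = as' @ u # r' \<Longrightarrow> as = as' \<and> r = r'"
proof (induction as arbitrary: as')
  case Nil
  then show ?case by (cases as') auto
next
  case (Cons a as)
  show ?case
  proof (cases as')
    case Nil
    then show ?thesis using Cons.prems by auto
  next
    case (Cons a' l)
    then have "as @ u # r = l @ u # r'" "a' = a" using Cons.prems by auto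
    moreover have "distinct (as @ u # r)" using Cons.prems by auto
    ultimately show ?thesis using Cons.IH[of l] Cons by simp
  qed
qed

lemma split_two_parts:
  assumes "distinct (xs @ ws)" "xs @ ws = as @ u # bs @ v # cs" "u \<in> set xs" "v \<in> set ws"
  obtains p q where "xs = as @ u # p" "ws = q @ v # cs" "bs = p @ q"
proof -
  obtain a1 p where x: "xs = a1 @ u # p" using assms(3) by (auto dest: split_list)
  obtain q c1 where w: "ws = q @ v # c1" using assms(4) by (auto dest: split_list)
  have e: "as @ u # bs @ v # cs = a1 @ u # (p @ q) @ v # c1" using assms(2) x w by simp
  have d: "distinct (as @ u # bs @ v # cs)" using assms(1,2) by simp
  have *: "as = a1 \<and> bs @ v # cs = (p @ q) @ v # c1" using split_unique[OF d e] .
  then have "bs = p @ q \<and> cs = c1" using split_unique[of bs v cs "p @ q" c1] d by auto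
  then show thesis using that x w * by blast
qed

text \<open>Only the first and the last element of a list lack a neighbour on one side. Applied to
  leaf faces, this rules out three of them on a path.\<close>

lemma nxt_three:
  assumes "distinct xs" "card A \<ge> 3" "A \<subseteq> set xs"
  obtains x p q where "x \<in> A" "p \<noteq> q" "nxt xs p x" "nxt xs x q"
proof -
  have "\<not> A \<subseteq> {hd xs, last xs}"
  proof
    assume "A \<subseteq> {hd xs, last xs}"
    then have "card A \<le> card {hd xs, last xs}" by (intro card_mono) auto
    also have "\<dots> \<le> 2" by (simp add: card_insert_if)
    finally show False using assms(2) by simp
  qed
  then obtain x where x: "x \<in> A" "x \<noteq> hd xs" "x \<noteq> last xs" by blast
  then obtain p q where pq: "xs = p @ x # q" using assms(3) by (meson split_list subsetD)
  then have ne: "p \<noteq> []" "q \<noteq> []" using x by auto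
  then have "nxt xs (last p) x" "nxt xs x (hd q)" unfolding pq by (auto simp: nxt_append)
  moreover have "set p \<inter> set q = {}" using assms(1) pq by auto
  then have "last p \<noteq> hd q" using ne last_in_set[of p] hd_in_set[of q] by (metis disjoint_iff)
  ultimately show thesis using that x(1) by blast
qed

section \<open>Chains of faces between two edges of a cycle\<close>

context outerplane_graph begin

abbreviation "on e F \<equiv> edge_on_face D e F"

text \<open>Every chord separates \<open>e'\<close> from the closing edge of the list:
  \<open>e'\<close> lies on the arc of the chord that does not run through the ends of the
  list.\<close>

definition sep :: "'a list \<Rightarrow> 'a set \<Rightarrow> bool" where
  "sep zs e' \<longleftrightarrow> (\<forall>as u bs v cs. zs = as @ u # bs @ v # cs \<longrightarrow> {u, v} \<in> chords zs \<longrightarrow> e' \<in> pedges (u # bs @ [v]))"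

lemma face_ex: "cyc E zs \<Longrightarrow> \<exists>F. F \<in> faces zs"
  by (metis face_of_cycle_edge cedges_def insertI1)

lemma face_of_chord:
  assumes "cyc E zs" "e \<in> chords zs"
  obtains F F' where "F \<noteq> F'" "F \<in> faces zs" "F' \<in> faces zs" "on e F" "on e F'"
    "\<And>H. H \<in> faces zs \<Longrightarrow> on e H \<Longrightarrow> H = F \<or> H = F'"
proof -
  obtain F F' where F: "F \<noteq> F'" "{H \<in> faces zs. on e H} = {F, F'}"
    using conjunct2[OF faces_on_edge[OF assms(1)], rule_format, OF assms(2)] by auto
  have "\<And>H. H \<in> faces zs \<and> on e H \<longleftrightarrow> H = F \<or> H = F'" using F(2) by (simp add: set_eq_iff)
  then show thesis using that[OF F(1)] by blast
qed

lemma single_face: "cyc E zs \<Longrightarrow> faces zs = {F} \<Longrightarrow> chords zs = {}"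
  by (metis face_of_chord equals0I singletonD)

text \<open>Both neighbours lie across a chord on \<open>F\<close>; there is only one such chord,
  and it has just one other face.\<close>

lemma leaf_degree:
  assumes "cyc E zs" "F \<in> faces zs" "card {e \<in> chords zs. on e F} \<le> 1"
    "F1 \<in> faces zs" "F1 \<noteq> F" "g1 \<in> E" "on g1 F" "on g1 F1"
    "F2 \<in> faces zs" "F2 \<noteq> F" "g2 \<in> E" "on g2 F" "on g2 F2"
  shows "F1 = F2"
proof -
  have *: "g \<in> chords zs" if "g \<in> E" "on g F" "on g F'" "F' \<in> faces zs" "F' \<noteq> F" for g F'
    using face_edges[OF assms(1,2) that(1,2)] face_of_cycle_edge[OF assms(1), of g] that assms(2) by blast
  have g: "g1 \<in> chords zs" "g2 \<in> chords zs"
    using *[of g1 F1] *[of g2 F2] assms by blast+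
  have "g1 = g2"
    using assms(3) card_le_Suc0_iff_eq[of "{e \<in> chords zs. on e F}"] g assms by auto
  then show ?thesis using face_of_chord[OF assms(1) g(1)] assms by metis
qed

lemma leaf_split:
  assumes a: "cyc E (as @ u # bs @ v # cs)" "{u, v} \<in> chords (as @ u # bs @ v # cs)"
    and z: "z = u # bs @ [v] \<or> z = as @ u # v # cs" and F: "F \<in> faces z"
  shows "{e \<in> chords (as @ u # bs @ v # cs). on e F} \<subseteq> {e \<in> insert {u, v} (chords z). on e F}"
proof
  fix e assume e: "e \<in> {e \<in> chords (as @ u # bs @ v # cs). on e F}"
  note c12 = cyc_split[OF a] and cs = chords_split[OF a]
  have "cyc E z" using z c12 by blast
  then have "e \<in> cedges z \<union> chords z" using face_edges[OF _ F, of e] e by (auto simp: chords_def)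
  then show "e \<in> {e \<in> insert {u, v} (chords z). on e F}" using e z cs(1,2) by blast
qed

text \<open>Cutting along a chord leaves the closing edge in one half and \<open>e'\<close> in the
  other. The chord serves as the far edge of the former and as the closing edge of the latter, so
  the two chains of faces are concatenated at the chord.\<close>

lemma faces_chain:
  assumes "cyc E zs" "e' \<in> pedges zs" "sep zs e'"
  shows "\<exists>Fs. Fs \<noteq> [] \<and> distinct Fs \<and> set Fs = faces zs \<and> on {last zs, hd zs} (hd Fs) \<and> on e' (last Fs) \<and>
    card {g \<in> chords zs. on g (hd Fs)} \<le> 1 \<and> card {g \<in> chords zs. on g (last Fs)} \<le> 1 \<and>
    (\<forall>F\<in>faces zs. \<forall>F'\<in>faces zs. F \<noteq> F' \<longrightarrow> ((\<exists>g\<in>E. on g F \<and> on g F') \<longleftrightarrow> nxt Fs F F' \<or> nxt Fs F' F))"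
  using assms
proof (induction arbitrary: e' rule: polygon_induct)
  case (no_chord zs)
  let ?F = "inside (dimg D (cedges zs))"
  have "on e ?F" if "e \<in> cedges zs" for e
    unfolding edge_on_face_def cyc_Jordan(10)[OF no_chord(1)] using that by (auto simp: dimg_def)
  then have "on {last zs, hd zs} ?F" "on e' ?F" using no_chord(3) by (auto simp: cedges_def)
  then show ?case using no_chord faces_no_chord[OF no_chord(1,2)] by (intro exI[of _ "[?F]"]) auto
next
  case (chord as u bs v cs)
  let ?zs = "as @ u # bs @ v # cs" and ?z1 = "u # bs @ [v]" and ?z2 = "as @ u # v # cs" and ?f = "{u, v}"
  note a = chord(1,2)
  note c12 = cyc_split[OF a] and cs = chords_split[OF a] and fs = faces_split[OF a] and ce = cedges_split_chord[OF a]
    and ne = chord_ends[OF a]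
  have d: "distinct ?zs" using a(1) by (simp add: cyc_def)
  have e'1: "e' \<in> pedges ?z1" using chord(6) a(2) unfolding sep_def by blast
  have s1: "sep ?z1 e'"
    unfolding sep_def
  proof (intro allI impI)
    fix as' x bs' y cs' assume z: "?z1 = as' @ x # bs' @ y # cs'" and "{x, y} \<in> chords ?z1"
    then have "{x, y} \<in> chords ?zs" using cs(1) by blast
    moreover have "?zs = (as @ as') @ x # bs' @ y # (cs' @ cs)"
    proof -
      have "?zs = as @ ?z1 @ cs" by simp
      then show ?thesis unfolding z by simp
    qed
    ultimately show "e' \<in> pedges (x # bs' @ [y])" using chord(6) unfolding sep_def by metis
  qed
  have f2: "?f \<in> pedges ?z2" by (auto simp: pedges_def nxt_append)
  \<comment> \<open>A chord of this half must join the part before the cut to the part after it;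
    otherwise its arc would lie within one part and could not contain \<open>e'\<close>.\<close>
  have s2: "sep ?z2 ?f"
    unfolding sep_def
  proof (intro allI impI)
    fix as' x bs' y cs' assume z: "?z2 = as' @ x # bs' @ y # cs'" and xy: "{x, y} \<in> chords ?z2"
    have xyc: "{x, y} \<in> chords ?zs" using cs(1) xy by blast
    have d2: "distinct ((as @ [u]) @ v # cs)" using d by auto
    have z': "(as @ [u]) @ (v # cs) = as' @ x # bs' @ y # cs'" using z by simp
    have in2: "x \<in> set ?z2" "y \<in> set ?z2" unfolding z by auto
    have ord: "before ?z2 x y" unfolding z before_split by blast
    have e'n: "e' \<notin> pedges (as @ [u])" "e' \<notin> pedges (v # cs)"
    proof -
      have E: "e' \<in> E" using e'1 c12(1) by (auto simp: cyc_def cedges_def)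
      have "\<not> e' \<subseteq> {u}" "\<not> e' \<subseteq> {v}"
        using edge_card[OF E] card_mono[of "{u}" e'] card_mono[of "{v}" e'] by auto
      moreover have "e' \<subseteq> set ?z1" using pedges_subset[OF e'1] .
      moreover have "set ?z1 \<inter> set (as @ [u]) = {u}" "set ?z1 \<inter> set (v # cs) = {v}" using d by auto
      ultimately show "e' \<notin> pedges (as @ [u])" "e' \<notin> pedges (v # cs)"
        using pedges_subset by blast+
    qed
    have 1: "\<not> before (as @ [u]) x y"
    proof
      assume "before (as @ [u]) x y"
      then obtain p q r where p: "as @ [u] = p @ x # q @ y # r" unfolding before_split by blast
      have "?zs = (as @ [u]) @ bs @ v # cs" by simp
      then have "?zs = p @ x # q @ y # (r @ bs @ v # cs)" unfolding p by simp
      then have "e' \<in> pedges (x # q @ [y])" using chord(6) xyc unfolding sep_def by metis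
      moreover have "as @ [u] = p @ (x # q @ [y]) @ r" using p by simp
      then have "pedges (x # q @ [y]) \<subseteq> pedges (as @ [u])" using pedges_append_subset by (metis subset_trans)
      ultimately show False using e'n by blast
    qed
    have 2: "\<not> before (v # cs) x y"
    proof
      assume "before (v # cs) x y"
      then obtain p q r where p: "v # cs = p @ x # q @ y # r" unfolding before_split by blast
      have "?zs = (as @ u # bs) @ (v # cs)" by simp
      then have "?zs = (as @ u # bs @ p) @ x # q @ y # r" unfolding p by simp
      then have "e' \<in> pedges (x # q @ [y])" using chord(6) xyc unfolding sep_def by metis
      moreover have "v # cs = p @ (x # q @ [y]) @ r" using p by simp
      then have "pedges (x # q @ [y]) \<subseteq> pedges (v # cs)" using pedges_append_subset by (metis subset_trans)
      ultimately show False using e'n by blast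
    qed
    have "before (as @ [u]) x y \<or> before (v # cs) x y \<or> x \<in> set (as @ [u]) \<and> y \<in> set (v # cs)"
      using ord before_append[of "as @ [u]" "v # cs" x y] by simp
    then have xy': "x \<in> set (as @ [u])" "y \<in> set (v # cs)" using 1 2 by auto
    obtain p q where pq: "as @ [u] = as' @ x # p" "v # cs = q @ y # cs'" "bs' = p @ q"
      using split_two_parts[OF d2 z' xy'] .
    have "last (x # p) = u" using pq(1) by (metis last_appendR last_snoc list.distinct(1))
    moreover have "hd (q @ [y]) = v" using pq(2) by (cases q) auto
    moreover have "x # bs' @ [y] = (x # p) @ (q @ [y])" using pq by simp
    moreover have "{last (x # p), hd (q @ [y])} \<in> pedges ((x # p) @ (q @ [y]))"
      unfolding pedges_append_if by simp
    ultimately show "?f \<in> pedges (x # bs' @ [y])" by simp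
  qed
  obtain Fs1 where F1: "Fs1 \<noteq> []" "distinct Fs1" "set Fs1 = faces ?z1" "on {last ?z1, hd ?z1} (hd Fs1)" "on e' (last Fs1)"
    "card {g \<in> chords ?z1. on g (hd Fs1)} \<le> 1" "card {g \<in> chords ?z1. on g (last Fs1)} \<le> 1"
    "\<forall>F\<in>faces ?z1. \<forall>F'\<in>faces ?z1. F \<noteq> F' \<longrightarrow> ((\<exists>g\<in>E. on g F \<and> on g F') \<longleftrightarrow> nxt Fs1 F F' \<or> nxt Fs1 F' F)"
    using chord(3)[OF e'1 s1] by blast
  obtain Fs2 where F2: "Fs2 \<noteq> []" "distinct Fs2" "set Fs2 = faces ?z2" "on {last ?z2, hd ?z2} (hd Fs2)" "on ?f (last Fs2)"
    "card {g \<in> chords ?z2. on g (hd Fs2)} \<le> 1" "card {g \<in> chords ?z2. on g (last Fs2)} \<le> 1"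
    "\<forall>F\<in>faces ?z2. \<forall>F'\<in>faces ?z2. F \<noteq> F' \<longrightarrow> ((\<exists>g\<in>E. on g F \<and> on g F') \<longleftrightarrow> nxt Fs2 F F' \<or> nxt Fs2 F' F)"
    using chord(4)[OF f2 s2] by blast
  have f1: "on ?f (hd Fs1)" using F1(4) by (simp add: insert_commute)
  \<comment> \<open>Compared with its half, a face at the far end of its chain gains at most the
    cutting chord, and only if it lies on it. Then it is both ends of its chain, and its half has no
    chords.\<close>
  have leaf: "card {g \<in> chords ?zs. on g F} \<le> 1"
    if z: "z = ?z1 \<or> z = ?z2" and FF: "F \<in> faces z" "H \<in> faces z" "on ?f H" "F = H \<Longrightarrow> faces z = {F}"
      "card {g \<in> chords z. on g F} \<le> 1" for z F H
  proof -
    have cz: "cyc E z" "?f \<in> cedges z" using z c12 ce by blast+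
    have s: "{g \<in> chords ?zs. on g F} \<subseteq> {g \<in> insert ?f (chords z). on g F}"
      using leaf_split[OF a z FF(1)] .
    show ?thesis
    proof (cases "F = H")
      case True
      then have "chords z = {}" using single_face[OF cz(1)] FF(4) by blast
      then have "{g \<in> chords ?zs. on g F} \<subseteq> {?f}" using s by blast
      from card_le1_mono[OF this] show ?thesis by simp
    next
      case False
      then have "\<not> on ?f F" using face_of_cycle_edge[OF cz] FF by metis
      then have "{g \<in> chords ?zs. on g F} \<subseteq> {g \<in> chords z. on g F}" using s by blast
      from card_le1_mono[OF this _ FF(5)] show ?thesis by simp
    qed
  qed
  have single: "set xs = {hd xs}" if "hd xs = last xs" "distinct xs" "xs \<noteq> []" for xs :: "complex set list"
    using that by (cases xs) (auto split: if_splits)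
  have hl: "hd Fs1 \<in> faces ?z1" "last Fs1 \<in> faces ?z1" "hd Fs2 \<in> faces ?z2" "last Fs2 \<in> faces ?z2"
    using F1(1,3) F2(1,3) hd_in_set[of Fs1] last_in_set[of Fs1] hd_in_set[of Fs2] last_in_set[of Fs2]
    by simp_all
  let ?Fs = "Fs2 @ Fs1"
  have dF: "set Fs1 \<inter> set Fs2 = {}" using F1 F2 fs by simp
  have hdl: "hd ?zs = hd ?z2" "last ?zs = last ?z2" by (auto simp: hd_append last_append)
  show ?case
  proof (intro exI[of _ ?Fs] conjI ballI impI)
    show "?Fs \<noteq> []" using F1 by simp
    show "distinct ?Fs" using F1 F2 dF by auto
    show "set ?Fs = faces ?zs" using F1 F2 fs by auto
    show "on {last ?zs, hd ?zs} (hd ?Fs)" unfolding hdl using F2 by simp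
    show "on e' (last ?Fs)" using F1 by simp
    have "card {g \<in> chords ?zs. on g (hd Fs2)} \<le> 1"
      using leaf[of ?z2 "hd Fs2" "last Fs2"] hl F2 single[of Fs2] by metis
    then show "card {g \<in> chords ?zs. on g (hd ?Fs)} \<le> 1" using F2 by simp
    have "card {g \<in> chords ?zs. on g (last Fs1)} \<le> 1"
      using leaf[of ?z1 "last Fs1" "hd Fs1"] hl F1 f1 single[of Fs1] by metis
    then show "card {g \<in> chords ?zs. on g (last ?Fs)} \<le> 1" using F1 by simp
  next
    fix F F' assume FF: "F \<in> faces ?zs" "F' \<in> faces ?zs" "F \<noteq> F'"
    \<comment> \<open>An edge shared by faces of different halves is the cutting chord, which lies
      only on the faces where the two chains meet.\<close>
    have mix: "(\<exists>g\<in>E. on g F \<and> on g F') \<longleftrightarrow> nxt ?Fs F F' \<or> nxt ?Fs F' F"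
      if m: "F \<in> faces ?z2" "F' \<in> faces ?z1" for F F'
    proof -
      have "(\<exists>g\<in>E. on g F \<and> on g F') \<longleftrightarrow> on ?f F \<and> on ?f F'"
      proof
        assume "\<exists>g\<in>E. on g F \<and> on g F'"
        then obtain g where g: "g \<in> E" "on g F" "on g F'" by blast
        then have "g = ?f"
          using face_edges[OF c12(2) m(1) g(1,2)] face_edges[OF c12(1) m(2) g(1,3)] cs(2) by blast
        then show "on ?f F \<and> on ?f F'" using g by simp
      qed (use a(2) in \<open>auto simp: chords_def\<close>)
      also have "\<dots> \<longleftrightarrow> F = last Fs2 \<and> F' = hd Fs1"
        using face_of_cycle_edge[OF c12(2) ce(3)] face_of_cycle_edge[OF c12(1) ce(2)] m hl f1 F2(5) by metis
      also have "\<dots> \<longleftrightarrow> nxt ?Fs F F' \<or> nxt ?Fs F' F"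
        using m F1 F2 dF nxt_set[of Fs1 F F'] nxt_set[of Fs2 F F'] nxt_set[of Fs1 F' F] nxt_set[of Fs2 F' F]
        by (auto simp: nxt_append)
      finally show ?thesis .
    qed
    consider "F \<in> faces ?z1" "F' \<in> faces ?z1" | "F \<in> faces ?z2" "F' \<in> faces ?z2"
      | "F \<in> faces ?z2" "F' \<in> faces ?z1" | "F \<in> faces ?z1" "F' \<in> faces ?z2" using FF fs by blast
    then show "(\<exists>g\<in>E. on g F \<and> on g F') \<longleftrightarrow> nxt ?Fs F F' \<or> nxt ?Fs F' F"
    proof cases
      case 1
      have "nxt ?Fs A B \<longleftrightarrow> nxt Fs1 A B" if "A \<in> faces ?z1" "B \<in> faces ?z1" for A B
        using that F1 F2 dF nxt_set[of Fs2 A B] last_in_set[of Fs2] by (auto simp: nxt_append)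
      then show ?thesis using F1(8) 1 FF by metis
    next
      case 2
      have "nxt ?Fs A B \<longleftrightarrow> nxt Fs2 A B" if "A \<in> faces ?z2" "B \<in> faces ?z2" for A B
        using that F1 F2 dF nxt_set[of Fs1 A B] hd_in_set[of Fs1] by (auto simp: nxt_append)
      then show ?thesis using F2(8) 2 FF by metis
    next
      case 3 then show ?thesis using mix by blast
    next
      case 4 then show ?thesis using mix[of F' F] by blast
    qed
  qed
qed

text \<open>A chord that does not separate the two edges cuts off a half containing neither, and
  that half has a leaf face of its own. Three leaf faces cannot occur on a path, since one of them
  would have two neighbours.\<close>

lemma sep_of_leaves:
  assumes zs: "cyc E zs" and Fs: "distinct Fs" "set Fs = faces zs"
    "\<And>F F'. nxt Fs F F' \<Longrightarrow> \<exists>g\<in>E. on g F \<and> on g F'"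
    and e: "e' \<in> pedges zs"
    and leaf: "chords zs = {} \<or> (\<exists>F\<in>faces zs. \<exists>F'\<in>faces zs. F \<noteq> F' \<and> on {last zs, hd zs} F \<and> on e' F' \<and>
      card {g \<in> chords zs. on g F} \<le> 1 \<and> card {g \<in> chords zs. on g F'} \<le> 1)"
  shows "sep zs e'"
  unfolding sep_def
proof (intro allI impI, rule ccontr)
  fix as u bs v cs assume z: "zs = as @ u # bs @ v # cs" and ch: "{u, v} \<in> chords zs" and n: "e' \<notin> pedges (u # bs @ [v])"
  let ?z1 = "u # bs @ [v]" and ?z2 = "as @ u # v # cs" and ?f = "{u, v}" and ?c = "{last zs, hd zs}"
  note a = zs[unfolded z] ch[unfolded z]
  note c12 = cyc_split[OF a] and cs = chords_split[OF a] and fs = faces_split[OF a] and ce = cedges_split_chord[OF a]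
    and ne = chord_ends[OF a]
  obtain F F' where F: "F \<in> faces zs" "F' \<in> faces zs" "F \<noteq> F'" "on ?c F" "on e' F'"
     "card {g \<in> chords zs. on g F} \<le> 1" "card {g \<in> chords zs. on g F'} \<le> 1"
    using leaf ch by blast
  have "?c = {last ?z2, hd ?z2}" unfolding z by (auto simp: hd_append last_append)
  then have c2: "?c \<in> cedges ?z2" by (simp add: cedges_def)
  have cz: "?c \<in> cedges zs" "e' \<in> cedges zs" using e by (auto simp: cedges_def)
  have e2: "e' \<in> cedges ?z2" using cz(2) n unfolding z cedges_split cedges_split2 by blast
  \<comment> \<open>A cycle edge has only one face, so a face on an edge that survives in this half
    belongs to it. This keeps \<open>F\<close> and \<open>F'\<close> apart from the third leaf
    face.\<close>
  have in2: "H \<in> faces ?z2" if g: "g \<in> cedges ?z2" "g \<in> cedges zs" "H \<in> faces zs" "on g H" for g H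
  proof -
    obtain H' where "H' \<in> faces ?z2" "on g H'" using face_of_cycle_edge[OF c12(2) g(1)] by metis
    moreover have "H' \<in> faces zs" using fs(1) z \<open>H' \<in> faces ?z2\<close> by blast
    ultimately show ?thesis using face_of_cycle_edge[OF zs g(2)] g by metis
  qed
  have F2: "F \<in> faces ?z2" "F' \<in> faces ?z2" using in2 c2 e2 cz F by blast+
  obtain H where H: "H \<in> faces ?z1" "card {e \<in> insert ?f (chords ?z1). on e H} \<le> 1"
    using leaf_face[OF c12(1) ce(2)] by blast
  have "card {g \<in> chords zs. on g H} \<le> card {e \<in> insert ?f (chords ?z1). on e H}"
    using leaf_split[OF a _ H(1)] z by (intro card_mono) auto
  then have H1: "card {g \<in> chords zs. on g H} \<le> 1" using H by simp
  have Hzs: "H \<in> faces zs" using H fs z by blast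
  have "H \<noteq> F" "H \<noteq> F'" using H F2 fs(2) by blast+
  then have "card {F, F', H} = 3" using F(3) by auto
  then obtain x p q where x: "x \<in> {F, F', H}" "p \<noteq> q" "nxt Fs p x" "nxt Fs x q"
    using nxt_three[OF Fs(1), of "{F, F', H}"] F Hzs Fs(2) by auto
  have xl: "card {g \<in> chords zs. on g x} \<le> 1" using x(1) F H1 by blast
  obtain g1 g2 where g: "g1 \<in> E" "on g1 p" "on g1 x" "g2 \<in> E" "on g2 x" "on g2 q" using Fs(3) x by meson
  have mem: "p \<in> faces zs" "q \<in> faces zs" "x \<in> faces zs" using nxt_set x Fs(2) by metis+
  have "p \<noteq> x" "q \<noteq> x" using nxt_neq[OF Fs(1)] x by metis+
  then have "p = q" using leaf_degree[OF zs mem(3) xl mem(1) _ g(1,3,2) mem(2) _ g(4,5,6)] by blast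
  then show False using x by simp
qed

text \<open>By \<open>leaf_face\<close>, each half of a chord contributes a leaf face that has a
  cycle edge other than the chord.\<close>

lemma leaves_exist:
  assumes "cyc E zs"
  obtains e e' where "e \<in> cedges zs" "e' \<in> cedges zs" "e \<noteq> e'"
    "chords zs = {} \<or> (\<exists>F\<in>faces zs. \<exists>F'\<in>faces zs. F \<noteq> F' \<and> on e F \<and> on e' F' \<and>
      card {g \<in> chords zs. on g F} \<le> 1 \<and> card {g \<in> chords zs. on g F'} \<le> 1)"
proof (cases "chords zs = {}")
  case True
  obtain e e' where "e \<in> cedges zs" "e' \<in> cedges zs" "e \<noteq> e'" using cedges_other[OF assms] by metis
  then show thesis using that True by blast
next
  case False
  then obtain e where e: "e \<in> chords zs" by blast
  then have "e \<subseteq> set zs" "e \<in> E" by (auto simp: chords_def)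
  then obtain as u bs v cs where z: "zs = as @ u # bs @ v # cs" "e = {u, v}"
    using two_in_list[of e zs] edge_card by metis
  let ?z1 = "u # bs @ [v]" and ?z2 = "as @ u # v # cs" and ?f = "{u, v}"
  note a = assms[unfolded z] e[unfolded z]
  note c12 = cyc_split[OF a] and cs = chords_split[OF a] and fs = faces_split[OF a] and ce = cedges_split_chord[OF a]
  have *: "\<exists>F\<in>faces z'. card {g \<in> chords zs. on g F} \<le> 1 \<and> (\<exists>e\<in>cedges z' - {?f}. on e F)"
    if z': "z' = ?z1 \<or> z' = ?z2" for z'
  proof -
    have c: "cyc E z'" "?f \<in> cedges z'" using z' c12 ce by blast+
    obtain F e where F: "F \<in> faces z'" "card {e \<in> insert ?f (chords z'). on e F} \<le> 1" "e \<in> cedges z'" "e \<noteq> ?f" "on e F"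
      using leaf_face[OF c] by blast
    have "card {g \<in> chords zs. on g F} \<le> card {e \<in> insert ?f (chords z'). on e F}"
      using leaf_split[OF a z' F(1)] z by (intro card_mono) auto
    then have "card {g \<in> chords zs. on g F} \<le> 1" using F(2) by linarith
    then show ?thesis using F by blast
  qed
  obtain F e where F: "F \<in> faces ?z1" "card {g \<in> chords zs. on g F} \<le> 1" "e \<in> cedges ?z1" "e \<noteq> ?f" "on e F"
    using *[of ?z1] by blast
  obtain F' e' where F': "F' \<in> faces ?z2" "card {g \<in> chords zs. on g F'} \<le> 1" "e' \<in> cedges ?z2" "e' \<noteq> ?f" "on e' F'"
    using *[of ?z2] by blast
  have "e \<noteq> e'" using F F' cs(2) by blast
  moreover have "F \<noteq> F'" using F F' fs(2) by blast
  moreover have "e \<in> cedges zs" "e' \<in> cedges zs" "F \<in> faces zs" "F' \<in> faces zs" using F F' ce(1) fs(1) z by blast+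
  ultimately show thesis using that F F' by blast
qed

end

section \<open>Blocks\<close>

lemma conn_cross:
  "conn E U \<Longrightarrow> x \<in> U \<Longrightarrow> x \<in> A \<Longrightarrow> y \<in> U \<Longrightarrow> y \<notin> A \<Longrightarrow>
    \<exists>a b. a \<in> U \<and> a \<in> A \<and> b \<in> U \<and> b \<notin> A \<and> {a, b} \<in> E"
  using conn_crossing[of E U x A y] by metis

text \<open>The vertex-set form of \<open>biconnected\<close>. Single vertices and single edges
  satisfy it, as the empty set and singletons are connected.\<close>

definition bic :: "'a set set \<Rightarrow> 'a set \<Rightarrow> bool" where
  "bic E U \<longleftrightarrow> conn E U \<and> (\<forall>x\<in>U. conn E (U - {x}))"

lemma comp_sets_subset:
  "\<forall>e\<in>edges G. e \<subseteq> verts G \<Longrightarrow> comp_sets G \<subseteq> Pow (verts G)"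
  by (auto simp: comp_sets_def)

lemma conn_iff_card_comp_sets:
  assumes "\<forall>e\<in>edges G. e \<subseteq> verts G" "finite (verts G)"
  shows "conn (edges G) (verts G) \<longleftrightarrow> card (comp_sets G) \<le> 1"
proof
  assume c: "conn (edges G) (verts G)"
  have "C = verts G" if "C \<in> comp_sets G" for C
  proof -
    have "C \<noteq> {}" "C \<subseteq> verts G" using that comp_sets_iff[OF assms(1)] by auto
    then show ?thesis using conn_subset_comp[OF assms(1) that c] by blast
  qed
  then have "comp_sets G \<subseteq> {verts G}" by blast
  then show "card (comp_sets G) \<le> 1" using card_le1_mono[of "comp_sets G" "{verts G}"] by simp
next
  assume le: "card (comp_sets G) \<le> 1"
  have fin: "finite (comp_sets G)"
    using comp_sets_subset[OF assms(1)] assms(2) by (meson finite_Pow_iff finite_subset)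
  show "conn (edges G) (verts G)"
  proof (cases "verts G = {}")
    case False
    then obtain x where x: "x \<in> verts G" by blast
    obtain C where C: "C \<in> comp_sets G" "x \<in> C" using comp_exists[OF assms(1) x] .
    have "verts G \<subseteq> C"
    proof
      fix y assume "y \<in> verts G"
      from comp_exists[OF assms(1) this] obtain C' where C': "C' \<in> comp_sets G" "y \<in> C'" .
      then have "C' = C" using le C card_le_Suc0_iff_eq[OF fin] by (metis One_nat_def)
      then show "y \<in> C" using C' by simp
    qed
    then have "C = verts G" using C comp_sets_iff[OF assms(1)] by blast
    then show ?thesis using C comp_sets_iff[OF assms(1)] by blast
  qed simp
qed

lemma delete_vertex_simps [simp]:
  "verts (delete_vertex G v) = verts G - {v}"
  "edges (delete_vertex G v) = {e \<in> edges G. e \<subseteq> verts G - {v}}"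
  by (auto simp: delete_vertex_def induce_def)

lemma induce_simps [simp]:
  "verts (induce G X) = verts G \<inter> X" "edges (induce G X) = {e \<in> edges G. e \<subseteq> X}"
  by (auto simp: induce_def)

lemma cutvertex_iff_not_conn:
  assumes "\<forall>e\<in>edges G. e \<subseteq> verts G" "finite (verts G)" "conn (edges G) (verts G)" "v \<in> verts G"
  shows "cutvertex G v \<longleftrightarrow> \<not> conn (edges G) (verts G - {v})"
proof -
  have wf: "\<forall>e\<in>edges (delete_vertex G v). e \<subseteq> verts (delete_vertex G v)" by auto
  obtain C where "C \<in> comp_sets G" using comp_exists[OF assms(1,4)] by blast
  moreover have "finite (comp_sets G)"
    using comp_sets_subset[OF assms(1)] assms(2) by (meson finite_Pow_iff finite_subset)
  ultimately have "card (comp_sets G) \<noteq> 0" by auto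
  then have "card (comp_sets G) = 1"
    using conn_iff_card_comp_sets[OF assms(1,2)] assms(3) by simp
  moreover have "conn (edges G) (verts G - {v}) \<longleftrightarrow> card (comp_sets (delete_vertex G v)) \<le> 1"
    using conn_iff_card_comp_sets[OF wf] assms(2) conn_cong[of "verts G - {v}" "verts G - {v}" "edges G"]
    by simp
  ultimately show ?thesis using assms(4) by (auto simp: cutvertex_def)
qed

lemma biconnected_iff_bic:
  assumes "\<forall>e\<in>edges G. e \<subseteq> verts G" "finite (verts G)"
  shows "biconnected G \<longleftrightarrow> bic (edges G) (verts G)"
proof (cases "conn (edges G) (verts G)")
  case True
  have "(\<forall>v. \<not> cutvertex G v) \<longleftrightarrow> (\<forall>v\<in>verts G. conn (edges G) (verts G - {v}))"
    using cutvertex_iff_not_conn[OF assms True] by (auto simp: cutvertex_def)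
  then show ?thesis using True connected_graph_conn[OF assms(1)] by (simp add: biconnected_def bic_def)
qed (use connected_graph_conn[OF assms(1)] in \<open>simp add: biconnected_def bic_def\<close>)

lemma bic_mono: "bic E U \<Longrightarrow> E \<subseteq> E' \<Longrightarrow> bic E' U"
  unfolding bic_def using conn_mono by blast

lemma bic_cong: "U \<subseteq> W \<Longrightarrow> bic {e \<in> E. e \<subseteq> W} U \<longleftrightarrow> bic E U"
  unfolding bic_def using conn_cong[of U W E] conn_cong[of "U - {_}" W E] by auto

text \<open>Two common vertices ensure that one of them survives the deletion of any vertex.\<close>

lemma bic_Un:
  assumes "bic E U" "bic E W" "x \<in> U \<inter> W" "y \<in> U \<inter> W" "x \<noteq> y"
  shows "bic E (U \<union> W)"
  unfolding bic_def
proof (intro conjI ballI)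
  show "conn E (U \<union> W)" using assms by (intro conn_Un) (auto simp: bic_def)
  fix z
  have "conn E (U - {z})" "conn E (W - {z})" using assms(1,2) unfolding bic_def
    by (metis Diff_empty Diff_insert0)+
  then have "conn E ((U - {z}) \<union> (W - {z}))"
  proof (rule conn_Un)
    show "(U - {z}) \<inter> (W - {z}) \<noteq> {}" using assms by blast
  qed
  then show "conn E (U \<union> W - {z})" by (simp add: Un_Diff)
qed

lemma bic_edge: "{x, y} \<in> E \<Longrightarrow> bic E {x, y}"
  unfolding bic_def using conn_edge[of x y E] by (auto simp: insert_Diff_if)

text \<open>Rotated to begin at \<open>x\<close>, the cycle leaves the path \<open>cs @ as\<close>
  when \<open>x\<close> is removed.\<close>

lemma conn_cycle_path:
  assumes "distinct (as @ x # cs)"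
  shows "conn (cedges (as @ x # cs)) (set (as @ x # cs) - {x})"
proof -
  have "pedges (cs @ as) \<subseteq> pedges (x # cs @ as)"
    by (cases "cs @ as = []") (auto simp: pedges_Cons)
  also have "\<dots> \<subseteq> cedges ((x # cs) @ as)" by (auto simp: cedges_def)
  also have "\<dots> = cedges (as @ x # cs)" using cedges_rotate[of as "x # cs"] by simp
  finally have "conn (cedges (as @ x # cs)) (set (cs @ as))" by (rule conn_list)
  moreover have "set (cs @ as) = set (as @ x # cs) - {x}" using assms by auto
  ultimately show ?thesis by simp
qed

lemma bic_cycle:
  assumes "cyc E zs"
  shows "bic E (set zs)"
proof (rule bic_mono)
  show "cedges zs \<subseteq> E" using assms by (simp add: cyc_def)
  show "bic (cedges zs) (set zs)" unfolding bic_def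
  proof (intro conjI ballI)
    show "conn (cedges zs) (set zs)" by (rule conn_list) (auto simp: cedges_def)
    fix x assume "x \<in> set zs"
    then obtain as cs where "zs = as @ x # cs" by (auto dest: split_list)
    then show "conn (cedges zs) (set zs - {x})"
      using conn_cycle_path[of as x cs] assms by (simp add: cyc_def)
  qed
qed

locale fin_graph =
  fixes G :: "'a ugraph"
  assumes simple: "simple_graph G"
begin

lemma edge_sub: "e \<in> edges G \<Longrightarrow> e \<subseteq> verts G"
  and card_edge: "e \<in> edges G \<Longrightarrow> card e = 2"
  and fin_verts: "finite (verts G)"
  using simple by (auto simp: simple_graph_def)

lemma wf: "\<forall>e\<in>edges G. e \<subseteq> verts G"
  using edge_sub by blast

lemma edge_neq: "{u, v} \<in> edges G \<Longrightarrow> u \<noteq> v"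
  using card_edge[of "{u, v}"] by auto

lemma subgraph_bic:
  assumes "subgraph B G"
  shows "biconnected B \<longleftrightarrow> bic (edges B) (verts B)"
  using assms fin_verts
  by (intro biconnected_iff_bic) (auto simp: subgraph_def intro: finite_subset)

text \<open>Adding edges between its vertices keeps a graph biconnected, so by maximality a block is
  induced and can be handled through its vertex set.\<close>

lemma block_edges:
  assumes "block G B"
  shows "edges B = {e \<in> edges G. e \<subseteq> verts B}"
proof -
  let ?B = "\<lparr>verts = verts B, edges = {e \<in> edges G. e \<subseteq> verts B}\<rparr>"
  have B: "subgraph B G" "biconnected B" using assms by (auto simp: block_def)
  have "bic (edges B) (verts B)" using B subgraph_bic by blast
  then have "bic {e \<in> edges G. e \<subseteq> verts B} (verts B)"
    by (rule bic_mono) (use B in \<open>auto simp: subgraph_def\<close>)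
  moreover have s: "subgraph ?B G" "subgraph B ?B" using B by (auto simp: subgraph_def)
  ultimately have "biconnected ?B" using subgraph_bic[OF s(1)] by simp
  then have "?B = B" using assms s unfolding block_def by blast
  then show ?thesis by (metis ugraph.select_convs(2))
qed

lemma block_bic:
  assumes "block G B"
  shows "bic (edges G) (verts B)" "verts B \<subseteq> verts G"
proof -
  have B: "subgraph B G" "biconnected B" using assms by (auto simp: block_def)
  then have "bic (edges B) (verts B)" using subgraph_bic by blast
  then show "bic (edges G) (verts B)" by (rule bic_mono) (use B in \<open>auto simp: subgraph_def\<close>)
  show "verts B \<subseteq> verts G" using B by (simp add: subgraph_def)
qed

lemma block_maximal:
  assumes "block G B" "bic (edges G) W" "W \<subseteq> verts G" "x \<in> W \<inter> verts B" "y \<in> W \<inter> verts B" "x \<noteq> y"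
  shows "W \<subseteq> verts B"
proof -
  let ?B = "\<lparr>verts = verts B \<union> W, edges = {e \<in> edges G. e \<subseteq> verts B \<union> W}\<rparr>"
  have "bic (edges G) (verts B \<union> W)"
    using bic_Un[OF block_bic(1)[OF assms(1)] assms(2), of x y] assms by blast
  then have "bic (edges ?B) (verts ?B)" using bic_cong[of "verts B \<union> W" "verts B \<union> W"] by simp
  moreover have s: "subgraph ?B G" "subgraph B ?B"
    using assms(1,3) block_bic(2)[OF assms(1)] by (auto simp: subgraph_def block_def)
  ultimately have "?B = B" using assms(1) subgraph_bic[OF s(1)] unfolding block_def by blast
  then have "verts B \<union> W = verts B" by (metis ugraph.select_convs(1))
  then show ?thesis by blast
qed

lemma block_eq:
  assumes "block G B" "block G B'" "x \<in> verts B \<inter> verts B'" "y \<in> verts B \<inter> verts B'" "x \<noteq> y"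
  shows "B = B'"
proof -
  have "verts B = verts B'"
    using block_maximal[OF assms(1), of "verts B'" x y] block_maximal[OF assms(2), of "verts B" x y]
      block_bic assms by (simp add: Int_commute subset_antisym)
  then show ?thesis using block_edges[OF assms(1)] block_edges[OF assms(2)] by (intro ugraph.equality) auto
qed

lemma block_exists:
  assumes "bic (edges G) W" "W \<subseteq> verts G"
  obtains B where "block G B" "W \<subseteq> verts B"
proof -
  let ?S = "{U. bic (edges G) U \<and> W \<subseteq> U \<and> U \<subseteq> verts G}"
  have "finite ?S" by (rule finite_subset[of _ "Pow (verts G)"]) (use fin_verts in auto)
  moreover have "W \<in> ?S" using assms by auto
  ultimately obtain U where U: "U \<in> ?S" "\<forall>U'\<in>?S. U \<subseteq> U' \<longrightarrow> U = U'"
    using finite_has_maximal[of ?S] by blast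
  let ?B = "induce G U"
  have v: "verts ?B = U" using U by auto
  have sB: "subgraph ?B G" unfolding subgraph_def using U by auto
  have "bic (edges ?B) (verts ?B)" using U bic_cong[of U U "edges G"] v by simp
  then have "biconnected ?B" using subgraph_bic[OF sB] by blast
  moreover have "B' = ?B" if B': "subgraph B' G" "biconnected B'" "subgraph ?B B'" for B'
  proof -
    have "bic (edges B') (verts B')" using B' subgraph_bic by blast
    then have "bic (edges G) (verts B')" by (rule bic_mono) (use B' in \<open>auto simp: subgraph_def\<close>)
    then have "verts B' \<in> ?S" using B' U v by (auto simp: subgraph_def)
    then have "verts B' = U" using U B' v by (auto simp: subgraph_def)
    moreover have "edges B' = {e \<in> edges G. e \<subseteq> U}"
      using B' \<open>verts B' = U\<close> unfolding subgraph_def by auto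
    ultimately show ?thesis using v by (intro ugraph.equality) auto
  qed
  ultimately have "block G ?B" using sB unfolding block_def by blast
  then show thesis using that[of ?B] U v by blast
qed

end

section \<open>Hamiltonian cycles and the weak dual\<close>

context outerplane_graph begin

sublocale fin_graph G
  by unfold_locales (rule simple)

text \<open>Excludes subdivisions of the complete bipartite graph on 2 and 3 vertices: one of the
  three paths would lie inside the cycle of the other two and bring an inner vertex with it.\<close>

lemma no_theta:
  assumes "distinct p" "pedges p \<subseteq> E" "hd p = u" "last p = v" "length p \<ge> 3"
    and "distinct q" "pedges q \<subseteq> E" "hd q = u" "last q = v" "length q \<ge> 3"
    and "distinct r" "pedges r \<subseteq> E" "hd r = u" "last r = v" "length r \<ge> 3"
    and i: "set p \<inter> set q = {u, v}" "set p \<inter> set r = {u, v}" "set q \<inter> set r = {u, v}"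
  shows False
proof -
  have ends: "\<exists>m. s = u # m @ [v] \<and> m \<noteq> []" if "hd s = u" "last s = v" "length s \<ge> 3" for s
  proof -
    have "s \<noteq> []" using that by auto
    then obtain a t where t: "s = a # t" by (meson neq_Nil_conv)
    then have "t \<noteq> []" using that by auto
    then have "s = u # butlast t @ [v]" using that t append_butlast_last_id[of t] by auto
    moreover have "length (butlast t) \<ge> 1" using that t by simp
    then have "butlast t \<noteq> []" by (metis list.size(3) not_one_le_zero)
    ultimately show ?thesis by blast
  qed
  have uv: "{u, v} \<notin> pedges s" if s: "hd s = u" "last s = v" "length s \<ge> 3" "distinct s" for s
    using closing_edge_notin[OF s(4,3)] s by (simp add: insert_commute)
  have dj: "pedges s \<inter> pedges t = {}"
    if "set s \<inter> set t = {u, v}" "hd s = u" "last s = v" "length s \<ge> 3" "distinct s" "pedges s \<subseteq> E" for s t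
  proof -
    have "e = {u, v}" if e: "e \<in> pedges s" "e \<in> pedges t" for e
    proof -
      have "e \<subseteq> {u, v}" using pedges_subset[OF e(1)] pedges_subset[OF e(2)] \<open>set s \<inter> set t = {u, v}\<close> by blast
      then show ?thesis using subset_two[of e u v] e(1) \<open>pedges s \<subseteq> E\<close> by blast
    qed
    then show ?thesis using uv[of s] that by blast
  qed
  have cyc: "cyc E (s @ rev (tl (butlast t))) \<and> dimg D (pedges s) \<union> dimg D (pedges t) = dimg D (cedges (s @ rev (tl (butlast t))))"
    if s: "distinct s" "pedges s \<subseteq> E" "hd s = u" "last s = v" "length s \<ge> 3"
      and t: "distinct t" "pedges t \<subseteq> E" "hd t = u" "last t = v" "length t \<ge> 3"
      and st: "set s \<inter> set t = {u, v}" for s t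
  proof -
    obtain m where m: "s = u # m @ [v]" "m \<noteq> []" using ends s by blast
    obtain n where n: "t = u # n @ [v]" "n \<noteq> []" using ends t by blast
    have e: "s @ rev (tl (butlast t)) = [] @ u # m @ v # rev n" unfolding m n by (simp add: butlast_append)
    have c: "cedges (s @ rev (tl (butlast t))) = pedges s \<union> pedges t"
      unfolding e cedges_split unfolding m n by simp
    have "distinct (s @ rev (tl (butlast t)))" unfolding e using s(1) t(1) st unfolding m n by auto
    then show ?thesis unfolding cyc_def c dimg_Un using s t by auto
  qed
  have no: "\<not> dimg D (pedges s) - {point D u, point D v} \<subseteq> inside (dimg D (pedges s') \<union> dimg D (pedges t))"
    if s: "distinct s" "pedges s \<subseteq> E" "hd s = u" "last s = v" "length s \<ge> 3"
      and t: "distinct t" "pedges t \<subseteq> E" "hd t = u" "last t = v" "length t \<ge> 3"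
      and s': "distinct s'" "pedges s' \<subseteq> E" "hd s' = u" "last s' = v" "length s' \<ge> 3"
      and st: "set s' \<inter> set t = {u, v}" for s s' t
  proof
    assume a: "dimg D (pedges s) - {point D u, point D v} \<subseteq> inside (dimg D (pedges s') \<union> dimg D (pedges t))"
    obtain m where m: "s = u # m @ [v]" "m \<noteq> []" using ends s by blast
    have V: "set s \<subseteq> V" using set_subset_V[of s] s by auto
    let ?w = "hd m"
    have w: "?w \<in> set s" "?w \<noteq> u" "?w \<noteq> v" using m s(1) hd_in_set[OF m(2)] by auto
    have "point D ?w \<in> dimg D (pedges s)"
      using point_in_dimg[OF s(2), of ?w] w V pedges_Union[of s] s(5) by auto
    moreover have "point D ?w \<notin> {point D u, point D v}"
    proof -
      have "?w \<in> V" "u \<in> V" "v \<in> V" using w(1) V m by auto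
      then show ?thesis using point_inj[of ?w u] point_inj[of ?w v] w(2,3) by blast
    qed
    ultimately have "point D ?w \<in> inside (dimg D (cedges (s' @ rev (tl (butlast t)))))"
      using a cyc[OF s' t st] by auto
    then show False using no_vertex_inside[of "s' @ rev (tl (butlast t))" ?w] cyc[OF s' t st] w V by blast
  qed
  have "length p \<ge> 2" "length q \<ge> 2" "length r \<ge> 2" using assms by auto
  then show False
    using theta_lists[of p u v q r] assms dj[of p q] dj[of p r] dj[of q r]
      no[of r q p] no[of q r p] no[of p r q] by (metis Int_commute)
qed

text \<open>A vertex with two neighbours in \<open>U\<close> closes a cycle with a path between them
  that avoids it.\<close>

lemma bic_cycle_exists:
  assumes "bic E U" "U \<subseteq> V" "card U \<ge> 3"
  obtains zs where "cyc E zs" "set zs \<subseteq> U"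
proof -
  have fin: "finite U" using assms(3) by (metis card.infinite not_numeral_le_zero)
  have "\<exists>w a b. w \<in> U \<and> a \<in> U \<and> b \<in> U \<and> a \<noteq> b \<and> {w, a} \<in> E \<and> {w, b} \<in> E"
  proof -
    obtain w where w: "w \<in> U" using assms(3) by fastforce
    obtain y where y: "y \<in> U" "y \<noteq> w"
    proof -
      have "\<not> U \<subseteq> {w}" using assms(3) card_mono[of "{w}" U] by auto
      then show thesis using that by blast
    qed
    have c: "conn E U" using assms(1) by (simp add: bic_def)
    obtain a where a: "a \<in> U" "a \<noteq> w" "{w, a} \<in> E"
      using conn_cross[OF c w _ y(1), of "{w}"] y by blast
    obtain z where z: "z \<in> U" "z \<noteq> w" "z \<noteq> a"
    proof -
      have "card {w, a} \<le> 2" by (simp add: card_insert_if)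
      then have "\<not> U \<subseteq> {w, a}" using assms(3) card_mono[of "{w, a}" U] by auto
      then show thesis using that by blast
    qed
    obtain c' b where cb: "c' \<in> {w, a}" "b \<in> U" "b \<notin> {w, a}" "{c', b} \<in> E"
      using conn_cross[OF c w _ z(1), of "{w, a}"] z by blast
    show ?thesis
    proof (cases "c' = w")
      case True then show ?thesis using a cb w by blast
    next
      case False
      then have "c' = a" using cb by blast
      then show ?thesis using a cb w by (metis insertCI insert_commute)
    qed
  qed
  then obtain w a b where w: "w \<in> U" "a \<in> U" "b \<in> U" "a \<noteq> b" "{w, a} \<in> E" "{w, b} \<in> E" by blast
  have "conn E (U - {w})" using assms(1) w by (simp add: bic_def)
  moreover have "a \<in> U - {w}" "b \<in> U - {w}" using w edge_neq by blast+
  ultimately obtain p where p: "distinct p" "p \<noteq> []" "hd p = a" "last p = b" "set p \<subseteq> U - {w}" "pedges p \<subseteq> E"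
    using conn_path by metis
  have "length p \<noteq> Suc 0" using p w(4) by (auto simp: length_Suc_conv)
  moreover have "length p \<noteq> 0" using p(2) by simp
  ultimately have "length p \<ge> 2" by linarith
  then have len: "length (w # p) \<ge> 3" by simp
  have "cyc E (w # p)"
    unfolding cyc_def cedges_def using len p w by (auto simp: pedges_Cons insert_commute)
  then show thesis using that[of "w # p"] p w by auto
qed

text \<open>A longest cycle is Hamiltonian: an ear attached to it would give a longer cycle or a theta
  graph.\<close>
lemma hamiltonian:
  assumes "bic E U" "U \<subseteq> V" "card U \<ge> 3"
  obtains zs where "cyc E zs" "set zs = U"
proof -
  have fin: "finite U" using finite_subset[OF assms(2) finite_V] .
  let ?P = "\<lambda>zs. cyc E zs \<and> set zs \<subseteq> U"
  obtain z0 where z0: "?P z0" using bic_cycle_exists[OF assms] by metis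
  have bnd: "length zs < Suc (card U)" if "?P zs" for zs
  proof -
    have "length zs = card (set zs)" using that by (simp add: cyc_def distinct_card)
    also have "\<dots> \<le> card U" using that fin by (intro card_mono) auto
    finally show ?thesis by simp
  qed
  define zs where "zs = arg_max length ?P"
  have P: "?P zs" and max: "\<And>ys. ?P ys \<Longrightarrow> length ys \<le> length zs"
    using arg_max_nat_lemma[of ?P z0 length "Suc (card U)"] z0 bnd unfolding zs_def by blast+
  have "set zs = U"
  proof (rule ccontr)
    assume n: "set zs \<noteq> U"
    have sub: "set zs \<subseteq> U" and cz: "cyc E zs" using P by auto
    obtain y where y: "y \<in> U" "y \<notin> set zs" using n sub by blast
    have "zs \<noteq> []" using cz by (auto simp: cyc_def)
    then have h: "hd zs \<in> set zs" by simp
    have cU: "conn E U" using assms(1) by (simp add: bic_def)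
    obtain u w where uw: "u \<in> set zs" "w \<in> U" "w \<notin> set zs" "{u, w} \<in> E"
      using conn_cross[OF cU _ h y] h sub by blast
    obtain a1 a2 where z: "zs = a1 @ u # a2" using uw(1) by (auto dest: split_list)
    let ?zs = "u # a2 @ a1"
    have cz': "cyc E ?zs" using cyc_rotate[of E a1 "u # a2"] cz z by simp
    have sz: "set ?zs = set zs" "length ?zs = length zs" using z by auto
    obtain v0 where v0: "v0 \<in> set zs" "v0 \<noteq> u"
    proof -
      have "a2 @ a1 \<noteq> []" using cz' by (auto simp: cyc_def)
      then have "hd (a2 @ a1) \<in> set (a2 @ a1)" by (rule hd_in_set)
      then show thesis using that[of "hd (a2 @ a1)"] cz' sz(1) by (auto simp: cyc_def)
    qed
    have cu: "conn E (U - {u})" using assms(1) uw(1) sub by (auto simp: bic_def)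
    \<comment> \<open>The ear leaves the cycle at \<open>u\<close> through \<open>w\<close>. A path
      that avoids \<open>u\<close> leads from \<open>w\<close> back to the cycle, and its first
      cycle vertex \<open>v\<close> ends the ear.\<close>
    obtain p where p: "distinct p" "p \<noteq> []" "hd p = w" "last p = v0" "set p \<subseteq> U - {u}" "pedges p \<subseteq> E"
      using conn_path[OF cu, of w v0] uw v0 sub by blast
    have "\<exists>x\<in>set p. x \<in> set zs" using p v0 last_in_set by metis
    then obtain q v r where q: "p = q @ v # r" "v \<in> set zs" "\<forall>x\<in>set q. x \<notin> set zs"
      using split_list_first_prop[of p "\<lambda>x. x \<in> set zs"] by blast
    have qne: "q \<noteq> []" using q p(3) uw(3) by (cases q) auto
    have hq: "hd q = w" using q p(3) qne by simp
    have pq: "pedges (q @ [v]) \<subseteq> E" using p(6) q(1) pedges_append_subset(1)[of "q @ [v]" r] by auto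
    have vu: "v \<noteq> u" using q p(5) by auto
    obtain bs cs where bc: "a2 @ a1 = bs @ v # cs"
    proof -
      have "v \<in> set (a2 @ a1)" using q(2) sz(1) vu by auto
      then show thesis using that by (meson split_list)
    qed
    have cyz: "cyc E ([] @ u # bs @ v # cs)" using cz' bc by simp
    have d: "distinct (u # bs @ v # cs)" using cyz by (simp add: cyc_def)
    have sz2: "set (u # bs @ v # cs) = set zs" "length (u # bs @ v # cs) = length zs"
      using sz bc by auto
    have dq: "distinct q" "set q \<inter> set zs = {}" "set q \<subseteq> U" using q p by auto
    have ce: "pedges (u # bs @ [v]) \<subseteq> E" "pedges (u # rev cs @ [v]) \<subseteq> E"
      using cyz unfolding cyc_def cedges_split by auto
    have ear: "pedges (u # q @ [v]) \<subseteq> E"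
      using pq uw(4) hq qne by (auto simp: pedges_Cons)
    have lq: "length q > 0" using qne by simp
    show False
    proof (cases "bs = [] \<or> cs = []")
      case False
      then show False
      proof (intro no_theta[of "u # bs @ [v]" u v "u # rev cs @ [v]" "u # q @ [v]"])
        show "set (u # bs @ [v]) \<inter> set (u # rev cs @ [v]) = {u, v}" using d by auto
        show "set (u # bs @ [v]) \<inter> set (u # q @ [v]) = {u, v}" using d dq sz2 by auto
        show "set (u # rev cs @ [v]) \<inter> set (u # q @ [v]) = {u, v}" using d dq sz2 by auto
        show "distinct (u # q @ [v])" using dq sz2 vu by auto
      qed (use d ce ear lq in \<open>auto simp: Suc_le_eq\<close>)
    next
      case True
      \<comment> \<open>Here \<open>u\<close> and \<open>v\<close> are adjacent on the cycle;
        \<open>m\<close> lists the other cycle vertices, and the ear will replace the edge between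
        \<open>u\<close> and \<open>v\<close>.\<close>
      obtain m where m: "set m = set zs - {u, v}" "distinct m" "pedges (u # rev m @ [v]) \<subseteq> E" "length m = length zs - 2"
      proof (cases "bs = []")
        case bs: True
        show thesis
        proof (rule that[of cs])
          show "set cs = set zs - {u, v}" using sz2(1) d bs by auto
          show "length cs = length zs - 2" using sz2(2) bs by simp
        qed (use d ce in auto)
      next
        case False
        then have "cs = []" using True by simp
        show thesis
        proof (rule that[of "rev bs"])
          show "set (rev bs) = set zs - {u, v}" using sz2(1) d \<open>cs = []\<close> by auto
          show "length (rev bs) = length zs - 2" using sz2(2) \<open>cs = []\<close> by simp
        qed (use d ce in auto)
      qed
      let ?n = "[] @ u # q @ v # m"
      have "cedges ?n = pedges (u # q @ [v]) \<union> pedges (u # rev m @ [v])"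
        using cedges_split[of "[]" u q v m] by simp
      moreover have "distinct ?n" using m dq vu uw q(2) by auto
      moreover have lnz: "length ?n > length zs"
      proof -
        have "length zs \<ge> 3" using cz by (simp add: cyc_def)
        moreover have "length ?n = length q + length m + 2" by simp
        ultimately show ?thesis using m(4) lq by linarith
      qed
      moreover have "length zs \<ge> 3" using cz by (simp add: cyc_def)
      then have "length ?n \<ge> 3" using lnz by linarith
      ultimately have "cyc E ?n" using ear m(3) by (simp add: cyc_def)
      moreover have "set ?n \<subseteq> U" using m dq sub uw q by auto
      ultimately have "length ?n \<le> length zs" using max by blast
      then show False using lnz by simp
    qed
  qed
  then show thesis using that P by blast
qed

section \<open>Bounded faces of the drawing as inner faces of cycles\<close>

lemma inside_minus_drawing:
  assumes "cyc E zs"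
  shows "inside (dimg D (cedges zs)) - dimg D (chords zs) = inside (dimg D (cedges zs)) - drawing_image G D"
proof -
  have "x \<in> dimg D (chords zs)" if x: "x \<in> inside (dimg D (cedges zs))" "x \<in> drawing_image G D" for x
  proof -
    have nv: "x \<notin> point D ` V" using no_vertex_inside[OF assms] x(1) by blast
    then obtain e where e: "e \<in> E" "x \<in> img e" using x(2) by (auto simp: drawing_image_eq dimg_def)
    then have "x \<in> opn e" using nv edge_subset by blast
    then have "opn e \<inter> inside (dimg D (cedges zs)) \<noteq> {}" using x by blast
    from edge_inside_ends[OF assms e(1) this] have "e \<in> chords zs" using e by (simp add: chords_def)
    then show ?thesis using e by (auto simp: dimg_def)
  qed
  moreover have "dimg D (chords zs) \<subseteq> drawing_image G D"
    using dimg_mono[of "chords zs" E D] by (auto simp: drawing_image_eq chords_def)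
  ultimately show ?thesis by blast
qed

lemma compact_drawing: "compact (drawing_image G D)"
  unfolding drawing_image_eq using compact_dimg[of E] finite_V by (simp add: compact_Un finite_imp_compact)

lemma components_drawing:
  assumes "cyc E zs"
  shows "components (- drawing_image G D) = faces zs \<union> components (outside (dimg D (cedges zs)) - drawing_image G D)"
proof -
  let ?Z = "dimg D (cedges zs)" and ?X = "drawing_image G D"
  note J = cyc_Jordan[OF assms]
  have "closed ?X" using compact_drawing by (rule compact_imp_closed)
  then have "open (inside ?Z - ?X)" "open (outside ?Z - ?X)" using J by (auto intro: open_Diff)
  moreover have "(inside ?Z - ?X) \<inter> (outside ?Z - ?X) = {}" using J(8) by blast
  moreover have "?Z \<subseteq> ?X" using assms dimg_mono[of "cedges zs" E D] by (auto simp: cyc_def drawing_image_eq)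
  then have "- ?X = (inside ?Z - ?X) \<union> (outside ?Z - ?X)" using J(9) by blast
  ultimately show ?thesis
    using components_Un_open[of "inside ?Z - ?X" "outside ?Z - ?X"] inside_minus_drawing[OF assms]
    by (simp add: faces_def)
qed

lemma component_face:
  assumes "cyc E zs" "F \<in> components (- drawing_image G D)" "p \<in> F" "p \<in> inside (dimg D (cedges zs))"
  shows "F \<in> faces zs"
proof -
  have "F \<notin> components (outside (dimg D (cedges zs)) - drawing_image G D)"
  proof
    assume "F \<in> components (outside (dimg D (cedges zs)) - drawing_image G D)"
    from in_components_subset[OF this] show False using assms cyc_Jordan(8)[OF assms(1)] by blast
  qed
  then show ?thesis using assms components_drawing[OF assms(1)] by blast
qed

lemma faces_bounded: "cyc E zs \<Longrightarrow> faces zs \<subseteq> bounded_faces G D"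
  unfolding bounded_faces_def using components_drawing[of zs] face_subset[of _ zs] cyc_Jordan(6)[of zs]
  by (auto intro: bounded_subset)

text \<open>A point of a bounded face is enclosed by some cycle, by
  \<open>outside_by_cycles\<close>, and the face is then an inner face of that cycle.\<close>

lemma bounded_faces_eq: "bounded_faces G D = (\<Union>zs\<in>{zs. cyc E zs}. faces zs)"
proof
  show "(\<Union>zs\<in>{zs. cyc E zs}. faces zs) \<subseteq> bounded_faces G D" using faces_bounded by blast
  show "bounded_faces G D \<subseteq> (\<Union>zs\<in>{zs. cyc E zs}. faces zs)"
  proof
    fix F assume "F \<in> bounded_faces G D"
    then have F: "F \<in> components (- drawing_image G D)" "bounded F" by (auto simp: bounded_faces_def)
    then obtain p where p: "p \<in> F" using in_components_nonempty by blast
    then have pd: "p \<notin> drawing_image G D" using in_components_subset[OF F(1)] by blast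
    have "F = connected_component_set (- drawing_image G D) p"
      using F(1) p by (metis components_iff connected_component_eq)
    then have "p \<notin> outside (drawing_image G D)" using F(2) by (simp add: outside_def)
    then obtain zs where "cyc E zs" "p \<in> inside (dimg D (cedges zs))"
      using outside_by_cycles[OF pd] by blast
    then show "F \<in> (\<Union>zs\<in>{zs. cyc E zs}. faces zs)" using component_face F p by blast
  qed
qed

lemma cyc_within:
  assumes "cyc E zs" "e \<in> E" "e \<subseteq> set zs"
  shows "img e \<subseteq> inside (dimg D (cedges zs)) \<union> dimg D (cedges zs)"
proof (cases "e \<in> cedges zs")
  case True
  then show ?thesis by (auto simp: dimg_def)
next
  case False
  then have "opn e \<subseteq> inside (dimg D (cedges zs))" using assms by (intro chord_inside) (auto simp: chords_def)
  moreover have "img e \<subseteq> closure (opn e)" using img_closure_opn[OF assms(2)] .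
  ultimately show ?thesis using closure_mono[of "opn e"] cyc_Jordan(13)[OF assms(1)] by blast
qed

text \<open>The second cycle is drawn within the closed disc of the first, so the connected
  unbounded outside of the first cannot meet the inside of the second. Hence what the second cycle
  encloses, apart from points on the first, is enclosed by the first.\<close>

lemma faces_mono:
  assumes "cyc E zs" "cyc E zs'" "set zs' \<subseteq> set zs"
  shows "faces zs' \<subseteq> faces zs"
proof
  fix F assume F: "F \<in> faces zs'"
  let ?Z = "dimg D (cedges zs)" and ?Z' = "dimg D (cedges zs')"
  note J = cyc_Jordan[OF assms(1)] and J' = cyc_Jordan[OF assms(2)]
  have Fc: "F \<in> components (- drawing_image G D)" using components_drawing[OF assms(2)] F by blast
  then obtain p where p: "p \<in> F" using in_components_nonempty by blast
  have p': "p \<in> inside ?Z'" using p face_subset[OF F] by blast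
  have "p \<notin> drawing_image G D" using in_components_subset[OF Fc] p by blast
  moreover have "?Z \<subseteq> drawing_image G D"
    using assms dimg_mono[of "cedges zs" E D] by (auto simp: cyc_def drawing_image_eq)
  ultimately have pZ: "p \<notin> ?Z" by blast
  have "?Z' \<subseteq> inside ?Z \<union> ?Z"
  proof -
    have "zs' \<noteq> []" using assms(2) by (auto simp: cyc_def)
    then have "img e \<subseteq> inside ?Z \<union> ?Z" if "e \<in> cedges zs'" for e
      using cyc_within[OF assms(1), of e] cedges_subset[of zs' e] that assms by (auto simp: cyc_def)
    then show ?thesis by (auto simp: dimg_def)
  qed
  then have sub: "outside ?Z \<subseteq> - ?Z'" using J(8) outside_no_overlap[of ?Z] by blast
  have "p \<notin> outside ?Z"
  proof
    assume "p \<in> outside ?Z"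
    then have "outside ?Z \<subseteq> connected_component_set (- ?Z') p"
      using sub J(5) by (intro connected_component_maximal) auto
    moreover have "bounded (connected_component_set (- ?Z') p)" using p' by (simp add: inside_def)
    ultimately show False using J(7) bounded_subset by blast
  qed
  then have "p \<in> inside ?Z" using pZ J(9) by blast
  then show "F \<in> faces zs" using component_face[OF assms(1) Fc p] by blast
qed

text \<open>All edges are drawn in the closed disc of a Hamiltonian cycle, so the outer face is
  exactly the outside of that cycle.\<close>

lemma ham_faces:
  assumes "cyc E zs" "set zs = V"
  shows "bounded_faces G D = faces zs" "boundary_edges G D = cedges zs" "internal_edges G D = chords zs"
proof -
  let ?Z = "dimg D (cedges zs)"
  note J = cyc_Jordan[OF assms(1)]
  have sV: "set zs' \<subseteq> set zs" if "cyc E zs'" for zs'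
    using that set_subset_V[of zs'] assms(2) by (auto simp: cyc_def cedges_def)
  show "bounded_faces G D = faces zs"
    using bounded_faces_eq faces_mono[OF assms(1)] sV assms(1) by blast
  have cE: "cedges zs \<subseteq> E" using assms(1) by (simp add: cyc_def)
  have out: "outer_face G D = outside ?Z"
  proof
    have "?Z \<subseteq> drawing_image G D" using dimg_mono[OF cE, of D] by (auto simp: drawing_image_eq)
    then show "outer_face G D \<subseteq> outside ?Z" unfolding outer_face_def by (rule outside_mono)
    have "V = \<Union>(cedges zs)"
      using assms cedges_subset[of zs] pedges_Union[of zs] by (fastforce simp: cyc_def cedges_def)
    then have "point D ` V \<subseteq> ?Z" using point_in_dimg[OF cE] by blast
    moreover have "img e \<subseteq> inside ?Z \<union> ?Z" if "e \<in> E" for e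
      using cyc_within[OF assms(1) that] assms(2) edge_subset[OF that] by simp
    then have "dimg D E \<subseteq> inside ?Z \<union> ?Z" unfolding dimg_def by blast
    ultimately have "drawing_image G D \<subseteq> inside ?Z \<union> ?Z" unfolding drawing_image_eq by blast
    then have sub: "outside ?Z \<subseteq> - drawing_image G D"
      using J(8) outside_no_overlap[of ?Z] by blast
    show "outside ?Z \<subseteq> outer_face G D"
    proof
      fix p assume p: "p \<in> outside ?Z"
      then have "outside ?Z \<subseteq> connected_component_set (- drawing_image G D) p"
        using sub J(5) by (intro connected_component_maximal) auto
      then have "\<not> bounded (connected_component_set (- drawing_image G D) p)" using J(7) bounded_subset by blast
      then show "p \<in> outer_face G D" using p sub unfolding outer_face_def outside_def by blast
    qed
  qed
  have "img e \<subseteq> ?Z \<longleftrightarrow> e \<in> cedges zs" if "e \<in> E" for e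
  proof
    assume s: "img e \<subseteq> ?Z"
    show "e \<in> cedges zs"
      using opn_disjoint[OF that cE] opn_ne[OF that] s by blast
  qed (auto simp: dimg_def)
  then show b: "boundary_edges G D = cedges zs"
    using cE unfolding boundary_edges_def edge_on_face_def out J(11) by auto
  then show "internal_edges G D = chords zs"
    using edge_subset assms(2) unfolding internal_edges_def chords_def by blast
qed

end

text \<open>Erasing part of the drawing only enlarges the outer face, so the vertices stay on its
  boundary.\<close>

lemma outerplane_subgraph:
  assumes "outerplane_graph G D" "subgraph B G"
  shows "outerplane_graph B D"
proof -
  interpret outerplane_graph G D by fact
  have sub: "verts B \<subseteq> V" "edges B \<subseteq> E" "\<forall>e\<in>edges B. e \<subseteq> verts B" using assms(2) by (auto simp: subgraph_def)
  have sB: "simple_graph B"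
    using sub edge_card finite_subset[OF sub(1) finite_V] by (auto simp: simple_graph_def)
  have pB: "plane_embedding B D"
    using plane sub unfolding plane_embedding_def
    by (meson inj_on_subset subsetD)
  interpret B: plane_graph B D by (unfold_locales) (fact sB, fact pB)
  show ?thesis
  proof unfold_locales
    fix v assume v: "v \<in> verts B"
    have "drawing_image B D \<subseteq> drawing_image G D"
      using sub unfolding drawing_image_def by blast
    then have s: "outer_face G D \<subseteq> outer_face B D" unfolding outer_face_def by (rule outside_mono)
    have "point D v \<in> closure (outer_face B D)"
    proof -
      have "v \<in> V" using v sub by blast
      then have "point D v \<in> closure (outer_face G D)" using outer by (simp add: frontier_def)
      then show ?thesis using closure_mono[OF s] by blast
    qed
    moreover have "point D v \<in> drawing_image B D" using v by (auto simp: drawing_image_def)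
    then have "point D v \<notin> outer_face B D" unfolding outer_face_def using outside_no_overlap by blast
    ultimately show "point D v \<in> frontier (outer_face B D)"
      using interior_subset by (auto simp: frontier_def)
  qed
qed

context outerplane_graph begin

lemma block_ham:
  assumes "nontrivial_block G B"
  obtains zs where "cyc E zs" "set zs = verts B"
proof -
  have bl: "block G B" "card (verts B) \<ge> 3" using assms by (auto simp: nontrivial_block_def)
  show thesis using hamiltonian[OF block_bic[OF bl(1)] bl(2)] that by metis
qed

text \<open>Chords and faces of a cycle depend only on the edges between its vertices, so they are
  the same in \<open>G\<close> and in the block, and \<open>ham_faces\<close> applies to the
  block.\<close>

lemma block_ham_faces:
  assumes "block G B" "cyc E zs" "set zs = verts B"
  shows "edges B = {e \<in> E. e \<subseteq> set zs}"
    "bounded_faces B D = faces zs" "boundary_edges B D = cedges zs" "internal_edges B D = chords zs"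
proof -
  show eB: "edges B = {e \<in> E. e \<subseteq> set zs}" using block_edges[OF assms(1)] assms by simp
  have "subgraph B G" using assms by (simp add: block_def)
  then interpret B: outerplane_graph B D using outerplane_subgraph outerplane_graph_axioms by blast
  have "zs \<noteq> []" using assms by (auto simp: cyc_def)
  then have cB: "cyc (edges B) zs" using assms(2) cedges_subset[of zs] eB by (auto simp: cyc_def)
  have ch: "B.chords zs = chords zs" unfolding B.chords_def chords_def eB by auto
  have "B.faces zs = faces zs" unfolding B.faces_def faces_def ch by simp
  then show "bounded_faces B D = faces zs" "boundary_edges B D = cedges zs" "internal_edges B D = chords zs"
    using B.ham_faces[OF cB assms(3)] ch by auto
qed

end

lemma distinct_outer: "distinct (as @ u # bs @ v # cs) \<Longrightarrow> distinct (u # rev as @ rev cs @ [v])"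
  by (auto simp: Int_Un_distrib)

section \<open>Ladders from chains of faces, and chains of faces from ladders\<close>

context outerplane_graph begin

lemma faces_on_block:
  assumes "block G B" "cyc E zs" "set zs = verts B" "F \<in> faces zs" "e \<in> E" "on e F"
  shows "e \<in> edges B"
proof -
  have "zs \<noteq> []" using assms(2) by (auto simp: cyc_def)
  then have "e \<subseteq> set zs"
    using face_edges[OF assms(2,4,5,6)] cedges_subset[of zs e] by (auto simp: chords_def)
  then show ?thesis using block_ham_faces(1)[OF assms(1-3)] assms(5) by simp
qed

lemma block_weak_dual:
  assumes "block G B" "cyc E zs" "set zs = verts B"
  shows "weak_dual B D = \<lparr>verts = faces zs, edges = {{F, F'} | F F'. F \<in> faces zs \<and> F' \<in> faces zs \<and> F \<noteq> F' \<and>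
    (\<exists>e\<in>E. on e F \<and> on e F')}\<rparr>"
proof -
  have "edges B \<subseteq> E" using block_ham_faces(1)[OF assms] by blast
  then have *: "(\<exists>e\<in>edges B. on e F \<and> on e F') \<longleftrightarrow> (\<exists>e\<in>E. on e F \<and> on e F')" if "F \<in> faces zs" for F F'
    using faces_on_block[OF assms that] by blast
  show ?thesis unfolding weak_dual_def block_ham_faces(2)[OF assms] by (simp add: * cong: conj_cong)
qed

text \<open>The cycle is cut at its closing edge and at \<open>e'\<close>. Chords separate these two
  edges, so they join the two parts; if two of them crossed as rungs, the ends of one would lie in
  different halves of the other.\<close>

lemma lad_of_sep:
  assumes "cyc E zs" "e' \<in> pedges zs" "sep zs e'"
  obtains xs ys where "zs = xs @ rev ys" "xs \<noteq> []" "ys \<noteq> []" "e' = {last xs, last ys}"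
    "lad {e \<in> E. e \<subseteq> set zs} xs ys"
proof -
  obtain a b where ab: "nxt zs a b" "e' = {a, b}" using assms(2) by (auto simp: pedges_def)
  then obtain p r where z: "zs = p @ a # b # r" by (auto simp: nxt_split)
  let ?xs = "p @ [a]" and ?ws = "b # r"
  let ?ys = "rev ?ws"
  have zx: "zs = ?xs @ ?ws" using z by simp
  have d: "distinct (?xs @ ?ws)" using assms(1) zx by (simp add: cyc_def)
  \<comment> \<open>The arc of a chord contains both ends of \<open>e'\<close>, which lie in
    different parts of the list, so the ends of the chord do too.\<close>
  have cross: "u \<in> set ?xs \<and> v \<in> set ?ws"
    if zz: "zs = as @ u # bs @ v # cs" and "{u, v} \<in> chords zs" for as u bs v cs
  proof -
    have e': "e' \<in> pedges (u # bs @ [v])" using assms(3) that unfolding sep_def by blast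
    then have sub: "a \<in> set (u # bs @ [v])" "b \<in> set (u # bs @ [v])"
      using pedges_subset[OF e'] ab(2) by blast+
    have uv: "u \<in> set ?xs \<union> set ?ws" "v \<in> set ?xs \<union> set ?ws" using zz zx by (metis UnCI in_set_conv_decomp set_append append_assoc append_Cons)+
    have "v \<notin> set ?xs"
    proof
      assume "v \<in> set ?xs"
      then obtain x1 x2 where x: "?xs = x1 @ v # x2" by (meson split_list)
      have "(as @ u # bs) @ v # cs = x1 @ v # (x2 @ ?ws)" using zz zx x by simp
      moreover have "distinct ((as @ u # bs) @ v # cs)" using d zx zz by simp
      ultimately have "as @ u # bs = x1" using split_unique[of "as @ u # bs" v cs x1] by metis
      then have "set (u # bs @ [v]) \<subseteq> set ?xs" unfolding x by auto
      then show False using sub d by auto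
    qed
    moreover have "u \<notin> set ?ws"
    proof
      assume "u \<in> set ?ws"
      then obtain w1 w2 where w: "?ws = w1 @ u # w2" by (meson split_list)
      have "as @ u # (bs @ v # cs) = (?xs @ w1) @ u # w2" using zz zx w by simp
      moreover have "distinct (as @ u # (bs @ v # cs))" using d zx zz by simp
      ultimately have "bs @ v # cs = w2" using split_unique[of as u "bs @ v # cs" "?xs @ w1" w2] by metis
      then have "set (u # bs @ [v]) \<subseteq> set ?ws" unfolding w by auto
      then show False using sub d by auto
    qed
    ultimately show ?thesis using uv by blast
  qed
  have "lad {e \<in> E. e \<subseteq> set zs} ?xs ?ys"
    unfolding lad_def
  proof (intro conjI ballI allI impI notI)
    show "distinct (?xs @ ?ys)" using d by auto
  next
    fix e assume "e \<in> {e \<in> E. e \<subseteq> set zs}"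
    then have e: "e \<in> E" "e \<subseteq> set zs" by auto
    show "e \<in> pedges ?xs \<or> e \<in> pedges ?ys \<or> (\<exists>a\<in>set ?xs. \<exists>b\<in>set ?ys. e = {a, b})"
    proof (cases "e \<in> chords zs")
      case True
      obtain as u bs v cs where zz: "zs = as @ u # bs @ v # cs" "e = {u, v}"
        using two_in_list[OF e(2) edge_card[OF e(1)]] by metis
      then have "u \<in> set ?xs" "v \<in> set ?ys" using cross[OF zz(1)] True by auto
      then show ?thesis using zz by blast
    next
      case False
      then have "e \<in> cedges zs" using e by (simp add: chords_def)
      then have "e = {last zs, hd zs} \<or> e \<in> pedges (?xs @ ?ws)" using zx by (simp add: cedges_def)
      then have "e = {last zs, hd zs} \<or> e = {a, b} \<or> e \<in> pedges ?xs \<or> e \<in> pedges ?ws"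
        unfolding pedges_append_if by auto
      moreover have "pedges ?ys = pedges ?ws" by (rule pedges_rev)
      moreover have "hd zs \<in> set ?xs" "last zs \<in> set ?ys" unfolding z by (auto simp: hd_append)
      moreover have "a \<in> set ?xs" "b \<in> set ?ys" by auto
      ultimately show ?thesis by (metis insert_commute)
    qed
  next
    fix t t' x x' assume e: "{t, x} \<in> {e \<in> E. e \<subseteq> set zs}" "{t', x'} \<in> {e \<in> E. e \<subseteq> set zs}"
      and b: "before ?xs t t'" "before ?ys x' x"
    have bw: "before ?ws x x'" using b(2) before_rev[of ?ws x' x] by simp
    obtain p1 p2 p3 where p: "?xs = p1 @ t # p2 @ t' # p3" using b(1) unfolding before_split by blast
    obtain q1 q2 q3 where q: "?ws = q1 @ x # q2 @ x' # q3" using bw unfolding before_split by blast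
    let ?b = "p2 @ t' # p3 @ q1" and ?c = "q2 @ x' # q3"
    have zz: "zs = p1 @ t # ?b @ x # ?c" using zx p q by simp
    have dz: "distinct (p1 @ t # ?b @ x # ?c)" using assms(1) zz by (simp add: cyc_def)
    have eE: "{t, x} \<in> E" "{t', x'} \<in> E" "{t', x'} \<subseteq> set zs" using e by auto
    have "{t, x} \<notin> cedges zs"
    proof
      assume "{t, x} \<in> cedges zs"
      then have "{t, x} \<in> pedges (t # ?b @ [x]) \<or> {t, x} \<in> pedges (t # rev p1 @ rev ?c @ [x])"
        unfolding zz cedges_split by blast
      moreover have "{t, x} \<notin> pedges (t # ?b @ [x])"
        using closing_edge_notin[of "t # ?b @ [x]"] dz by (auto simp: insert_commute)
      moreover have "{t, x} \<notin> pedges (t # rev p1 @ rev ?c @ [x])"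
      proof -
        from closing_edge_notin[OF distinct_outer[OF dz]] show ?thesis by (simp add: insert_commute)
      qed
      ultimately show False by blast
    qed
    then have ch: "{t, x} \<in> chords zs" using e by (simp add: chords_def)
    note a = assms(1)[unfolded zz] ch[unfolded zz]
    let ?z1 = "t # ?b @ [x]" and ?z2 = "p1 @ t # x # ?c"
    have "{t', x'} \<in> cedges zs \<union> chords zs" using eE by (auto simp: chords_def)
    moreover have gen: "A \<union> C \<subseteq> (a1 \<union> c1) \<union> (a2 \<union> c2)"
      if "A = (a1 - {f}) \<union> (a2 - {f})" "C = insert f (c1 \<union> c2)" "f \<in> a1" for A C a1 a2 c1 c2 :: "'a set set" and f
      using that by blast
    from gen[OF cedges_split_chord(1)[OF a] chords_split(1)[OF a] cedges_split_chord(2)[OF a]]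
    have "cedges zs \<union> chords zs \<subseteq> (cedges ?z1 \<union> chords ?z1) \<union> (cedges ?z2 \<union> chords ?z2)"
      unfolding zz .
    moreover have "f \<subseteq> set z" if "f \<in> cedges z \<union> chords z" "z \<noteq> []" for f z
      using that cedges_subset[of z f] by (auto simp: chords_def)
    ultimately have "{t', x'} \<subseteq> set ?z1 \<or> {t', x'} \<subseteq> set ?z2" by blast
    then show False using dz by auto
  qed
  moreover have "zs = ?xs @ rev ?ys" using zx by (simp only: rev_rev_ident)
  moreover have "e' = {last ?xs, last ?ys}" using ab by simp
  ultimately show thesis using that[of ?xs ?ys] by blast
qed

lemma rotate_closing:
  assumes "cyc E zs" "e \<in> cedges zs"
  obtains zs' where "cyc E zs'" "set zs' = set zs" "cedges zs' = cedges zs" "e = {last zs', hd zs'}"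
proof (cases "e = {last zs, hd zs}")
  case True
  then show thesis using that assms by blast
next
  case False
  then obtain a b where "nxt zs a b" "e = {a, b}" using assms(2) by (auto simp: cedges_def pedges_def)
  then obtain p r where z: "zs = (p @ [a]) @ (b # r)" "e = {a, b}" by (auto simp: nxt_split)
  show thesis
  proof (rule that[of "(b # r) @ (p @ [a])"])
    show "cyc E ((b # r) @ (p @ [a]))" using assms(1) cyc_rotate z(1) by metis
    show "cedges ((b # r) @ (p @ [a])) = cedges zs" using cedges_rotate z(1) by metis
  qed (use z in auto)
qed

text \<open>Antipodal edges lie on different leaf faces, or there is only one face and no chord.
  Either way every chord separates them, once the cycle is rotated so that the first becomes the
  closing edge.\<close>

lemma lad_of_antipodal:
  assumes "nontrivial_block G B" "path_graph (weak_dual B D)"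
    "{a0, b0} \<noteq> {a1, b1}" "antipodal B D {{a0, b0}, {a1, b1}}"
  obtains xs ys where "lad (edges B) xs ys" "set xs \<union> set ys = verts B" "xs \<noteq> []" "ys \<noteq> []"
    "{hd xs, hd ys} = {a0, b0}" "{last xs, last ys} = {a1, b1}"
proof -
  have bl: "block G B" using assms by (auto simp: nontrivial_block_def)
  obtain z0 where z0: "cyc E z0" "set z0 = verts B" using block_ham[OF assms(1)] .
  have be: "{a0, b0} \<in> cedges z0" "{a1, b1} \<in> cedges z0"
    using assms(4) block_ham_faces(3)[OF bl z0] by (auto simp: antipodal_def)
  obtain zs where zs: "cyc E zs" "set zs = set z0" "cedges zs = cedges z0" "{a0, b0} = {last zs, hd zs}"
    using rotate_closing[OF z0(1) be(1)] .
  have zB: "set zs = verts B" using zs z0 by simp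
  note hf = block_ham_faces[OF bl zs(1) zB] and wd = block_weak_dual[OF bl zs(1) zB]
  have "{a1, b1} \<in> cedges zs" using be(2) zs(3) by simp
  then have e': "{a1, b1} \<in> pedges zs" using assms(3) zs(4) unfolding cedges_def by blast
  obtain Fs where Fs: "distinct Fs" "faces zs = set Fs" "edges (weak_dual B D) = pedges Fs"
    using assms(2) unfolding path_graph_iff wd by auto
  have nx: "\<exists>g\<in>E. on g F \<and> on g F'" if "nxt Fs F F'" for F F'
  proof -
    have "{F, F'} \<in> edges (weak_dual B D)" using that Fs(3) by (auto simp: pedges_def)
    then show ?thesis unfolding wd by (auto simp: doubleton_eq_iff)
  qed
  have leaf: "chords zs = {} \<or> (\<exists>F\<in>faces zs. \<exists>F'\<in>faces zs. F \<noteq> F' \<and> on {last zs, hd zs} F \<and> on {a1, b1} F' \<and>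
      card {g \<in> chords zs. on g F} \<le> 1 \<and> card {g \<in> chords zs. on g F'} \<le> 1)"
  proof (cases "card (bounded_faces B D) = 1")
    case True
    then obtain F where "faces zs = {F}" using hf(2) by (metis card_1_singletonE)
    from single_face[OF zs(1) this] show ?thesis by blast
  next
    case False
    then obtain f where f: "inj_on f {{a0, b0}, {a1, b1}}"
      "\<forall>e\<in>{{a0, b0}, {a1, b1}}. f e \<in> leaf_faces B D \<and> on e (f e)"
      using assms(4) unfolding antipodal_def by blast
    have "f {a0, b0} \<noteq> f {a1, b1}" using f(1) assms(3) by (auto dest: inj_onD)
    moreover have "F \<in> leaf_faces B D \<Longrightarrow> F \<in> faces zs \<and> card {g \<in> chords zs. on g F} \<le> 1" for F
      unfolding leaf_faces_def hf by simp
    moreover have "f {a0, b0} \<in> leaf_faces B D" "on {a0, b0} (f {a0, b0})"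
      "f {a1, b1} \<in> leaf_faces B D" "on {a1, b1} (f {a1, b1})" using f(2) by auto
    ultimately show ?thesis unfolding zs(4)[symmetric] by blast
  qed
  have "sep zs {a1, b1}" using sep_of_leaves[OF zs(1) Fs(1) Fs(2)[symmetric] nx e' leaf] .
  from lad_of_sep[OF zs(1) e' this] obtain xs ys where xy: "zs = xs @ rev ys" "xs \<noteq> []" "ys \<noteq> []"
    "{a1, b1} = {last xs, last ys}" "lad {e \<in> E. e \<subseteq> set zs} xs ys" .
  have "hd zs = hd xs" "last zs = hd ys" using xy by (auto simp: last_rev)
  then show thesis using that[of xs ys] xy zs(4) zB hf(1) by (metis insert_commute set_append set_rev)
qed

text \<open>As all chords join the two rows, each separates the first rung from the last, so the
  faces form a chain whose two ends are leaf faces on these rungs.\<close>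

lemma path_of_lad:
  assumes "block G B" "cyc E zs" "set zs = verts B" "zs = xs @ rev ys" "xs \<noteq> []" "ys \<noteq> []"
    and cross: "\<And>e. e \<in> chords zs \<Longrightarrow> \<exists>a\<in>set xs. \<exists>b\<in>set ys. e = {a, b}"
  shows "path_graph (weak_dual B D)" "{hd xs, hd ys} \<noteq> {last xs, last ys}"
    "antipodal B D {{hd xs, hd ys}, {last xs, last ys}}"
proof -
  let ?e = "{hd xs, hd ys}" and ?e' = "{last xs, last ys}"
  note hf = block_ham_faces[OF assms(1-3)] and wd = block_weak_dual[OF assms(1-3)]
  have hl: "hd zs = hd xs" "last zs = hd ys" using assms by (auto simp: last_rev)
  have cl: "{last zs, hd zs} = ?e" using hl by (simp add: insert_commute)
  have e': "?e' \<in> pedges zs" using assms by (simp add: pedges_append_if hd_rev)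
  have d: "distinct (xs @ rev ys)" using assms by (simp add: cyc_def)
  show ne: "?e \<noteq> ?e'" using closing_edge_notin[of zs] e' assms(2) cl by (auto simp: cyc_def)
  have "sep zs ?e'"
    unfolding sep_def
  proof (intro allI impI)
    fix as u bs v cs assume z: "zs = as @ u # bs @ v # cs" and ch: "{u, v} \<in> chords zs"
    have "u \<in> set xs \<and> v \<in> set (rev ys)"
    proof -
      obtain a b where ab: "a \<in> set xs" "b \<in> set ys" "{u, v} = {a, b}" using cross[OF ch] by blast
      have "before zs u v" using z before_split by metis
      then have "\<not> before zs v u" using before_asym d assms(4) by metis
      then have "\<not> (v \<in> set xs \<and> u \<in> set (rev ys))" using assms(4) by (simp add: before_append)
      then show ?thesis using ab by (auto simp: doubleton_eq_iff)
    qed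
    then obtain p q where pq: "xs = as @ u # p" "rev ys = q @ v # cs" "bs = p @ q"
      using split_two_parts[OF d, of as u bs v cs] z assms(4) by metis
    have "last (u # p) = last xs" using pq by simp
    moreover have "hd (q @ [v]) = last ys"
      using pq(2) assms(6) hd_rev[of ys] by (cases q) auto
    moreover have "{last (u # p), hd (q @ [v])} \<in> pedges ((u # p) @ (q @ [v]))"
      unfolding pedges_append_if by simp
    ultimately show "?e' \<in> pedges (u # bs @ [v])" using pq by simp
  qed
  from faces_chain[OF assms(2) e' this] obtain Fs where Fs: "Fs \<noteq> []" "distinct Fs" "set Fs = faces zs"
    "on ?e (hd Fs)" "on ?e' (last Fs)" "card {g \<in> chords zs. on g (hd Fs)} \<le> 1" "card {g \<in> chords zs. on g (last Fs)} \<le> 1"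
    and adj0: "\<forall>F\<in>faces zs. \<forall>F'\<in>faces zs. F \<noteq> F' \<longrightarrow> ((\<exists>g\<in>E. on g F \<and> on g F') \<longleftrightarrow> nxt Fs F F' \<or> nxt Fs F' F)"
    unfolding cl by (elim exE conjE)
  note adj = adj0[rule_format]
  have "edges (weak_dual B D) = pedges Fs"
  proof (intro equalityI subsetI)
    fix f assume "f \<in> edges (weak_dual B D)"
    then obtain F F' where f: "f = {F, F'}" "F \<in> faces zs" "F' \<in> faces zs" "F \<noteq> F'" "\<exists>e\<in>E. on e F \<and> on e F'"
      unfolding wd by auto
    then have "nxt Fs F F' \<or> nxt Fs F' F" using adj by blast
    then show "f \<in> pedges Fs" using f(1) unfolding pedges_def by blast
  next
    fix f assume "f \<in> pedges Fs"
    then obtain F F' where f: "f = {F, F'}" "nxt Fs F F'" by (auto simp: pedges_def)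
    then have "F \<in> faces zs" "F' \<in> faces zs" "F \<noteq> F'" using nxt_set Fs(3) nxt_neq[OF Fs(2)] by metis+
    moreover have "\<exists>g\<in>E. on g F \<and> on g F'" using adj[of F F'] f calculation by blast
    ultimately show "f \<in> edges (weak_dual B D)" unfolding wd using f(1) by (simp; blast)
  qed
  moreover have "verts (weak_dual B D) = set Fs" unfolding wd using Fs by simp
  ultimately show "path_graph (weak_dual B D)" unfolding path_graph_iff using Fs(2) by metis
  have hdl: "hd Fs \<in> leaf_faces B D" "last Fs \<in> leaf_faces B D"
    unfolding leaf_faces_def hf using hd_in_set[OF Fs(1)] last_in_set[OF Fs(1)] Fs(3,6,7) by simp_all
  show "antipodal B D {?e, ?e'}"
    unfolding antipodal_def
  proof (intro conjI)
    show "{?e, ?e'} \<subseteq> boundary_edges B D" unfolding hf using e' cl by (auto simp: cedges_def)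
    show "card {?e, ?e'} \<le> 2" by (simp add: card_insert_if)
    show "card (bounded_faces B D) = 1 \<or> (\<exists>f. inj_on f {?e, ?e'} \<and> (\<forall>e\<in>{?e, ?e'}. f e \<in> leaf_faces B D \<and> on e (f e)))"
    proof (cases "length Fs = 1")
      case True
      then have "card (faces zs) = 1" using Fs(2,3) distinct_card by metis
      then show ?thesis using hf by simp
    next
      case False
      then obtain F F' ms where "Fs = F # ms @ [F']"
        using Fs(1) by (metis One_nat_def length_Cons list.size(3) neq_Nil_conv rev_exhaust)
      then have "hd Fs \<noteq> last Fs" using Fs(2) by auto
      then have "inj_on (\<lambda>e. if e = ?e then hd Fs else last Fs) {?e, ?e'}" by (auto simp: inj_on_def)
      then show ?thesis using Fs hdl ne by (intro disjI2 exI[of _ "\<lambda>e. if e = ?e then hd Fs else last Fs"]) auto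
    qed
  qed
qed

section \<open>Components of the weak dual and nontrivial blocks\<close>

lemma weak_dual_wf: "\<forall>e\<in>edges (weak_dual G D). e \<subseteq> verts (weak_dual G D)"
  by (auto simp: weak_dual_def)

text \<open>Adjacent faces share an edge, an edge lies in only one block, and every bounded face is
  an inner face of some nontrivial block. So the faces of a block are closed under
  adjacency.\<close>

lemma weak_dual_component:
  assumes "nontrivial_block G B"
  shows "bounded_faces B D \<in> comp_sets (weak_dual G D)"
    "induce (weak_dual G D) (bounded_faces B D) = weak_dual B D"
proof -
  let ?W = "weak_dual G D"
  have bl: "block G B" using assms by (auto simp: nontrivial_block_def)
  obtain zs where zs: "cyc E zs" "set zs = verts B" using block_ham[OF assms] .
  note hf = block_ham_faces[OF bl zs] and wd = block_weak_dual[OF bl zs]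
  have sub: "faces zs \<subseteq> bounded_faces G D" using faces_bounded[OF zs(1)] .
  have eW: "edges ?W = {e \<in> dual_edges. e \<subseteq> bounded_faces G D}"
    unfolding weak_dual_def dual_edges_def by auto
  show "induce ?W (bounded_faces B D) = weak_dual B D"
    unfolding hf wd
  proof (rule ugraph.equality)
    show "verts (induce ?W (faces zs)) = verts \<lparr>verts = faces zs, edges = {{F, F'} | F F'. F \<in> faces zs \<and>
      F' \<in> faces zs \<and> F \<noteq> F' \<and> (\<exists>e\<in>E. on e F \<and> on e F')}\<rparr>"
      using sub by (auto simp: weak_dual_def)
    have *: "{e \<in> {{F, F'} | F F'. F \<in> A \<and> F' \<in> A \<and> F \<noteq> F' \<and> R F F'}. e \<subseteq> C} =
        {{F, F'} | F F'. F \<in> C \<and> F' \<in> C \<and> F \<noteq> F' \<and> R F F'}" (is "?L = ?R")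
      if "C \<subseteq> A" for A C :: "complex set set" and R
    proof (intro equalityI subsetI)
      fix e assume "e \<in> ?L"
      then obtain F F' where "e = {F, F'}" "F \<noteq> F'" "R F F'" "e \<subseteq> C" by blast
      then show "e \<in> ?R" by blast
    next
      fix e assume "e \<in> ?R"
      then obtain F F' where "e = {F, F'}" "F \<in> C" "F' \<in> C" "F \<noteq> F'" "R F F'" by blast
      then show "e \<in> ?L" using that by blast
    qed
    show "edges (induce ?W (faces zs)) = edges \<lparr>verts = faces zs, edges = {{F, F'} | F F'. F \<in> faces zs \<and>
      F' \<in> faces zs \<and> F \<noteq> F' \<and> (\<exists>e\<in>E. on e F \<and> on e F')}\<rparr>"
      unfolding weak_dual_def induce_simps ugraph.simps by (rule *[OF sub])
  qed simp
  have "conn (edges ?W) (faces zs)"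
    unfolding eW using conn_cong[OF sub] faces_connected[OF zs(1)] by simp
  moreover have "F' \<in> faces zs" if h: "F \<in> faces zs" "{F, F'} \<in> edges ?W" for F F'
  proof -
    obtain e where e: "F' \<in> bounded_faces G D" "e \<in> E" "on e F" "on e F'"
      using h(2) unfolding weak_dual_def by (auto simp: doubleton_eq_iff)
    then obtain z' where z': "cyc E z'" "F' \<in> faces z'" using bounded_faces_eq by blast
    have V': "set z' \<subseteq> V" using z' set_subset_V[of z'] by (auto simp: cyc_def cedges_def)
    obtain B' where B': "block G B'" "set z' \<subseteq> verts B'" using block_exists[OF bic_cycle[OF z'(1)] V'] .
    have "card (set z') \<ge> 3" using z'(1) by (simp add: cyc_def distinct_card)
    moreover have "finite (verts B')" using block_bic(2)[OF B'(1)] finite_V finite_subset by blast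
    ultimately have "card (verts B') \<ge> 3" using B'(2) card_mono order_trans by metis
    then have "nontrivial_block G B'" using B' by (simp add: nontrivial_block_def)
    then obtain z2 where z2: "cyc E z2" "set z2 = verts B'" using block_ham by metis
    have F2: "F' \<in> faces z2" using faces_mono[OF z2(1) z'(1)] z'(2) B'(2) z2(2) by blast
    have "e \<in> edges B" "e \<in> edges B'"
      using faces_on_block[OF bl zs h(1) e(2,3)] faces_on_block[OF B'(1) z2 F2 e(2,4)] by auto
    then have "e \<subseteq> verts B \<inter> verts B'" using block_edges bl B'(1) by blast
    moreover obtain x y where "e = {x, y}" "x \<noteq> y" using edge_card[OF e(2)] by (auto simp: card_2_iff)
    ultimately have "B = B'" using block_eq[OF bl B'(1), of x y] by blast
    then show ?thesis using F2 faces_mono[OF zs(1) z2(1)] zs(2) z2(2) by auto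
  qed
  moreover have "faces zs \<noteq> {}" using face_ex[OF zs(1)] by blast
  ultimately show "bounded_faces B D \<in> comp_sets ?W"
    unfolding hf comp_sets_iff[OF weak_dual_wf] using sub by (auto simp: weak_dual_def)
qed

lemma linear_forest_weak_dual:
  "linear_forest (weak_dual G D) \<longleftrightarrow> (\<forall>B. nontrivial_block G B \<longrightarrow> path_graph (weak_dual B D))"
proof
  assume "linear_forest (weak_dual G D)"
  then show "\<forall>B. nontrivial_block G B \<longrightarrow> path_graph (weak_dual B D)"
    using weak_dual_component unfolding linear_forest_def by metis
next
  assume a: "\<forall>B. nontrivial_block G B \<longrightarrow> path_graph (weak_dual B D)"
  show "linear_forest (weak_dual G D)"
    unfolding linear_forest_def
  proof
    fix C assume C: "C \<in> comp_sets (weak_dual G D)"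
    then obtain F where F: "F \<in> C" "F \<in> bounded_faces G D"
      using comp_sets_iff[OF weak_dual_wf] by (auto simp: weak_dual_def)
    then obtain z' where z': "cyc E z'" "F \<in> faces z'" using bounded_faces_eq by blast
    have V': "set z' \<subseteq> V" using z' set_subset_V[of z'] by (auto simp: cyc_def cedges_def)
    obtain B where B: "block G B" "set z' \<subseteq> verts B" using block_exists[OF bic_cycle[OF z'(1)] V'] .
    have "card (set z') \<ge> 3" using z'(1) by (simp add: cyc_def distinct_card)
    moreover have "finite (verts B)" using block_bic(2)[OF B(1)] finite_V finite_subset by blast
    ultimately have "card (verts B) \<ge> 3" using B(2) card_mono order_trans by metis
    then have nB: "nontrivial_block G B" using B by (simp add: nontrivial_block_def)
    then obtain zs where zs: "cyc E zs" "set zs = verts B" using block_ham by metis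
    have "F \<in> faces zs" using faces_mono[OF zs(1) z'(1)] z'(2) B(2) zs(2) by blast
    then have "F \<in> bounded_faces B D" using block_ham_faces(2)[OF B(1) zs] by simp
    then have "C = bounded_faces B D"
      using comp_sets_disjoint[OF weak_dual_wf C weak_dual_component(1)[OF nB]] F by blast
    then show "path_graph (induce (weak_dual G D) C)" using weak_dual_component(2)[OF nB] a nB by simp
  qed
qed

end

lemma self_block:
  assumes "simple_graph H" "biconnected H"
  shows "block H H"
  using assms unfolding block_def subgraph_def simple_graph_def by (auto intro!: ugraph.equality)

text \<open>\<open>leaves_exist\<close> supplies an antipodal pair, to which
  \<open>lad_of_antipodal\<close> applies. Graphs with at most two vertices have no Hamiltonian
  cycle and are treated by hand.\<close>

lemma outerpath_lad:
  fixes H :: "'a ugraph"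
  assumes "outerpath H" "biconnected H"
  obtains xs ys where "lad (edges H) xs ys" "set xs \<union> set ys = verts H"
proof -
  have sg: "simple_graph H" using assms by (simp add: outerpath_def)
  obtain D where D: "outerplane_embedding H D" "path_graph (weak_dual H D)"
    using assms by (auto simp: outerpath_def)
  interpret outerplane_graph H D
    by unfold_locales (use sg D in \<open>auto simp: outerplane_embedding_def\<close>)
  show thesis
  proof (cases "card V \<ge> 3")
    case False
    then have "card V = 0 \<or> card V = 1 \<or> card V = 2" by linarith
    then consider "V = {}" | x where "V = {x}" | x y where "V = {x, y}" "x \<noteq> y"
      using finite_V by (auto simp: card_1_singleton_iff card_2_iff)
    then show thesis
    proof cases
      case 1
      then have "E = {}" using edge_subset edge_card by fastforce
      then show thesis using that[of "[]" "[]"] 1 by (simp add: lad_def)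
    next
      case (2 x)
      have "e = {x}" if "e \<in> E" for e using edge_subset[OF that] edge_card[OF that] 2 by (auto simp: subset_singleton_iff)
      then have "E = {}" using edge_card by fastforce
      then show thesis using that[of "[x]" "[]"] 2 by (simp add: lad_def)
    next
      case (3 x y)
      have "E \<subseteq> {{x, y}}" using subset_two[of _ x y] edge_subset 3 by blast
      then show thesis using that[of "[x]" "[y]"] 3 by (auto simp: lad_def)
    qed
  next
    case True
    have bl: "block H H" using self_block sg assms(2) by blast
    then have nB: "nontrivial_block H H" using True by (simp add: nontrivial_block_def)
    obtain zs where zs: "cyc E zs" "set zs = V" using block_ham[OF nB] .
    note hf = block_ham_faces[OF bl zs]
    obtain e e' where e: "e \<in> cedges zs" "e' \<in> cedges zs" "e \<noteq> e'"
      "chords zs = {} \<or> (\<exists>F\<in>faces zs. \<exists>F'\<in>faces zs. F \<noteq> F' \<and> on e F \<and> on e' F' \<and>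
      card {g \<in> chords zs. on g F} \<le> 1 \<and> card {g \<in> chords zs. on g F'} \<le> 1)"
      using leaves_exist[OF zs(1)] .
    have "cedges zs \<subseteq> E" using zs by (simp add: cyc_def)
    then obtain a0 b0 a1 b1 where ab: "e = {a0, b0}" "e' = {a1, b1}"
      using e edge_card by (metis card_2_iff subsetD)
    have "antipodal H D {e, e'}"
      unfolding antipodal_def
    proof (intro conjI)
      show "{e, e'} \<subseteq> boundary_edges H D" using e hf by simp
      show "card {e, e'} \<le> 2" by (simp add: card_insert_if)
      show "card (bounded_faces H D) = 1 \<or> (\<exists>f. inj_on f {e, e'} \<and> (\<forall>e\<in>{e, e'}. f e \<in> leaf_faces H D \<and> on e (f e)))"
      proof (cases "chords zs = {}")
        case True
        then show ?thesis using faces_no_chord[OF zs(1)] hf by simp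
      next
        case False
        then obtain F F' where F: "F \<in> faces zs" "F' \<in> faces zs" "F \<noteq> F'" "on e F" "on e' F'"
          "card {g \<in> chords zs. on g F} \<le> 1" "card {g \<in> chords zs. on g F'} \<le> 1" using e(4) by blast
        have "inj_on (\<lambda>x. if x = e then F else F') {e, e'}" using F by (auto simp: inj_on_def)
        moreover have "\<forall>x\<in>{e, e'}. (if x = e then F else F') \<in> leaf_faces H D \<and> on x (if x = e then F else F')"
          unfolding leaf_faces_def hf using F e(3) by auto
        ultimately show ?thesis by blast
      qed
    qed
    then show thesis
      using lad_of_antipodal[OF nB D(2), of a0 b0 a1 b1] e(3) that unfolding ab by metis
  qed
qed

section \<open>Ladders are safe\<close>

lemma lad_rev: "lad E xs ys \<Longrightarrow> lad E (rev xs) (rev ys)"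
  unfolding lad_def by (auto simp: pedges_rev)

lemma lad_swap: "lad E xs ys \<Longrightarrow> lad E ys xs"
  unfolding lad_def by (auto simp: insert_commute)

lemma lad_mono: "lad E xs ys \<Longrightarrow> E' \<subseteq> E \<Longrightarrow> lad E' xs ys"
  unfolding lad_def by blast

lemma pedges_filter:
  assumes "e \<in> pedges xs" "\<forall>x\<in>e. P x"
  shows "e \<in> pedges (filter P xs)"
proof -
  obtain a b where "e = {a, b}" "nxt xs a b" using assms(1) by (auto simp: pedges_def)
  then show ?thesis using nxt_filter[of xs a b P] assms(2) unfolding pedges_def by blast
qed

lemma lad_filter:
  assumes "lad E xs ys" "\<forall>e\<in>E. \<forall>x\<in>e. P x"
  shows "lad E (filter P xs) (filter P ys)"
  unfolding lad_def
proof (intro conjI ballI allI impI)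
  show "distinct (filter P xs @ filter P ys)" using assms(1) unfolding lad_def by auto
  fix e assume e: "e \<in> E"
  then have "e \<in> pedges xs \<or> e \<in> pedges ys \<or> (\<exists>a\<in>set xs. \<exists>b\<in>set ys. e = {a, b})"
    using assms(1) unfolding lad_def by blast
  then show "e \<in> pedges (filter P xs) \<or> e \<in> pedges (filter P ys) \<or>
      (\<exists>a\<in>set (filter P xs). \<exists>b\<in>set (filter P ys). e = {a, b})"
  proof (elim disjE bexE)
    fix a b assume "a \<in> set xs" "b \<in> set ys" "e = {a, b}"
    moreover have "P a" "P b" using assms(2) e calculation by auto
    ultimately show ?thesis by auto
  qed (use assms(2) e pedges_filter[of e _ P] in blast)+
next
  fix t t' b b' assume "{t, b} \<in> E" "{t', b'} \<in> E" "before (filter P xs) t t'"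
  then show "\<not> before (filter P ys) b' b"
    using assms(1) unfolding lad_def before_filter by blast
qed

lemma nxt_before: "nxt xs a b \<Longrightarrow> before xs a b"
  unfolding nxt_split before_split by (metis append_Nil)

lemma before_trans:
  "distinct xs \<Longrightarrow> before xs a b \<Longrightarrow> before xs b c \<Longrightarrow> before xs a c"
proof (induction xs)
  case (Cons x xs)
  then show ?case by (auto dest: before_set)
qed simp

lemma nxt_between:
  "distinct xs \<Longrightarrow> nxt xs a c \<Longrightarrow> before xs a z \<Longrightarrow> before xs z c \<Longrightarrow> False"
proof (induction xs)
  case (Cons x xs)
  then show ?case
    by (cases xs) (auto dest: before_set nxt_set)
qed simp

lemma nxt_filter_before:
  assumes "distinct xs" "nxt (filter P xs) a b"
  shows "before xs a b" "\<And>z. before xs a z \<Longrightarrow> before xs z b \<Longrightarrow> \<not> P z"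
proof -
  have ab: "before (filter P xs) a b" using nxt_before[OF assms(2)] .
  then show "before xs a b" by (simp add: before_filter)
  fix z assume "before xs a z" "before xs z b"
  then show "\<not> P z" using nxt_between[of "filter P xs" a b z] assms ab by (auto simp: before_filter)
qed

lemma lad_distinct: "lad E xs ys \<Longrightarrow> distinct xs \<and> distinct ys \<and> set xs \<inter> set ys = {}"
  by (auto simp: lad_def)

lemma lad_noncross:
  "lad E xs ys \<Longrightarrow> {t, b} \<in> E \<Longrightarrow> {t', b'} \<in> E \<Longrightarrow> before xs t t' \<Longrightarrow> before ys b' b \<Longrightarrow> False"
  unfolding lad_def by blast

lemma lad_row_edge:
  assumes "lad E xs ys" "{p, q} \<in> E" "p \<in> set xs" "q \<in> set xs"
  shows "nxt xs p q \<or> nxt xs q p"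
proof -
  have d: "set xs \<inter> set ys = {}" using lad_distinct[OF assms(1)] by blast
  have "{p, q} \<in> pedges xs \<or> {p, q} \<in> pedges ys \<or> (\<exists>a\<in>set xs. \<exists>b\<in>set ys. {p, q} = {a, b})"
    using assms(1,2) unfolding lad_def by blast
  then have "{p, q} \<in> pedges xs"
    using pedges_subset[of "{p, q}" ys] assms(3,4) d by (auto simp: doubleton_eq_iff)
  then show ?thesis by (auto simp: pedges_def doubleton_eq_iff)
qed

text \<open>An edge within a row joins consecutive vertices. In this form the fact complements
  \<open>lad_noncross\<close> in the separation arguments.\<close>

lemma lad_no_jump:
  assumes "lad E xs ys" "{p, q} \<in> E" "before xs p z" "before xs z q"
  shows False
proof -
  have d: "distinct xs" using lad_distinct[OF assms(1)] by blast
  have pq: "before xs p q" using before_trans[OF d assms(3,4)] .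
  then have "nxt xs p q \<or> nxt xs q p" using lad_row_edge[OF assms(1,2)] before_set by metis
  then show False
  proof
    assume "nxt xs p q"
    from nxt_between[OF d this assms(3,4)] show False .
  next
    assume "nxt xs q p"
    from nxt_before[OF this] show False using before_asym[OF d pq] by blast
  qed
qed

text \<open>The ends of a rung separate the left of the ladder from the right: an edge from left to
  right would jump over an end of the rung within a row, or cross the rung.\<close>

lemma lad_separation:
  assumes L: "lad E xs ys" "{t, b} \<in> E" "t \<in> set xs" "b \<in> set ys"
    and U: "conn E U" "U \<subseteq> set xs \<union> set ys" "t \<notin> U" "b \<notin> U"
    and x: "x \<in> U" "before xs x t \<or> before ys x b" and y: "y \<in> U"
  shows "before xs y t \<or> before ys y b"
proof (rule ccontr)
  assume n: "\<not> ?thesis"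
  let ?A = "{z. before xs z t \<or> before ys z b}"
  obtain p q where pq: "p \<in> U" "p \<in> ?A" "q \<in> U" "q \<notin> ?A" "{p, q} \<in> E"
    using conn_cross[OF U(1) x(1) _ y, of ?A] x(2) n by blast
  have q: "before xs t q \<or> before ys b q"
    using pq(3,4) U(2-4) before_total[of q xs t] before_total[of q ys b] L by blast
  have qp: "{q, p} \<in> E" using pq(5) by (simp add: insert_commute)
  have bt: "{b, t} \<in> E" using L(2) by (simp add: insert_commute)
  from pq(2) q consider "before xs p t" "before xs t q" | "before xs p t" "before ys b q"
    | "before ys p b" "before xs t q" | "before ys p b" "before ys b q" by blast
  then show False
  proof cases
    case 1 then show False using lad_no_jump[OF L(1) pq(5)] by blast
  next
    case 2 then show False using lad_noncross[OF L(1) pq(5) L(2)] by blast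
  next
    case 3 then show False using lad_noncross[OF L(1) L(2) qp] by blast
  next
    case 4 then show False using lad_no_jump[OF lad_swap[OF L(1)] pq(5)] by blast
  qed
qed

text \<open>Connectedness requires an edge across each gap of \<open>C\<close> in the row, and only
  neighbours in the row can be adjacent.\<close>

lemma row_path:
  assumes L: "lad E xs ys" and C: "conn E C" "C \<subseteq> set xs"
  shows "path_graph \<lparr>verts = C, edges = {e \<in> E. e \<subseteq> C}\<rparr>"
proof -
  let ?ps = "filter (\<lambda>x. x \<in> C) xs"
  have d: "distinct xs" "set xs \<inter> set ys = {}" using lad_distinct[OF L] by blast+
  have "{e \<in> E. e \<subseteq> C} = pedges ?ps"
  proof (intro equalityI subsetI)
    fix e assume "e \<in> {e \<in> E. e \<subseteq> C}"
    then have e: "e \<in> E" "e \<subseteq> C" by auto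
    then have "e \<in> pedges xs \<or> e \<in> pedges ys \<or> (\<exists>a\<in>set xs. \<exists>b\<in>set ys. e = {a, b})"
      using L unfolding lad_def by blast
    moreover have "e \<notin> pedges ys"
    proof
      assume "e \<in> pedges ys"
      then obtain a b where "e = {a, b}" "nxt ys a b" by (auto simp: pedges_def)
      then show False using e C d nxt_set by fastforce
    qed
    ultimately have "e \<in> pedges xs" using e C d by auto
    then show "e \<in> pedges ?ps" using e(2) by (intro pedges_filter) auto
  next
    fix e assume "e \<in> pedges ?ps"
    then obtain a b where e: "e = {a, b}" "nxt ?ps a b" by (auto simp: pedges_def)
    then have ab: "a \<in> C" "b \<in> C" using nxt_set[OF e(2)] by auto
    note nf = nxt_filter_before[OF d(1) e(2)]
    \<comment> \<open>The edge that leaves the part up to \<open>a\<close> must run from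
      \<open>a\<close> to \<open>b\<close>: nothing of \<open>C\<close> lies between them, and row
      edges do not jump.\<close>
    let ?A = "{x. x = a \<or> before xs x a}"
    have "b \<notin> ?A" using nf(1) before_asym[OF d(1)] before_irrefl[OF d(1)] by blast
    then obtain p q where pq: "p \<in> C" "p \<in> ?A" "q \<in> C" "q \<notin> ?A" "{p, q} \<in> E"
      using conn_cross[OF C(1) ab(1) _ ab(2), of ?A] by blast
    have aq: "before xs a q" using pq(3,4) C(2) ab before_total[of q xs a] by blast
    then have "\<not> before xs q b" using nf(2) pq(3) by blast
    then have bq: "q = b \<or> before xs b q" using before_total[of q xs b] pq(3) ab C(2) by blast
    have "p = a" using pq(2) lad_no_jump[OF L pq(5)] aq by blast
    moreover have "q = b" using bq lad_no_jump[OF L, of a q b] pq(5) nf(1) \<open>p = a\<close> by blast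
    ultimately show "e \<in> {e \<in> E. e \<subseteq> C}" using pq(5) e(1) ab by simp
  qed
  moreover have "C = set ?ps" using C(2) by auto
  moreover have "distinct ?ps" using d(1) by simp
  ultimately show ?thesis unfolding path_graph_iff by auto
qed

section \<open>Branches at a vertex, and cut-safety of ladders\<close>

context fin_graph begin

lemma edge_two: "e \<in> edges G \<Longrightarrow> \<exists>a b. e = {a, b} \<and> a \<noteq> b"
  using card_edge by (simp add: card_2_iff)

definition branches :: "'a \<Rightarrow> 'a set set" where
  "branches v = {C \<in> comp_sets (delete_vertex G v). \<exists>u\<in>C. {v, u} \<in> edges G}"

lemma incident_components_eq: "incident_components G v = (\<lambda>C. induce G (insert v C)) ` branches v"
  by (auto simp: incident_components_def branches_def)

lemma wf_delete: "\<forall>e\<in>edges (delete_vertex G v). e \<subseteq> verts (delete_vertex G v)"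
  by auto

lemma branch_props:
  assumes "C \<in> branches v"
  shows "C \<noteq> {}" "C \<subseteq> verts G" "v \<notin> C" "conn (edges G) C" "conn (edges G) (insert v C)" "v \<in> verts G"
    "\<And>a b. a \<in> C \<Longrightarrow> {a, b} \<in> edges G \<Longrightarrow> b \<noteq> v \<Longrightarrow> b \<in> C"
proof -
  have C: "C \<in> comp_sets (delete_vertex G v)" using assms by (simp add: branches_def)
  obtain u where u: "u \<in> C" "{v, u} \<in> edges G" using assms by (auto simp: branches_def)
  note ci = C[unfolded comp_sets_iff[OF wf_delete]]
  show ne: "C \<noteq> {}" and s: "C \<subseteq> verts G" and v: "v \<notin> C" using ci by auto
  have "C \<subseteq> verts G - {v}" using s v by blast
  then show c: "conn (edges G) C" using ci conn_cong[of C "verts G - {v}" "edges G"] by simp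
  show "conn (edges G) (insert v C)" using conn_insert[OF c u(1), of v] u(2) by (simp add: insert_commute)
  show "v \<in> verts G" using edge_sub[OF u(2)] by simp
  fix a b assume a: "a \<in> C" "{a, b} \<in> edges G" "b \<noteq> v"
  then have "{a, b} \<in> edges (delete_vertex G v)" using edge_sub[OF a(2)] v by auto
  then show "b \<in> C" using ci a(1) by blast
qed

lemma branch_subset:
  assumes "C \<in> branches v" "conn (edges G) U" "U \<subseteq> verts G" "v \<notin> U" "U \<inter> C \<noteq> {}"
  shows "U \<subseteq> C"
proof -
  have C: "C \<in> comp_sets (delete_vertex G v)" using assms by (simp add: branches_def)
  have "U \<subseteq> verts G - {v}" using assms by blast
  then have "conn (edges (delete_vertex G v)) U"
    using assms(2) conn_cong[of U "verts G - {v}" "edges G"] by simp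
  then show ?thesis using conn_subset_comp[OF wf_delete C] assms(5) by blast
qed

lemma branches_disjoint:
  assumes "C \<in> branches v" "C' \<in> branches v" "C \<inter> C' \<noteq> {}"
  shows "C = C'"
  using assms comp_sets_disjoint[OF wf_delete] by (auto simp: branches_def)

lemma finite_branches: "finite (branches v)"
  by (rule finite_subset[of _ "Pow (verts G)"]) (use branch_props(2) fin_verts in auto)

lemma induce_branch:
  assumes "C \<in> branches v"
  shows "verts (induce G (insert v C)) = insert v C"
    "delete_vertex (induce G (insert v C)) v = \<lparr>verts = C, edges = {e \<in> edges G. e \<subseteq> C}\<rparr>"
proof -
  note b = branch_props[OF assms]
  show v: "verts (induce G (insert v C)) = insert v C" using b by auto
  show "delete_vertex (induce G (insert v C)) v = \<lparr>verts = C, edges = {e \<in> edges G. e \<subseteq> C}\<rparr>"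
  proof (rule ugraph.equality)
    show "edges (delete_vertex (induce G (insert v C)) v) = edges \<lparr>verts = C, edges = {e \<in> edges G. e \<subseteq> C}\<rparr>"
      using b(2,3) edge_sub by fastforce
  qed (use b in auto)
qed

text \<open>Stated for arbitrary vertex sets: applied to a branch it expresses small components, and
  with \<open>v\<close> inserted it expresses tails.\<close>

definition path_branch :: "'a set \<Rightarrow> bool" where
  "path_branch C \<longleftrightarrow> path_graph \<lparr>verts = C, edges = {e \<in> edges G. e \<subseteq> C}\<rparr>"

lemma big_branch: "C \<in> branches v \<Longrightarrow> big_component (induce G (insert v C)) v \<longleftrightarrow> \<not> path_branch C"
  by (simp add: big_component_def small_component_def induce_branch path_branch_def)

lemma inj_branches: "inj_on (\<lambda>C. induce G (insert v C)) (branches v)"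
proof
  fix C C' assume C: "C \<in> branches v" "C' \<in> branches v" "induce G (insert v C) = induce G (insert v C')"
  then have "insert v C = insert v C'" using induce_branch(1) by metis
  then show "C = C'" using branch_props(3) C by (metis insert_ident)
qed

lemma safe_cutvertex_iff: "safe_cutvertex G v \<longleftrightarrow> card {C \<in> branches v. \<not> path_branch C} \<le> 2"
proof -
  have "{K \<in> incident_components G v. big_component K v} =
      (\<lambda>C. induce G (insert v C)) ` {C \<in> branches v. \<not> path_branch C}"
    unfolding incident_components_eq using big_branch by blast
  then have "card {K \<in> incident_components G v. big_component K v} = card {C \<in> branches v. \<not> path_branch C}"
    using card_image[OF inj_on_subset[OF inj_branches, of "{C \<in> branches v. \<not> path_branch C}" v]] by simp
  then show ?thesis by (simp add: safe_cutvertex_def)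
qed

text \<open>A branch within one row would be a path by \<open>row_path\<close>, so a big one
  contains a rung.\<close>

lemma big_branch_cross:
  assumes L: "lad (edges G) xs ys" "set xs \<union> set ys = verts G" and v: "v \<in> set xs"
    and C: "C \<in> branches v" "\<not> path_branch C"
  shows "\<exists>t b. t \<in> C \<and> b \<in> C \<and> {t, b} \<in> edges G \<and> b \<in> set ys \<and> (before xs t v \<or> before xs v t)"
proof -
  note b = branch_props[OF C(1)]
  have "\<not> C \<subseteq> set xs" using row_path[OF L(1) b(4)] C(2) unfolding path_branch_def by blast
  moreover have "\<not> C \<subseteq> set ys" using row_path[OF lad_swap[OF L(1)] b(4)] C(2) unfolding path_branch_def by blast
  ultimately obtain t0 b0 where tb: "t0 \<in> C" "t0 \<in> set xs" "b0 \<in> C" "b0 \<in> set ys" using b(2) L(2) by blast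
  have "b0 \<notin> set xs" using lad_distinct[OF L(1)] tb by blast
  then obtain p q where "p \<in> C" "p \<in> set xs" "q \<in> C" "q \<notin> set xs" "{p, q} \<in> edges G"
    using conn_cross[OF b(4) tb(1) tb(2) tb(3)] by blast
  moreover have "q \<in> set ys" using calculation b(2) L(2) by blast
  moreover have "before xs p v \<or> before xs v p" using before_total[of p xs v] v calculation b(3) by blast
  ultimately show ?thesis by blast
qed

text \<open>Of the two rungs, the one nearer to \<open>v\<close> would separate the other branch
  from \<open>v\<close>, although that branch together with \<open>v\<close> is connected and avoids
  the rung.\<close>

lemma big_branches_left:
  assumes L: "lad (edges G) xs ys" "set xs \<union> set ys = verts G" and v: "v \<in> set xs"
    and C: "C \<in> branches v" "t \<in> C" "b \<in> C" "{t, b} \<in> edges G" "b \<in> set ys" "before xs t v"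
    and C': "C' \<in> branches v" "t' \<in> C'" "b' \<in> C'" "{t', b'} \<in> edges G" "b' \<in> set ys" "before xs t' v"
  shows "C = C'"
proof (rule ccontr)
  assume "C \<noteq> C'"
  have d: "distinct xs" "distinct ys" "set xs \<inter> set ys = {}" using lad_distinct[OF L(1)] by auto
  have *: False
    if ne: "C \<inter> C' = {}"
      and C: "C \<in> branches v" "t \<in> C" "b \<in> C" "{t, b} \<in> edges G" "b \<in> set ys" "before xs t v"
      and C': "C' \<in> branches v" "t' \<in> C'" "b' \<in> C'" "{t', b'} \<in> edges G" "b' \<in> set ys" "before xs t' v"
      and tt: "before xs t t'" for C C' t b t' b'
  proof -
    note p = branch_props[OF C(1)] and p' = branch_props[OF C'(1)]
    have U: "insert v C \<subseteq> set xs \<union> set ys" using p(2) L(2) v by auto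
    have n: "t' \<notin> insert v C" "b' \<notin> insert v C" using C' p'(3) ne by blast+
    have "before xs v t' \<or> before ys v b'"
      using lad_separation[OF L(1) C'(4) _ C'(5) p(5) U n, of t v] tt C(2) before_set[OF tt] by blast
    moreover have "\<not> before xs v t'" using before_asym[OF d(1) C'(6)] .
    moreover have "\<not> before ys v b'" using before_set[of ys v b'] v d(3) by blast
    ultimately show False by blast
  qed
  have ne: "C \<inter> C' = {}" using branches_disjoint[OF C(1) C'(1)] \<open>C \<noteq> C'\<close> by blast
  then have "t \<noteq> t'" using C C' by blast
  then have "before xs t t' \<or> before xs t' t" using before_total[of t xs t'] before_set[OF C(6)] before_set[OF C'(6)] by blast
  then show False using *[OF ne C C'] *[OF _ C' C] ne by blast
qed

text \<open>At most one big branch has a rung on the left of \<open>v\<close>, and at most one on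
  the right, the second by reversing the rows.\<close>

lemma lad_safe_cutvertex:
  assumes L: "lad (edges G) xs ys" "set xs \<union> set ys = verts G" and v: "v \<in> set xs"
  shows "safe_cutvertex G v"
proof -
  let ?S = "{C \<in> branches v. \<not> path_branch C}"
  let ?P = "\<lambda>zs C. \<exists>t b. t \<in> C \<and> b \<in> C \<and> {t, b} \<in> edges G \<and> b \<in> set ys \<and> before zs t v"
  let ?A = "{C \<in> branches v. ?P xs C}" and ?B = "{C \<in> branches v. ?P (rev xs) C}"
  have "?S \<subseteq> ?A \<union> ?B" using big_branch_cross[OF L v] by fastforce
  moreover have "finite ?A" "finite ?B" using finite_branches by auto
  moreover have "card ?A \<le> 1"
    using card_le_Suc0_iff_eq[of ?A] finite_branches big_branches_left[OF L v] by fastforce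
  moreover have "card ?B \<le> 1"
    using card_le_Suc0_iff_eq[of ?B] finite_branches big_branches_left[OF lad_rev[OF L(1)]] L(2) v by fastforce
  ultimately have "card ?S \<le> card (?A \<union> ?B)" "card (?A \<union> ?B) \<le> 2"
    using card_mono[of "?A \<union> ?B" ?S] card_Un_le[of ?A ?B] by auto
  then show ?thesis unfolding safe_cutvertex_iff by linarith
qed

lemma lad_cut_safe:
  assumes L: "lad (edges G) xs ys" "set xs \<union> set ys = verts G"
  shows "cut_safe G"
  unfolding cut_safe_def
proof (intro allI impI)
  fix v assume "cutvertex G v"
  then have "v \<in> set xs \<or> v \<in> set ys" using L(2) by (auto simp: cutvertex_def)
  then show "safe_cutvertex G v"
    using lad_safe_cutvertex[OF L] lad_safe_cutvertex[OF lad_swap[OF L(1)]] L(2) by blast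
qed

end

section \<open>Biconnected ladders\<close>

lemma filter_contiguous:
  assumes d: "distinct xs" and n: "\<And>a b. nxt (filter P xs) a b \<Longrightarrow> nxt xs a b"
    and z: "before xs (hd (filter P xs)) z" "before xs z (last (filter P xs))" "filter P xs \<noteq> []"
  shows "P z"
proof (rule ccontr)
  assume "\<not> P z"
  let ?h = "hd (filter P xs)" and ?l = "last (filter P xs)"
  obtain p r where x: "xs = p @ z # r" using before_set[OF z(1)] by (meson split_list)
  have d': "distinct (p @ z # r)" using d x by simp
  have hl: "?h \<in> set xs" "P ?h" "?l \<in> set xs" "P ?l"
    using hd_in_set[OF z(3)] last_in_set[OF z(3)] by auto
  have f: "filter P xs = filter P p @ filter P r" using x \<open>\<not> P z\<close> by simp
  have gen: "before (p @ z # r) h z \<Longrightarrow> h \<in> set p" "before (p @ z # r) z h \<Longrightarrow> h \<in> set r" for h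
    using d' by (auto simp: before_append dest: before_set)
  have "?h \<in> set p" using gen(1)[of ?h] z(1) x by simp
  then have ne1: "filter P p \<noteq> []" using hl by (auto simp: filter_empty_conv)
  have "?l \<in> set r" using gen(2)[of ?l] z(2) x by simp
  then have ne2: "filter P r \<noteq> []" using hl by (auto simp: filter_empty_conv)
  let ?a = "last (filter P p)" and ?b = "hd (filter P r)"
  have "nxt xs ?a ?b" using ne1 ne2 by (intro n) (simp add: f nxt_append)
  moreover have "?a \<in> set p" "?b \<in> set r" using last_in_set[OF ne1] hd_in_set[OF ne2] by auto
  then have "before xs ?a z" "before xs z ?b" unfolding x by (auto simp: before_append)
  ultimately show False using nxt_between[OF d] by blast
qed

lemma hd_before: "y \<in> set xs \<Longrightarrow> y = hd xs \<or> before xs (hd xs) y"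
  by (cases xs) auto

lemma last_before: "y \<in> set xs \<Longrightarrow> y = last xs \<or> before xs y (last xs)"
  using hd_before[of y "rev xs"] by (cases "xs = []") (auto simp: hd_rev)

lemma exists_last:
  assumes "\<exists>x\<in>set xs. P x"
  shows "\<exists>y\<in>set xs. P y \<and> (\<forall>x\<in>set xs. P x \<longrightarrow> x = y \<or> before xs x y)"
proof -
  have ne: "filter P xs \<noteq> []" using assms by (auto simp: filter_empty_conv)
  let ?y = "last (filter P xs)"
  have "?y \<in> set xs" "P ?y" using last_in_set[OF ne] by auto
  moreover have "x = ?y \<or> before xs x ?y" if "x \<in> set xs" "P x" for x
    using last_before[of x "filter P xs"] that by (auto simp: before_filter)
  ultimately show ?thesis by blast
qed

lemma exists_first:
  assumes "\<exists>x\<in>set xs. P x"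
  shows "\<exists>y\<in>set xs. P y \<and> (\<forall>x\<in>set xs. P x \<longrightarrow> x = y \<or> before xs y x)"
  using exists_last[of "rev xs" P] assms by auto

text \<open>If the two were not adjacent, the last vertex of the other row that is adjacent to the part of the row
  before the gap would be a cutvertex.\<close>
lemma bic_lad_row:
  assumes L: "lad E xs ys" and U: "bic E (set xs \<union> set ys)" and n: "nxt xs x x'"
  shows "{x, x'} \<in> E"
proof (rule ccontr)
  assume nE: "{x, x'} \<notin> E"
  let ?U = "set xs \<union> set ys"
  have d: "distinct xs" "distinct ys" "set xs \<inter> set ys = {}" using lad_distinct[OF L] by auto
  have xx: "x \<in> set xs" "x' \<in> set xs" "before xs x x'" using nxt_set[OF n] nxt_before[OF n] by auto
  let ?T = "{z. z = x \<or> before xs z x}"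
  have x'T: "x' \<notin> ?T" using xx(3) before_asym[OF d(1)] before_irrefl[OF d(1)] by blast
  \<comment> \<open>Within the row, the only edge that could leave the part up to \<open>x\<close>
    is the missing one.\<close>
  have row: False if "p \<in> ?T" "q \<in> set xs" "q \<notin> ?T" "{p, q} \<in> E" for p q
  proof -
    have xq: "before xs x q" using that(2,3) before_total[of q xs x] xx by blast
    have "p = x" using that(1) lad_no_jump[OF L that(4)] xq by blast
    moreover have "q = x' \<or> before xs x' q"
      using before_total[of q xs x'] that(2) xx nxt_between[OF d(1) n xq] by blast
    then have "q = x'" using lad_no_jump[OF L that(4)] xx(3) \<open>p = x\<close> by blast
    ultimately show False using nE that(4) by simp
  qed
  have TX: "?T \<subseteq> set xs" using xx before_set by fastforce
  show False
  proof (cases "\<exists>y\<in>set ys. \<exists>t\<in>?T. {t, y} \<in> E")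
    case False
    have "conn E ?U" using U by (simp add: bic_def)
    then obtain p q where pq: "p \<in> ?U" "p \<in> ?T" "q \<in> ?U" "q \<notin> ?T" "{p, q} \<in> E"
      using conn_cross[of E ?U x ?T x'] xx x'T by blast
    then show False using row[OF pq(2) _ pq(4,5)] False by blast
  next
    case True
    then obtain y where y: "y \<in> set ys" "\<exists>t\<in>?T. {t, y} \<in> E"
      and ymax: "\<forall>z\<in>set ys. (\<exists>t\<in>?T. {t, z} \<in> E) \<longrightarrow> z = y \<or> before ys z y"
      using exists_last[OF True] by blast
    \<comment> \<open>With \<open>y\<close> deleted, no edge leaves this set: from the upper part,
      rungs lead only to vertices before \<open>y\<close>; an edge from the lower part would jump
      over \<open>y\<close> or cross a rung at \<open>y\<close>.\<close>
    let ?A = "?T \<union> {z. before ys z y}"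
    have c: "conn E (?U - {y})" using U y by (auto simp: bic_def)
    have "x \<in> ?U - {y}" "x' \<in> ?U - {y}" using xx y d(3) by auto
    moreover have "x' \<notin> ?A" using x'T xx(2) d(3) before_set[of ys x' y] by blast
    ultimately obtain p q where pq: "p \<in> ?U - {y}" "p \<in> ?A" "q \<in> ?U - {y}" "q \<notin> ?A" "{p, q} \<in> E"
      using conn_cross[OF c, of x ?A x'] by blast
    show False
    proof (cases "p \<in> ?T")
      case pT: True
      then have "q \<in> set ys" using row[OF pT _ _ pq(5)] pq(3,4) by blast
      then show False using ymax pT pq(3-5) by blast
    next
      case False
      then have py: "before ys p y" using pq(2) by blast
      show False
      proof (cases "q \<in> set ys")
        case True
        then have "before ys y q" using before_total[of q ys y] pq(3,4) y(1) by blast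
        then show False using lad_no_jump[OF lad_swap[OF L] pq(5) py] by blast
      next
        case False
        then have qx: "q \<in> set xs" using pq(3) by blast
        obtain t where t: "t \<in> ?T" "{t, y} \<in> E" using y by blast
        have "before xs x q" using before_total[of q xs x] qx xx pq(4) by blast
        then have "before xs t q" using t(1) before_trans[OF d(1)] by blast
        moreover have "{q, p} \<in> E" using pq(5) by (simp add: insert_commute)
        ultimately show False using lad_noncross[OF L t(2)] py by blast
      qed
    qed
  qed
qed

text \<open>With a single row of at least three vertices, the second vertex would be a cutvertex,
  since row edges cannot jump over it.\<close>

lemma bic_lad_nonempty:
  assumes L: "lad E xs ys" and U: "bic E (set xs \<union> set ys)" "card (set xs \<union> set ys) \<ge> 3"
  shows "ys \<noteq> []"
proof
  assume y: "ys = []"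
  have d: "distinct xs" using lad_distinct[OF L] by blast
  then have "length xs \<ge> 3" using U(2) y by (simp add: distinct_card)
  then obtain a b c r where x: "xs = a # b # c # r"
    by (metis Suc_le_length_iff numeral_3_eq_3)
  have "conn E (set xs - {b})" using U(1) x y by (auto simp: bic_def)
  moreover have "a \<in> set xs - {b}" "c \<in> set xs - {b}" "c \<notin> {a}" using d x by auto
  ultimately obtain p q where pq: "p \<in> {a}" "q \<in> set xs - {b}" "q \<notin> {a}" "{p, q} \<in> E"
    using conn_cross[of E "set xs - {b}" a "{a}" c] by blast
  then have "before xs p b" "before xs b q" unfolding x by auto
  then show False using lad_no_jump[OF L pq(4)] by blast
qed

text \<open>Otherwise the first vertex of the row that has a rung would separate the vertices before
  it from the rest.\<close>

lemma bic_lad_first: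
  assumes L: "lad E xs ys" and U: "bic E (set xs \<union> set ys)" and ne: "xs \<noteq> []" "ys \<noteq> []"
  shows "\<exists>y\<in>set ys. {hd xs, y} \<in> E"
proof (rule ccontr)
  assume n: "\<not> ?thesis"
  let ?U = "set xs \<union> set ys" and ?x = "hd xs"
  have d: "distinct xs" "distinct ys" "set xs \<inter> set ys = {}" using lad_distinct[OF L] by auto
  have hx: "?x \<in> set xs" "hd ys \<in> set ys" using ne by auto
  have "conn E ?U" using U by (simp add: bic_def)
  then obtain p q where "p \<in> set xs" "q \<in> ?U" "q \<notin> set xs" "{p, q} \<in> E"
    using conn_cross[of E ?U ?x "set xs" "hd ys"] hx d by blast
  then have "\<exists>t\<in>set xs. \<exists>y\<in>set ys. {t, y} \<in> E" by blast
  then obtain t where t: "t \<in> set xs" "\<exists>y\<in>set ys. {t, y} \<in> E"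
    and tmin: "\<forall>s\<in>set xs. (\<exists>y\<in>set ys. {s, y} \<in> E) \<longrightarrow> s = t \<or> before xs t s"
    using exists_first[of xs "\<lambda>t. \<exists>y\<in>set ys. {t, y} \<in> E"] by blast
  have "?x \<noteq> t" using n t by blast
  then have xt: "before xs ?x t" using hd_before[OF t(1)] by auto
  let ?A = "{z. before xs z t}"
  have c: "conn E (?U - {t})" using U t by (auto simp: bic_def)
  moreover have "?x \<in> ?U - {t}" "hd ys \<in> ?U - {t}" "hd ys \<notin> ?A"
    using hx \<open>?x \<noteq> t\<close> d(3) t(1) before_set[of xs "hd ys" t] by auto
  ultimately obtain p q where pq: "p \<in> ?U - {t}" "p \<in> ?A" "q \<in> ?U - {t}" "q \<notin> ?A" "{p, q} \<in> E"
    using conn_cross[OF c, of ?x ?A "hd ys"] xt by blast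
  show False
  proof (cases "q \<in> set ys")
    case True
    then have "p = t \<or> before xs t p" using tmin pq before_set[of xs p t] by blast
    then show False using pq(2) before_asym[OF d(1)] before_irrefl[OF d(1)] by blast
  next
    case False
    then have "before xs t q" using before_total[of q xs t] pq(3,4) t(1) by blast
    then show False using lad_no_jump[OF L pq(5)] pq(2) by blast
  qed
qed

text \<open>Both first vertices have rungs; unless they are joined to each other, these rungs
  cross.\<close>

lemma bic_lad_rung:
  assumes L: "lad E xs ys" and U: "bic E (set xs \<union> set ys)" and ne: "xs \<noteq> []" "ys \<noteq> []"
  shows "{hd xs, hd ys} \<in> E"
proof -
  obtain y where y: "y \<in> set ys" "{hd xs, y} \<in> E" using bic_lad_first[OF assms] by blast
  have U': "bic E (set ys \<union> set xs)" using U by (simp add: Un_commute)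
  obtain x where x: "x \<in> set xs" "{hd ys, x} \<in> E" using bic_lad_first[OF lad_swap[OF L] U' ne(2,1)] by blast
  have x2: "{x, hd ys} \<in> E" using x(2) by (simp add: insert_commute)
  show ?thesis
  proof (rule ccontr)
    assume "\<not> ?thesis"
    then have "before xs (hd xs) x" "before ys (hd ys) y"
      using hd_before[OF x(1)] hd_before[OF y(1)] x2 y(2) by auto
    then show False using lad_noncross[OF L y(2) x2] by blast
  qed
qed

lemma bic_lad_cycle:
  assumes L: "lad E xs ys" and U: "bic E (set xs \<union> set ys)" "card (set xs \<union> set ys) \<ge> 3"
  shows "xs \<noteq> []" "ys \<noteq> []" "cyc E (xs @ rev ys)" "{hd xs, hd ys} \<in> E" "{last xs, last ys} \<in> E"
proof -
  have U': "bic E (set ys \<union> set xs)" "card (set ys \<union> set xs) \<ge> 3" using U by (auto simp: Un_commute)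
  show ne: "ys \<noteq> []" "xs \<noteq> []"
    using bic_lad_nonempty[OF L U] bic_lad_nonempty[OF lad_swap[OF L] U'] by auto
  show r1: "{hd xs, hd ys} \<in> E" using bic_lad_rung[OF L U(1)] ne by blast
  show r2: "{last xs, last ys} \<in> E" using bic_lad_rung[OF lad_rev[OF L]] U(1) ne by (auto simp: hd_rev)
  have p: "pedges xs \<subseteq> E" "pedges ys \<subseteq> E"
    using bic_lad_row[OF L U(1)] bic_lad_row[OF lad_swap[OF L] U'(1)] by (auto simp: pedges_def)
  have "distinct (xs @ rev ys)" using L by (auto simp: lad_def)
  moreover have "length (xs @ rev ys) = card (set xs \<union> set ys)"
    using distinct_card[OF \<open>distinct (xs @ rev ys)\<close>] by simp
  moreover have "cedges (xs @ rev ys) \<subseteq> E"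
    unfolding cedges_def pedges_append_if pedges_rev using ne r1 r2 p
    by (auto simp: hd_rev last_rev insert_commute)
  ultimately show "cyc E (xs @ rev ys)" using U(2) by (simp add: cyc_def)
qed

section \<open>Components attached to a block\<close>

context fin_graph begin

text \<open>\<open>B\<close> without \<open>v\<close> is connected, so it lies within
  \<open>C\<close> or misses it. In the converse direction \<open>B\<close> cannot consist of
  \<open>v\<close> alone, since the edge from \<open>v\<close> into \<open>C\<close> would enlarge
  it.\<close>

lemma block_component_branch:
  assumes B: "block G B" and v: "v \<in> verts B" and C: "C \<in> branches v"
  shows "\<not> subgraph B (induce G (insert v C)) \<longleftrightarrow> C \<inter> verts B = {}"
proof
  assume n: "\<not> subgraph B (induce G (insert v C))"
  show "C \<inter> verts B = {}"
  proof (rule ccontr)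
    assume "C \<inter> verts B \<noteq> {}"
    then have "(verts B - {v}) \<inter> C \<noteq> {}" using branch_props(3)[OF C] by blast
    moreover have "conn (edges G) (verts B - {v})" "verts B - {v} \<subseteq> verts G"
      using block_bic[OF B] v by (auto simp: bic_def)
    ultimately have "verts B - {v} \<subseteq> C" using branch_subset[OF C, of "verts B - {v}"] by blast
    then have "verts B \<subseteq> insert v C" by blast
    then have "subgraph B (induce G (insert v C))"
      using block_edges[OF B] block_bic(2)[OF B] unfolding subgraph_def by auto
    then show False using n by simp
  qed
next
  assume d: "C \<inter> verts B = {}"
  show "\<not> subgraph B (induce G (insert v C))"
  proof
    assume "subgraph B (induce G (insert v C))"
    then have "verts B \<subseteq> insert v C" using induce_branch(1)[OF C] by (simp add: subgraph_def)
    then have vB: "verts B = {v}" using d v by blast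
    obtain u where u: "u \<in> C" "{v, u} \<in> edges G" using C by (auto simp: branches_def)
    have "\<exists>W. bic (edges G) W \<and> W \<subseteq> verts G \<and> verts B \<subset> W"
      using bic_edge[OF u(2)] edge_sub[OF u(2)] vB u(1) branch_props(3)[OF C] by (intro exI[of _ "{v, u}"]) auto
    then obtain W where W: "bic (edges G) W" "W \<subseteq> verts G" "verts B \<subset> W" by blast
    let ?B = "\<lparr>verts = W, edges = {e \<in> edges G. e \<subseteq> W}\<rparr>"
    have s: "subgraph ?B G" "subgraph B ?B"
      using W block_edges[OF B] by (auto simp: subgraph_def)
    have "bic (edges ?B) (verts ?B)" using W(1) bic_cong[of W W] by simp
    then have "biconnected ?B" using subgraph_bic[OF s(1)] by blast
    then have "?B = B" using B s unfolding block_def by blast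
    then show False using W(3) by (metis order_less_irrefl ugraph.select_convs(1))
  qed
qed

text \<open>Pairs of root and branch, since the graph of a component does not display its root;
  \<open>attached_inj\<close> recovers the pair.\<close>

definition attached :: "'a ugraph \<Rightarrow> ('a \<times> 'a set) set" where
  "attached B = {(v, C). cutvertex G v \<and> v \<in> verts B \<and> C \<in> branches v \<and> C \<inter> verts B = {}}"

lemma block_components_eq:
  assumes "block G B"
  shows "block_components G B = (\<lambda>(v, C). induce G (insert v C)) ` attached B"
  unfolding block_components_def attached_def incident_components_eq
  using block_component_branch[OF assms] by (auto; blast)

lemma attached_inj:
  assumes "(v, C) \<in> attached B" "w \<in> verts B" "C' \<in> branches w" "induce G (insert v C) = induce G (insert w C')"
  shows "v = w" "C = C'"
proof -
  have v: "v \<in> verts B" "C \<in> branches v" "C \<inter> verts B = {}" using assms(1) by (auto simp: attached_def)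
  have e: "insert v C = insert w C'" using induce_branch(1) v assms(3,4) by metis
  have "w \<in> insert v C" using e by simp
  then show "v = w" using v(3) assms(2) by blast
  then show "C = C'" using e branch_props(3)[OF v(2)] branch_props(3)[OF assms(3)] by (metis insert_ident)
qed

lemma tail_branch:
  assumes "C \<in> branches v" "path_branch C" "path_branch (insert v C)"
  shows "tail (induce G (insert v C)) v"
proof -
  have "induce G (insert v C) = \<lparr>verts = insert v C, edges = {e \<in> edges G. e \<subseteq> insert v C}\<rparr>"
    using branch_props(2,6)[OF assms(1)] by (auto simp: induce_def)
  then show ?thesis using assms big_branch[OF assms(1)]
    by (simp add: tail_def big_component_def path_branch_def)
qed

end

section \<open>The two ends of a block in a ladder\<close>

locale ladder_block = fin_graph +
  fixes xs ys :: "'a list" and B :: "'a ugraph"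
  assumes L: "lad (edges G) xs ys" and VG: "set xs \<union> set ys = verts G"
    and B: "nontrivial_block G B"
begin

abbreviation "X \<equiv> filter (\<lambda>x. x \<in> verts B) xs"
abbreviation "Y \<equiv> filter (\<lambda>x. x \<in> verts B) ys"

lemma bl: "block G B" "card (verts B) \<ge> 3"
  using B by (auto simp: nontrivial_block_def)

lemma XY: "set X \<union> set Y = verts B"
  using block_bic(2)[OF bl(1)] VG by auto

lemma XY_lad: "lad (edges B) X Y"
  using lad_filter[OF lad_mono[OF L], of "edges B" "\<lambda>x. x \<in> verts B"] block_edges[OF bl(1)] by blast

lemma XY_bic: "bic (edges B) (set X \<union> set Y)"
  using block_bic(1)[OF bl(1)] bic_cong[of "verts B" "verts B" "edges G"] block_edges[OF bl(1)] XY by simp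

lemma XY_cycle: "X \<noteq> []" "Y \<noteq> []" "cyc (edges B) (X @ rev Y)" "{hd X, hd Y} \<in> edges B" "{last X, last Y} \<in> edges B"
  using bic_lad_cycle[OF XY_lad XY_bic] bl(2) XY by simp_all

lemma XY_edges: "edges B \<subseteq> edges G"
  using block_edges[OF bl(1)] by blast

text \<open>What lies beyond the first rung of the block; the part beyond the last rung is obtained
  by reversing the rows.\<close>

definition left :: "'a set" where
  "left = {z. before xs z (hd X) \<or> before ys z (hd Y)}"

lemma ends: "hd X \<in> set xs" "hd X \<in> verts B" "hd Y \<in> set ys" "hd Y \<in> verts B"
  using hd_in_set[OF XY_cycle(1)] hd_in_set[OF XY_cycle(2)] by auto

lemma rung: "{hd X, hd Y} \<in> edges G"
  using XY_cycle(4) XY_edges by blast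

lemma left_disjoint: "left \<inter> verts B = {}"
proof -
  have d: "distinct xs" "distinct ys" using lad_distinct[OF L] by auto
  have "\<not> before xs z (hd X)" if "z \<in> verts B" for z
    using hd_before[of z X] before_asym[OF d(1)] before_irrefl[OF d(1)] that before_set[of xs z "hd X"]
    by (auto simp: before_filter)
  moreover have "\<not> before ys z (hd Y)" if "z \<in> verts B" for z
    using hd_before[of z Y] before_asym[OF d(2)] before_irrefl[OF d(2)] that before_set[of ys z "hd Y"]
    by (auto simp: before_filter)
  ultimately show ?thesis unfolding left_def by blast
qed

lemma left_subset:
  assumes "conn (edges G) U" "U \<subseteq> verts G" "hd X \<notin> U" "hd Y \<notin> U" "U \<inter> left \<noteq> {}"
  shows "U \<subseteq> left"
proof
  fix y assume y: "y \<in> U"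
  obtain x where x: "x \<in> U" "x \<in> left" using assms(5) by blast
  then show "y \<in> left"
    using lad_separation[OF L rung ends(1,3) assms(1) _ assms(3,4) x(1) _ y] assms(2) VG
    unfolding left_def by blast
qed

text \<open>A branch whose root is neither end of the first rung avoids the rung together with its
  root, so the root would lie beyond the rung as well, outside the block.\<close>

lemma left_root:
  assumes "(v, C) \<in> attached B" "C \<subseteq> left"
  shows "v = hd X \<or> v = hd Y"
proof (rule ccontr)
  assume n: "\<not> ?thesis"
  have v: "v \<in> verts B" "C \<in> branches v" "C \<inter> verts B = {}" using assms(1) by (auto simp: attached_def)
  note b = branch_props[OF v(2)]
  have "insert v C \<subseteq> left"
    using left_subset[OF b(5)] b(1,2,6) n assms(2) ends v(3) by blast
  then show False using left_disjoint v(1) by blast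
qed

text \<open>Each of the two branches, with its root, contains an edge between the rows. The one
  nearer to the block would separate the other branch from its root in the block.\<close>

lemma left_conflict:
  assumes C: "(hd X, C) \<in> attached B" "C \<subseteq> left" "b \<in> C" "b \<in> set ys"
    and C': "(hd Y, C') \<in> attached B" "C' \<subseteq> left" "t \<in> C'" "t \<in> set xs"
  shows False
proof -
  have d: "distinct xs" "distinct ys" "set xs \<inter> set ys = {}" using lad_distinct[OF L] by auto
  have Cb: "C \<in> branches (hd X)" "C \<inter> verts B = {}" and Cb': "C' \<in> branches (hd Y)" "C' \<inter> verts B = {}"
    using C(1) C'(1) by (auto simp: attached_def)
  note p = branch_props[OF Cb(1)] and p' = branch_props[OF Cb'(1)]
  have dj: "C \<inter> C' = {}"
  proof (rule ccontr)
    assume a: "C \<inter> C' \<noteq> {}"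
    have "C' \<subseteq> C" using branch_subset[OF Cb(1) p'(4) p'(2)] ends Cb'(2) a by blast
    moreover obtain u where "u \<in> C'" "{hd Y, u} \<in> edges G" using Cb'(1) by (auto simp: branches_def)
    ultimately have "hd Y \<in> C" using p(7)[of u "hd Y"] ends d(3) by (metis disjoint_iff insert_commute subsetD)
    then show False using Cb(2) ends by blast
  qed
  have "hd X \<notin> set ys" "hd Y \<notin> set xs" using ends d by blast+
  have nxy: "hd X \<noteq> hd Y" using ends(1,3) d(3) by (metis disjoint_iff)
  \<comment> \<open>The edge between the rows inside the first branch with its root; the upper end
    \<open>t1\<close> may be the root itself.\<close>
  obtain b1 t1 where bt1: "b1 \<in> insert (hd X) C" "b1 \<in> set ys" "t1 \<in> insert (hd X) C" "t1 \<notin> set ys" "{b1, t1} \<in> edges G"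
    using conn_cross[OF p(5), of b "set ys" "hd X"] C \<open>hd X \<notin> set ys\<close> by blast
  have b1: "b1 \<in> C" using bt1 \<open>hd X \<notin> set ys\<close> by blast
  have t1: "t1 \<in> set xs" using bt1 p(2,6) VG by blast
  obtain t2 b2 where bt2: "t2 \<in> insert (hd Y) C'" "t2 \<in> set xs" "b2 \<in> insert (hd Y) C'" "b2 \<notin> set xs" "{t2, b2} \<in> edges G"
    using conn_cross[OF p'(5), of t "set xs" "hd Y"] C' \<open>hd Y \<notin> set xs\<close> by blast
  have t2: "t2 \<in> C'" using bt2 \<open>hd Y \<notin> set xs\<close> by blast
  have b2: "b2 \<in> set ys" using bt2 p'(2,6) VG by blast
  have e1: "{t1, b1} \<in> edges G" using bt1(5) by (simp add: insert_commute)
  have n1: "t2 \<notin> insert (hd X) C" "b2 \<notin> insert (hd X) C"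
    using t2 dj Cb'(2) Cb(2) ends bt2(3) nxy by blast+
  have n2: "t1 \<notin> insert (hd Y) C'" "b1 \<notin> insert (hd Y) C'"
  proof -
    have X: "hd X \<notin> C'" and Y: "hd Y \<notin> C" using Cb(2) Cb'(2) ends by blast+
    show "t1 \<notin> insert (hd Y) C'"
    proof (cases "t1 = hd X")
      case True
      then show ?thesis using X nxy by simp
    next
      case False
      then have "t1 \<in> C" using bt1(3) by simp
      then show ?thesis using Y dj by (metis disjoint_iff insertE)
    qed
    have "b1 \<noteq> hd Y" using b1 Y by blast
    then show "b1 \<notin> insert (hd Y) C'" using b1 dj by blast
  qed
  have "t1 \<noteq> t2" using n1 bt1 by blast
  then consider "before xs t1 t2" | "before xs t2 t1" using before_total[of t1 xs t2] t1 bt2(2) by blast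
  then show False
  proof cases
    case 1
    have "before xs (hd X) t2 \<or> before ys (hd X) b2"
      using lad_separation[OF L bt2(5,2) b2 p(5) _ n1 bt1(3) _ insertI1] 1 p(2,6) VG by blast
    moreover have "before xs t2 (hd X)" using t2 C'(2) bt2(2) d(3) before_set[of ys t2 "hd Y"] unfolding left_def by blast
    ultimately show False using before_asym[OF d(1)] before_set[of ys "hd X" b2] \<open>hd X \<notin> set ys\<close> by blast
  next
    case 2
    have "b1 \<noteq> b2" using n1 b1 by blast
    then have "before ys b2 b1"
      using before_total[of b1 ys b2] bt1(2) b2 lad_noncross[OF L bt2(5) e1 2] by blast
    then have "before xs (hd Y) t1 \<or> before ys (hd Y) b1"
      using lad_separation[OF L e1 t1 bt1(2) p'(5) _ n2 bt2(3) _ insertI1] p'(2,6) VG by blast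
    moreover have "before ys b1 (hd Y)" using b1 C(2) bt1(2) d(3) before_set[of xs b1 "hd X"] unfolding left_def by blast
    ultimately show False using before_asym[OF d(2)] before_set[of xs "hd Y" t1] \<open>hd Y \<notin> set xs\<close> by blast
  qed
qed

lemma row_tail:
  assumes "(hd X, C) \<in> attached B" "C \<subseteq> set xs"
  shows "tail (induce G (insert (hd X) C)) (hd X)"
proof -
  have C: "C \<in> branches (hd X)" using assms(1) by (simp add: attached_def)
  note p = branch_props[OF C]
  have "path_branch C" unfolding path_branch_def using row_path[OF L p(4) assms(2)] .
  moreover have "path_branch (insert (hd X) C)" unfolding path_branch_def
    using row_path[OF L p(5)] assms(2) ends by blast
  ultimately show ?thesis using tail_branch[OF C] by blast
qed

text \<open>Such a branch must contain the vertex just before \<open>hd X\<close> in the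
  row.\<close>

lemma row_tail_unique:
  assumes C: "(hd X, C) \<in> attached B" "C \<subseteq> left" "C \<subseteq> set xs"
    and C': "(hd X, C') \<in> attached B" "C' \<subseteq> left" "C' \<subseteq> set xs"
  shows "C = C'"
proof -
  have d: "distinct xs" "set xs \<inter> set ys = {}" using lad_distinct[OF L] by auto
  have *: "\<exists>u. u \<in> C \<and> nxt xs u (hd X)"
    if a: "(hd X, C) \<in> attached B" "C \<subseteq> left" "C \<subseteq> set xs" for C
  proof -
    obtain u where u: "u \<in> C" "{hd X, u} \<in> edges G" using a(1) by (auto simp: attached_def branches_def)
    have "u \<in> set xs" using u a(3) by blast
    then have "before xs u (hd X)" using u(1) a(2) d before_set[of ys u "hd Y"] unfolding left_def by blast
    then have "\<not> nxt xs (hd X) u" using nxt_before[of xs "hd X" u] before_asym[OF d(1)] by blast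
    then have "nxt xs u (hd X)"
      using lad_row_edge[OF L u(2) ends(1) \<open>u \<in> set xs\<close>] by simp
    then show ?thesis using u(1) by blast
  qed
  obtain u u' where "u \<in> C" "nxt xs u (hd X)" "u' \<in> C'" "nxt xs u' (hd X)" using *[OF C] *[OF C'] by blast
  moreover have "u = u'"
  proof (rule ccontr)
    assume "u \<noteq> u'"
    then have "before xs u u' \<or> before xs u' u" using before_total[of u xs u'] nxt_set calculation by metis
    then show False using nxt_between[OF d(1)] nxt_before calculation by metis
  qed
  ultimately show ?thesis using branches_disjoint[of C "hd X" C'] C(1) C'(1) by (auto simp: attached_def)
qed

definition leftK :: "'a ugraph set" where
  "leftK = (\<lambda>(v, C). induce G (insert v C)) ` {(v, C) \<in> attached B. C \<subseteq> left}"

lemma safe_left_aux: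
  assumes "\<And>C. (hd X, C) \<in> attached B \<Longrightarrow> C \<subseteq> left \<Longrightarrow> C \<subseteq> set xs"
  shows "safe_side G leftK (hd X) (hd Y)"
proof -
  have at: "\<exists>C. K = induce G (insert (hd X) C) \<and> (hd X, C) \<in> attached B \<and> C \<subseteq> left"
    if h: "K \<in> incident_at G leftK (hd X)" for K
  proof -
    have "K \<in> leftK" "K \<in> incident_components G (hd X)" using h by (auto simp: incident_at_def)
    then obtain v C where vC: "K = induce G (insert v C)" "(v, C) \<in> attached B" "C \<subseteq> left"
      by (auto simp: leftK_def)
    moreover obtain C' where "C' \<in> branches (hd X)" "K = induce G (insert (hd X) C')"
      using \<open>K \<in> incident_components G (hd X)\<close> by (auto simp: incident_components_eq)
    ultimately have "v = hd X" using attached_inj[OF vC(2) ends(2)] by metis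
    then show ?thesis using vC by blast
  qed
  have "K = K'" if K: "K \<in> incident_at G leftK (hd X)" "K' \<in> incident_at G leftK (hd X)" for K K'
    using at[OF K(1)] at[OF K(2)] row_tail_unique assms by metis
  then have "card (incident_at G leftK (hd X)) \<le> 1"
    by (metis One_nat_def card_le_Suc0_iff_eq card.infinite zero_le_one)
  moreover have "\<forall>K\<in>incident_at G leftK (hd X). tail K (hd X)"
    using at row_tail assms by metis
  moreover have "leftK \<subseteq> incident_at G leftK (hd X) \<union> incident_at G leftK (hd Y)"
  proof
    fix K assume "K \<in> leftK"
    then obtain v C where vC: "K = induce G (insert v C)" "(v, C) \<in> attached B" "C \<subseteq> left"
      by (auto simp: leftK_def)
    then have "K \<in> incident_components G v" "cutvertex G v"
      by (auto simp: attached_def incident_components_eq)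
    then show "K \<in> incident_at G leftK (hd X) \<union> incident_at G leftK (hd Y)"
      using left_root[OF vC(2,3)] \<open>K \<in> leftK\<close> by (auto simp: incident_at_def)
  qed
  ultimately show ?thesis by (simp add: safe_side_def)
qed

end

lemma (in ladder_block) swapped: "ladder_block G ys xs B"
  by unfold_locales (use L VG B lad_swap in auto)

lemma (in ladder_block) reversed: "ladder_block G (rev xs) (rev ys) B"
  by unfold_locales (use L VG B lad_rev in auto)

text \<open>By \<open>left_conflict\<close>, the components at one of the two ends of the rung stay
  in the row of that end. This end becomes the \<open>a\<close> of \<open>safe_side\<close>, and the
  row that supplies it depends on the block.\<close>

lemma (in ladder_block) safe_left:
  "\<exists>a b. {a, b} = {hd X, hd Y} \<and> safe_side G leftK a b"
proof -
  interpret S: ladder_block G ys xs B by (rule swapped)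
  have l: "S.left = left" unfolding S.left_def left_def by blast
  have K: "S.leftK = leftK" unfolding S.leftK_def leftK_def l by simp
  show ?thesis
  proof (cases "\<forall>C. (hd X, C) \<in> attached B \<longrightarrow> C \<subseteq> left \<longrightarrow> C \<subseteq> set xs")
    case True
    then show ?thesis using safe_left_aux by blast
  next
    case False
    then obtain C where C: "(hd X, C) \<in> attached B" "C \<subseteq> left" "\<not> C \<subseteq> set xs" by blast
    have "C \<subseteq> verts G" using C(1) branch_props(2) by (auto simp: attached_def)
    then obtain b where b: "b \<in> C" "b \<in> set ys" using C(3) VG by blast
    have "C' \<subseteq> set ys" if "(hd Y, C') \<in> attached B" "C' \<subseteq> left" for C'
    proof -
      have "C' \<subseteq> verts G" using that(1) branch_props(2) by (auto simp: attached_def)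
      then show ?thesis using left_conflict[OF C(1,2) b that] VG by blast
    qed
    then have "safe_side G leftK (hd Y) (hd X)" using S.safe_left_aux K l by simp
    then show ?thesis by (metis insert_commute)
  qed
qed

text \<open>The block fills its part of both rows without gaps, as its row edges are present by
  \<open>bic_lad_row\<close>. So an attached branch has vertices only beyond the first or beyond the
  last rung, and connectedness keeps it on one side.\<close>

lemma (in ladder_block) sides:
  assumes "(v, C) \<in> attached B"
  shows "C \<subseteq> left \<or> C \<subseteq> ladder_block.left (rev xs) (rev ys) B"
    "\<not> (C \<subseteq> left \<and> C \<subseteq> ladder_block.left (rev xs) (rev ys) B)"
proof -
  interpret R: ladder_block G "rev xs" "rev ys" B by (rule reversed)
  have d: "distinct xs" "distinct ys" "set xs \<inter> set ys = {}" using lad_distinct[OF L] by auto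
  have C: "C \<in> branches v" "C \<inter> verts B = {}" using assms by (auto simp: attached_def)
  note p = branch_props[OF C(1)]
  have rX: "R.X = rev X" "R.Y = rev Y" by (simp_all add: rev_filter)
  have hr: "hd R.X = last X" "hd R.Y = last Y" unfolding rX using XY_cycle(1,2) by (auto simp: hd_rev)
  have Rl: "z \<in> R.left \<longleftrightarrow> before xs (last X) z \<or> before ys (last Y) z" for z
    unfolding R.left_def hr by simp
  have row: "nxt xs a b" if "nxt X a b" for a b
  proof -
    have "{a, b} \<in> edges B" using bic_lad_row[OF XY_lad XY_bic that] .
    then have "{a, b} \<in> edges G" using XY_edges by blast
    moreover have "a \<in> set xs" "b \<in> set xs" using nxt_set[OF that] by auto
    ultimately have "nxt xs a b \<or> nxt xs b a" using lad_row_edge[OF L] by blast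
    moreover have "before xs a b" using nxt_before[OF that] by (simp add: before_filter)
    then have "\<not> nxt xs b a" using nxt_before[of xs b a] before_asym[OF d(1)] by metis
    ultimately show ?thesis by simp
  qed
  have row': "nxt ys a b" if "nxt Y a b" for a b
  proof -
    have "bic (edges B) (set Y \<union> set X)" using XY_bic by (simp add: Un_commute)
    then have "{a, b} \<in> edges B" using bic_lad_row[OF lad_swap[OF XY_lad] _ that] by blast
    then have "{a, b} \<in> edges G" using XY_edges by blast
    moreover have "a \<in> set ys" "b \<in> set ys" using nxt_set[OF that] by auto
    ultimately have "nxt ys a b \<or> nxt ys b a" using lad_row_edge[OF lad_swap[OF L]] by blast
    moreover have "before ys a b" using nxt_before[OF that] by (simp add: before_filter)
    then have "\<not> nxt ys b a" using nxt_before[of ys b a] before_asym[OF d(2)] by metis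
    ultimately show ?thesis by simp
  qed
  have "c \<in> left \<or> c \<in> R.left" if c: "c \<in> C" for c
  proof -
    have cB: "c \<notin> verts B" using C(2) c by blast
    have "c \<in> set xs \<or> c \<in> set ys" using p(2) c VG by blast
    then show ?thesis
    proof
      assume cx: "c \<in> set xs"
      have "hd X \<in> set xs" "last X \<in> set xs" "hd X \<in> verts B" "last X \<in> verts B"
        using ends last_in_set[OF XY_cycle(1)] by auto
      then have "before xs c (hd X) \<or> before xs (hd X) c" "before xs c (last X) \<or> before xs (last X) c"
        using before_total[of c xs] cx cB by blast+
      moreover have "\<not> (before xs (hd X) c \<and> before xs c (last X))"
        using filter_contiguous[OF d(1) row _ _ XY_cycle(1)] cB by blast
      ultimately show ?thesis unfolding Rl left_def by blast
    next
      assume cy: "c \<in> set ys"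
      have "hd Y \<in> set ys" "last Y \<in> set ys" "hd Y \<in> verts B" "last Y \<in> verts B"
        using ends last_in_set[OF XY_cycle(2)] by auto
      then have "before ys c (hd Y) \<or> before ys (hd Y) c" "before ys c (last Y) \<or> before ys (last Y) c"
        using before_total[of c ys] cy cB by blast+
      moreover have "\<not> (before ys (hd Y) c \<and> before ys c (last Y))"
        using filter_contiguous[OF d(2) row' _ _ XY_cycle(2)] cB by blast
      ultimately show ?thesis unfolding Rl left_def by blast
    qed
  qed
  moreover obtain c where "c \<in> C" using p(1) by blast
  ultimately show "C \<subseteq> left \<or> C \<subseteq> R.left"
    using left_subset[OF p(4,2)] R.left_subset[OF p(4,2)] ends R.ends C(2) by blast
  have "\<not> (before xs c (hd X) \<and> before xs (last X) c)" for c
  proof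
    assume a: "before xs c (hd X) \<and> before xs (last X) c"
    then have "before xs (last X) (hd X)" using before_trans[OF d(1)] by blast
    moreover have "hd X = last X \<or> before xs (hd X) (last X)"
      using hd_before[of "last X" X] last_in_set[OF XY_cycle(1)] by (auto simp: before_filter)
    ultimately show False using before_asym[OF d(1)] before_irrefl[OF d(1)] by metis
  qed
  moreover have "\<not> (before ys c (hd Y) \<and> before ys (last Y) c)" for c
  proof
    assume a: "before ys c (hd Y) \<and> before ys (last Y) c"
    then have "before ys (last Y) (hd Y)" using before_trans[OF d(2)] by blast
    moreover have "hd Y = last Y \<or> before ys (hd Y) (last Y)"
      using hd_before[of "last Y" Y] last_in_set[OF XY_cycle(2)] by (auto simp: before_filter)
    ultimately show False using before_asym[OF d(2)] before_irrefl[OF d(2)] by metis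
  qed
  ultimately have "\<not> (c \<in> left \<and> c \<in> R.left)" for c
    unfolding Rl left_def using before_set d(3) by (metis disjoint_iff mem_Collect_eq)
  then show "\<not> (C \<subseteq> left \<and> C \<subseteq> R.left)" using \<open>c \<in> C\<close> by blast
qed

context outerplane_graph begin

lemma lad_block:
  assumes "lad E xs ys" "set xs \<union> set ys = V" "nontrivial_block G B"
  shows "path_graph (weak_dual B D)" "safe_block G D B"
proof -
  interpret ladder_block G xs ys B by unfold_locales (use assms in auto)
  interpret R: ladder_block G "rev xs" "rev ys" B by (rule reversed)
  have z: "cyc E (X @ rev Y)" "set (X @ rev Y) = verts B"
    using XY_cycle(3) XY_edges XY by (auto simp: cyc_def)
  have cross: "\<exists>a\<in>set X. \<exists>b\<in>set Y. e = {a, b}" if "e \<in> chords (X @ rev Y)" for e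
  proof -
    have "e \<in> edges B" using that z block_ham_faces(1)[OF bl(1) z] by (auto simp: chords_def)
    moreover have "e \<notin> pedges X" "e \<notin> pedges Y"
      using that by (auto simp: chords_def cedges_def pedges_append_if)
    ultimately show ?thesis using XY_lad unfolding lad_def by blast
  qed
  note P = path_of_lad[OF bl(1) z refl XY_cycle(1,2) cross]
  show "path_graph (weak_dual B D)" using P(1) by blast
  have rX: "hd R.X = last X" "hd R.Y = last Y"
    using XY_cycle(1,2) by (simp_all add: rev_filter[symmetric] hd_rev)
  obtain a0 b0 where 0: "{a0, b0} = {hd X, hd Y}" "safe_side G leftK a0 b0" using safe_left by blast
  obtain a1 b1 where 1: "{a1, b1} = {last X, last Y}" "safe_side G R.leftK a1 b1"
    using R.safe_left unfolding rX by blast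
  have "leftK \<union> R.leftK = block_components G B"
    unfolding block_components_eq[OF bl(1)] leftK_def R.leftK_def using sides(1) by fast
  moreover have "leftK \<inter> R.leftK = {}"
  proof (rule ccontr)
    assume "leftK \<inter> R.leftK \<noteq> {}"
    then obtain v C w C' where K: "(v, C) \<in> attached B" "C \<subseteq> left" "(w, C') \<in> attached B" "C' \<subseteq> R.left"
      "induce G (insert v C) = induce G (insert w C')"
      unfolding leftK_def R.leftK_def by auto
    then have "C = C'" using attached_inj(2)[OF K(1), of w C'] by (auto simp: attached_def)
    then show False using sides(2)[OF K(1)] K by blast
  qed
  ultimately show "safe_block G D B"
    unfolding safe_block_def using P(2,3) 0 1 by metis
qed

theorem lad_safe:
  assumes "lad E xs ys" "set xs \<union> set ys = V"
  shows "cut_safe G" "block_safe G D" "linear_forest (weak_dual G D)"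
  using lad_cut_safe[OF assms] lad_block[OF assms] linear_forest_weak_dual
  unfolding block_safe_def by blast+

end

section \<open>Gluing ladders\<close>

lemma lad_subset:
  assumes "lad E xs ys" "e \<in> E"
  shows "e \<subseteq> set xs \<union> set ys"
proof -
  have "e \<in> pedges xs \<or> e \<in> pedges ys \<or> (\<exists>a\<in>set xs. \<exists>b\<in>set ys. e = {a, b})"
    using assms unfolding lad_def by blast
  then show ?thesis using pedges_subset[of e xs] pedges_subset[of e ys] by blast
qed

text \<open>The shared vertex ends the upper row of the first ladder and begins that of the second.
  Rungs of the first precede those of the second in both rows, up to equality at \<open>v\<close>,
  so no new crossing arises.\<close>

lemma lad_glue:
  assumes 1: "lad E1 (xs1 @ [v]) ys1" and 2: "lad E2 (v # xs2) ys2"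
    and dj: "(set xs1 \<union> set ys1) \<inter> (set xs2 \<union> set ys2) = {}"
  shows "lad (E1 \<union> E2) (xs1 @ v # xs2) (ys1 @ ys2)"
proof -
  have d1: "distinct (xs1 @ [v])" "distinct ys1" "set (xs1 @ [v]) \<inter> set ys1 = {}" using lad_distinct[OF 1] by auto
  have d2: "distinct (v # xs2)" "distinct ys2" "set (v # xs2) \<inter> set ys2 = {}" using lad_distinct[OF 2] by auto
  have dx: "distinct (xs1 @ v # xs2)" using d1 d2 dj by auto
  have dy: "distinct (ys1 @ ys2)" using d1 d2 dj by auto
  have v: "v \<notin> set xs1" "v \<notin> set xs2" "v \<notin> set ys1" "v \<notin> set ys2" using d1 d2 by auto
  have px: "pedges (xs1 @ [v]) \<subseteq> pedges (xs1 @ v # xs2)" "pedges (v # xs2) \<subseteq> pedges (xs1 @ v # xs2)"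
    using pedges_append_subset(1)[of "xs1 @ [v]" xs2] pedges_append_subset(2)[of "v # xs2" xs1] by auto
  have py: "pedges ys1 \<subseteq> pedges (ys1 @ ys2)" "pedges ys2 \<subseteq> pedges (ys1 @ ys2)"
    by (rule pedges_append_subset)+
  show ?thesis
    unfolding lad_def
  proof (intro conjI ballI allI impI notI)
    have "(set xs1 \<union> {v} \<union> set xs2) \<inter> (set ys1 \<union> set ys2) = {}"
      using d1(3) d2(3) dj by auto
    then show "distinct ((xs1 @ v # xs2) @ ys1 @ ys2)" using dx dy by auto
  next
    fix e assume "e \<in> E1 \<union> E2"
    then show "e \<in> pedges (xs1 @ v # xs2) \<or> e \<in> pedges (ys1 @ ys2) \<or>
      (\<exists>a\<in>set (xs1 @ v # xs2). \<exists>b\<in>set (ys1 @ ys2). e = {a, b})"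
    proof
      assume "e \<in> E1"
      then have "e \<in> pedges (xs1 @ [v]) \<or> e \<in> pedges ys1 \<or> (\<exists>a\<in>set (xs1 @ [v]). \<exists>b\<in>set ys1. e = {a, b})"
        using 1 unfolding lad_def by blast
      then show ?thesis
      proof (elim disjE bexE)
        fix a b assume "a \<in> set (xs1 @ [v])" "b \<in> set ys1" "e = {a, b}"
        then have "a \<in> set (xs1 @ v # xs2)" "b \<in> set (ys1 @ ys2)" by auto
        then show ?thesis using \<open>e = {a, b}\<close> by blast
      qed (use px py in blast)+
    next
      assume "e \<in> E2"
      then have "e \<in> pedges (v # xs2) \<or> e \<in> pedges ys2 \<or> (\<exists>a\<in>set (v # xs2). \<exists>b\<in>set ys2. e = {a, b})"
        using 2 unfolding lad_def by blast
      then show ?thesis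
      proof (elim disjE bexE)
        fix a b assume "a \<in> set (v # xs2)" "b \<in> set ys2" "e = {a, b}"
        then have "a \<in> set (xs1 @ v # xs2)" "b \<in> set (ys1 @ ys2)" by auto
        then show ?thesis using \<open>e = {a, b}\<close> by blast
      qed (use px py in blast)+
    qed
  next
    fix t t' b b' assume e: "{t, b} \<in> E1 \<union> E2" "{t', b'} \<in> E1 \<union> E2"
      and bx: "before (xs1 @ v # xs2) t t'" and by': "before (ys1 @ ys2) b' b"
    have bb: "b' \<in> set ys1 \<union> set ys2" "b \<in> set ys1 \<union> set ys2" using before_set[OF by'] by auto
    have tt: "t \<in> set (xs1 @ v # xs2)" "t' \<in> set (xs1 @ v # xs2)" using before_set[OF bx] by auto
    have s1: "s \<in> set (xs1 @ [v]) \<and> c \<in> set ys1"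
      if "{s, c} \<in> E1" "s \<in> set (xs1 @ v # xs2)" "c \<in> set ys1 \<union> set ys2" for s c
    proof -
      have "s \<in> set (xs1 @ [v]) \<union> set ys1" "c \<in> set (xs1 @ [v]) \<union> set ys1"
        using lad_subset[OF 1 that(1)] by auto
      then show ?thesis using that(2,3) dj v d1(3) d2(3) by auto
    qed
    have s2: "s \<in> set (v # xs2) \<and> c \<in> set ys2"
      if "{s, c} \<in> E2" "s \<in> set (xs1 @ v # xs2)" "c \<in> set ys1 \<union> set ys2" for s c
    proof -
      have "s \<in> set (v # xs2) \<union> set ys2" "c \<in> set (v # xs2) \<union> set ys2"
        using lad_subset[OF 2 that(1)] by auto
      then show ?thesis using that(2,3) dj v d1(3) d2(3) by auto
    qed
    have bx1: "before (xs1 @ [v]) t t'" if "t \<in> set (xs1 @ [v])" "t' \<in> set (xs1 @ [v])"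
    proof -
      have "before ((xs1 @ [v]) @ xs2) t t'" using bx by simp
      then show ?thesis using that dj dx before_set[of xs2 t t'] unfolding before_append by auto
    qed
    have bx2: "before (v # xs2) t t'" if "t \<in> set (v # xs2)" "t' \<in> set (v # xs2)"
      using bx that dx before_set[of xs1 t t'] unfolding before_append by auto
    have by1: "before ys1 b' b" if "b \<in> set ys1" "b' \<in> set ys1"
      using by' that dy before_set[of ys2 b' b] unfolding before_append by auto
    have by2: "before ys2 b' b" if "b \<in> set ys2" "b' \<in> set ys2"
      using by' that dy before_set[of ys1 b' b] unfolding before_append by auto
    from e consider "{t, b} \<in> E1" "{t', b'} \<in> E1" | "{t, b} \<in> E2" "{t', b'} \<in> E2"
      | "{t, b} \<in> E1" "{t', b'} \<in> E2" | "{t, b} \<in> E2" "{t', b'} \<in> E1" by blast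
    then show False
    proof cases
      case a: 1
      then show False using lad_noncross[OF 1 a] bx1 by1 s1 tt bb by blast
    next
      case a: 2
      then show False using lad_noncross[OF 2 a] bx2 by2 s2 tt bb by blast
    next
      case 3
      then have "b \<in> set ys1" "b' \<in> set ys2" using s1 s2 tt bb by blast+
      then have "before (ys1 @ ys2) b b'" by (simp add: before_append)
      then show False using before_asym[OF dy by'] by blast
    next
      case 4
      then have t: "t \<in> set (v # xs2)" "t' \<in> set (xs1 @ [v])" using s1 s2 tt bb by blast+
      have "t \<noteq> t'" using bx before_irrefl[OF dx] by blast
      then have "before (xs1 @ v # xs2) t' t" using t by (auto simp: before_append)
      then show False using before_asym[OF dx bx] by blast
    qed
  qed
qed

lemma lad_append:
  assumes 1: "lad E1 xs1 ys1" and 2: "lad E2 xs2 ys2"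
    and dj: "(set xs1 \<union> set ys1) \<inter> (set xs2 \<union> set ys2) = {}"
  shows "lad (E1 \<union> E2) (xs1 @ xs2) (ys1 @ ys2)"
proof -
  have d1: "distinct xs1" "distinct ys1" "set xs1 \<inter> set ys1 = {}" using lad_distinct[OF 1] by auto
  have d2: "distinct xs2" "distinct ys2" "set xs2 \<inter> set ys2 = {}" using lad_distinct[OF 2] by auto
  have dx: "distinct (xs1 @ xs2)" and dy: "distinct (ys1 @ ys2)" using d1 d2 dj by auto
  show ?thesis
    unfolding lad_def
  proof (intro conjI ballI allI impI notI)
    show "distinct ((xs1 @ xs2) @ ys1 @ ys2)" using dx dy d1 d2 dj by auto
  next
    fix e assume "e \<in> E1 \<union> E2"
    then have "e \<in> pedges xs1 \<or> e \<in> pedges ys1 \<or> (\<exists>a\<in>set xs1. \<exists>b\<in>set ys1. e = {a, b}) \<or>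
      e \<in> pedges xs2 \<or> e \<in> pedges ys2 \<or> (\<exists>a\<in>set xs2. \<exists>b\<in>set ys2. e = {a, b})"
      using 1 2 unfolding lad_def by blast
    then show "e \<in> pedges (xs1 @ xs2) \<or> e \<in> pedges (ys1 @ ys2) \<or>
      (\<exists>a\<in>set (xs1 @ xs2). \<exists>b\<in>set (ys1 @ ys2). e = {a, b})"
      using pedges_append_subset[of xs1 xs2] pedges_append_subset[of ys2 ys1] pedges_append_subset[of ys1 ys2]
        pedges_append_subset[of xs2 xs1] pedges_append_subset by (auto; blast)
  next
    fix t t' b b' assume e: "{t, b} \<in> E1 \<union> E2" "{t', b'} \<in> E1 \<union> E2"
      and bx: "before (xs1 @ xs2) t t'" and by': "before (ys1 @ ys2) b' b"
    have bb: "b' \<in> set ys1 \<union> set ys2" "b \<in> set ys1 \<union> set ys2" using before_set[OF by'] by auto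
    have tt: "t \<in> set xs1 \<union> set xs2" "t' \<in> set xs1 \<union> set xs2" using before_set[OF bx] by auto
    have s1: "s \<in> set xs1 \<and> c \<in> set ys1"
      if "{s, c} \<in> E1" "s \<in> set xs1 \<union> set xs2" "c \<in> set ys1 \<union> set ys2" for s c
      using lad_subset[OF 1 that(1)] that(2,3) dj d1(3) by blast
    have s2: "s \<in> set xs2 \<and> c \<in> set ys2"
      if "{s, c} \<in> E2" "s \<in> set xs1 \<union> set xs2" "c \<in> set ys1 \<union> set ys2" for s c
      using lad_subset[OF 2 that(1)] that(2,3) dj d2(3) by blast
    have bxs: "before xs1 t t' \<or> before xs2 t t' \<or> t \<in> set xs1 \<and> t' \<in> set xs2" using bx by (simp add: before_append)
    have bys: "before ys1 b' b \<or> before ys2 b' b \<or> b' \<in> set ys1 \<and> b \<in> set ys2" using by' by (simp add: before_append)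
    have dX: "set xs1 \<inter> set xs2 = {}" and dY: "set ys1 \<inter> set ys2 = {}" using dj by auto
    from e consider "{t, b} \<in> E1" "{t', b'} \<in> E1" | "{t, b} \<in> E2" "{t', b'} \<in> E2"
      | "{t, b} \<in> E1" "{t', b'} \<in> E2" | "{t, b} \<in> E2" "{t', b'} \<in> E1" by blast
    then show False
    proof cases
      case a: 1
      then have "t' \<in> set xs1" "b \<in> set ys1" using s1 tt bb by blast+
      then have "before xs1 t t'" "before ys1 b' b" using bxs bys before_set[of xs2] before_set[of ys2] dX dY by blast+
      then show False using lad_noncross[OF 1 a] by blast
    next
      case a: 2
      then have "t \<in> set xs2" "b' \<in> set ys2" using s2 tt bb by blast+
      then have "before xs2 t t'" "before ys2 b' b" using bxs bys before_set[of xs1] before_set[of ys1] dX dY by blast+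
      then show False using lad_noncross[OF 2 a] by blast
    next
      case 3
      then have "b \<in> set ys1" "b' \<in> set ys2" using s1 s2 tt bb by blast+
      then show False using bys dY before_set[of ys1 b' b] before_set[of ys2 b' b] by blast
    next
      case 4
      then have "t \<in> set xs2" "t' \<in> set xs1" using s1 s2 tt bb by blast+
      then show False using bxs dX before_set[of xs1 t t'] before_set[of xs2 t t'] by blast
    qed
  qed
qed

context fin_graph begin

text \<open>Ladders of induced subgraphs: \<open>W\<close> determines the edges, so gluing becomes a
  matter of vertex sets.\<close>

definition ladset :: "'a set \<Rightarrow> 'a list \<Rightarrow> 'a list \<Rightarrow> bool" where
  "ladset W xs ys \<longleftrightarrow> lad {e \<in> edges G. e \<subseteq> W} xs ys \<and> set xs \<union> set ys = W"

lemma ladset_rev: "ladset W xs ys \<Longrightarrow> ladset W (rev xs) (rev ys)"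
  and ladset_swap: "ladset W xs ys \<Longrightarrow> ladset W ys xs"
  using lad_rev lad_swap unfolding ladset_def by (auto simp: Un_commute)

lemma ladset_glue:
  assumes 1: "ladset W (xs1 @ [v]) ys1" and 2: "ladset (insert v C) (v # xs2) ys2"
    and dj: "W \<inter> C = {}" and sep: "\<And>a b. a \<in> C \<Longrightarrow> {a, b} \<in> edges G \<Longrightarrow> b \<noteq> v \<Longrightarrow> b \<in> C"
    and v: "v \<notin> C"
  shows "ladset (W \<union> C) (xs1 @ v # xs2) (ys1 @ ys2)"
proof -
  have l: "lad {e \<in> edges G. e \<subseteq> W} (xs1 @ [v]) ys1" "lad {e \<in> edges G. e \<subseteq> insert v C} (v # xs2) ys2"
    and s: "set (xs1 @ [v]) \<union> set ys1 = W" "set (v # xs2) \<union> set ys2 = insert v C"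
    using 1 2 by (auto simp: ladset_def)
  have d2: "v \<notin> set xs2" "v \<notin> set ys2" using lad_distinct[OF l(2)] by auto
  then have s2: "set xs2 \<union> set ys2 \<subseteq> C" using s(2) by auto
  have "set xs1 \<union> set ys1 \<subseteq> W" using s(1) by auto
  then have "(set xs1 \<union> set ys1) \<inter> (set xs2 \<union> set ys2) = {}" using s2 dj by blast
  from lad_glue[OF l this]
  have "lad ({e \<in> edges G. e \<subseteq> W} \<union> {e \<in> edges G. e \<subseteq> insert v C}) (xs1 @ v # xs2) (ys1 @ ys2)" .
  moreover have "{e \<in> edges G. e \<subseteq> W \<union> C} \<subseteq> {e \<in> edges G. e \<subseteq> W} \<union> {e \<in> edges G. e \<subseteq> insert v C}"
  proof
    fix e assume e: "e \<in> {e \<in> edges G. e \<subseteq> W \<union> C}"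
    obtain a b where ab: "e = {a, b}" using e edge_two by blast
    then have E: "{a, b} \<in> edges G" "{b, a} \<in> edges G" using e by (auto simp: insert_commute)
    show "e \<in> {e \<in> edges G. e \<subseteq> W} \<union> {e \<in> edges G. e \<subseteq> insert v C}"
    proof (cases "a \<in> C \<or> b \<in> C")
      case True
      then have "e \<subseteq> insert v C" using sep E ab by blast
      then show ?thesis using e by blast
    next
      case False
      then have "e \<subseteq> W" using e ab by blast
      then show ?thesis using e by blast
    qed
  qed
  ultimately have "lad {e \<in> edges G. e \<subseteq> W \<union> C} (xs1 @ v # xs2) (ys1 @ ys2)" using lad_mono by blast
  moreover have "set (xs1 @ v # xs2) \<union> set (ys1 @ ys2) = W \<union> C" using s by auto
  ultimately show ?thesis by (simp add: ladset_def)
qed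

lemma branches_closed:
  assumes "\<C> \<subseteq> branches v" "a \<in> \<Union>\<C>" "{a, b} \<in> edges G" "b \<noteq> v"
  shows "b \<in> \<Union>\<C>"
  using assms branch_props(7) by blast

lemma glue_branches:
  assumes 1: "ladset W (xs1 @ [v]) ys1" and 2: "ladset (insert v (\<Union>\<C>)) (v # xs2) ys2"
    and C: "\<C> \<subseteq> branches v" and dj: "W \<inter> \<Union>\<C> = {}"
  shows "ladset (W \<union> \<Union>\<C>) (xs1 @ v # xs2) (ys1 @ ys2)"
proof (rule ladset_glue[OF 1 2 dj])
  show "v \<notin> \<Union>\<C>" using branch_props(3) C by blast
qed (use branches_closed[OF C] in blast)

lemma ladset_single: "ladset {v} [v] []"
proof -
  have "\<not> e \<subseteq> {v}" if "e \<in> edges G" for e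
    using card_edge[OF that] card_mono[of "{v}" e] by auto
  then have "{e \<in> edges G. e \<subseteq> {v}} = {}" by blast
  then show ?thesis by (simp add: ladset_def lad_def)
qed

section \<open>Fans of branches at one vertex\<close>

lemma path_list:
  assumes "path_branch P"
  obtains ps where "lad {e \<in> edges G. e \<subseteq> P} ps []" "set ps = P" "{e \<in> edges G. e \<subseteq> P} = pedges ps" "distinct ps"
proof -
  obtain ps where "distinct ps" "P = set ps" "{e \<in> edges G. e \<subseteq> P} = pedges ps"
    using assms unfolding path_branch_def path_graph_iff by auto
  note ps = this
  have "lad (pedges ps) ps []" using ps(1) by (simp add: lad_def)
  then have "lad {e \<in> edges G. e \<subseteq> P} ps []" unfolding ps(3) .
  then show thesis using ps(2)[symmetric] ps(3,1) by (rule that)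
qed

lemma path_branch_subset:
  assumes "path_branch P" "conn (edges G) C" "C \<subseteq> P"
  shows "path_branch C"
proof -
  obtain ps where ps: "lad {e \<in> edges G. e \<subseteq> P} ps []" "set ps = P" using path_list[OF assms(1)] by metis
  have "conn {e \<in> edges G. e \<subseteq> P} C" using conn_cong[OF assms(3)] assms(2) by simp
  from row_path[OF ps(1) this] have "path_graph \<lparr>verts = C, edges = {e \<in> {e \<in> edges G. e \<subseteq> P}. e \<subseteq> C}\<rparr>"
    using ps assms(3) by simp
  moreover have "{e \<in> {e \<in> edges G. e \<subseteq> P}. e \<subseteq> C} = {e \<in> edges G. e \<subseteq> C}" using assms(3) by blast
  ultimately show ?thesis by (simp add: path_branch_def)
qed

text \<open>The path becomes the row opposite \<open>v\<close>, so \<open>v\<close> may be adjacent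
  to any of its vertices. As \<open>v\<close> is alone in its row, further ladders can be glued
  there on both sides.\<close>

lemma small_ladset:
  assumes "C \<in> branches v" "path_branch C"
  obtains ps where "ladset (insert v C) [v] ps"
proof -
  obtain ps where ps: "set ps = C" "{e \<in> edges G. e \<subseteq> C} = pedges ps" "distinct ps" using path_list[OF assms(2)] by metis
  have v: "v \<notin> C" using branch_props(3)[OF assms(1)] .
  have "lad {e \<in> edges G. e \<subseteq> insert v C} [v] ps"
    unfolding lad_def
  proof (intro conjI ballI allI impI notI)
    show "distinct ([v] @ ps)" using ps v by auto
    fix e assume e: "e \<in> {e \<in> edges G. e \<subseteq> insert v C}"
    show "e \<in> pedges [v] \<or> e \<in> pedges ps \<or> (\<exists>a\<in>set [v]. \<exists>b\<in>set ps. e = {a, b})"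
    proof (cases "v \<in> e")
      case True
      obtain a b where ab: "e = {a, b}" "a \<noteq> b" using e edge_two by blast
      then have "\<exists>u. e = {v, u} \<and> u \<noteq> v" using True by auto
      then show ?thesis using e ps(1) by auto
    next
      case False
      then have "e \<in> {e \<in> edges G. e \<subseteq> C}" using e by blast
      then show ?thesis using ps(2) by blast
    qed
  qed (auto)
  then show thesis using that[of ps] ps(1) by (simp add: ladset_def)
qed

text \<open>With \<open>v\<close> first in its row, another ladder whose row ends with
  \<open>v\<close> can be glued before it.\<close>

definition rooted :: "'a \<Rightarrow> 'a set \<Rightarrow> bool" where
  "rooted v C \<longleftrightarrow> (\<exists>xs ys. ladset (insert v C) (v # xs) ys)"

text \<open>All the paths go into the opposite row, one after the other, with \<open>v\<close> alone
  in its own row.\<close>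

lemma small_fan:
  assumes "\<C> \<subseteq> branches v" "\<forall>C\<in>\<C>. path_branch C"
  shows "\<exists>ps. ladset (insert v (\<Union>\<C>)) [v] ps"
proof -
  have "finite \<C>" using finite_branches finite_subset[OF assms(1)] by blast
  then show ?thesis using assms
  proof (induction \<C>)
    case empty
    then show ?case using ladset_single by auto
  next
    case (insert C \<C>)
    then obtain ps where ps: "ladset (insert v (\<Union>\<C>)) [v] ps" by auto
    obtain qs where qs: "ladset (insert v (\<Union>{C})) [v] qs"
      using small_ladset[of C v] insert.prems by auto
    have "insert v (\<Union>\<C>) \<inter> \<Union>{C} = {}"
    proof -
      have "v \<notin> C" using branch_props(3) insert.prems by blast
      moreover have "C' \<inter> C = {}" if "C' \<in> \<C>" for C'
        using branches_disjoint[of C' v C] that insert by blast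
      ultimately show ?thesis by blast
    qed
    from glue_branches[of "insert v (\<Union>\<C>)" "[]" v ps "{C}" "[]" qs] this ps qs insert.prems
    have "ladset (insert v (\<Union>\<C>) \<union> \<Union>{C}) [v] (ps @ qs)" by simp
    moreover have "insert v (\<Union>\<C>) \<union> \<Union>{C} = insert v (\<Union>(insert C \<C>))" by blast
    ultimately show ?case by auto
  qed
qed

text \<open>The path branches come first and leave \<open>v\<close> last in its row; the single big
  branch, rooted at \<open>v\<close>, is then glued on.\<close>

lemma fan:
  assumes "\<C> \<subseteq> branches v" "\<forall>C\<in>\<C>. path_branch C \<or> rooted v C"
    "\<forall>C\<in>\<C>. \<forall>C'\<in>\<C>. \<not> path_branch C \<longrightarrow> \<not> path_branch C' \<longrightarrow> C = C'"
  shows "\<exists>xs ys. ladset (insert v (\<Union>\<C>)) (v # xs) ys"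
proof (cases "\<exists>C\<in>\<C>. \<not> path_branch C")
  case False
  then show ?thesis using small_fan[OF assms(1)] by blast
next
  case True
  then obtain C where C: "C \<in> \<C>" "\<not> path_branch C" by blast
  let ?S = "\<C> - {C}"
  have "?S \<subseteq> branches v" "\<forall>C\<in>?S. path_branch C" using assms C by blast+
  then obtain ps where ps: "ladset (insert v (\<Union>?S)) [v] ps"
    using small_fan[of ?S v] by metis
  obtain xs ys where xy: "ladset (insert v (\<Union>{C})) (v # xs) ys"
    using assms(2) C by (auto simp: rooted_def)
  have "insert v (\<Union>?S) \<inter> \<Union>{C} = {}"
  proof -
    have "v \<notin> C" using branch_props(3) assms(1) C by blast
    moreover have "C' \<inter> C = {}" if "C' \<in> ?S" for C'
      using branches_disjoint[of C' v C] that assms(1) C by blast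
    ultimately show ?thesis by blast
  qed
  moreover have "{C} \<subseteq> branches v" using assms(1) C by blast
  moreover have "ladset (insert v (\<Union>?S)) ([] @ [v]) ps" using ps by simp
  ultimately have "ladset (insert v (\<Union>?S) \<union> \<Union>{C}) ([] @ v # xs) (ps @ ys)"
    using glue_branches[OF _ xy] by blast
  moreover have "insert v (\<Union>?S) \<union> \<Union>{C} = insert v (\<Union>\<C>)" using C by blast
  ultimately show ?thesis by auto
qed

lemma tail_path_branch:
  assumes "C \<in> branches v" "tail (induce G (insert v C)) v"
  shows "path_branch C" "path_branch (insert v C)"
proof -
  show "path_branch C" using assms big_branch[OF assms(1)] by (auto simp: tail_def big_component_def)
  have "induce G (insert v C) = \<lparr>verts = insert v C, edges = {e \<in> edges G. e \<subseteq> insert v C}\<rparr>"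
    using branch_props(2,6)[OF assms(1)] by (auto simp: induce_def)
  then show "path_branch (insert v C)" using assms(2) by (simp add: tail_def path_branch_def)
qed

text \<open>\<open>v\<close> is an end of the path, because otherwise \<open>C\<close> would be
  disconnected.\<close>

lemma tail_ladset:
  assumes "C \<in> branches v" "tail (induce G (insert v C)) v"
  obtains ts where "ladset (insert v C) (v # ts) []"
proof -
  note p = branch_props[OF assms(1)]
  obtain ps where ps: "lad {e \<in> edges G. e \<subseteq> insert v C} ps []" "set ps = insert v C" "distinct ps"
    using path_list[OF tail_path_branch(2)[OF assms]] by metis
  have "v \<in> set ps" using ps by simp
  then obtain p1 p2 where pp: "ps = p1 @ v # p2" by (meson split_list)
  have C: "C = set p1 \<union> set p2" using ps p(3) pp by auto
  have "p1 = [] \<or> p2 = []"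
  proof (rule ccontr)
    assume n: "\<not> ?thesis"
    then have l: "last p1 \<in> set p1" "hd p2 \<in> set p2" by auto
    have "hd p2 \<notin> set p1" using l ps(3) pp by auto
    then obtain s t where st: "s \<in> C" "s \<in> set p1" "t \<in> C" "t \<notin> set p1" "{s, t} \<in> edges G"
      using conn_cross[OF p(4), of "last p1" "set p1" "hd p2"] l C by blast
    then have "t \<in> set p2" using C by blast
    then have "before ps s v" "before ps v t" using st(2) pp by (auto simp: before_append)
    moreover have "{s, t} \<in> {e \<in> edges G. e \<subseteq> insert v C}" using st by simp
    ultimately show False using lad_no_jump[OF ps(1)] by blast
  qed
  then show thesis
  proof
    assume "p1 = []"
    then show thesis using that[of p2] ps pp by (simp add: ladset_def)
  next
    assume "p2 = []"
    then have "rev ps = v # rev p1" using pp by simp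
    then show thesis using that[of "rev p1"] lad_rev[OF ps(1)] ps(2) by (simp add: ladset_def)
  qed
qed

lemma glue_tails:
  assumes 1: "ladset W xs ys" "ys \<noteq> []" "last ys = a"
    and C: "\<C> \<subseteq> branches a" "\<forall>C\<in>\<C>. tail (induce G (insert a C)) a" "\<forall>C\<in>\<C>. \<forall>C'\<in>\<C>. C = C'" "W \<inter> \<Union>\<C> = {}"
  shows "\<exists>ts. ladset (W \<union> \<Union>\<C>) xs (ys @ ts)"
proof (cases "\<C> = {}")
  case True
  then show ?thesis using 1 by (intro exI[of _ "[]"]) simp
next
  case False
  then obtain C where CC: "\<C> = {C}" using C(3) by blast
  then obtain ts where ts: "ladset (insert a (\<Union>\<C>)) (a # ts) []" using tail_ladset[of C a] C by auto
  have "ladset W (butlast ys @ [a]) xs" using 1 ladset_swap append_butlast_last_id by metis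
  from glue_branches[OF this ts C(1,4)] have "ladset (W \<union> \<Union>\<C>) (butlast ys @ a # ts) xs" by simp
  moreover have "butlast ys @ a # ts = ys @ ts" using 1 append_butlast_last_id[of ys] by simp
  ultimately show ?thesis using ladset_swap by metis
qed

text \<open>The tail prolongs the row of \<open>a\<close>, which leaves \<open>b\<close> last in the
  other row, ready to take a ladder that begins with \<open>b\<close>.\<close>

lemma glue_side:
  assumes 1: "ladset W xs ys" "xs \<noteq> []" "ys \<noteq> []" "{last xs, last ys} = {a, b}"
    and A: "\<A> \<subseteq> branches a" "\<forall>C\<in>\<A>. tail (induce G (insert a C)) a" "\<forall>C\<in>\<A>. \<forall>C'\<in>\<A>. C = C'" "W \<inter> \<Union>\<A> = {}"
    and B: "\<B> \<subseteq> branches b" "\<exists>us vs. ladset (insert b (\<Union>\<B>)) (b # us) vs" "W \<inter> \<Union>\<B> = {}" "\<Union>\<A> \<inter> \<Union>\<B> = {}"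
  shows "\<exists>xs' ys'. ladset (W \<union> \<Union>\<A> \<union> \<Union>\<B>) (xs @ xs') (ys @ ys')"
proof -
  obtain us vs where uv: "ladset (insert b (\<Union>\<B>)) (b # us) vs" using B(2) by blast
  have *: "\<exists>xs' ys'. ladset (W \<union> \<Union>\<A> \<union> \<Union>\<B>) (xs @ xs') (ys @ ys')"
    if 1: "ladset W xs ys" "xs \<noteq> []" "ys \<noteq> []" "last xs = b" "last ys = a" for xs ys
  proof -
    obtain ts where ts: "ladset (W \<union> \<Union>\<A>) xs (ys @ ts)" using glue_tails[OF 1(1,3,5) A] by blast
    then have l: "ladset (W \<union> \<Union>\<A>) (butlast xs @ [b]) (ys @ ts)" using 1 append_butlast_last_id by metis
    have "(W \<union> \<Union>\<A>) \<inter> \<Union>\<B> = {}" using B(3,4) by blast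
    from glue_branches[OF l uv B(1) this]
    have "ladset (W \<union> \<Union>\<A> \<union> \<Union>\<B>) (butlast xs @ b # us) ((ys @ ts) @ vs)" .
    moreover have "butlast xs @ b # us = xs @ us" using 1 append_butlast_last_id[of xs] by simp
    ultimately show ?thesis by (metis append_assoc)
  qed
  consider "last xs = b" "last ys = a" | "last xs = a" "last ys = b" using 1(4) by (auto simp: doubleton_eq_iff)
  then show ?thesis
  proof cases
    case a: 1
    then show ?thesis using * 1 by blast
  next
    case 2
    obtain xs' ys' where "ladset (W \<union> \<Union>\<A> \<union> \<Union>\<B>) (ys @ ys') (xs @ xs')"
      using *[OF ladset_swap[OF 1(1)] 1(3,2) 2(2,1)] by blast
    then show ?thesis using ladset_swap by blast
  qed
qed

text \<open>Deleting \<open>v\<close> keeps all components of \<open>G\<close> except the one of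
  \<open>v\<close>, and in place of that one there are at least \<open>C\<close> and
  \<open>C'\<close>.\<close>

lemma two_branches_cutvertex:
  assumes "C \<in> branches v" "C' \<in> branches v" "C \<noteq> C'"
  shows "cutvertex G v"
proof -
  have v: "v \<in> verts G" using branch_props(6)[OF assms(1)] .
  let ?D = "comp_sets (delete_vertex G v)"
  obtain W where W: "W \<in> comp_sets G" "v \<in> W" using comp_exists[OF wf v] .
  have fD: "finite ?D" using comp_sets_subset[OF wf_delete] fin_verts
    by (metis delete_vertex_simps(1) finite_Diff finite_Pow_iff finite_subset)
  have fG: "finite (comp_sets G)" using comp_sets_subset[OF wf] fin_verts by (meson finite_Pow_iff finite_subset)
  have sub: "comp_sets G - {W} \<subseteq> ?D - branches v"
  proof
    fix X assume X: "X \<in> comp_sets G - {W}"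
    then have vX: "v \<notin> X" using comp_sets_disjoint[OF wf _ W(1)] W(2) by blast
    have Xi: "X \<noteq> {}" "X \<subseteq> verts G" "conn (edges G) X" "\<forall>a\<in>X. \<forall>b. {a, b} \<in> edges G \<longrightarrow> b \<in> X"
      using X comp_sets_iff[OF wf] by auto
    have XV: "X \<subseteq> verts G - {v}" using Xi(2) vX by blast
    then have "conn (edges (delete_vertex G v)) X" using conn_cong[OF XV, of "edges G"] Xi(3) by simp
    then have "X \<in> ?D" unfolding comp_sets_iff[OF wf_delete] using Xi XV by simp
    moreover have "X \<notin> branches v"
    proof
      assume "X \<in> branches v"
      then obtain u where "u \<in> X" "{u, v} \<in> edges G" by (auto simp: branches_def insert_commute)
      then show False using Xi(4) vX by blast
    qed
    ultimately show "X \<in> ?D - branches v" by blast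
  qed
  have "card (comp_sets G - {W}) + card {C, C'} = card ((comp_sets G - {W}) \<union> {C, C'})"
    using sub assms fG by (intro card_Un_disjoint[symmetric]) auto
  also have "\<dots> \<le> card ?D" using sub assms fD by (intro card_mono) (auto simp: branches_def)
  finally have "card (comp_sets G - {W}) + 2 \<le> card ?D" using assms(3) by simp
  moreover have "card (comp_sets G) = card (comp_sets G - {W}) + 1" using W(1) fG
    by (metis Suc_eq_plus1 card_Suc_Diff1)
  ultimately show ?thesis using v by (simp add: cutvertex_def)
qed

section \<open>Decomposition along a block or a bridge\<close>

lemma branch_exists:
  assumes "x \<in> verts G" "x \<noteq> v" "conn (edges G) U" "U \<subseteq> verts G" "x \<in> U" "v \<in> U"
  obtains C where "C \<in> branches v" "x \<in> C"
proof -
  have "x \<in> verts (delete_vertex G v)" using assms by simp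
  then obtain C where C: "C \<in> comp_sets (delete_vertex G v)" "x \<in> C" using comp_exists[OF wf_delete] by blast
  note ci = C(1)[unfolded comp_sets_iff[OF wf_delete]]
  then have "v \<notin> C" by auto
  then obtain a b where ab: "a \<in> U" "a \<in> C" "b \<in> U" "b \<notin> C" "{a, b} \<in> edges G"
    using conn_cross[OF assms(3,5) C(2) assms(6)] by blast
  have "b = v"
  proof (rule ccontr)
    assume "b \<noteq> v"
    then have "{a, b} \<in> edges (delete_vertex G v)" using ab edge_sub[OF ab(5)] \<open>v \<notin> C\<close> by auto
    then show False using ci ab by blast
  qed
  then have "{v, a} \<in> edges G" using ab(5) by (simp add: insert_commute)
  then have "C \<in> branches v" using C(1) ab(2) by (auto simp: branches_def)
  then show thesis using that C(2) by blast
qed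

lemma component_branches:
  assumes "W \<in> comp_sets G" "v \<in> W"
  shows "W = insert v (\<Union>(branches v))"
proof
  have Wi: "W \<subseteq> verts G" "conn (edges G) W" "\<forall>a\<in>W. \<forall>b. {a, b} \<in> edges G \<longrightarrow> b \<in> W"
    using assms comp_sets_iff[OF wf] by auto
  show "W \<subseteq> insert v (\<Union>(branches v))"
    using branch_exists[OF _ _ Wi(2,1) _ assms(2)] Wi(1) by blast
  have "C \<subseteq> W" if "C \<in> branches v" for C
    using conn_subset_comp[OF wf assms(1) branch_props(5)[OF that]] assms(2) by blast
  then show "insert v (\<Union>(branches v)) \<subseteq> W" using assms by blast
qed

text \<open>Covers blocks and bridges at once.\<close>
definition gated :: "'a set \<Rightarrow> bool" where
  "gated U \<longleftrightarrow> U \<subseteq> verts G \<and> conn (edges G) U \<and>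
     (\<forall>D u u'. conn (edges G) D \<longrightarrow> D \<subseteq> verts G \<longrightarrow> D \<inter> U = {} \<longrightarrow> u \<in> U \<longrightarrow> u' \<in> U \<longrightarrow>
        (\<exists>d\<in>D. {u, d} \<in> edges G) \<longrightarrow> (\<exists>d\<in>D. {u', d} \<in> edges G) \<longrightarrow> u = u')"

text \<open>The counterpart of \<open>attached\<close> for gated sets, without the cutvertex
  condition; for blocks with at least two vertices both agree by
  \<open>block_hanging\<close>.\<close>

definition hanging :: "'a set \<Rightarrow> ('a \<times> 'a set) set" where
  "hanging U = {(v, C). v \<in> U \<and> C \<in> branches v \<and> C \<inter> U = {}}"

lemma gatedD:
  "gated U \<Longrightarrow> conn (edges G) D \<Longrightarrow> D \<subseteq> verts G \<Longrightarrow> D \<inter> U = {} \<Longrightarrow> u \<in> U \<Longrightarrow> d \<in> D \<Longrightarrow> {u, d} \<in> edges G \<Longrightarrow>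
    u' \<in> U \<Longrightarrow> d' \<in> D \<Longrightarrow> {u', d'} \<in> edges G \<Longrightarrow> u = u'"
  unfolding gated_def by blast

text \<open>Two hanging branches that meet form one connected set outside \<open>U\<close>, which by
  gatedness has only one root.\<close>

lemma hanging_disjoint:
  assumes "gated U" "(v, C) \<in> hanging U" "(v', C') \<in> hanging U" "C \<inter> C' \<noteq> {}"
  shows "v = v'" "C = C'"
proof -
  have C: "v \<in> U" "C \<in> branches v" "C \<inter> U = {}" "v' \<in> U" "C' \<in> branches v'" "C' \<inter> U = {}"
    using assms by (auto simp: hanging_def)
  have "conn (edges G) (C \<union> C')" using conn_Un branch_props(4) C assms(4) by blast
  moreover have "C \<union> C' \<subseteq> verts G" using branch_props(2) C by blast
  moreover have "(C \<union> C') \<inter> U = {}" using C by blast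
  moreover have "\<exists>d\<in>C \<union> C'. {v, d} \<in> edges G" "\<exists>d\<in>C \<union> C'. {v', d} \<in> edges G"
    using C(2,5) by (auto simp: branches_def)
  ultimately show "v = v'" using assms(1) C(1,4) unfolding gated_def by blast
  then show "C = C'" using branches_disjoint[of C v C'] C assms(4) by blast
qed

lemma gated_cover:
  assumes "gated U" "W \<in> comp_sets G" "U \<subseteq> W" "U \<noteq> {}"
  shows "W = U \<union> \<Union>(snd ` hanging U)"
proof
  have Wi: "W \<subseteq> verts G" "conn (edges G) W" "\<forall>a\<in>W. \<forall>b. {a, b} \<in> edges G \<longrightarrow> b \<in> W"
    using assms comp_sets_iff[OF wf] by auto
  show "U \<union> \<Union>(snd ` hanging U) \<subseteq> W"
  proof -
    have "C \<subseteq> W" if "(v, C) \<in> hanging U" for v C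
    proof -
      have "C \<in> branches v" "v \<in> W" using that assms(3) by (auto simp: hanging_def)
      then show ?thesis using conn_subset_comp[OF wf assms(2) branch_props(5)] by blast
    qed
    then show ?thesis using assms(3) by fastforce
  qed
  show "W \<subseteq> U \<union> \<Union>(snd ` hanging U)"
  proof
    fix x assume x: "x \<in> W"
    show "x \<in> U \<union> \<Union>(snd ` hanging U)"
    proof (cases "x \<in> U")
      case False
      \<comment> \<open>The union of this family is the component of \<open>x\<close> outside
        \<open>U\<close>. By gatedness it is attached to a single vertex \<open>b\<close> of
        \<open>U\<close>, which makes it a branch at \<open>b\<close>.\<close>
      define \<D> where "\<D> = {D. conn (edges G) D \<and> D \<subseteq> verts G - U \<and> x \<in> D}"
      let ?D = "\<Union>\<D>"
      have cD: "conn (edges G) ?D" by (rule conn_Union[of _ _ x]) (auto simp: \<D>_def)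
      have "{x} \<in> \<D>" using x False Wi by (auto simp: \<D>_def)
      then have xD: "x \<in> ?D" by blast
      have DV: "?D \<subseteq> verts G - U" by (auto simp: \<D>_def)
      have clD: "b \<in> ?D \<or> b \<in> U" if "a \<in> ?D" "{a, b} \<in> edges G" for a b
      proof -
        have "b \<in> ?D" if "b \<notin> U"
        proof -
          have "conn (edges G) (insert b ?D)" using conn_insert[OF cD \<open>a \<in> ?D\<close> \<open>{a, b} \<in> edges G\<close>] .
          moreover have "b \<in> verts G" using edge_sub[OF \<open>{a, b} \<in> edges G\<close>] by blast
          ultimately have "insert b ?D \<in> \<D>" using DV xD that unfolding \<D>_def by blast
          then show ?thesis by blast
        qed
        then show ?thesis by blast
      qed
      obtain y where y: "y \<in> U" using assms(4) by blast
      then have "y \<notin> ?D" using DV by blast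
      then obtain a b where ab: "a \<in> ?D" "b \<notin> ?D" "{a, b} \<in> edges G"
        using conn_cross[OF Wi(2) x xD, of y] y assms(3) by blast
      then have bU: "b \<in> U" using clD by blast
      have ba: "{b, a} \<in> edges G" using ab(3) by (simp add: insert_commute)
      have only: "u = b" if "u \<in> U" "d \<in> ?D" "{u, d} \<in> edges G" for u d
      proof (rule gatedD[OF assms(1) cD])
        show "?D \<subseteq> verts G" "?D \<inter> U = {}" using DV by blast+
      qed (use that bU ab(1) ba in blast)+
      have bD: "b \<notin> ?D" using bU DV by blast
      have "?D \<in> comp_sets (delete_vertex G b)"
        unfolding comp_sets_iff[OF wf_delete]
      proof (intro conjI ballI allI impI)
        show "?D \<noteq> {}" using xD by blast
        show s: "?D \<subseteq> verts (delete_vertex G b)" using DV bD by auto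
        show "conn (edges (delete_vertex G b)) ?D" using cD conn_cong[of ?D "verts G - {b}" "edges G"] s by simp
        fix p q assume p: "p \<in> ?D" "{p, q} \<in> edges (delete_vertex G b)"
        then have "{p, q} \<in> edges G" "q \<noteq> b" by auto
        then show "q \<in> ?D" using clD[OF p(1)] only[of q p] p(1) by (metis insert_commute)
      qed
      then have "?D \<in> branches b" using ab(1) ba by (auto simp: branches_def)
      then have "(b, ?D) \<in> hanging U" using bU DV by (auto simp: hanging_def)
      then show ?thesis using xD by force
    qed simp
  qed
qed

text \<open>Sorts the cover given by \<open>gated_cover\<close>: what hangs at \<open>v\<close> lies
  in other branches at \<open>v\<close>, and what hangs elsewhere is joined to the rest of
  \<open>U\<close> without passing through \<open>v\<close>.\<close>

lemma gated_branch:
  assumes U: "gated U" and v: "v \<in> U" and C: "C \<in> branches v" "U - {v} \<subseteq> C" "U - {v} \<noteq> {}"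
  shows "insert v C = U \<union> \<Union>{D. \<exists>u. (u, D) \<in> hanging U \<and> u \<noteq> v}"
proof
  obtain W where W: "W \<in> comp_sets G" "v \<in> W" using comp_exists[OF wf branch_props(6)[OF C(1)]] .
  have "U \<subseteq> W" using conn_subset_comp[OF wf W(1), of U] U v W(2) by (auto simp: gated_def)
  then have cov: "W = U \<union> \<Union>(snd ` hanging U)" using gated_cover[OF U W(1)] v by blast
  have CW: "C \<subseteq> W" using component_branches[OF W] C(1) by blast
  show "insert v C \<subseteq> U \<union> \<Union>{D. \<exists>u. (u, D) \<in> hanging U \<and> u \<noteq> v}"
  proof
    fix x assume x: "x \<in> insert v C"
    show "x \<in> U \<union> \<Union>{D. \<exists>u. (u, D) \<in> hanging U \<and> u \<noteq> v}"
    proof (cases "x \<in> U")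
      case False
      then have "x \<in> C" using x v by blast
      then obtain u D where D: "(u, D) \<in> hanging U" "x \<in> D" using cov CW False by auto
      have "u \<noteq> v"
      proof
        assume "u = v"
        then have "D \<in> branches v" "D \<inter> U = {}" using D by (auto simp: hanging_def)
        then have "D = C" using branches_disjoint[of D v C] C(1) D(2) \<open>x \<in> C\<close> by blast
        then show False using \<open>D \<inter> U = {}\<close> C(2,3) by blast
      qed
      then show ?thesis using D by blast
    qed simp
  qed
  have "D \<subseteq> C" if D: "(u, D) \<in> hanging U" "u \<noteq> v" for u D
  proof -
    have d: "u \<in> U" "D \<in> branches u" "D \<inter> U = {}" using D by (auto simp: hanging_def)
    have "insert u D \<subseteq> C"
      using branch_subset[OF C(1) branch_props(5)[OF d(2)]] branch_props(2,6)[OF d(2)] d v D(2) C(2) by blast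
    then show ?thesis by blast
  qed
  then show "U \<union> \<Union>{D. \<exists>u. (u, D) \<in> hanging U \<and> u \<noteq> v} \<subseteq> insert v C" using C(2) v by blast
qed

text \<open>A connected set outside the block with two attachment vertices would give a path that
  closes a cycle with a path in the block, so the block could be enlarged.\<close>

lemma block_gated:
  assumes B: "block G B"
  shows "gated (verts B)"
  unfolding gated_def
proof (intro conjI allI impI)
  show UV: "verts B \<subseteq> verts G" using block_bic[OF B] by blast
  show cU: "conn (edges G) (verts B)" using block_bic[OF B] by (simp add: bic_def)
  fix D u u' assume D: "conn (edges G) D" "D \<subseteq> verts G" "D \<inter> verts B = {}"
    and u: "u \<in> verts B" "u' \<in> verts B" "\<exists>d\<in>D. {u, d} \<in> edges G" "\<exists>d\<in>D. {u', d} \<in> edges G"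
  show "u = u'"
  proof (rule ccontr)
    assume ne: "u \<noteq> u'"
    obtain d d' where d: "d \<in> D" "{u, d} \<in> edges G" "d' \<in> D" "{u', d'} \<in> edges G" using u by blast
    obtain q where q: "distinct q" "q \<noteq> []" "hd q = d" "last q = d'" "set q \<subseteq> D" "pedges q \<subseteq> edges G"
      using conn_path[OF D(1) d(1,3)] .
    obtain r where r: "distinct r" "r \<noteq> []" "hd r = u" "last r = u'" "set r \<subseteq> verts B" "pedges r \<subseteq> edges G"
      using conn_path[OF cU u(1,2)] .
    have "length r \<ge> 2" using r ne by (cases r; cases "tl r") auto
    moreover have "length q \<ge> 1" using q(2) by (cases q) auto
    moreover have "cedges (r @ rev q) \<subseteq> edges G"
      unfolding cedges_def pedges_append_if pedges_rev using q r d by (auto simp: hd_rev last_rev insert_commute)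
    moreover have "distinct (r @ rev q)" using q r D(3) by auto
    ultimately have "cyc (edges G) (r @ rev q)" by (simp add: cyc_def)
    from bic_cycle[OF this] have "bic (edges G) (set r \<union> set q)" by simp
    moreover have "u \<in> set r" "u' \<in> set r" using r hd_in_set last_in_set by metis+
    ultimately have "set r \<union> set q \<subseteq> verts B"
      using block_maximal[OF B, of "set r \<union> set q" u u'] ne u q(5) r(5) D(2) UV by blast
    moreover have "d \<in> set q" using q hd_in_set by metis
    ultimately show False using d(1) D(3) by blast
  qed
qed

text \<open>The rest of the block lies in another branch at the root, so the root is automatically a
  cutvertex.\<close>

lemma block_hanging:
  assumes B: "block G B" "card (verts B) \<ge> 2"
  shows "hanging (verts B) = attached B"
proof -
  have "cutvertex G v" if h: "v \<in> verts B" "C \<in> branches v" "C \<inter> verts B = {}" for v C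
  proof -
    have "\<not> verts B \<subseteq> {v}" using B(2) card_mono[of "{v}" "verts B"] by auto
    then obtain x where x: "x \<in> verts B" "x \<noteq> v" by blast
    have "conn (edges G) (verts B)" "verts B \<subseteq> verts G" using block_bic[OF B(1)] by (auto simp: bic_def)
    then obtain C' where "C' \<in> branches v" "x \<in> C'" using branch_exists[of x v "verts B"] x h by blast
    then show ?thesis using two_branches_cutvertex[OF h(2)] h(3) x by blast
  qed
  then show ?thesis unfolding hanging_def attached_def by blast
qed

text \<open>A connected set that avoids both ends and is adjacent to both would lie in
  \<open>C\<close> and contain a second neighbour of \<open>v\<close>.\<close>

lemma bridge_gated:
  assumes C: "C \<in> branches v" and w: "w \<in> C" "{v, w} \<in> edges G" and only: "\<And>u. u \<in> C \<Longrightarrow> {v, u} \<in> edges G \<Longrightarrow> u = w"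
  shows "gated {v, w}"
  unfolding gated_def
proof (intro conjI allI impI)
  show "{v, w} \<subseteq> verts G" using edge_sub[OF w(2)] .
  show "conn (edges G) {v, w}" using conn_edge[OF w(2)] .
  fix D u u' assume D: "conn (edges G) D" "D \<subseteq> verts G" "D \<inter> {v, w} = {}"
    and u: "u \<in> {v, w}" "u' \<in> {v, w}" "\<exists>d\<in>D. {u, d} \<in> edges G" "\<exists>d\<in>D. {u', d} \<in> edges G"
  have "\<not> ((\<exists>d\<in>D. {v, d} \<in> edges G) \<and> (\<exists>d\<in>D. {w, d} \<in> edges G))"
  proof
    assume "(\<exists>d\<in>D. {v, d} \<in> edges G) \<and> (\<exists>d\<in>D. {w, d} \<in> edges G)"
    then obtain d d' where d: "d \<in> D" "{v, d} \<in> edges G" "d' \<in> D" "{w, d'} \<in> edges G" by blast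
    have "d' \<in> C" using branch_props(7)[OF C w(1) d(4)] d(3) D(3) by blast
    then have "D \<subseteq> C" using branch_subset[OF C D(1,2)] D(3) d(3) by blast
    then have "d = w" using only d by blast
    then show False using d D(3) by blast
  qed
  then show "u = u'" using u by blast
qed

text \<open>The bridge becomes the first rung, with \<open>v\<close> first in the row opposite
  \<open>w\<close>, and the fan of the remaining branches at \<open>w\<close> is glued on at
  \<open>w\<close>.\<close>

lemma bridge_rooted:
  assumes C: "C \<in> branches v" and w: "w \<in> C" "{v, w} \<in> edges G" and only: "\<And>u. u \<in> C \<Longrightarrow> {v, u} \<in> edges G \<Longrightarrow> u = w"
    and h: "\<And>C'. C' \<in> branches w \<Longrightarrow> v \<notin> C' \<Longrightarrow> C' \<subset> C \<Longrightarrow> path_branch C' \<or> rooted w C'"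
    and one: "\<And>C' C''. C' \<in> branches w \<Longrightarrow> v \<notin> C' \<Longrightarrow> \<not> path_branch C' \<Longrightarrow> C'' \<in> branches w \<Longrightarrow> v \<notin> C'' \<Longrightarrow>
      \<not> path_branch C'' \<Longrightarrow> C' = C''"
  shows "rooted v C"
proof -
  have g: "gated {v, w}" using bridge_gated[OF C w only] by blast
  have vw: "v \<noteq> w" using edge_neq[OF w(2)] .
  let ?\<C> = "{C' \<in> branches w. v \<notin> C'}"
  have hang: "{D. \<exists>u. (u, D) \<in> hanging {v, w} \<and> u \<noteq> v} = ?\<C>"
    using branch_props(3) vw unfolding hanging_def by blast
  have dec: "insert v C = {v, w} \<union> \<Union>?\<C>"
    using gated_branch[OF g _ C] hang w vw by auto
  have small: "C' \<subset> C" if "C' \<in> ?\<C>" for C'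
  proof -
    have "C' \<subseteq> \<Union>?\<C>" using that by (rule Union_upper)
    then have "C' \<subseteq> insert v C" unfolding dec by (rule le_supI2)
    then have "C' \<subseteq> C" using that by blast
    moreover have "w \<notin> C'" using branch_props(3) that by blast
    ultimately show ?thesis using w by blast
  qed
  have "\<exists>xs ys. ladset (insert w (\<Union>?\<C>)) (w # xs) ys"
  proof (rule fan)
    show "\<forall>C\<in>?\<C>. path_branch C \<or> rooted w C" using h small by blast
    show "\<forall>C\<in>?\<C>. \<forall>C'\<in>?\<C>. \<not> path_branch C \<longrightarrow> \<not> path_branch C' \<longrightarrow> C = C'" using one by blast
  qed blast
  then obtain xs ys where xy: "ladset (insert w (\<Union>?\<C>)) (w # xs) ys" by blast
  have "ladset {v, w} ([] @ [w]) [v]"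
  proof -
    have "e = {v, w}" if "e \<in> edges G" "e \<subseteq> {v, w}" for e
      using card_edge[OF that(1)] that(2) card_seteq[of "{v, w}" e] vw by auto
    then show ?thesis using vw by (auto simp: ladset_def lad_def)
  qed
  moreover have "{v, w} \<inter> \<Union>?\<C> = {}" using branch_props(3) by blast
  ultimately have "ladset ({v, w} \<union> \<Union>?\<C>) ([] @ w # xs) ([v] @ ys)"
    using glue_branches[OF _ xy] by blast
  then have "ladset (insert v C) (v # ys) (w # xs)" using dec ladset_swap by simp
  then show ?thesis by (auto simp: rooted_def)
qed

text \<open>A path in \<open>C\<close> between two neighbours of \<open>v\<close> closes a cycle
  through \<open>v\<close>, and the block of that cycle does not extend beyond \<open>C\<close> and
  \<open>v\<close>.\<close>

lemma nontrivial_block_at: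
  assumes C: "C \<in> branches v" and w: "w \<in> C" "{v, w} \<in> edges G" "w' \<in> C" "{v, w'} \<in> edges G" "w \<noteq> w'"
  obtains B where "nontrivial_block G B" "v \<in> verts B" "verts B - {v} \<subseteq> C" "verts B - {v} \<noteq> {}"
proof -
  note p = branch_props[OF C]
  obtain q where q: "distinct q" "q \<noteq> []" "hd q = w" "last q = w'" "set q \<subseteq> C" "pedges q \<subseteq> edges G"
    using conn_path[OF p(4) w(1,3)] .
  have "length q \<ge> 2" using q w(5) by (cases q; cases "tl q") auto
  then have cyc: "cyc (edges G) (v # q)"
    unfolding cyc_def cedges_def using q w p(3) by (auto simp: pedges_Cons insert_commute)
  have "set (v # q) \<subseteq> verts G" using q p by auto
  then obtain B where B: "block G B" "set (v # q) \<subseteq> verts B" using block_exists[OF bic_cycle[OF cyc]] by blast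
  have bV: "bic (edges G) (verts B)" "verts B \<subseteq> verts G" using block_bic[OF B(1)] by auto
  have "card (set (v # q)) \<ge> 3" using cyc distinct_card[of "v # q"] by (simp add: cyc_def)
  moreover have "finite (verts B)" using bV fin_verts finite_subset by blast
  ultimately have "card (verts B) \<ge> 3" using B(2) card_mono order_trans by metis
  then have nB: "nontrivial_block G B" using B by (simp add: nontrivial_block_def)
  have wq: "w \<in> set q" using q hd_in_set by metis
  have "conn (edges G) (verts B - {v})" using bV(1) B(2) by (auto simp: bic_def)
  then have "verts B - {v} \<subseteq> C"
    using branch_subset[OF C, of "verts B - {v}"] bV(2) wq B(2) w(1) p(3) by auto
  moreover have "verts B - {v} \<noteq> {}" using wq B(2) q(5) p(3) by auto
  ultimately show thesis using that nB B(2) by auto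
qed

end

section \<open>Safe graphs are ladders\<close>

context fin_graph begin

text \<open>\<open>safe_side\<close> for pairs of root and branch; \<open>a\<close> is the end that
  admits at most one branch, a tail.\<close>

definition side :: "('a \<times> 'a set) set \<Rightarrow> 'a \<Rightarrow> 'a \<Rightarrow> bool" where
  "side \<A> a b \<longleftrightarrow> (\<forall>v C. (v, C) \<in> \<A> \<longrightarrow> v = a \<or> v = b) \<and>
     (\<forall>C. (a, C) \<in> \<A> \<longrightarrow> tail (induce G (insert a C)) a) \<and>
     (\<forall>C C'. (a, C) \<in> \<A> \<longrightarrow> (a, C') \<in> \<A> \<longrightarrow> C = C')"

lemma side_mono: "side \<A> a b \<Longrightarrow> \<A>' \<subseteq> \<A> \<Longrightarrow> side \<A>' a b"
  unfolding side_def by (meson subsetD)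

lemma side_root: "side \<A> a b \<Longrightarrow> (v, C) \<in> \<A> \<Longrightarrow> v = a \<or> v = b"
  unfolding side_def by metis

lemma side_of_safe_side:
  assumes B: "block G B" and ab: "a \<in> verts B" "b \<in> verts B"
    and s: "safe_side G \<C> a b" "\<C> \<subseteq> block_components G B"
  shows "side {(v, C). (v, C) \<in> attached B \<and> induce G (insert v C) \<in> \<C>} a b"
proof -
  have root: "v = x" if h: "(v, C) \<in> attached B" "induce G (insert v C) \<in> incident_at G \<C> x" "x \<in> verts B" for v C x
  proof -
    have "induce G (insert v C) \<in> incident_components G x" using h(2) by (simp add: incident_at_def)
    then obtain C' where "C' \<in> branches x" "induce G (insert v C) = induce G (insert x C')"
      by (auto simp: incident_components_eq)
    then show ?thesis using attached_inj(1)[OF h(1,3)] by blast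
  qed
  have inc: "induce G (insert v C) \<in> incident_at G \<C> v"
    if "(v, C) \<in> attached B" "induce G (insert v C) \<in> \<C>" for v C
    using that by (auto simp: incident_at_def attached_def incident_components_eq)
  have fin: "finite (incident_at G \<C> a)"
    by (rule finite_subset[of _ "incident_components G a"])
      (auto simp: incident_at_def incident_components_eq finite_branches)
  show ?thesis
    unfolding side_def
  proof (intro conjI allI impI)
    fix v C assume "(v, C) \<in> {(v, C). (v, C) \<in> attached B \<and> induce G (insert v C) \<in> \<C>}"
    then have h: "(v, C) \<in> attached B" "induce G (insert v C) \<in> \<C>" by auto
    then have "induce G (insert v C) \<in> incident_at G \<C> a \<union> incident_at G \<C> b"
      using s(1) unfolding safe_side_def by blast
    then show "v = a \<or> v = b" using root[OF h(1)] ab by blast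
  next
    fix C assume "(a, C) \<in> {(v, C). (v, C) \<in> attached B \<and> induce G (insert v C) \<in> \<C>}"
    then have "induce G (insert a C) \<in> incident_at G \<C> a" using inc by auto
    then show "tail (induce G (insert a C)) a" using s(1) unfolding safe_side_def by blast
  next
    fix C C' assume "(a, C) \<in> {(v, C). (v, C) \<in> attached B \<and> induce G (insert v C) \<in> \<C>}"
      "(a, C') \<in> {(v, C). (v, C) \<in> attached B \<and> induce G (insert v C) \<in> \<C>}"
    then have h: "(a, C) \<in> attached B" "(a, C') \<in> attached B" "induce G (insert a C) \<in> incident_at G \<C> a"
      "induce G (insert a C') \<in> incident_at G \<C> a" using inc by auto
    then have "induce G (insert a C) = induce G (insert a C')"
      using s(1) card_le_Suc0_iff_eq[OF fin] unfolding safe_side_def by simp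
    moreover have "C' \<in> branches a" using h(2) by (simp add: attached_def)
    ultimately show "C = C'" using attached_inj(2)[OF h(1) ab(1)] by blast
  qed
qed

text \<open>An instance of \<open>glue_side\<close> in which the branches at \<open>b\<close> are
  first gathered into a fan; gatedness keeps the branches at \<open>a\<close> and at
  \<open>b\<close> disjoint.\<close>

lemma glue_block_side:
  assumes U: "gated U" and A: "\<A> \<subseteq> hanging U" "side \<A> a b" "a \<noteq> b"
    and W: "ladset W xs ys" "xs \<noteq> []" "ys \<noteq> []" "{last xs, last ys} = {a, b}" "W \<inter> \<Union>(snd ` \<A>) = {}"
    and f: "\<And>C. (b, C) \<in> \<A> \<Longrightarrow> path_branch C \<or> rooted b C"
      "\<And>C C'. (b, C) \<in> \<A> \<Longrightarrow> (b, C') \<in> \<A> \<Longrightarrow> \<not> path_branch C \<Longrightarrow> \<not> path_branch C' \<Longrightarrow> C = C'"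
  shows "\<exists>xs' ys'. ladset (W \<union> \<Union>(snd ` \<A>)) (xs @ xs') (ys @ ys')"
proof -
  let ?A = "{C. (a, C) \<in> \<A>}" and ?B = "{C. (b, C) \<in> \<A>}"
  have U': "\<Union>(snd ` \<A>) = \<Union>?A \<union> \<Union>?B"
  proof -
    have "v = a \<or> v = b" if "(v, C) \<in> \<A>" for v C using A(2) that unfolding side_def by metis
    then have "snd ` \<A> = ?A \<union> ?B" by (force simp: image_iff)
    then show ?thesis by simp
  qed
  have br: "?A \<subseteq> branches a" "?B \<subseteq> branches b" using A(1) by (auto simp: hanging_def)
  have "\<exists>us vs. ladset (insert b (\<Union>?B)) (b # us) vs"
    using br(2) f by (intro fan) blast+
  moreover have "\<Union>?A \<inter> \<Union>?B = {}"
  proof (rule ccontr)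
    assume "\<Union>?A \<inter> \<Union>?B \<noteq> {}"
    then obtain C C' where "(a, C) \<in> \<A>" "(b, C') \<in> \<A>" "C \<inter> C' \<noteq> {}" by blast
    then show False using hanging_disjoint(1)[OF U] A by blast
  qed
  moreover have "\<forall>C\<in>?A. tail (induce G (insert a C)) a" "\<forall>C\<in>?A. \<forall>C'\<in>?A. C = C'"
    using A(2) unfolding side_def by blast+
  moreover have "W \<inter> \<Union>?A = {}" "W \<inter> \<Union>?B = {}" using W(5) U' by blast+
  ultimately show ?thesis unfolding U' Un_assoc[symmetric]
    using glue_side[OF W(1-4) br(1) _ _ _ br(2)] by blast
qed

lemma big_branches_finite: "finite {C \<in> branches v. \<not> path_branch C}"
  using finite_branches by auto

text \<open>Ladders of different components are placed one behind the other, as no edge joins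
  them.\<close>

lemma ladset_comps:
  assumes "\<And>W. W \<in> comp_sets G \<Longrightarrow> \<exists>xs ys. ladset W xs ys"
  shows "\<exists>xs ys. lad (edges G) xs ys \<and> set xs \<union> set ys = verts G"
proof -
  have fin: "finite (comp_sets G)"
    using comp_sets_subset[OF wf] fin_verts by (meson finite_Pow_iff finite_subset)
  have *: "\<exists>xs ys. ladset (\<Union>\<S>) xs ys" if "\<S> \<subseteq> comp_sets G" for \<S>
    using finite_subset[OF that fin] that
  proof (induction \<S>)
    case empty
    have "ladset {} [] []" using card_edge by (fastforce simp: ladset_def lad_def)
    then show ?case by auto
  next
    case (insert W \<S>)
    obtain xs ys where 1: "ladset W xs ys" using assms insert.prems by blast
    obtain xs' ys' where 2: "ladset (\<Union>\<S>) xs' ys'" using insert by blast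
    have dj: "W \<inter> \<Union>\<S> = {}" using comp_sets_disjoint[OF wf] insert by blast
    have "{e \<in> edges G. e \<subseteq> W \<union> \<Union>\<S>} \<subseteq> {e \<in> edges G. e \<subseteq> W} \<union> {e \<in> edges G. e \<subseteq> \<Union>\<S>}"
    proof
      fix e assume e: "e \<in> {e \<in> edges G. e \<subseteq> W \<union> \<Union>\<S>}"
      obtain a b where ab: "e = {a, b}" using e edge_two by blast
      then have "{a, b} \<in> edges G" "{b, a} \<in> edges G" using e by (auto simp: insert_commute)
      moreover have "\<forall>a\<in>W. \<forall>b. {a, b} \<in> edges G \<longrightarrow> b \<in> W"
        using comp_sets_iff[OF wf] insert.prems by blast
      ultimately have "a \<in> W \<longleftrightarrow> b \<in> W" by blast
      then show "e \<in> {e \<in> edges G. e \<subseteq> W} \<union> {e \<in> edges G. e \<subseteq> \<Union>\<S>}" using e ab by auto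
    qed
    moreover have "lad ({e \<in> edges G. e \<subseteq> W} \<union> {e \<in> edges G. e \<subseteq> \<Union>\<S>}) (xs @ xs') (ys @ ys')"
      using 1 2 dj unfolding ladset_def by (intro lad_append) auto
    ultimately have "lad {e \<in> edges G. e \<subseteq> W \<union> \<Union>\<S>} (xs @ xs') (ys @ ys')" using lad_mono by blast
    then have "ladset (\<Union>(insert W \<S>)) (xs @ xs') (ys @ ys')" using 1 2 unfolding ladset_def by auto
    then show ?case by blast
  qed
  have "verts G = \<Union>(comp_sets G)"
    using comp_sets_subset[OF wf] comp_exists[OF wf] by blast
  moreover have "{e \<in> edges G. e \<subseteq> verts G} = edges G" using edge_sub by blast
  ultimately show ?thesis using *[OF order_refl] unfolding ladset_def by metis
qed

end

locale safe_graph = outerplane_graph +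
  assumes cut_safe: "cut_safe G" and block_safe: "block_safe G D"
    and forest: "linear_forest (weak_dual G D)"
begin

text \<open>Three different branches make \<open>v\<close> a cutvertex, so cut-safety applies to
  it.\<close>

lemma two_big:
  assumes "C1 \<in> branches v" "C2 \<in> branches v" "C3 \<in> branches v"
    "\<not> path_branch C1" "\<not> path_branch C2" "\<not> path_branch C3"
  shows "C1 = C2 \<or> C1 = C3 \<or> C2 = C3"
proof (rule ccontr)
  assume n: "\<not> ?thesis"
  then have "cutvertex G v" using two_branches_cutvertex assms by blast
  then have "card {C \<in> branches v. \<not> path_branch C} \<le> 2"
    using cut_safe safe_cutvertex_iff unfolding cut_safe_def by blast
  moreover have "{C1, C2, C3} \<subseteq> {C \<in> branches v. \<not> path_branch C}" using assms by blast
  moreover have "card {C1, C2, C3} = 3" using n by simp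
  ultimately show False using card_mono[OF big_branches_finite, of "{C1, C2, C3}" v] by linarith
qed

text \<open>Block-safety and the ladder of the block are matched: the antipodal edges of the safe
  partition are the first and the last rung.\<close>

lemma block_data:
  assumes "nontrivial_block G B"
  shows "\<exists>xs ys a0 b0 a1 b1 \<A>0 \<A>1. ladset (verts B) xs ys \<and> xs \<noteq> [] \<and> ys \<noteq> [] \<and>
    {hd xs, hd ys} = {a0, b0} \<and> {last xs, last ys} = {a1, b1} \<and> \<A>0 \<union> \<A>1 = hanging (verts B) \<and> \<A>0 \<inter> \<A>1 = {} \<and>
    side \<A>0 a0 b0 \<and> side \<A>1 a1 b1"
proof -
  have bl: "block G B" "card (verts B) \<ge> 2" using assms by (auto simp: nontrivial_block_def)
  have dual: "path_graph (weak_dual B D)" using forest linear_forest_weak_dual assms by blast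
  have "safe_block G D B" using block_safe assms unfolding block_safe_def by blast
  then obtain a0 b0 a1 b1 \<C>0 \<C>1 where S: "{a0, b0} \<noteq> {a1, b1}" "antipodal B D {{a0, b0}, {a1, b1}}"
    "\<C>0 \<union> \<C>1 = block_components G B" "\<C>0 \<inter> \<C>1 = {}" "safe_side G \<C>0 a0 b0" "safe_side G \<C>1 a1 b1"
    unfolding safe_block_def by (elim exE conjE) (rule that)
  obtain xs ys where L: "lad (edges B) xs ys" "set xs \<union> set ys = verts B" "xs \<noteq> []" "ys \<noteq> []"
    "{hd xs, hd ys} = {a0, b0}" "{last xs, last ys} = {a1, b1}"
    using lad_of_antipodal[OF assms dual S(1,2)] by metis
  have ls: "ladset (verts B) xs ys" using L(1,2) block_edges[OF bl(1)] by (simp add: ladset_def)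
  have "{hd xs, hd ys} \<subseteq> verts B" "{last xs, last ys} \<subseteq> verts B"
    using L(2) hd_in_set[OF L(3)] hd_in_set[OF L(4)] last_in_set[OF L(3)] last_in_set[OF L(4)] by blast+
  then have ab: "a0 \<in> verts B" "b0 \<in> verts B" "a1 \<in> verts B" "b1 \<in> verts B" unfolding L(5,6) by auto
  let ?A = "\<lambda>\<C>. {(v, C). (v, C) \<in> attached B \<and> induce G (insert v C) \<in> \<C>}"
  have "side (?A \<C>0) a0 b0" "side (?A \<C>1) a1 b1"
    using side_of_safe_side[OF bl(1) ab(1,2) S(5)] side_of_safe_side[OF bl(1) ab(3,4) S(6)] S(3) by blast+
  moreover have "?A \<C>0 \<union> ?A \<C>1 = hanging (verts B)"
  proof -
    have "induce G (insert v C) \<in> \<C>0 \<union> \<C>1" if "(v, C) \<in> attached B" for v C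
      unfolding S(3) block_components_eq[OF bl(1)] using that by force
    then show ?thesis unfolding block_hanging[OF bl] by auto
  qed
  moreover have "?A \<C>0 \<inter> ?A \<C>1 = {}" using S(4) by auto
  ultimately show ?thesis using ls L(3-6)
    by (intro exI[of _ xs] exI[of _ ys] exI[of _ a0] exI[of _ b0] exI[of _ a1] exI[of _ b1] exI[of _ "?A \<C>0"]
      exI[of _ "?A \<C>1"] conjI)
qed

text \<open>At every further vertex the branch that leads back is big, so at most one other branch is.\<close>
lemma rooted_if_other_big:
  assumes "C \<in> branches v" "C2 \<in> branches v" "C2 \<noteq> C" "\<not> path_branch C2"
  shows "rooted v C"
  using assms
proof (induction "card C" arbitrary: C v C2 rule: less_induct)
  case less
  note C = less.prems(1) and C2 = less.prems(2-4)
  note p = branch_props[OF C] and p2 = branch_props[OF C2(1)]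
  have dj: "C \<inter> C2 = {}" using branches_disjoint[OF C C2(1)] C2(2) by blast
  have finC: "finite C" using p(2) fin_verts finite_subset by blast
  \<comment> \<open>The branch at \<open>u\<close> through \<open>v\<close> contains all of
    \<open>C2\<close> and is therefore not a path.\<close>
  have returning: "\<exists>X. X \<in> branches u \<and> v \<in> X \<and> \<not> path_branch X" if u: "u \<in> C" for u
  proof -
    have uv: "u \<noteq> v" "u \<notin> C2" using u p(3) dj by blast+
    obtain X where X: "X \<in> branches u" "v \<in> X"
      using branch_exists[of v u "insert v C"] p u uv by blast
    have "insert v C2 \<subseteq> X" using branch_subset[OF X(1) p2(5)] p2(2,6) uv X(2) by blast
    then have "\<not> path_branch X" using path_branch_subset[OF _ p2(4)] C2(3) by blast
    then show ?thesis using X by blast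
  qed
  have key1: "rooted u C'" if h: "u \<in> C" "C' \<in> branches u" "v \<notin> C'" "C' \<subset> C" for u C'
  proof -
    obtain X where X: "X \<in> branches u" "v \<in> X" "\<not> path_branch X" using returning[OF h(1)] by blast
    have "card C' < card C" using psubset_card_mono[OF finC h(4)] .
    then show ?thesis using less.hyps[OF _ h(2) X(1) _ X(3)] X(2) h(3) by blast
  qed
  have key2: "C' = C''" if h: "u \<in> C" "C' \<in> branches u" "v \<notin> C'" "\<not> path_branch C'"
      "C'' \<in> branches u" "v \<notin> C''" "\<not> path_branch C''" for u C' C''
  proof -
    obtain X where X: "X \<in> branches u" "v \<in> X" "\<not> path_branch X" using returning[OF h(1)] by blast
    then show ?thesis using two_big[OF X(1) h(2,5) X(3) h(4,7)] h(3,6) by blast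
  qed
  obtain w where w: "w \<in> C" "{v, w} \<in> E" using C by (auto simp: branches_def)
  show ?case
  proof (cases "\<forall>u\<in>C. {v, u} \<in> E \<longrightarrow> u = w")
    case True
    show ?thesis
    proof (rule bridge_rooted[OF C w])
      show "\<And>u. u \<in> C \<Longrightarrow> {v, u} \<in> E \<Longrightarrow> u = w" using True by blast
    qed (use key1[OF w(1)] key2[OF w(1)] in blast)+
  next
    case False
    then obtain w' where w': "w' \<in> C" "{v, w'} \<in> E" "w \<noteq> w'" by blast
    obtain B where B: "nontrivial_block G B" "v \<in> verts B" "verts B - {v} \<subseteq> C" "verts B - {v} \<noteq> {}"
      using nontrivial_block_at[OF C w w'] .
    let ?U = "verts B"
    have g: "gated ?U" using B(1) block_gated by (simp add: nontrivial_block_def)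
    note dec = gated_branch[OF g B(2) C B(3,4)]
    have vC2: "(v, C2) \<in> hanging ?U" using B(2,3) C2(1) p2(3) dj by (auto simp: hanging_def)
    have smaller: "C' \<subset> C \<and> u \<in> C \<and> v \<notin> C' \<and> C' \<in> branches u" if "(u, C') \<in> hanging ?U" "u \<noteq> v" for u C'
    proof -
      have h: "u \<in> ?U" "C' \<in> branches u" "C' \<inter> ?U = {}" using that(1) by (auto simp: hanging_def)
      have "C' \<subseteq> insert v C" unfolding dec using that by blast
      then show ?thesis using h B(2,3) that(2) by blast
    qed
    \<comment> \<open>The normalised case: \<open>v\<close> is the first vertex of the upper row and
      plays the part of \<open>b0\<close>, while \<open>a0\<close> is the other end of the first
      rung.\<close>
    have main: "rooted v C"
      if d: "ladset ?U xs ys" "xs \<noteq> []" "ys \<noteq> []" "hd xs = v" "hd ys = a0" "{last xs, last ys} = {a1, b1}"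
        "\<A>0 \<union> \<A>1 = hanging ?U" "\<A>0 \<inter> \<A>1 = {}" "side \<A>0 a0 v" "side \<A>1 a1 b1"
      for xs ys a0 a1 b1 \<A>0 \<A>1
    proof -
      have disj: "set xs \<inter> set ys = {}" using d(1) lad_distinct unfolding ladset_def by blast
      have a0v: "a0 \<noteq> v" using disj d(2-5) hd_in_set by (metis disjoint_iff)
      have ab1: "a1 \<noteq> b1"
      proof
        assume "a1 = b1"
        then have "last xs = last ys" using d(6) by auto
        then show False using disj d(2,3) last_in_set by (metis disjoint_iff)
      qed
      \<comment> \<open>On the first side, branches hang only at \<open>a0\<close> and at
        \<open>v\<close>. Those at \<open>v\<close> do not belong to \<open>C\<close>, so at most a
        tail at \<open>a0\<close> has to be added.\<close>
      let ?T = "{C'. (a0, C') \<in> \<A>0}"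
      have hT: "(a0, C') \<in> hanging ?U" if "C' \<in> ?T" for C' using that d(7) by blast
      have "ladset ?U (rev xs) (rev ys)" "rev ys \<noteq> []" "last (rev ys) = a0"
        using ladset_rev[OF d(1)] d(3,5) by (auto simp: last_rev)
      moreover have "?T \<subseteq> branches a0" using hT by (auto simp: hanging_def)
      moreover have "\<forall>C\<in>?T. tail (induce G (insert a0 C)) a0" "\<forall>C\<in>?T. \<forall>C'\<in>?T. C = C'"
        using d(9) unfolding side_def by blast+
      moreover have "?U \<inter> \<Union>?T = {}" using hT by (auto simp: hanging_def)
      ultimately have "\<exists>ts. ladset (?U \<union> \<Union>?T) (rev xs) (rev ys @ ts)"
        by (rule glue_tails)
      then obtain ts where "ladset (?U \<union> \<Union>?T) (rev xs) (rev ys @ ts)" ..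
      then have l0: "ladset (?U \<union> \<Union>?T) xs (rev ts @ ys)" using ladset_rev by fastforce
      \<comment> \<open>\<open>v\<close> may also be an end of the last rung; branches that hang
        there do not belong to \<open>C\<close> and are left out.\<close>
      let ?A = "{(u, C'). (u, C') \<in> \<A>1 \<and> u \<noteq> v}"
      have hA: "(u, C') \<in> hanging ?U" "u \<noteq> v" if "(u, C') \<in> ?A" for u C' using that d(7) by auto
      have "\<exists>xs' ys'. ladset (?U \<union> \<Union>?T \<union> \<Union>(snd ` ?A)) (xs @ xs') ((rev ts @ ys) @ ys')"
      proof (rule glue_block_side[OF g _ _ ab1 l0])
        show "?A \<subseteq> hanging ?U" using hA by blast
        show "side ?A a1 b1" by (rule side_mono[OF d(10)]) auto
        show "xs \<noteq> []" "rev ts @ ys \<noteq> []" "{last xs, last (rev ts @ ys)} = {a1, b1}" using d(2,3,6) by auto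
        show "(?U \<union> \<Union>?T) \<inter> \<Union>(snd ` ?A) = {}"
        proof (rule ccontr)
          assume "(?U \<union> \<Union>?T) \<inter> \<Union>(snd ` ?A) \<noteq> {}"
          then obtain uC x where "uC \<in> ?A" "x \<in> snd uC" "x \<in> ?U \<union> \<Union>?T" by blast
          then obtain u C' where x: "(u, C') \<in> ?A" "x \<in> C'" "x \<in> ?U \<union> \<Union>?T" by (cases uC) auto
          have h: "(u, C') \<in> hanging ?U" using hA x(1) by blast
          then have "x \<notin> ?U" using x(2) by (auto simp: hanging_def)
          then obtain C'' where "(a0, C'') \<in> \<A>0" "x \<in> C''" using x(3) by blast
          moreover have "(a0, C'') \<in> hanging ?U" using calculation d(7) by blast
          ultimately have "(a0, C'') = (u, C')" using hanging_disjoint[OF g _ h] x(2) by blast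
          then show False using \<open>(a0, C'') \<in> \<A>0\<close> x(1) d(8) by blast
        qed
        fix C' assume C': "(b1, C') \<in> ?A"
        then show "path_branch C' \<or> rooted b1 C'" using smaller[OF hA[OF C']] key1 by blast
        fix C'' assume C'': "(b1, C'') \<in> ?A" "\<not> path_branch C'" "\<not> path_branch C''"
        then show "C' = C''" using smaller[OF hA[OF C']] smaller[OF hA[OF C''(1)]] key2 by blast
      qed
      moreover have "?U \<union> \<Union>?T \<union> \<Union>(snd ` ?A) = insert v C"
      proof -
        have "{X. \<exists>u. (u, X) \<in> hanging ?U \<and> u \<noteq> v} = ?T \<union> snd ` ?A"
        proof (intro equalityI subsetI)
          fix X assume "X \<in> {X. \<exists>u. (u, X) \<in> hanging ?U \<and> u \<noteq> v}"
          then obtain u where u: "(u, X) \<in> \<A>0 \<union> \<A>1" "u \<noteq> v" using d(7) by blast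
          show "X \<in> ?T \<union> snd ` ?A"
          proof (cases "(u, X) \<in> \<A>0")
            case True
            then have "u = a0" using side_root[OF d(9)] u(2) by metis
            then show ?thesis using True by blast
          next
            case False
            then have "(u, X) \<in> ?A" using u by blast
            then show ?thesis by force
          qed
        next
          fix X assume "X \<in> ?T \<union> snd ` ?A"
          then consider "(a0, X) \<in> \<A>0" | u where "(u, X) \<in> \<A>1" "u \<noteq> v" by auto
          then show "X \<in> {X. \<exists>u. (u, X) \<in> hanging ?U \<and> u \<noteq> v}"
          proof cases
            case 1
            then show ?thesis using d(7) a0v by blast
          next
            case 2
            then show ?thesis using d(7) by blast
          qed
        qed
        then show ?thesis unfolding dec by blast
      qed
      moreover have "xs = v # tl xs" using d(2,4) by (cases xs) auto
      ultimately show "rooted v C" unfolding rooted_def by (metis append_Cons)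
    qed
    have main': "rooted v C"
      if d: "ladset ?U xs ys" "xs \<noteq> []" "ys \<noteq> []" "{hd xs, hd ys} = {a0, b0}" "{last xs, last ys} = {a1, b1}"
        "\<A>0 \<union> \<A>1 = hanging ?U" "\<A>0 \<inter> \<A>1 = {}" "side \<A>0 a0 b0" "side \<A>1 a1 b1" "(v, C2) \<in> \<A>0"
      for xs ys a0 b0 a1 b1 \<A>0 \<A>1
    proof -
      \<comment> \<open>A branch at \<open>a0\<close> on this side is a tail, and the big branch
        \<open>C2\<close> is none, so \<open>v\<close> must be the other end
        \<open>b0\<close>.\<close>
      have "v \<noteq> a0"
      proof
        assume "v = a0"
        then have "tail (induce G (insert v C2)) v" using d(8,10) unfolding side_def by blast
        then show False using tail_path_branch(1)[OF C2(1)] C2(3) by blast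
      qed
      then have b0: "b0 = v" using side_root[OF d(8,10)] by simp
      consider "hd xs = v" "hd ys = a0" | "hd ys = v" "hd xs = a0"
        using d(4) b0 by (auto simp: doubleton_eq_iff)
      then show ?thesis
      proof cases
        case 1
        then show ?thesis using main[OF d(1-3) 1 d(5-7) _ d(9)] d(8) b0 by blast
      next
        case 2
        have "{last ys, last xs} = {a1, b1}" using d(5) by (simp add: insert_commute)
        then show ?thesis using main[OF ladset_swap[OF d(1)] d(3,2) 2 _ d(6,7) _ d(9)] d(8) b0 by blast
      qed
    qed
    obtain xs ys a0 b0 a1 b1 \<A>0 \<A>1 where d: "ladset ?U xs ys" "xs \<noteq> []" "ys \<noteq> []" "{hd xs, hd ys} = {a0, b0}"
      "{last xs, last ys} = {a1, b1}" "\<A>0 \<union> \<A>1 = hanging ?U" "\<A>0 \<inter> \<A>1 = {}" "side \<A>0 a0 b0" "side \<A>1 a1 b1"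
      using block_data[OF B(1)] by (elim exE conjE) (rule that)
    show ?thesis
    proof (cases "(v, C2) \<in> \<A>0")
      case True
      then show ?thesis using main'[OF d] by blast
    next
      case False
      then have "(v, C2) \<in> \<A>1" using vC2 d(6) by blast
      moreover have "\<A>1 \<union> \<A>0 = hanging ?U" "\<A>1 \<inter> \<A>0 = {}" using d(6,7) by auto
      moreover have "{hd (rev xs), hd (rev ys)} = {a1, b1}" "{last (rev xs), last (rev ys)} = {a0, b0}"
        "rev xs \<noteq> []" "rev ys \<noteq> []"
        using d(2-5) by (auto simp: hd_rev last_rev)
      ultimately show ?thesis using main'[OF ladset_rev[OF d(1)], of a1 b1 a0 b0 \<A>1 \<A>0] d(8,9) by blast
    qed
  qed
qed

text \<open>Three cases by the number of big branches: a vertex with none is the centre of a fan, a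
  vertex with two is where two rooted ladders meet, and otherwise every vertex has exactly
  one.\<close>

lemma component_ladset:
  assumes W: "W \<in> comp_sets G"
  shows "\<exists>xs ys. ladset W xs ys"
proof -
  have Wi: "W \<noteq> {}" "W \<subseteq> V" "conn E W" using W comp_sets_iff[OF wf] by auto
  have all: "W = insert v (\<Union>(branches v))" if "v \<in> W" for v using component_branches[OF W that] .
  consider v where "v \<in> W" "\<forall>C\<in>branches v. path_branch C"
    | v C1 C2 where "v \<in> W" "C1 \<in> branches v" "C2 \<in> branches v" "\<not> path_branch C1" "\<not> path_branch C2" "C1 \<noteq> C2"
    | "\<forall>v\<in>W. \<exists>C\<in>branches v. \<not> path_branch C \<and> (\<forall>C'\<in>branches v. \<not> path_branch C' \<longrightarrow> C' = C)"
    by metis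
  then show ?thesis
  proof cases
    case (1 v)
    then show ?thesis using small_fan[OF order_refl 1(2)] all[OF 1(1)] by metis
  next
    case (2 v C1 C2)
    have r: "rooted v C1" "rooted v C2"
      using rooted_if_other_big[OF 2(2,3)] rooted_if_other_big[OF 2(3,2)] 2 by blast+
    let ?\<C> = "branches v - {C2}"
    have big: "C = C1" if "C \<in> ?\<C>" "\<not> path_branch C" for C
      using two_big[of C v C1 C2] that 2 by blast
    have "\<exists>xs ys. ladset (insert v (\<Union>?\<C>)) (v # xs) ys"
      by (rule fan) (use big r(1) in blast)+
    then obtain xs ys where xy: "ladset (insert v (\<Union>?\<C>)) (v # xs) ys" by blast
    obtain us vs where uv: "ladset (insert v C2) (v # us) vs" using r(2) by (auto simp: rooted_def)
    \<comment> \<open>The ladder of \<open>C2\<close> is reversed so that \<open>v\<close> ends its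
      row; there it meets the fan of all other branches, which begins with \<open>v\<close>.\<close>
    have "ladset (insert v C2) (rev us @ [v]) (rev vs)" using ladset_rev[OF uv] by simp
    moreover have "insert v C2 \<inter> \<Union>?\<C> = {}"
    proof -
      have "C \<inter> C2 = {}" if "C \<in> ?\<C>" for C using branches_disjoint[of C v C2] that 2(3) by blast
      moreover have "v \<notin> \<Union>?\<C>" using branch_props(3) by blast
      ultimately show ?thesis by blast
    qed
    ultimately have "ladset (insert v C2 \<union> \<Union>?\<C>) (rev us @ v # xs) (rev vs @ ys)"
      using glue_branches[OF _ xy] by blast
    moreover have "insert v C2 \<union> \<Union>?\<C> = W" using all[OF 2(1)] 2(3) by blast
    ultimately show ?thesis by metis
  next
    case 3
    \<comment> \<open>Pairs of a vertex and a big branch at it. One with a smallest branch is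
      chosen, so that every branch properly inside it is a path.\<close>
    let ?S = "\<lambda>vC. fst vC \<in> W \<and> snd vC \<in> branches (fst vC) \<and> \<not> path_branch (snd vC)"
    obtain v0 where "v0 \<in> W" using Wi by blast
    then obtain C0 where "?S (v0, C0)" using 3 by auto
    then obtain vC where vC: "?S vC" "\<forall>y. ?S y \<longrightarrow> card (snd vC) \<le> card (snd y)"
      using ex_has_least_nat[of ?S "(v0, C0)" "\<lambda>x. card (snd x)"] by blast
    obtain v C where vCeq: "vC = (v, C)" by (cases vC)
    have v: "v \<in> W" and C: "C \<in> branches v" "\<not> path_branch C" using vC(1) vCeq by auto
    have min: "card C \<le> card C'" if "u \<in> W" "C' \<in> branches u" "\<not> path_branch C'" for u C'
      using vC(2) vCeq that by auto
    note p = branch_props[OF C(1)]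
    have finC: "finite C" using p(2) fin_verts finite_subset by blast
    have CW: "C \<subseteq> W" using all[OF v] C by blast
    have small: "path_branch C'" if "u \<in> W" "C' \<in> branches u" "C' \<subset> C" for u C'
      using min[OF that(1,2)] psubset_card_mono[OF finC that(3)] by linarith
    have only: "path_branch C'" if "C' \<in> branches v" "C' \<noteq> C" for C'
      using 3 v C that by blast
    obtain w where w: "w \<in> C" "{v, w} \<in> E" using C by (auto simp: branches_def)
    show ?thesis
    proof (cases "\<forall>u\<in>C. {v, u} \<in> E \<longrightarrow> u = w")
      case True
      have g: "gated {v, w}" using bridge_gated[OF C(1) w] True by blast
      have vw: "v \<noteq> w" using edge_neq[OF w(2)] .
      have dec: "insert v C = {v, w} \<union> \<Union>{D. \<exists>u. (u, D) \<in> hanging {v, w} \<and> u \<noteq> v}"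
        using gated_branch[OF g _ C(1)] w vw by blast
      have sm: "path_branch C'" if h: "C' \<in> branches w" "v \<notin> C'" for C'
      proof -
        have "(w, C') \<in> hanging {v, w}" using h branch_props(3)[OF h(1)] by (auto simp: hanging_def)
        then have "C' \<subseteq> insert v C" using dec vw by blast
        then have "C' \<subset> C" using h(2) w(1) branch_props(3)[OF h(1)] by blast
        then show ?thesis using small[OF _ h(1)] w(1) CW by blast
      qed
      have "rooted v C"
      proof (rule bridge_rooted[OF C(1) w])
        show "\<And>u. u \<in> C \<Longrightarrow> {v, u} \<in> E \<Longrightarrow> u = w" using True by blast
      qed (use sm in blast)+
      then have "\<exists>xs ys. ladset (insert v (\<Union>(branches v))) (v # xs) ys"
        using only by (intro fan) blast+
      then show ?thesis using all[OF v] by metis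
    next
      case False
      then obtain w' where w': "w' \<in> C" "{v, w'} \<in> E" "w \<noteq> w'" by blast
      obtain B where B: "nontrivial_block G B" "v \<in> verts B" "verts B - {v} \<subseteq> C" "verts B - {v} \<noteq> {}"
        using nontrivial_block_at[OF C(1) w w'] .
      let ?U = "verts B"
      have g: "gated ?U" using B(1) block_gated by (simp add: nontrivial_block_def)
      note dec = gated_branch[OF g B(2) C(1) B(3,4)]
      have UW: "?U \<subseteq> W" using B(2,3) CW v by blast
      have cov: "W = ?U \<union> \<Union>(snd ` hanging ?U)" using gated_cover[OF g W UW] B(2) by blast
      \<comment> \<open>At \<open>v\<close> every branch other than \<open>C\<close> is a path
        because the big branch is unique, elsewhere by minimality of \<open>C\<close>. So both sides
        of the block can be completed at once.\<close>
      have path: "path_branch C'" if h: "(u, C') \<in> hanging ?U" for u C'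
      proof (cases "u = v")
        case True
        then have "C' \<noteq> C" "C' \<in> branches v" using h B(3,4) by (auto simp: hanging_def)
        then show ?thesis using only by blast
      next
        case False
        have h': "u \<in> ?U" "C' \<in> branches u" "C' \<inter> ?U = {}" using h by (auto simp: hanging_def)
        have "C' \<subseteq> insert v C" unfolding dec using h False by blast
        then have "C' \<subset> C" using h' B(2,3) False by blast
        then show ?thesis using small h' UW by blast
      qed
      obtain xs ys a0 b0 a1 b1 \<A>0 \<A>1 where d: "ladset ?U xs ys" "xs \<noteq> []" "ys \<noteq> []" "{hd xs, hd ys} = {a0, b0}"
        "{last xs, last ys} = {a1, b1}" "\<A>0 \<union> \<A>1 = hanging ?U" "\<A>0 \<inter> \<A>1 = {}" "side \<A>0 a0 b0" "side \<A>1 a1 b1"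
        using block_data[OF B(1)] by (elim exE conjE) (rule that)
      have disj: "set xs \<inter> set ys = {}" using d(1) lad_distinct unfolding ladset_def by blast
      have ab1: "a1 \<noteq> b1"
      proof
        assume "a1 = b1"
        then have "last xs = last ys" using d(5) by auto
        then show False using disj d(2,3) last_in_set by (metis disjoint_iff)
      qed
      have ab0: "a0 \<noteq> b0"
      proof
        assume "a0 = b0"
        then have "hd xs = hd ys" using d(4) by auto
        then show False using disj d(2,3) hd_in_set by (metis disjoint_iff)
      qed
      have dU: "?U \<inter> \<Union>(snd ` \<A>) = {}" if "\<A> \<subseteq> hanging ?U" for \<A>
        using that by (force simp: hanging_def)
      have h01: "\<A>0 \<subseteq> hanging ?U" "\<A>1 \<subseteq> hanging ?U" using d(6) by auto
      have "\<exists>xs' ys'. ladset (?U \<union> \<Union>(snd ` \<A>1)) (xs @ xs') (ys @ ys')"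
        using path h01 by (intro glue_block_side[OF g h01(2) d(9) ab1 d(1-3,5) dU[OF h01(2)]]) blast+
      then obtain xs1 ys1 where 1: "ladset (?U \<union> \<Union>(snd ` \<A>1)) (xs @ xs1) (ys @ ys1)" by blast
      have r: "ladset (?U \<union> \<Union>(snd ` \<A>1)) (rev (xs @ xs1)) (rev (ys @ ys1))" using ladset_rev[OF 1] .
      have "{last (rev (xs @ xs1)), last (rev (ys @ ys1))} = {a0, b0}" using d(2-4) by (simp add: last_rev)
      moreover have "rev (xs @ xs1) \<noteq> []" "rev (ys @ ys1) \<noteq> []" using d(2,3) by auto
      moreover have "(?U \<union> \<Union>(snd ` \<A>1)) \<inter> \<Union>(snd ` \<A>0) = {}"
      proof (rule ccontr)
        assume "(?U \<union> \<Union>(snd ` \<A>1)) \<inter> \<Union>(snd ` \<A>0) \<noteq> {}"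
        then obtain u C' u' C'' where x: "(u, C') \<in> \<A>1" "(u', C'') \<in> \<A>0" "C' \<inter> C'' \<noteq> {}"
          using dU[OF h01(1)] by force
        then have "(u, C') = (u', C'')" using hanging_disjoint[OF g] h01 by blast
        then show False using x d(7) by blast
      qed
      ultimately have "\<exists>xs' ys'. ladset (?U \<union> \<Union>(snd ` \<A>1) \<union> \<Union>(snd ` \<A>0)) (rev (xs @ xs1) @ xs') (rev (ys @ ys1) @ ys')"
        using path h01 by (intro glue_block_side[OF g h01(1) d(8) ab0 r]) blast+
      moreover have "?U \<union> \<Union>(snd ` \<A>1) \<union> \<Union>(snd ` \<A>0) = W" unfolding cov d(6)[symmetric] by blast
      ultimately show ?thesis by metis
    qed
  qed
qed

theorem safe_lad: "\<exists>xs ys. lad E xs ys \<and> set xs \<union> set ys = V"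
  using ladset_comps component_ladset by blast

end

section \<open>Drawing ladders\<close>

definition pos :: "'a list \<Rightarrow> 'a \<Rightarrow> nat" where
  "pos xs z = length (takeWhile (\<lambda>y. y \<noteq> z) xs)"

lemma pos_split: "distinct (p @ z # r) \<Longrightarrow> pos (p @ z # r) z = length p"
  unfolding pos_def by (subst takeWhile_append2) auto

lemma before_pos: "distinct xs \<Longrightarrow> before xs a b \<Longrightarrow> pos xs a < pos xs b"
proof -
  assume d: "distinct xs" and "before xs a b"
  then obtain p q r where x: "xs = p @ a # q @ b # r" unfolding before_split by blast
  have "pos xs a = length p" using pos_split[of p a "q @ b # r"] d x by simp
  moreover have "pos xs b = length (p @ a # q)" using pos_split[of "p @ a # q" b r] d x by simp
  ultimately show ?thesis by simp
qed

lemma nxt_pos: "distinct xs \<Longrightarrow> nxt xs a b \<Longrightarrow> pos xs b = Suc (pos xs a)"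
proof -
  assume d: "distinct xs" and "nxt xs a b"
  then obtain p r where x: "xs = p @ a # b # r" unfolding nxt_split by blast
  have "pos xs a = length p" using pos_split[of p a "b # r"] d x by simp
  moreover have "pos xs b = length (p @ [a])" using pos_split[of "p @ [a]" b r] d x by simp
  ultimately show ?thesis by simp
qed

lemma pos_inj: "distinct xs \<Longrightarrow> a \<in> set xs \<Longrightarrow> b \<in> set xs \<Longrightarrow> pos xs a = pos xs b \<Longrightarrow> a = b"
  using before_total[of a xs b] before_pos[of xs a b] before_pos[of xs b a] by auto

definition lpoint :: "'a list \<Rightarrow> 'a list \<Rightarrow> 'a \<Rightarrow> complex" where
  "lpoint xs ys z = (if z \<in> set xs then Complex (pos xs z) 1 else Complex (pos ys z) 0)"

text \<open>\<open>curve\<close> receives an unordered edge, so the direction of the segment is an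
  arbitrary choice, on which its image does not depend.\<close>

definition ldraw :: "'a list \<Rightarrow> 'a list \<Rightarrow> 'a drawing" where
  "ldraw xs ys = \<lparr>point = lpoint xs ys,
     curve = (\<lambda>e. let p = (SOME p. e = {fst p, snd p}) in linepath (lpoint xs ys (fst p)) (lpoint xs ys (snd p)))\<rparr>"

lemma ldraw_point [simp]: "point (ldraw xs ys) = lpoint xs ys"
  by (simp add: ldraw_def)

lemma ldraw_curve:
  obtains a' b' where "{a, b} = {a', b'}" "curve (ldraw xs ys) {a, b} = linepath (lpoint xs ys a') (lpoint xs ys b')"
proof -
  have "{a, b} = {fst (SOME p. {a, b} = {fst p, snd p}), snd (SOME p. {a, b} = {fst p, snd p})}"
    by (rule someI[of "\<lambda>p. {a, b} = {fst p, snd p}" "(a, b)"]) simp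
  then show thesis using that by (simp add: ldraw_def Let_def)
qed

lemma ldraw_image: "path_image (curve (ldraw xs ys) {a, b}) = closed_segment (lpoint xs ys a) (lpoint xs ys b)"
proof -
  obtain a' b' where ab: "{a, b} = {a', b'}" "curve (ldraw xs ys) {a, b} = linepath (lpoint xs ys a') (lpoint xs ys b')"
    using ldraw_curve .
  then have "a' = a \<and> b' = b \<or> a' = b \<and> b' = a" by (auto simp: doubleton_eq_iff)
  then show ?thesis unfolding ab(2) by (auto simp: closed_segment_commute)
qed

lemma seg_row:
  assumes "z \<in> closed_segment (Complex p h) (Complex q h)" "p \<le> q"
  shows "Im z = h" "p \<le> Re z" "Re z \<le> q"
proof -
  obtain u where u: "0 \<le> u" "u \<le> 1" "z = (1 - u) *\<^sub>R Complex p h + u *\<^sub>R Complex q h"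
    using assms(1) by (auto simp: in_segment)
  have r: "Re z = p + u * (q - p)" unfolding u(3) by (simp add: algebra_simps)
  show "Im z = h" unfolding u(3) by (simp add: algebra_simps)
  have "0 \<le> u * (q - p)" using u assms(2) by simp
  moreover have "u * (q - p) \<le> 1 * (q - p)" using u assms(2) by (intro mult_right_mono) simp_all
  ultimately show "p \<le> Re z" "Re z \<le> q" unfolding r by auto
qed

lemma seg_cross:
  assumes "z \<in> closed_segment (Complex p 1) (Complex q 0)"
  shows "0 \<le> Im z" "Im z \<le> 1" "Re z = Im z * p + (1 - Im z) * q"
proof -
  obtain u where u: "0 \<le> u" "u \<le> 1" "z = (1 - u) *\<^sub>R Complex p 1 + u *\<^sub>R Complex q 0"
    using assms(1) by (auto simp: in_segment)
  have i: "Im z = 1 - u" using u(3) by simp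
  show "0 \<le> Im z" "Im z \<le> 1" using i u by auto
  show "Re z = Im z * p + (1 - Im z) * q" unfolding i using u(3) by simp
qed

lemma edge_kind:
  assumes "lad E xs ys" "e \<in> E"
  obtains (top) a b where "e = {a, b}" "nxt xs a b" | (bottom) a b where "e = {a, b}" "nxt ys a b"
    | (cross) a b where "e = {a, b}" "a \<in> set xs" "b \<in> set ys"
proof -
  have "e \<in> pedges xs \<or> e \<in> pedges ys \<or> (\<exists>a\<in>set xs. \<exists>b\<in>set ys. e = {a, b})"
    using assms unfolding lad_def by blast
  then show thesis using that by (auto simp: pedges_def)
qed

locale ladder_drawing =
  fixes E :: "'a set set" and xs ys :: "'a list"
  assumes L: "lad E xs ys"
begin

lemma dist: "distinct xs" "distinct ys" "set xs \<inter> set ys = {}"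
  using lad_distinct[OF L] by auto

abbreviation "P \<equiv> lpoint xs ys"
abbreviation "H \<equiv> \<lparr>verts = set xs \<union> set ys, edges = E\<rparr>"
abbreviation "DD \<equiv> ldraw xs ys"

lemma P_top: "a \<in> set xs \<Longrightarrow> P a = Complex (pos xs a) 1"
  and P_bottom: "a \<in> set ys \<Longrightarrow> P a = Complex (pos ys a) 0"
  using dist(3) by (auto simp: lpoint_def)

lemma P_inj: "inj_on P (set xs \<union> set ys)"
proof
  fix a b assume a: "a \<in> set xs \<union> set ys" and b: "b \<in> set xs \<union> set ys" and e: "P a = P b"
  consider "a \<in> set xs" "b \<in> set xs" | "a \<in> set ys" "b \<in> set ys" | "a \<in> set xs" "b \<in> set ys" | "a \<in> set ys" "b \<in> set xs"
    using a b by blast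
  then show "a = b"
  proof cases
    case 1 then show ?thesis using e P_top pos_inj[OF dist(1)] by simp
  next
    case 2 then show ?thesis using e P_bottom pos_inj[OF dist(2)] by simp
  next
    case 3 then show ?thesis using e P_bottom P_top by simp
  next
    case 4 then show ?thesis using e P_bottom P_top by simp
  qed
qed

lemma simple_H: "simple_graph H"
proof -
  have "e \<subseteq> set xs \<union> set ys \<and> card e = 2" if "e \<in> E" for e
  proof
    show "e \<subseteq> set xs \<union> set ys" using lad_subset[OF L that] .
    from L that show "card e = 2"
    proof (cases rule: edge_kind)
      case (top a b) then show ?thesis using nxt_neq[OF dist(1)] by auto
    next
      case (bottom a b) then show ?thesis using nxt_neq[OF dist(2)] by auto
    next
      case (cross a b) then have "a \<noteq> b" using dist(3) by blast
      then show ?thesis using cross by simp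
    qed
  qed
  then show ?thesis by (simp add: simple_graph_def)
qed

lemma img_top:
  assumes "nxt xs a b" "z \<in> path_image (curve DD {a, b})"
  shows "Im z = 1" "pos xs a \<le> Re z" "Re z \<le> real (pos xs a) + 1"
  using assms nxt_set[OF assms(1)] nxt_pos[OF dist(1) assms(1)] seg_row[of z "pos xs a" 1 "real (pos xs a) + 1"]
  by (auto simp: ldraw_image P_top add.commute)

lemma img_bottom:
  assumes "nxt ys a b" "z \<in> path_image (curve DD {a, b})"
  shows "Im z = 0" "pos ys a \<le> Re z" "Re z \<le> real (pos ys a) + 1"
  using assms nxt_set[OF assms(1)] nxt_pos[OF dist(2) assms(1)] seg_row[of z "pos ys a" 0 "real (pos ys a) + 1"]
  by (auto simp: ldraw_image P_bottom add.commute)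

lemma img_cross:
  assumes "a \<in> set xs" "b \<in> set ys" "z \<in> path_image (curve DD {a, b})"
  shows "0 \<le> Im z" "Im z \<le> 1" "Re z = Im z * pos xs a + (1 - Im z) * pos ys b"
  using assms seg_cross[of z "pos xs a" "pos ys b"] by (auto simp: ldraw_image P_top P_bottom)

lemma row_point:
  assumes "distinct us" "nxt us a b" "c \<in> set us" "real (pos us a) \<le> pos us c" "real (pos us c) \<le> real (pos us a) + 1"
  shows "c \<in> {a, b}"
proof -
  have "pos us c = pos us a \<or> pos us c = pos us b" using assms(4,5) nxt_pos[OF assms(1,2)] by linarith
  then show ?thesis using pos_inj[OF assms(1)] nxt_set[OF assms(2)] assms(3) by blast
qed

lemma vertex_on_edge:
  assumes e: "e \<in> E" and w: "w \<in> set xs \<union> set ys" and i: "P w \<in> path_image (curve DD e)"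
  shows "w \<in> e"
  using L e
proof (cases rule: edge_kind)
  case (top a b)
  note t = img_top[OF top(2) i[unfolded top(1)]]
  have wx: "w \<in> set xs" using t(1) w P_bottom by auto
  show ?thesis using row_point[OF dist(1) top(2) wx] t(2,3) wx top(1) by (simp add: P_top)
next
  case (bottom a b)
  note t = img_bottom[OF bottom(2) i[unfolded bottom(1)]]
  have wy: "w \<in> set ys" using t(1) w P_top by auto
  show ?thesis using row_point[OF dist(2) bottom(2) wy] t(2,3) wy bottom(1) by (simp add: P_bottom)
next
  case (cross a b)
  note t = img_cross[OF cross(2,3) i[unfolded cross(1)]]
  from w show ?thesis
  proof
    assume wx: "w \<in> set xs"
    then have "pos xs w = pos xs a" using t(3) by (simp add: P_top)
    then show ?thesis using pos_inj[OF dist(1) wx cross(2)] cross(1) by simp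
  next
    assume wy: "w \<in> set ys"
    then have "pos ys w = pos ys b" using t(3) by (simp add: P_bottom)
    then show ?thesis using pos_inj[OF dist(2) wy cross(3)] cross(1) by simp
  qed
qed

lemma row_row:
  assumes d: "distinct us" and n: "nxt us a b" "nxt us c d'" "{a, b} \<noteq> {c, d'}"
    and x: "real (pos us a) \<le> x" "x \<le> real (pos us a) + 1" "real (pos us c) \<le> x" "x \<le> real (pos us c) + 1"
  shows "\<exists>w\<in>{a, b} \<inter> {c, d'}. x = real (pos us w)"
proof -
  have s: "a \<in> set us" "b \<in> set us" "c \<in> set us" "d' \<in> set us" using nxt_set n by metis+
  have p: "pos us b = Suc (pos us a)" "pos us d' = Suc (pos us c)" using nxt_pos[OF d] n by auto
  have "pos us a \<noteq> pos us c"
  proof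
    assume e: "pos us a = pos us c"
    then have "a = c" using pos_inj[OF d] s by blast
    moreover have "b = d'" using pos_inj[OF d, of b d'] s p e by simp
    ultimately show False using n(3) by simp
  qed
  then consider "pos us c = pos us b" "x = pos us c" | "pos us a = pos us d'" "x = pos us a"
    using x p by linarith
  then show ?thesis
  proof cases
    case 1
    then have "c = b" using pos_inj[OF d] s by blast
    then show ?thesis using 1 by blast
  next
    case 2
    then have "a = d'" using pos_inj[OF d] s by blast
    then show ?thesis using 2 by blast
  qed
qed

text \<open>At height \<open>Im z\<close> the horizontal offset of the two segments is a convex
  combination of the offsets of their ends. As rungs do not cross, these do not have opposite signs,
  so both terms vanish where the segments meet.\<close>

lemma cross_cross:
  assumes 1: "{a, b} \<in> E" "a \<in> set xs" "b \<in> set ys" and 2: "{c, d} \<in> E" "c \<in> set xs" "d \<in> set ys" and ne: "{a, b} \<noteq> {c, d}"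
    and z: "z \<in> path_image (curve DD {a, b})" "z \<in> path_image (curve DD {c, d})"
  shows "z \<in> P ` ({a, b} \<inter> {c, d})"
proof -
  let ?y = "Im z" and ?p = "real (pos xs a)" and ?q = "real (pos ys b)" and ?p' = "real (pos xs c)" and ?q' = "real (pos ys d)"
  note t = img_cross[OF 1(2,3) z(1)] and t' = img_cross[OF 2(2,3) z(2)]
  have eq: "?y * (?p' - ?p) + (1 - ?y) * (?q' - ?q) = 0" using t(3) t'(3) by (simp add: algebra_simps)
  have sgn: "0 \<le> (?p' - ?p) * (?q' - ?q)"
  proof (cases "a = c \<or> b = d")
    case False
    then consider "before xs a c" | "before xs c a" using before_total[of a xs c] 1 2 by blast
    then show ?thesis
    proof cases
      case b: 1
      then have "before ys b d" using lad_noncross[OF L 1(1) 2(1) b] before_total[of b ys d] 1 2 False by blast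
      then show ?thesis using before_pos[OF dist(1) b] before_pos[OF dist(2), of b d] by simp
    next
      case b: 2
      then have "before ys d b" using lad_noncross[OF L 2(1) 1(1) b] before_total[of b ys d] 1 2 False by blast
      then show ?thesis using before_pos[OF dist(1) b] before_pos[OF dist(2), of d b] by (simp add: mult_nonpos_nonpos)
    qed
  qed auto
  have zero: "?y * (?p' - ?p) = 0 \<and> (1 - ?y) * (?q' - ?q) = 0"
  proof (cases "?p' - ?p \<ge> 0 \<and> ?q' - ?q \<ge> 0")
    case True
    then have "0 \<le> ?y * (?p' - ?p)" "0 \<le> (1 - ?y) * (?q' - ?q)" using t(1,2) by auto
    then show ?thesis using eq by linarith
  next
    case False
    then have "?p' - ?p \<le> 0 \<and> ?q' - ?q \<le> 0" using sgn by (smt (verit) mult_neg_pos mult_pos_neg)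
    then have "?y * (?p' - ?p) \<le> 0" "(1 - ?y) * (?q' - ?q) \<le> 0"
      using t(1,2) by (auto intro: mult_nonneg_nonpos)
    then show ?thesis using eq by linarith
  qed
  show ?thesis
  proof (cases "a = c")
    case True
    then have "b \<noteq> d" using ne by blast
    then have "?q' \<noteq> ?q" using pos_inj[OF dist(2)] 1 2 by (metis of_nat_eq_iff)
    then have "?y = 1" using zero by simp
    then have "z = P a" using t(3) 1(2) by (simp add: P_top complex_eq_iff)
    then show ?thesis using True by simp
  next
    case False
    then have "?p' \<noteq> ?p" using pos_inj[OF dist(1)] 1 2 by (metis of_nat_eq_iff)
    then have y: "?y = 0" using zero by simp
    then have "?q' = ?q" using zero by simp
    then have "b = d" using pos_inj[OF dist(2)] 1 2 by (metis of_nat_eq_iff)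
    moreover have "z = P b" using t(3) y 1(3) by (simp add: P_bottom complex_eq_iff)
    ultimately show ?thesis by simp
  qed
qed

lemma top_cross:
  assumes n: "nxt xs a b" and c: "c \<in> set xs" "d \<in> set ys"
    and z: "z \<in> path_image (curve DD {a, b})" "z \<in> path_image (curve DD {c, d})"
  shows "z \<in> P ` ({a, b} \<inter> {c, d})"
proof -
  note t = img_top[OF n z(1)] and t' = img_cross[OF c z(2)]
  have r: "Re z = pos xs c" using t(1) t'(3) by simp
  then have "c \<in> {a, b}" using row_point[OF dist(1) n c(1)] t by simp
  moreover have "z = P c" using r t(1) c by (simp add: P_top complex_eq_iff)
  ultimately show ?thesis by blast
qed

lemma bottom_cross:
  assumes n: "nxt ys a b" and c: "c \<in> set xs" "d \<in> set ys"
    and z: "z \<in> path_image (curve DD {a, b})" "z \<in> path_image (curve DD {c, d})"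
  shows "z \<in> P ` ({a, b} \<inter> {c, d})"
proof -
  note t = img_bottom[OF n z(1)] and t' = img_cross[OF c z(2)]
  have r: "Re z = pos ys d" using t(1) t'(3) by simp
  then have "d \<in> {a, b}" using row_point[OF dist(2) n c(2)] t by simp
  moreover have "z = P d" using r t(1) c by (simp add: P_bottom complex_eq_iff)
  ultimately show ?thesis by blast
qed

lemma edges_meet:
  assumes e: "e \<in> E" "e' \<in> E" "e \<noteq> e'" and z: "z \<in> path_image (curve DD e)" "z \<in> path_image (curve DD e')"
  shows "z \<in> P ` (e \<inter> e')"
  using L e(1)
proof (cases rule: edge_kind)
  case (top a b)
  note t = img_top[OF top(2) z(1)[unfolded top(1)]]
  from L e(2) show ?thesis
  proof (cases rule: edge_kind)
    case top': (top c d)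
    note t' = img_top[OF top'(2) z(2)[unfolded top'(1)]]
    obtain w where w: "w \<in> {a, b} \<inter> {c, d}" "Re z = pos xs w"
      using row_row[OF dist(1) top(2) top'(2) _ t(2,3) t'(2,3)] e(3) top(1) top'(1) by auto
    then have "w \<in> set xs" using nxt_set[OF top(2)] by auto
    then have "z = P w" using w(2) t(1) by (simp add: P_top complex_eq_iff)
    then show ?thesis using w top(1) top'(1) by blast
  next
    case (bottom c d)
    then show ?thesis using img_bottom(1)[OF bottom(2) z(2)[unfolded bottom(1)]] t(1) by simp
  next
    case (cross c d)
    then show ?thesis using top_cross[OF top(2) cross(2,3)] z top(1) by simp
  qed
next
  case (bottom a b)
  note t = img_bottom[OF bottom(2) z(1)[unfolded bottom(1)]]
  from L e(2) show ?thesis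
  proof (cases rule: edge_kind)
    case bottom': (bottom c d)
    note t' = img_bottom[OF bottom'(2) z(2)[unfolded bottom'(1)]]
    obtain w where w: "w \<in> {a, b} \<inter> {c, d}" "Re z = pos ys w"
      using row_row[OF dist(2) bottom(2) bottom'(2) _ t(2,3) t'(2,3)] e(3) bottom(1) bottom'(1) by auto
    then have "w \<in> set ys" using nxt_set[OF bottom(2)] by auto
    then have "z = P w" using w(2) t(1) by (simp add: P_bottom complex_eq_iff)
    then show ?thesis using w bottom(1) bottom'(1) by blast
  next
    case (top c d)
    then show ?thesis using img_top(1)[OF top(2) z(2)[unfolded top(1)]] t(1) by simp
  next
    case (cross c d)
    then show ?thesis using bottom_cross[OF bottom(2) cross(2,3)] z bottom(1) by simp
  qed
next
  case (cross a b)
  from L e(2) show ?thesis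
  proof (cases rule: edge_kind)
    case (top c d)
    then show ?thesis using top_cross[OF top(2) cross(2,3)] z cross(1) by (metis Int_commute)
  next
    case (bottom c d)
    then show ?thesis using bottom_cross[OF bottom(2) cross(2,3)] z cross(1) by (metis Int_commute)
  next
    case cross': (cross c d)
    then show ?thesis using cross_cross[OF _ cross(2,3) _ cross'(2,3)] e z cross(1) by simp
  qed
qed

lemma plane_H: "plane_embedding H DD"
  unfolding plane_embedding_def
proof (intro conjI ballI impI)
  show "inj_on (point DD) (verts H)" using P_inj by simp
  fix e assume "e \<in> edges H"
  then have e: "e \<in> E" by simp
  obtain a b where ab: "e = {a, b}" "a \<noteq> b" "a \<in> set xs \<union> set ys" "b \<in> set xs \<union> set ys"
    using simple_H e unfolding simple_graph_def card_2_iff by fastforce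
  obtain a' b' where c: "{a, b} = {a', b'}" "curve DD {a, b} = linepath (P a') (P b')" using ldraw_curve .
  have "P a' \<noteq> P b'" using P_inj ab c(1) by (metis doubleton_eq_iff inj_on_def)
  then show "arc (curve DD e)" unfolding ab(1) c(2) by simp
  show "{pathstart (curve DD e), pathfinish (curve DD e)} = point DD ` e"
    unfolding ab(1) c(2) unfolding c(1) by simp
next
  fix e v assume "e \<in> edges H" "v \<in> verts H" "point DD v \<in> path_image (curve DD e)"
  then show "v \<in> e" using vertex_on_edge by simp
next
  fix e e' assume "e \<in> edges H" "e' \<in> edges H" "e \<noteq> e'"
  then show "path_image (curve DD e) \<inter> path_image (curve DD e') \<subseteq> point DD ` (e \<inter> e')"
    using edges_meet by auto
qed

lemma outerplane_H: "outerplane_graph H DD"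
proof unfold_locales
  show "simple_graph H" by (rule simple_H)
  show "plane_embedding H DD" by (rule plane_H)
  fix v assume v: "v \<in> verts H"
  \<comment> \<open>The drawing lies in the closed strip between the two rows, whose complement
    belongs to the outer face and comes arbitrarily close to every vertex.\<close>
  let ?T = "{z. 0 \<le> Im z \<and> Im z \<le> 1}"
  have T: "?T = {z. Im z \<ge> 0} \<inter> {z. Im z \<le> 1}" by auto
  have "convex ?T" unfolding T by (intro convex_Int convex_halfspace_Im_ge convex_halfspace_Im_le)
  moreover have sub: "drawing_image H DD \<subseteq> ?T"
  proof -
    have "P z \<in> ?T" if "z \<in> set xs \<union> set ys" for z using that P_top P_bottom by auto
    moreover have "path_image (curve DD e) \<subseteq> ?T" if "e \<in> E" for e
      using L that
    proof (cases rule: edge_kind)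
      case (top a b) then show ?thesis using img_top(1)[OF top(2)] by auto
    next
      case (bottom a b) then show ?thesis using img_bottom(1)[OF bottom(2)] by auto
    next
      case (cross a b) then show ?thesis using img_cross(1,2)[OF cross(2,3)] by auto
    qed
    ultimately show ?thesis unfolding drawing_image_def by auto
  qed
  ultimately have out: "- ?T \<subseteq> outer_face H DD" unfolding outer_face_def by (rule outside_subset_convex)
  have "P v \<in> closure (- ?T)"
    unfolding closure_approachable
  proof (intro allI impI)
    fix e :: real assume e: "e > 0"
    show "\<exists>y\<in>- ?T. dist y (P v) < e"
    proof (cases "v \<in> set xs")
      case True
      let ?y = "Complex (pos xs v) (1 + e / 2)"
      have "?y - P v = Complex 0 (e / 2)" using True by (simp add: P_top complex_eq_iff)
      then have "dist ?y (P v) < e" using e by (simp add: dist_norm cmod_def)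
      moreover have "?y \<in> - ?T" using e by simp
      ultimately show ?thesis by blast
    next
      case False
      then have vy: "v \<in> set ys" using v by simp
      let ?y = "Complex (pos ys v) (- (e / 2))"
      have "?y - P v = Complex 0 (- (e / 2))" using vy by (simp add: P_bottom complex_eq_iff)
      then have "dist ?y (P v) < e" using e by (simp add: dist_norm cmod_def)
      moreover have "?y \<in> - ?T" using e by simp
      ultimately show ?thesis by blast
    qed
  qed
  then have "P v \<in> closure (outer_face H DD)" using closure_mono[OF out] by blast
  moreover have "P v \<in> drawing_image H DD" using v by (auto simp: drawing_image_def)
  then have "P v \<notin> interior (outer_face H DD)"
    unfolding outer_face_def using outside_no_overlap[of "drawing_image H DD"] interior_subset by blast
  ultimately show "point DD v \<in> frontier (outer_face H DD)" by (simp add: frontier_def)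
qed

sublocale outerplane_graph H DD
  by (rule outerplane_H)

lemma outerplane_embedding_H: "outerplane_embedding H DD"
  using plane_H outer by (simp add: outerplane_embedding_def)

text \<open>Without cycles there are no bounded faces, and the empty weak dual counts as a
  path.\<close>

lemma outerpath_small:
  assumes "card (set xs \<union> set ys) \<le> 2"
  shows "outerpath H"
proof -
  have "\<not> cyc E zs" for zs
  proof
    assume c: "cyc E zs"
    then have "set zs \<subseteq> set xs \<union> set ys" using set_subset_V[of zs] by (simp add: cyc_def cedges_def)
    then have "card (set zs) \<le> 2" using card_mono[of "set xs \<union> set ys" "set zs"] assms by simp
    then show False using c distinct_card[of zs] by (simp add: cyc_def)
  qed
  then have "bounded_faces H DD = {}" using bounded_faces_eq by simp
  then have "path_graph (weak_dual H DD)" unfolding path_graph_iff weak_dual_def by auto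
  then show ?thesis using simple_H outerplane_embedding_H by (auto simp: outerpath_def)
qed

lemma outerpath_cycle:
  assumes "xs \<noteq> []" "ys \<noteq> []" "cyc E (xs @ rev ys)"
  shows "outerpath H" "biconnected H"
proof -
  have sV: "set (xs @ rev ys) = verts H" by auto
  have "bic (edges H) (verts H)" using bic_cycle[OF assms(3)] sV by simp
  then show bi: "biconnected H" using biconnected_iff_bic[OF wf] fin_verts by simp
  have bl: "block H H" using self_block[OF simple_H bi] .
  have cross: "\<exists>a\<in>set xs. \<exists>b\<in>set ys. e = {a, b}" if "e \<in> chords (xs @ rev ys)" for e
  proof -
    have "e \<in> E" "e \<notin> pedges xs" "e \<notin> pedges ys"
      using that by (auto simp: chords_def cedges_def pedges_append_if)
    then show ?thesis using L unfolding lad_def by blast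
  qed
  have "cyc (edges H) (xs @ rev ys)" using assms(3) by simp
  from path_of_lad(1)[OF bl this sV refl assms(1,2) cross]
  show "outerpath H" using simple_H outerplane_embedding_H by (auto simp: outerpath_def)
qed

end

section \<open>Host graphs\<close>

lemma lad_map:
  assumes L: "lad E xs ys" and inj: "inj_on h (set xs \<union> set ys)"
  shows "lad ((`) h ` E) (map h xs) (map h ys)"
  unfolding lad_def
proof (intro conjI ballI allI impI notI)
  have "distinct (xs @ ys)" using L by (simp add: lad_def)
  then have "distinct (map h (xs @ ys))" using inj by (simp add: distinct_map del: map_append)
  then show "distinct (map h xs @ map h ys)" by simp
next
  fix f assume "f \<in> (`) h ` E"
  then obtain e where e: "e \<in> E" "f = h ` e" by blast
  then have "e \<in> pedges xs \<or> e \<in> pedges ys \<or> (\<exists>a\<in>set xs. \<exists>b\<in>set ys. e = {a, b})" using L unfolding lad_def by blast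
  then show "f \<in> pedges (map h xs) \<or> f \<in> pedges (map h ys) \<or> (\<exists>a\<in>set (map h xs). \<exists>b\<in>set (map h ys). f = {a, b})"
  proof (elim disjE bexE)
    fix a b assume "a \<in> set xs" "b \<in> set ys" "e = {a, b}"
    then have "h a \<in> set (map h xs)" "h b \<in> set (map h ys)" "f = {h a, h b}" using e(2) by auto
    then show ?thesis by blast
  qed (auto simp: pedges_map e(2))
next
  fix t t' b b' assume e: "{t, b} \<in> (`) h ` E" "{t', b'} \<in> (`) h ` E"
    and bx: "before (map h xs) t t'" and by': "before (map h ys) b' b"
  obtain x x' where x: "before xs x x'" "t = h x" "t' = h x'" using bx unfolding before_map by blast
  obtain y y' where y: "before ys y' y" "b = h y" "b' = h y'" using by' unfolding before_map by blast
  have *: "{p, q} \<in> E" if m: "{h p, h q} \<in> (`) h ` E" "p \<in> set xs" "q \<in> set ys" for p q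
  proof -
    obtain e where e: "e \<in> E" "h ` {p, q} = h ` e" using m(1) by auto
    have "e \<subseteq> set xs \<union> set ys" "{p, q} \<subseteq> set xs \<union> set ys" using lad_subset[OF L e(1)] m by auto
    then have "{p, q} = e" using inj_on_image_eq_iff[OF inj, of "{p, q}" e] e(2) by blast
    then show ?thesis using e(1) by simp
  qed
  have "{x, y} \<in> E" "{x', y'} \<in> E" using * e x y before_set[OF x(1)] before_set[OF y(1)] by auto
  then show False using lad_noncross[OF L _ _ x(1) y(1)] by blast
qed

text \<open>The last edge of the row, if present, becomes a rung. This serves to fill an empty
  row.\<close>

lemma lad_move_last: "lad E (xs @ [x]) [] \<Longrightarrow> lad E xs [x]"
  unfolding lad_def
proof (elim conjE, intro conjI ballI allI impI)
  fix e assume "\<forall>e\<in>E. e \<in> pedges (xs @ [x]) \<or> e \<in> pedges [] \<or> (\<exists>a\<in>set (xs @ [x]). \<exists>b\<in>set []. e = {a, b})" "e \<in> E"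
  then have "e \<in> pedges (xs @ [x])" by auto
  then have "e \<in> pedges xs \<or> xs \<noteq> [] \<and> e = {last xs, x}" by (auto simp: pedges_append_if split: if_splits)
  then show "e \<in> pedges xs \<or> e \<in> pedges [x] \<or> (\<exists>a\<in>set xs. \<exists>b\<in>set [x]. e = {a, b})" by auto
qed auto

lemma lad_nonempty_rows:
  assumes "lad E xs ys" "card (set xs \<union> set ys) \<ge> 2"
  obtains us vs where "lad E us vs" "us \<noteq> []" "vs \<noteq> []" "set us \<union> set vs = set xs \<union> set ys"
proof -
  have *: "\<exists>us vs. lad E us vs \<and> us \<noteq> [] \<and> vs \<noteq> [] \<and> set us \<union> set vs = set xs"
    if h: "lad E xs []" "card (set xs) \<ge> 2" for xs
  proof -
    have "xs \<noteq> []" using h(2) by auto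
    then obtain us x where x: "xs = us @ [x]" by (meson rev_exhaust)
    then have "us \<noteq> []" using h(2) by auto
    then show ?thesis using lad_move_last[of E us x] h(1) x by (intro exI[of _ us] exI[of _ "[x]"]) auto
  qed
  consider "xs \<noteq> []" "ys \<noteq> []" | "ys = []" | "xs = []" by blast
  then show thesis
  proof cases
    case 1 then show thesis using that assms by blast
  next
    case 2 then show thesis using *[of xs] that assms by auto
  next
    case 3 then show thesis using *[of ys] lad_swap[OF assms(1)] that assms by auto
  qed
qed

definition full_edges :: "'a set set \<Rightarrow> 'a list \<Rightarrow> 'a list \<Rightarrow> 'a set set" where
  "full_edges M xs ys = M \<union> pedges xs \<union> pedges ys \<union> {{hd xs, hd ys}, {last xs, last ys}}"

text \<open>An extreme rung crosses nothing, since no vertex comes before the first or after the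
  last of a row.\<close>

lemma full_ladder:
  assumes L: "lad M xs ys" and ne: "xs \<noteq> []" "ys \<noteq> []"
  shows "lad (full_edges M xs ys) xs ys"
  unfolding lad_def
proof (intro conjI ballI allI impI notI)
  have d: "distinct xs" "distinct ys" "set xs \<inter> set ys = {}" using lad_distinct[OF L] by auto
  show "distinct (xs @ ys)" using L by (simp add: lad_def)
  have hl: "hd xs \<in> set xs" "last xs \<in> set xs" "hd ys \<in> set ys" "last ys \<in> set ys" using ne by auto
  fix e assume e: "e \<in> full_edges M xs ys"
  show "e \<in> pedges xs \<or> e \<in> pedges ys \<or> (\<exists>a\<in>set xs. \<exists>b\<in>set ys. e = {a, b})"
  proof (cases "e \<in> M")
    case True
    then show ?thesis using L unfolding lad_def by blast
  next
    case False
    then show ?thesis using e hl unfolding full_edges_def by blast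
  qed
next
  have d: "distinct xs" "distinct ys" "set xs \<inter> set ys = {}" using lad_distinct[OF L] by auto
  fix t t' b b' assume e: "{t, b} \<in> full_edges M xs ys" "{t', b'} \<in> full_edges M xs ys"
    and bx: "before xs t t'" and by': "before ys b' b"
  have m: "t \<in> set xs" "t' \<in> set xs" "b \<in> set ys" "b' \<in> set ys" using before_set[OF bx] before_set[OF by'] by auto
  have hl: "hd xs \<in> set xs" "last xs \<in> set xs" "hd ys \<in> set ys" "last ys \<in> set ys" using ne by auto
  have kind: "{p, q} \<in> M \<or> p = hd xs \<and> q = hd ys \<or> p = last xs \<and> q = last ys"
    if "{p, q} \<in> full_edges M xs ys" "p \<in> set xs" "q \<in> set ys" for p q
  proof -
    have "{p, q} \<notin> pedges xs" "{p, q} \<notin> pedges ys" using pedges_subset that d(3) by blast+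
    then have "{p, q} \<in> M \<or> {p, q} = {hd xs, hd ys} \<or> {p, q} = {last xs, last ys}"
      using that(1) unfolding full_edges_def by blast
    then show ?thesis using that(2,3) hl d(3) by (auto simp: doubleton_eq_iff)
  qed
  have no: "\<not> before xs z (hd xs)" "\<not> before xs (last xs) z" if "z \<in> set xs" for z
    using hd_before[OF that] last_before[OF that] before_asym[OF d(1)] before_irrefl[OF d(1)] by metis+
  have no': "\<not> before ys z (hd ys)" "\<not> before ys (last ys) z" if "z \<in> set ys" for z
    using hd_before[OF that] last_before[OF that] before_asym[OF d(2)] before_irrefl[OF d(2)] by metis+
  have "{t, b} \<in> M" using kind[OF e(1) m(1,3)] no(2)[OF m(2)] no'(1)[OF m(4)] bx by' by blast
  moreover have "{t', b'} \<in> M" using kind[OF e(2) m(2,4)] no(1)[OF m(1)] no'(2)[OF m(3)] bx by' by blast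
  ultimately show False using lad_noncross[OF L _ _ bx by'] by blast
qed

lemma full_host:
  assumes L: "lad M xs ys" and ne: "xs \<noteq> []" "ys \<noteq> []" and c: "card (set xs \<union> set ys) \<ge> 3"
  shows "outerpath \<lparr>verts = set xs \<union> set ys, edges = full_edges M xs ys\<rparr>"
    "biconnected \<lparr>verts = set xs \<union> set ys, edges = full_edges M xs ys\<rparr>"
proof -
  interpret ladder_drawing "full_edges M xs ys" xs ys
    by unfold_locales (rule full_ladder[OF L ne])
  have d: "distinct (xs @ rev ys)" using L by (auto simp: lad_def)
  moreover have "length (xs @ rev ys) \<ge> 3" using distinct_card[OF d] c by simp
  moreover have "cedges (xs @ rev ys) \<subseteq> full_edges M xs ys"
    unfolding cedges_def pedges_append_if pedges_rev full_edges_def using ne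
    by (auto simp: hd_rev last_rev insert_commute)
  ultimately have "cyc (full_edges M xs ys) (xs @ rev ys)" by (simp add: cyc_def)
  from outerpath_cycle[OF ne this]
  show "outerpath \<lparr>verts = set xs \<union> set ys, edges = full_edges M xs ys\<rparr>"
    "biconnected \<lparr>verts = set xs \<union> set ys, edges = full_edges M xs ys\<rparr>" by auto
qed

text \<open>At most two vertices admit no Hamiltonian cycle, so \<open>full_host\<close> does not
  cover them and the complete graph serves as host.\<close>

lemma complete_host:
  assumes "finite V" "card V \<le> 2"
  defines "H \<equiv> \<lparr>verts = V, edges = {e. e \<subseteq> V \<and> card e = 2}\<rparr>"
  shows "outerpath H" "biconnected H"
proof -
  let ?E = "{e. e \<subseteq> V \<and> card e = 2}"
  obtain xs where xs: "set xs = V" "distinct xs" using finite_distinct_list[OF assms(1)] by blast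
  then have len: "length xs \<le> 2" using assms(2) distinct_card by metis
  have E: "?E \<subseteq> pedges xs"
  proof
    fix e assume "e \<in> ?E"
    then have e: "e \<subseteq> set xs" "card e = 2" using xs by auto
    obtain as u bs v cs where z: "xs = as @ u # bs @ v # cs" "e = {u, v}" using two_in_list[OF e] by metis
    then have "xs = [u, v]" using len by auto
    then show "e \<in> pedges xs" using z by (simp add: pedges_Cons)
  qed
  have L: "lad ?E xs []" using E xs unfolding lad_def by auto
  interpret ladder_drawing ?E xs "[]" by unfold_locales (rule L)
  have H: "\<lparr>verts = set xs \<union> set [], edges = ?E\<rparr> = H" using xs by (simp add: H_def)
  show "outerpath H" using outerpath_small assms(2) xs H by simp
  have cE: "conn ?E U" if U: "U \<subseteq> V" for U
    unfolding conn_def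
  proof (intro allI impI)
    fix A assume A: "A \<subseteq> U \<and> A \<noteq> {} \<and> A \<noteq> U"
    then obtain a b where ab: "a \<in> A" "b \<in> U - A" by blast
    then have "{a, b} \<subseteq> V" "a \<noteq> b" using A U by blast+
    then have "{a, b} \<in> ?E" by simp
    then show "\<exists>a\<in>A. \<exists>b\<in>U - A. {a, b} \<in> ?E" using ab by blast
  qed
  have "bic ?E V" unfolding bic_def using cE by blast
  then show "biconnected H" using biconnected_iff_bic[of H] assms(1) by (auto simp: H_def)
qed

lemma isomorphic_image:
  assumes "inj_on f (verts G)"
  shows "isomorphic G \<lparr>verts = f ` verts G, edges = (`) f ` edges G\<rparr>"
  unfolding isomorphic_def using assms by (intro exI[of _ f]) (auto simp: bij_betw_def)

lemma nat_embedding: "finite A \<Longrightarrow> \<exists>f :: 'a \<Rightarrow> nat. inj_on f A"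
  using finite_imp_inj_to_nat_seg by metis

lemma lad_spanning_host:
  fixes G :: "'a ugraph"
  assumes sg: "simple_graph G" and L: "lad (edges G) xs ys" "set xs \<union> set ys = verts G"
  shows "\<exists>(H :: nat ugraph) K. outerpath H \<and> biconnected H \<and> spanning_subgraph K H \<and> isomorphic G K"
proof -
  have fin: "finite (verts G)" and eG: "\<forall>e\<in>edges G. e \<subseteq> verts G \<and> card e = 2" using sg by (auto simp: simple_graph_def)
  obtain f :: "'a \<Rightarrow> nat" where f: "inj_on f (verts G)" using nat_embedding[OF fin] by blast
  let ?K = "\<lparr>verts = f ` verts G, edges = (`) f ` edges G\<rparr>"
  have iso: "isomorphic G ?K" using isomorphic_image[OF f] .
  have Ke: "\<forall>e\<in>edges ?K. e \<subseteq> verts ?K" using eG by auto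
  have card: "card (f ` verts G) = card (verts G)" using f by (rule card_image)
  show ?thesis
  proof (cases "card (verts G) \<le> 2")
    case True
    let ?H = "\<lparr>verts = f ` verts G, edges = {e. e \<subseteq> f ` verts G \<and> card e = 2}\<rparr>"
    have "outerpath ?H" "biconnected ?H" using complete_host[of "f ` verts G"] fin card True by auto
    moreover have "spanning_subgraph ?K ?H"
    proof -
      have "card (f ` e) = 2" if "e \<in> edges G" for e
        using eG that card_image[OF inj_on_subset[OF f, of e]] by auto
      then show ?thesis using Ke eG by (force simp: spanning_subgraph_def subgraph_def)
    qed
    ultimately show ?thesis using iso by blast
  next
    case False
    obtain us vs where uv: "lad (edges G) us vs" "us \<noteq> []" "vs \<noteq> []" "set us \<union> set vs = verts G"
      using lad_nonempty_rows[OF L(1)] L(2) False by (metis linear)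
    let ?us = "map f us" and ?vs = "map f vs"
    have L': "lad ((`) f ` edges G) ?us ?vs" using lad_map[OF uv(1)] f uv(4) by simp
    let ?H = "\<lparr>verts = set ?us \<union> set ?vs, edges = full_edges ((`) f ` edges G) ?us ?vs\<rparr>"
    have V: "set ?us \<union> set ?vs = f ` verts G" using uv(4) by auto
    have "outerpath ?H" "biconnected ?H" using full_host[OF L'] uv(2,3) False V card by auto
    moreover have "spanning_subgraph ?K ?H"
      using Ke V by (auto simp: spanning_subgraph_def subgraph_def full_edges_def)
    ultimately show ?thesis using iso by blast
  qed
qed

text \<open>Subdividing the missing row edges keeps them out of the subgraph induced on the original vertices.\<close>
fun subdivide :: "('a \<Rightarrow> 'a) \<Rightarrow> 'a set set \<Rightarrow> 'a list \<Rightarrow> 'a list" where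
  "subdivide s F [] = []"
| "subdivide s F [x] = [x, s x]"
| "subdivide s F (x # y # r) = (if {x, y} \<in> F then x # subdivide s F (y # r) else x # s x # subdivide s F (y # r))"

lemma subdivide_set: "set (subdivide s F xs) \<subseteq> set xs \<union> s ` set xs" "set xs \<subseteq> set (subdivide s F xs)"
  by (induction s F xs rule: subdivide.induct) auto

lemma subdivide_Cons: "\<exists>r. subdivide s F (x # xs) = x # r \<and> r \<noteq> []"
proof (induction xs arbitrary: x)
  case (Cons y ys)
  then show ?case by (metis list.distinct(1) subdivide.simps(3))
qed simp

lemma subdivide_last: "xs \<noteq> [] \<Longrightarrow> last (subdivide s F xs) = s (last xs)"
proof (induction s F xs rule: subdivide.induct)
  case (3 s F x y r)
  obtain q where "subdivide s F (y # r) = y # q" "q \<noteq> []" using subdivide_Cons by metis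
  then show ?case using 3 by auto
qed auto

lemma subdivide_filter:
  assumes "\<forall>x\<in>set xs. P x \<and> \<not> P (s x)"
  shows "filter P (subdivide s F xs) = xs"
  using assms by (induction s F xs rule: subdivide.induct) auto

lemma subdivide_distinct:
  assumes "distinct xs" "\<forall>x\<in>set xs. P x \<and> \<not> P (s x)" "inj_on s (set xs)"
  shows "distinct (subdivide s F xs)"
  using assms
proof (induction s F xs rule: subdivide.induct)
  case (2 s F x)
  then show ?case by auto
next
  case (3 s F x y r)
  then have IH: "distinct (subdivide s F (y # r))" by (auto simp: inj_on_def)
  have "x \<notin> set (y # r) \<union> s ` set (y # r)" using "3.prems" by auto
  then have 1: "x \<notin> set (subdivide s F (y # r))" using subdivide_set(1)[of s F "y # r"] by blast
  have "s x \<notin> s ` set (y # r)" using "3.prems"(1,3) by (auto simp: inj_on_def)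
  moreover have "s x \<notin> set (y # r)" using "3.prems"(2) by (metis list.set_intros(1,2))
  ultimately have 2: "s x \<notin> set (subdivide s F (y # r))" using subdivide_set(1)[of s F "y # r"] by blast
  have "x \<noteq> s x" using "3.prems"(2) by (metis list.set_intros(1))
  then show ?case using IH 1 2 by simp
qed simp

lemma subdivide_nxt:
  assumes "\<forall>x\<in>set xs. P x \<and> \<not> P (s x)" "P a" "P b"
  shows "nxt (subdivide s F xs) a b \<longleftrightarrow> nxt xs a b \<and> {a, b} \<in> F"
  using assms
proof (induction s F xs rule: subdivide.induct)
  case (3 s F x y r)
  obtain q where q: "subdivide s F (y # r) = y # q" "q \<noteq> []" using subdivide_Cons by metis
  have IH: "nxt (subdivide s F (y # r)) a b \<longleftrightarrow> nxt (y # r) a b \<and> {a, b} \<in> F"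
    using 3 by (cases "{x, y} \<in> F") auto
  have sx: "\<not> P (s x)" using "3.prems"(1) by simp
  then have "a \<noteq> s x" "b \<noteq> s x" using "3.prems"(2,3) by auto
  then show ?case using IH q by auto
qed auto

text \<open>The extreme rungs of the host must not join two original vertices either. Hence each row
  gets an extra first vertex, and a nonempty row ends with the subdividing vertex of its last
  member.\<close>

lemma lad_induced_host:
  fixes G :: "'a ugraph"
  assumes sg: "simple_graph G" and L: "lad (edges G) xs0 ys0" "set xs0 \<union> set ys0 = verts G"
  shows "\<exists>(H :: nat ugraph) K. outerpath H \<and> biconnected H \<and> induced_subgraph K H \<and> isomorphic G K"
proof -
  have fin: "finite (verts G)" and eG: "\<forall>e\<in>edges G. e \<subseteq> verts G \<and> card e = 2" using sg by (auto simp: simple_graph_def)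
  obtain f0 :: "'a \<Rightarrow> nat" where f0: "inj_on f0 (verts G)" using nat_embedding[OF fin] by blast
  \<comment> \<open>Original vertices get positive even numbers. The odd numbers from 3 on serve as
    subdividing vertices, and 0 and 1 as the extra first vertices of the rows.\<close>
  define f where "f x = 2 * f0 x + 2" for x
  have f: "inj_on f (verts G)" using f0 by (auto simp: inj_on_def f_def)
  define F where "F = (`) f ` edges G"
  define W where "W = f ` verts G"
  let ?K = "\<lparr>verts = W, edges = F\<rparr>"
  have iso: "isomorphic G ?K" using isomorphic_image[OF f] unfolding F_def W_def .
  have Ke: "\<forall>e\<in>F. e \<subseteq> W" using eG by (auto simp: F_def W_def)
  let ?P = "\<lambda>z. even z \<and> z \<noteq> (0 :: nat)"
  have WP: "?P z" if "z \<in> W" for z using that by (auto simp: W_def f_def)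
  show ?thesis
  proof (cases "verts G = {}")
    case True
    let ?H = "\<lparr>verts = {} :: nat set, edges = {e. e \<subseteq> {} \<and> card e = 2}\<rparr>"
    have "outerpath ?H" "biconnected ?H" using complete_host[of "{} :: nat set"] by auto
    moreover have "?K = induce ?H {}" using True eG by (auto simp: induce_def F_def W_def)
    then have "induced_subgraph ?K ?H" using True by (simp add: induced_subgraph_def W_def)
    ultimately show ?thesis using iso by blast
  next
    case ne: False
    define us where "us = map f xs0"
    define vs where "vs = map f ys0"
    have LF: "lad F us vs" using lad_map[OF L(1)] f L(2) unfolding F_def us_def vs_def by simp
    have V: "set us \<union> set vs = W" using L(2) by (auto simp: W_def us_def vs_def)
    have dF: "distinct us" "distinct vs" "set us \<inter> set vs = {}" using lad_distinct[OF LF] by auto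
    define X where "X = 0 # subdivide Suc F us"
    define Y where "Y = 1 # subdivide Suc F vs"
    have Pu: "\<forall>x\<in>set us. ?P x \<and> \<not> ?P (Suc x)" and Pv: "\<forall>x\<in>set vs. ?P x \<and> \<not> ?P (Suc x)"
    proof -
      have "?P x \<and> \<not> ?P (Suc x)" if "x \<in> W" for x using WP[OF that] by simp
      then show "\<forall>x\<in>set us. ?P x \<and> \<not> ?P (Suc x)" "\<forall>x\<in>set vs. ?P x \<and> \<not> ?P (Suc x)"
        unfolding V[symmetric] by blast+
    qed
    have si: "inj_on Suc A" for A by (auto simp: inj_on_def)
    have fX: "filter ?P X = us" and fY: "filter ?P Y = vs"
      unfolding X_def Y_def using subdivide_filter[OF Pu] subdivide_filter[OF Pv] by simp_all
    have nX: "nxt X a b \<longleftrightarrow> nxt us a b \<and> {a, b} \<in> F" if "?P a" "?P b" for a b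
      unfolding X_def using that subdivide_nxt[OF Pu that] by simp
    have nY: "nxt Y a b \<longleftrightarrow> nxt vs a b \<and> {a, b} \<in> F" if "?P a" "?P b" for a b
    proof -
      have "a \<noteq> 1" using that by auto
      then show ?thesis unfolding Y_def using subdivide_nxt[OF Pv that] by simp
    qed
    have sX: "set X \<subseteq> {0} \<union> set us \<union> Suc ` set us" "set us \<subseteq> set X"
      unfolding X_def using subdivide_set(1)[of Suc F us] subdivide_set(2)[of us Suc F] by auto
    have sY: "set Y \<subseteq> {1} \<union> set vs \<union> Suc ` set vs" "set vs \<subseteq> set Y"
      unfolding Y_def using subdivide_set(1)[of Suc F vs] subdivide_set(2)[of vs Suc F] by auto
    have ev: "even z \<and> z \<noteq> 0" if "z \<in> set us \<union> set vs" for z using that Pu Pv by blast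
    have od: "odd z \<and> z \<noteq> 1" if z: "z \<in> Suc ` set us \<union> Suc ` set vs" for z
    proof -
      obtain x where "x \<in> set us \<union> set vs" "z = Suc x" using z by blast
      then show ?thesis using ev by simp
    qed
    have dX: "distinct X" unfolding X_def
    proof -
      have "0 \<notin> set (subdivide Suc F us)" using subdivide_set(1)[of Suc F us] ev od by (metis Un_iff even_zero subsetD)
      then show "distinct (0 # subdivide Suc F us)" using subdivide_distinct[OF dF(1) Pu si] by simp
    qed
    have dY: "distinct Y" unfolding Y_def
    proof -
      have "1 \<notin> set (subdivide Suc F vs)" using subdivide_set(1)[of Suc F vs] ev od by (metis Un_iff odd_one subsetD)
      then show "distinct (1 # subdivide Suc F vs)" using subdivide_distinct[OF dF(2) Pv si] by simp
    qed
    have dXY: "set X \<inter> set Y = {}"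
    proof (rule ccontr)
      assume "set X \<inter> set Y \<noteq> {}"
      then obtain z where "z \<in> set X" "z \<in> set Y" by blast
      then have z: "z \<in> {0} \<union> set us \<union> Suc ` set us" "z \<in> {1} \<union> set vs \<union> Suc ` set vs"
        using subsetD[OF sX(1)] subsetD[OF sY(1)] by simp_all
      have "z \<notin> set us \<inter> set vs" using dF(3) by blast
      moreover have "z \<notin> Suc ` set us \<inter> Suc ` set vs"
      proof
        assume "z \<in> Suc ` set us \<inter> Suc ` set vs"
        then obtain x y where "x \<in> set us" "y \<in> set vs" "Suc x = Suc y" by blast
        then show False using dF(3) by auto
      qed
      ultimately show False using z ev[of z] od[of z] by (metis IntI UnE UnI1 UnI2 even_zero odd_one singletonD)
    qed
    \<comment> \<open>Only the rungs are passed on. Row edges of the copy reappear because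
      \<open>X\<close> and \<open>Y\<close> keep exactly the adjacent pairs consecutive, while all
      other gaps are subdivided.\<close>
    let ?M = "{e \<in> F. \<exists>a\<in>set us. \<exists>b\<in>set vs. e = {a, b}}"
    have LM: "lad ?M X Y"
      unfolding lad_def
    proof (intro conjI ballI allI impI notI)
      show "distinct (X @ Y)" using dX dY dXY by simp
      fix e assume "e \<in> ?M"
      then show "e \<in> pedges X \<or> e \<in> pedges Y \<or> (\<exists>a\<in>set X. \<exists>b\<in>set Y. e = {a, b})" using sX(2) sY(2) by blast
    next
      fix t t' b b' assume e: "{t, b} \<in> ?M" "{t', b'} \<in> ?M" and bx: "before X t t'" and by': "before Y b' b"
      have eF: "{t, b} \<in> F" "{t', b'} \<in> F" using e by blast+
      then have P: "?P t" "?P b" "?P t'" "?P b'" using Ke WP by (metis insertI1 insertCI subsetD)+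
      have "before us t t'" unfolding fX[symmetric] before_filter using bx P by blast
      moreover have "before vs b' b" unfolding fY[symmetric] before_filter using by' P by blast
      ultimately show False using lad_noncross[OF LF eF] by blast
    qed
    have nXY: "X \<noteq> []" "Y \<noteq> []" by (auto simp: X_def Y_def)
    let ?H = "\<lparr>verts = set X \<union> set Y, edges = full_edges ?M X Y\<rparr>"
    obtain w where w: "w \<in> W" using ne W_def by blast
    have "card (set X \<union> set Y) \<ge> 3"
    proof -
      have "w \<in> set X \<union> set Y" using w V sX(2) sY(2) by blast
      then have "{0, 1, w} \<subseteq> set X \<union> set Y" by (simp add: X_def Y_def)
      moreover have "card {0, 1, w} = 3" using WP[OF w] by auto
      ultimately show ?thesis by (metis List.finite_set card_mono finite_UnI)
    qed
    then have H: "outerpath ?H" "biconnected ?H" using full_host[OF LM nXY] by auto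
    have lastX: "\<not> ?P (last X)"
    proof (cases "us = []")
      case True then show ?thesis by (simp add: X_def)
    next
      case False
      then have "last X = Suc (last us)"
        using subdivide_last[OF False, of Suc F] subdivide_Cons[of Suc F] unfolding X_def
        by (metis (no_types, lifting) last.simps neq_Nil_conv)
      then show ?thesis using Pu last_in_set[OF False] by metis
    qed
    have "{e \<in> full_edges ?M X Y. e \<subseteq> W} = F"
    proof (intro equalityI subsetI)
      fix e assume "e \<in> {e \<in> full_edges ?M X Y. e \<subseteq> W}"
      then have e: "e \<in> full_edges ?M X Y" "\<forall>z\<in>e. ?P z" using WP by blast+
      have "e \<noteq> {hd X, hd Y}" using e(2) by (auto simp: X_def)
      moreover have "e \<noteq> {last X, last Y}" using e(2) lastX by auto
      ultimately consider "e \<in> ?M" | "e \<in> pedges X" | "e \<in> pedges Y" using e(1) unfolding full_edges_def by blast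
      then show "e \<in> F"
      proof cases
        case 2
        then obtain a b where "e = {a, b}" "nxt X a b" by (auto simp: pedges_def)
        then show ?thesis using nX e(2) by auto
      next
        case 3
        then obtain a b where "e = {a, b}" "nxt Y a b" by (auto simp: pedges_def)
        then show ?thesis using nY e(2) by auto
      qed blast
    next
      fix e assume e: "e \<in> F"
      then have eW: "e \<subseteq> W" using Ke by blast
      from LF e have "e \<in> full_edges ?M X Y"
      proof (cases rule: edge_kind)
        case (top a b)
        then have "nxt X a b" using nX[of a b] eW WP e by blast
        then show ?thesis using top unfolding full_edges_def pedges_def by blast
      next
        case (bottom a b)
        then have "nxt Y a b" using nY[of a b] eW WP e by blast
        then show ?thesis using bottom unfolding full_edges_def pedges_def by blast
      next
        case (cross a b)
        then show ?thesis using e unfolding full_edges_def by blast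
      qed
      then show "e \<in> {e \<in> full_edges ?M X Y. e \<subseteq> W}" using eW by blast
    qed
    moreover have "W \<subseteq> set X \<union> set Y" using V sX(2) sY(2) by blast
    ultimately have "?K = induce ?H W" "W \<subseteq> verts ?H" by (auto simp: induce_def)
    then have "induced_subgraph ?K ?H" unfolding induced_subgraph_def ugraph.select_convs by blast
    then show ?thesis using H iso by blast
  qed
qed

text \<open>The rows of the host's ladder are restricted to the vertices of the copy and carried
  back along the inverse of the isomorphism.\<close>

lemma linear_lad:
  fixes G :: "'a ugraph"
  assumes sg: "simple_graph G" and lin: "linear_graph G"
  obtains xs ys where "lad (edges G) xs ys" "set xs \<union> set ys = verts G"
proof -
  obtain H :: "nat ugraph" and K where H: "outerpath H" "biconnected H" "subgraph K H" "isomorphic G K"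
    using lin by (auto simp: linear_graph_def)
  obtain xs ys where L: "lad (edges H) xs ys" "set xs \<union> set ys = verts H" using outerpath_lad[OF H(1,2)] .
  obtain f where f: "bij_betw f (verts G) (verts K)" "edges K = (`) f ` edges G" using H(4) by (auto simp: isomorphic_def)
  have K: "verts K \<subseteq> verts H" "edges K \<subseteq> edges H" "\<forall>e\<in>edges K. e \<subseteq> verts K" using H(3) by (auto simp: subgraph_def)
  let ?xs = "filter (\<lambda>z. z \<in> verts K) xs" and ?ys = "filter (\<lambda>z. z \<in> verts K) ys"
  have LK: "lad (edges K) ?xs ?ys" by (rule lad_filter[OF lad_mono[OF L(1) K(2)]]) (use K(3) in blast)
  have VK: "set ?xs \<union> set ?ys = verts K" using L(2) K(1) by auto
  let ?g = "inv_into (verts G) f"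
  have gi: "inj_on ?g (verts K)" "?g ` verts K = verts G"
    using bij_betw_inv_into[OF f(1)] by (auto simp: bij_betw_def)
  have "?g ` (f ` e) = e" if "e \<in> edges G" for e
  proof -
    have "e \<subseteq> verts G" using sg that by (auto simp: simple_graph_def)
    then show ?thesis using f(1) inv_into_image_cancel[of f "verts G" e] by (auto simp: bij_betw_def)
  qed
  then have "(`) ?g ` edges K = edges G" unfolding f(2) by (force simp: image_image)
  moreover have "inj_on ?g (set ?xs \<union> set ?ys)" unfolding VK by (rule gi(1))
  ultimately have "lad (edges G) (map ?g ?xs) (map ?g ?ys)" using lad_map[OF LK, of ?g] by metis
  moreover have "set (map ?g ?xs) \<union> set (map ?g ?ys) = verts G" using VK gi(2) by (simp add: image_Un[symmetric])
  ultimately show thesis using that by blast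
qed

theorem theorem2:
  fixes G :: "'a ugraph" and D :: "'a drawing"
  assumes "simple_graph G" and "outerplane_embedding G D"
  shows "(linear_graph G \<longleftrightarrow>
            cut_safe G \<and> block_safe G D \<and> linear_forest (weak_dual G D)) \<and>
         (linear_graph G \<longrightarrow>
            (\<exists>(H :: nat ugraph) K. outerpath H \<and> biconnected H \<and>
               induced_subgraph K H \<and> isomorphic G K) \<and>
            (\<exists>(H :: nat ugraph) K. outerpath H \<and> biconnected H \<and>
               spanning_subgraph K H \<and> isomorphic G K))"
proof -
  interpret outerplane_graph G D
    by unfold_locales (use assms in \<open>auto simp: outerplane_embedding_def\<close>)
  let ?lad = "\<exists>xs ys. lad (edges G) xs ys \<and> set xs \<union> set ys = verts G"
  have "?lad" if "linear_graph G" using linear_lad[OF assms(1) that] by metis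
  moreover have "cut_safe G \<and> block_safe G D \<and> linear_forest (weak_dual G D)" if "?lad"
    using lad_safe that by blast
  moreover have "?lad" if "cut_safe G \<and> block_safe G D \<and> linear_forest (weak_dual G D)"
  proof -
    interpret safe_graph G D by unfold_locales (use that in auto)
    show ?thesis by (rule safe_lad)
  qed
  moreover have span: "\<exists>(H :: nat ugraph) K. outerpath H \<and> biconnected H \<and> spanning_subgraph K H \<and> isomorphic G K" if "?lad"
    using lad_spanning_host[OF assms(1)] that by blast
  moreover have "\<exists>(H :: nat ugraph) K. outerpath H \<and> biconnected H \<and> induced_subgraph K H \<and> isomorphic G K" if "?lad"
    using lad_induced_host[OF assms(1)] that by blast
  \<comment> \<open>The spanning host is itself a witness of linearity.\<close>
  moreover have "linear_graph G" if "?lad"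
    using span[OF that] unfolding linear_graph_def spanning_subgraph_def by blast
  ultimately show ?thesis by blast
qed

end
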